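(* Let $G$ be a connected complex reductive group, $T\subset G$ a maximal torus with Weyl group $W$, and $\lambda:\mathbb C^*\to T$ a cocharacter. Let $X=\mathbb{CP}^3$, let $Q\subset X$ be a smooth quadric, and let $\mathcal P_\lambda$ be the sourced Ward principal $G$-bundle of type $\lambda$ on the gluing groupoid of $(X,Q)$. Let $x\in Q$ and choose a formal coordinate $z$ transverse to $Q$ near $x$, so that $Q$ is locally given by $z=0$. Then the formal normal type of $\mathcal P_\lambda$ at $x$ is the point $$z^{-\lambda}G(\mathbb C[[z]])\in\mathrm{Gr}_G:=G(\mathbb C((z)))/G(\mathbb C[[z]]).$$ Its gauge-invariant type (i.e. its type up to changes of formal trivialization on both sides of the modification) is the Schubert orbit $$\mathrm{Gr}_G^\lambda=G(\mathbb C[[z]])\,z^{-\lambda}\,G(\mathbb C[[z]])/G(\mathbb C[[z]]),$$ or equivalently the Weyl orbit of $\lambda$ (that is, for cocharacters $\lambda,\lambda'$ of $T$ one has $\mathrm{Gr}_G^{\lambda}=\mathrm{Gr}_G^{\lambda'}$ if and only if $\lambda'\in W\lambda$).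
   Context: Let $U=X\setminus Q$, let $X_+,X_-$ be two copies of $X$, and let $q\in H^0(X,\mathcal O_X(Q))=H^0(\mathbb{CP}^3,\mathcal O(2))$ be a defining section of $Q$. The gluing groupoid of $(X,Q)$ has unit space $X_+\sqcup X_-$ and, besides identities, exactly the arrows $p_+\leftrightarrow p_-$ for $p\in U$; a principal $G$-bundle on it is a pair of principal $G$-bundles on $X_+$ and $X_-$ together with an isomorphism between them over $U$. Sourced Ward principal bundle: put $\mathcal L_Q=\mathcal O_X(-Q)\cong\mathcal O_X(-2)$, with associated principal $\mathbb C^*$-bundle $\mathcal L_Q^\times$. Then $\mathcal P_\lambda$ consists of $P_{\lambda,+}=X_+\times G$ and $P_{\lambda,-}=\mathcal L_Q^\times\times_{\mathbb C^*,\lambda}G$ (where $t\in\mathbb C^*$ acts on $G$ by left multiplication by $\lambda(t)$, so $[\ell t,g]=[\ell,\lambda(t)g]$), glued over $U$ by the trivialization of $P_{\lambda,-}|_U$ coming from the nowhere-vanishing section $q^{-1}$ of $\mathcal L_Q|_U$, i.e. $(p,g)\mapsto[q(p)^{-1},g]$. This gluing is written $q^{-\lambda}$. Formal normal type: restrict to a formal disc $D=\mathrm{Spec}\,\mathbb C[[z]]$ through $x$ transverse to $Q$. There $q|_D$ vanishes to first order at $z=0$, so $z q^{-1}$ is a frame of $\mathcal L_Q|_D$; it gives a formal trivialization of $P_{\lambda,-}|_D$, while $P_{\lambda,+}|_D$ has its given trivialization. The gluing of $\mathcal P_\lambda$ over the punctured formal disc, expressed in these trivializations, is an element of $G(\mathbb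 C((z)))$, and its class in $\mathrm{Gr}_G$ is the formal normal type. Changes of formal trivialization are by $G(\mathbb C[[z]])$. The element $z^{-\lambda}\in T(\mathbb C((z)))\subset G(\mathbb C((z)))$ is the image of $z^{-1}\in\mathbb C((z))^*$ under $\lambda$. *)

theory Defs
  imports
    "HOL-Analysis.Analysis"
    "HOL-Complex_Analysis.Laurent_Convergence"
    "HOL-Library.Poly_Mapping"
begin

no_notation fps_nth (infixl \<open>$\<close> 75)

section \<open>Test rings\<close>

text \<open>
  Schemes over the complex numbers are described by their points with values in
  commutative algebras. The test rings used below are the complex numbers, formal power series
  and formal Laurent series: all of them are local, so that every line bundle and every torsor
  for the multiplicative group over their spectrum is trivial. This is what justifies the
  descriptions of points of projective space and of associated bundles as plain quotients.
  The operation \<open>inverse\<close> is only meaningful on units.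
\<close>

lemma field_unit_inverse: "x dvd 1 \<Longrightarrow> x * inverse x = (1 :: 'a :: field)"
  by (rule right_inverse) (metis dvd_0_left zero_neq_one)

class complex_algebra = comm_ring_1 + inverse +
  fixes of_complex :: "complex \<Rightarrow> 'a"
  assumes of_complex_1: "of_complex 1 = 1"
    and of_complex_add: "of_complex (a + b) = of_complex a + of_complex b"
    and of_complex_mult: "of_complex (a * b) = of_complex a * of_complex b"
    and unit_inverse: "x dvd 1 \<Longrightarrow> x * inverse x = 1"

class complex_field = field + complex_algebra

instantiation complex :: complex_field
begin
definition of_complex_complex :: "complex \<Rightarrow> complex" where
  "of_complex_complex a = a"
instance
  by standard (simp_all only: of_complex_complex_def field_unit_inverse)
end

instantiation fps :: (complex_field) complex_algebra
begin
definition of_complex_fps :: "complex \<Rightarrow> 'a fps" where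
  "of_complex_fps a = fps_const (of_complex a)"
instance
proof
  fix x :: "'a fps"
  assume "x dvd 1"
  then have "fps_nth x 0 \<noteq> 0" by simp
  then show "x * inverse x = 1" by (rule inverse_mult_eq_1')
qed (simp_all only: of_complex_fps_def of_complex_1 of_complex_add of_complex_mult
       fps_const_1_eq_1 fps_const_add fps_const_mult)
end

instantiation fls :: (complex_field) complex_field
begin
definition of_complex_fls :: "complex \<Rightarrow> 'a fls" where
  "of_complex_fls a = fls_const (of_complex a)"
instance
  by standard (simp_all only: of_complex_fls_def of_complex_1 of_complex_add of_complex_mult
      fls_const_1 fls_plus_const fls_const_mult_const field_unit_inverse)
end


section \<open>Linear algebraic groups\<close>

text \<open>Polynomials in the entries of a square matrix: the monomial \<open>m\<close> has exponent
  \<open>lookup m (i, j)\<close> in the entry \<open>(i, j)\<close>.\<close>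

type_synonym 'n matrix_poly = "('n \<times> 'n \<Rightarrow>\<^sub>0 nat) \<Rightarrow>\<^sub>0 complex"

definition eval_poly :: "'n matrix_poly \<Rightarrow> 'r::complex_algebra ^'n^'n \<Rightarrow> 'r" where
  "eval_poly p g =
     (\<Sum>m\<in>Poly_Mapping.keys p. of_complex (Poly_Mapping.lookup p m) *
        (\<Prod>(i, j)\<in>Poly_Mapping.keys m. (g $ i $ j) ^ Poly_Mapping.lookup m (i, j)))"

definition zariski_closed_GL :: "(complex^'n^'n) set \<Rightarrow> bool" where
  "zariski_closed_GL S \<longleftrightarrow>
     (\<exists>I. S = {g. invertible g \<and> (\<forall>p\<in>I. eval_poly p g = 0)})"

definition linear_algebraic_group :: "(complex^'n^'n) set \<Rightarrow> bool" where
  "linear_algebraic_group G \<longleftrightarrow> zariski_closed_GL G \<and> mat 1 \<in> G \<and>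
     (\<forall>g\<in>G. \<forall>h\<in>G. g ** h \<in> G) \<and> (\<forall>g\<in>G. matrix_inv g \<in> G)"

text \<open>The group \<open>G(R)\<close> of points with values in a test ring \<open>R\<close>.\<close>

definition points :: "(complex^'n^'n) set \<Rightarrow> ('r::complex_algebra ^'n^'n) set" where
  "points G = {g. invertible g \<and> (\<forall>p. (\<forall>h\<in>G. eval_poly p h = 0) \<longrightarrow> eval_poly p g = 0)}"

definition unipotent :: "complex^'n^'n \<Rightarrow> bool" where
  "unipotent g \<longleftrightarrow> (\<exists>k. (((**) (g - mat 1)) ^^ k) (mat 1) = 0)"

text \<open>Reductivity is triviality of the unipotent radical. For algebraic groups over the complex
  numbers, connectedness in the Euclidean and in the Zariski topology agree.\<close>

definition connected_reductive_group :: "(complex^'n^'n) set \<Rightarrow> bool" where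
  "connected_reductive_group G \<longleftrightarrow> linear_algebraic_group G \<and> connected G \<and>
     (\<forall>U. linear_algebraic_group U \<and> connected U \<and> U \<subseteq> G \<and>
          (\<forall>g\<in>G. \<forall>u\<in>U. g ** u ** matrix_inv g \<in> U) \<and> (\<forall>u\<in>U. unipotent u)
        \<longrightarrow> U = {mat 1})"

definition diagonalizable_group :: "(complex^'n^'n) set \<Rightarrow> bool" where
  "diagonalizable_group S \<longleftrightarrow> linear_algebraic_group S \<and>
     (\<exists>P::complex^'n^'n. invertible P \<and> (\<forall>s\<in>S. \<forall>i j. i \<noteq> j \<longrightarrow> (P ** s ** matrix_inv P) $ i $ j = 0))"

definition torus :: "(complex^'n^'n) set \<Rightarrow> bool" where
  "torus S \<longleftrightarrow> diagonalizable_group S \<and> connected S"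

definition maximal_torus :: "(complex^'n^'n) set \<Rightarrow> (complex^'n^'n) set \<Rightarrow> bool" where
  "maximal_torus T G \<longleftrightarrow> torus T \<and> T \<subseteq> G \<and> (\<forall>S. torus S \<and> S \<subseteq> G \<and> T \<subseteq> S \<longrightarrow> S = T)"


section \<open>Cocharacters and the Weyl group\<close>

text \<open>A morphism from the multiplicative group to matrices is a matrix of Laurent polynomials,
  i.e. a finitely supported family of matrix coefficients indexed by the exponent. It can be
  evaluated at a unit of any test ring.\<close>

type_synonym 'n laurent_matrix = "int \<Rightarrow>\<^sub>0 complex^'n^'n"

definition cochar_at :: "'n::finite laurent_matrix \<Rightarrow> 'r::complex_algebra \<Rightarrow> 'r^'n^'n" where
  "cochar_at lam r =
     (\<chi> i j. \<Sum>k\<in>Poly_Mapping.keys lam. of_complex (Poly_Mapping.lookup lam k $ i $ j) * r powi k)"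

definition cocharacter :: "(complex^'n^'n) set \<Rightarrow> 'n::finite laurent_matrix \<Rightarrow> bool" where
  "cocharacter T lam \<longleftrightarrow>
     (\<forall>t::complex. t \<noteq> 0 \<longrightarrow> cochar_at lam t \<in> T) \<and>
     (\<forall>s t::complex. s \<noteq> 0 \<longrightarrow> t \<noteq> 0 \<longrightarrow>
        cochar_at lam (s * t) = cochar_at lam s ** cochar_at lam t)"

definition normalizer :: "(complex^'n^'n) set \<Rightarrow> (complex^'n^'n) set \<Rightarrow> (complex^'n^'n) set" where
  "normalizer G T = {g\<in>G. (\<lambda>t. g ** t ** matrix_inv g) ` T = T}"

definition weyl_group :: "(complex^'n^'n) set \<Rightarrow> (complex^'n^'n) set \<Rightarrow> (complex^'n^'n) set set" where
  "weyl_group G T = (\<lambda>n. (\<lambda>t. n ** t) ` T) ` normalizer G T"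

definition conj_cochar :: "complex^'n^'n \<Rightarrow> 'n::finite laurent_matrix \<Rightarrow> 'n laurent_matrix" where
  "conj_cochar n lam = Poly_Mapping.map (\<lambda>M. n ** M ** matrix_inv n) lam"

text \<open>The action of a class \<open>w = n T\<close> does not depend on the representative \<open>n\<close>.\<close>

definition weyl_orbit ::
    "(complex^'n^'n) set \<Rightarrow> (complex^'n^'n) set \<Rightarrow> 'n::finite laurent_matrix \<Rightarrow> 'n laurent_matrix set" where
  "weyl_orbit G T lam = {conj_cochar n lam | n w. w \<in> weyl_group G T \<and> n \<in> w}"


section \<open>The affine Grassmannian\<close>

definition gr_coset ::
    "(complex^'n^'n) set \<Rightarrow> complex fls^'n^'n \<Rightarrow> (complex fls^'n^'n) set" where
  "gr_coset G \<gamma> = {\<gamma> ** map_matrix fps_to_fls h | h. h \<in> points G}"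

definition affine_grassmannian :: "(complex^'n^'n) set \<Rightarrow> (complex fls^'n^'n) set set" where
  "affine_grassmannian G = gr_coset G ` points G"

text \<open>\<open>z^(-\<lambda>)\<close>: the image of \<open>z^(-1)\<close> under \<open>\<lambda>\<close>.\<close>

definition z_minus :: "'n::finite laurent_matrix \<Rightarrow> complex fls^'n^'n" where
  "z_minus lam = cochar_at lam fls_X_inv"

definition schubert_orbit ::
    "(complex^'n^'n) set \<Rightarrow> 'n::finite laurent_matrix \<Rightarrow> (complex fls^'n^'n) set set" where
  "schubert_orbit G lam =
     {gr_coset G (map_matrix fps_to_fls a ** z_minus lam ** map_matrix fps_to_fls b) | a b.
        a \<in> points G \<and> b \<in> points G}"


section \<open>Projective space and smooth quadrics\<close>

definition unimodular :: "'r::complex_algebra^4 \<Rightarrow> bool" where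
  "unimodular v \<longleftrightarrow> (\<exists>w. (\<Sum>i\<in>UNIV. w $ i * v $ i) = 1)"

definition proj_class :: "'r::complex_algebra^4 \<Rightarrow> ('r^4) set" where
  "proj_class v = {u *s v | u. u dvd 1}"

definition proj_space :: "('r::complex_algebra^4) set set" where
  "proj_space = {proj_class v | v. unimodular v}"

definition proj_base_change ::
    "('r \<Rightarrow> 's) \<Rightarrow> ('r::complex_algebra^4) set \<Rightarrow> ('s::complex_algebra^4) set" where
  "proj_base_change f p = (\<Union>v\<in>p. proj_class (\<chi> i. f (v $ i)))"

text \<open>A section of \<open>O(2)\<close> is a quadratic form, given by its symmetric matrix \<open>A\<close>; as a function
  of \<open>v\<close> its gradient is \<open>2 A v\<close>.\<close>

definition quadratic_form :: "complex^4^4 \<Rightarrow> 'r::complex_algebra^4 \<Rightarrow> 'r" where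
  "quadratic_form A v = (\<Sum>i\<in>UNIV. \<Sum>j\<in>UNIV. of_complex (A $ i $ j) * v $ i * v $ j)"

definition smooth_quadric :: "complex^4^4 \<Rightarrow> bool" where
  "smooth_quadric A \<longleftrightarrow> transpose A = A \<and>
     (\<forall>v. v \<noteq> 0 \<and> quadratic_form A v = 0 \<longrightarrow> 2 *s (A *v v) \<noteq> 0)"

definition quadric_points :: "complex^4^4 \<Rightarrow> ('r::complex_algebra^4) set set" where
  "quadric_points A = {p \<in> proj_space. \<forall>v\<in>p. quadratic_form A v = 0}"

definition quadric_complement :: "complex^4^4 \<Rightarrow> ('r::complex_algebra^4) set set" where
  "quadric_complement A = {p \<in> proj_space. \<forall>v\<in>p. quadratic_form A v dvd 1}"

text \<open>A parametrized formal disc \<open>D\<close> in projective space, that is, a point with values in formal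
  power series, with closed point \<open>x\<close>, on which the quadric vanishes to first order.\<close>

definition transverse_formal_disc ::
    "complex^4^4 \<Rightarrow> (complex^4) set \<Rightarrow> (complex fps^4) set \<Rightarrow> bool" where
  "transverse_formal_disc A x D \<longleftrightarrow> D \<in> proj_space \<and>
     proj_base_change (\<lambda>f. fps_nth f 0) D = x \<and>
     (\<forall>v\<in>D. fps_nth (quadratic_form A v) 0 = 0 \<and> fps_nth (quadratic_form A v) 1 \<noteq> 0)"

abbreviation punctured :: "(complex fps^4) set \<Rightarrow> (complex fls^4) set" where
  "punctured D \<equiv> proj_base_change fps_to_fls D"


section \<open>The line bundle of the quadric\<close>

text \<open>\<open>O(-2)\<close> is the square of the tautological line bundle: its fibre over the class of \<open>v\<close> is the
  line spanned by the symmetric tensor \<open>v \<otimes> v\<close>. It is dual to \<open>O(2)\<close> by pairing a symmetric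
  tensor with the matrix \<open>A\<close> of a quadratic form. The nonzero vectors form the principal
  bundle for the multiplicative group.\<close>

definition scale_tensor :: "'r::times \<Rightarrow> 'r^'m^'n \<Rightarrow> 'r^'m^'n" where
  "scale_tensor c l = map_matrix (\<lambda>a. c * a) l"

definition LQ_units :: "('r::complex_algebra^4) set \<Rightarrow> ('r^4^4) set" where
  "LQ_units p = {scale_tensor c (\<chi> i j. v $ i * v $ j) | c v. c dvd 1 \<and> v \<in> p}"

definition q_pairing :: "complex^4^4 \<Rightarrow> 'r::complex_algebra^4^4 \<Rightarrow> 'r" where
  "q_pairing A l = (\<Sum>i\<in>UNIV. \<Sum>j\<in>UNIV. of_complex (A $ i $ j) * l $ i $ j)"

text \<open>The value at \<open>p\<close> in the complement of the quadric of the section \<open>q^(-1)\<close> of \<open>O(-2)\<close>.\<close>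

definition q_inverse :: "complex^4^4 \<Rightarrow> ('r::complex_algebra^4) set \<Rightarrow> 'r^4^4" where
  "q_inverse A p = (THE l. l \<in> LQ_units p \<and> q_pairing A l = 1)"

text \<open>The frame over \<open>D\<close> that restricts to \<open>z q^(-1)\<close> on the punctured disc.\<close>

definition zq_frame :: "complex^4^4 \<Rightarrow> (complex fps^4) set \<Rightarrow> complex fps^4^4" where
  "zq_frame A D = (THE l. l \<in> LQ_units D \<and>
     map_matrix fps_to_fls l = scale_tensor fls_X (q_inverse A (punctured D)))"


section \<open>The sourced Ward principal bundle\<close>

text \<open>A principal bundle on the gluing groupoid, evaluated on a fixed test ring: two bundles
  \<open>P_+\<close> and \<open>P_-\<close>, given by their fibres over points of the base and the right action of the
  structure group, and an isomorphism from \<open>P_+\<close> to \<open>P_-\<close> over the open set \<open>glue_locus\<close>.\<close>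

record ('p, 'a, 'b, 'g) gluing_bundle =
  fibre_plus :: "'p \<Rightarrow> 'a set"
  act_plus :: "'a \<Rightarrow> 'g \<Rightarrow> 'a"
  fibre_minus :: "'p \<Rightarrow> 'b set"
  act_minus :: "'b \<Rightarrow> 'g \<Rightarrow> 'b"
  glue_locus :: "'p set"
  glue :: "'p \<Rightarrow> 'a \<Rightarrow> 'b"

text \<open>The class \<open>[l, g]\<close> for the relation \<open>[l t, h] = [l, \<lambda>(t) h]\<close>.\<close>

definition assoc_class ::
    "'n::finite laurent_matrix \<Rightarrow> 'r::complex_algebra^4^4 \<Rightarrow> 'r^'n^'n \<Rightarrow> (('r^4^4) \<times> ('r^'n^'n)) set" where
  "assoc_class lam l g = {(scale_tensor t l, h) | t h. t dvd 1 \<and> cochar_at lam t ** h = g}"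

definition ward_bundle ::
    "(complex^'n^'n) set \<Rightarrow> 'n::finite laurent_matrix \<Rightarrow> complex^4^4 \<Rightarrow>
      (('r::complex_algebra^4) set, ('r^4) set \<times> ('r^'n^'n), (('r^4^4) \<times> ('r^'n^'n)) set, 'r^'n^'n)
        gluing_bundle" where
  "ward_bundle G lam A =
     \<lparr> fibre_plus = (\<lambda>p. {p} \<times> points G),
       act_plus = (\<lambda>(p, g) h. (p, g ** h)),
       fibre_minus = (\<lambda>p. {assoc_class lam l g | l g. l \<in> LQ_units p \<and> g \<in> points G}),
       act_minus = (\<lambda>c h. {(l, g ** h) | l g. (l, g) \<in> c}),
       glue_locus = quadric_complement A,
       glue = (\<lambda>p (p', g). assoc_class lam (q_inverse A p) g) \<rparr>"


section \<open>Formal normal type\<close>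

text \<open>A formal trivialization of a bundle over \<open>D\<close> is the same as a section over \<open>D\<close>, i.e. an
  element of the fibre over the point \<open>D\<close> with values in power series. The following
  restrict sections of \<open>P_+\<close> and \<open>P_-\<close> to the punctured disc.\<close>

definition restrict_plus ::
    "(complex fps^4) set \<times> (complex fps^'n^'n) \<Rightarrow> (complex fls^4) set \<times> (complex fls^'n^'n)" where
  "restrict_plus = (\<lambda>(p, g). (punctured p, map_matrix fps_to_fls g))"

definition restrict_minus ::
    "'n::finite laurent_matrix \<Rightarrow> ((complex fps^4^4) \<times> (complex fps^'n^'n)) set \<Rightarrow>
      ((complex fls^4^4) \<times> (complex fls^'n^'n)) set" where
  "restrict_minus lam c =
     (\<Union>(l, g)\<in>c. assoc_class lam (map_matrix fps_to_fls l) (map_matrix fps_to_fls g))"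

text \<open>The gluing over the punctured disc, expressed in the trivializations \<open>s\<close> and \<open>t\<close>: the
  element \<open>\<gamma>\<close> for which the gluing isomorphism takes \<open>s\<close> to \<open>t \<gamma>\<close>. Replacing \<open>s\<close> by \<open>s b\<close> and \<open>t\<close>
  by \<open>t a\<close> turns \<open>\<gamma>\<close> into \<open>a^(-1) \<gamma> b\<close>.\<close>

definition gluing_element ::
    "(complex^'n^'n) set \<Rightarrow> 'n::finite laurent_matrix \<Rightarrow> complex^4^4 \<Rightarrow> (complex fps^4) set \<Rightarrow>
      (complex fps^4) set \<times> (complex fps^'n^'n) \<Rightarrow> ((complex fps^4^4) \<times> (complex fps^'n^'n)) set \<Rightarrow>
      complex fls^'n^'n" where
  "gluing_element G lam A D s t =
     (THE \<gamma>. \<gamma> \<in> points G \<and>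
        glue (ward_bundle G lam A) (punctured D) (restrict_plus s) =
        act_minus (ward_bundle G lam A) (restrict_minus lam t) \<gamma>)"

definition formal_normal_type ::
    "(complex^'n^'n) set \<Rightarrow> 'n::finite laurent_matrix \<Rightarrow> complex^4^4 \<Rightarrow> (complex fps^4) set \<Rightarrow>
      (complex fls^'n^'n) set" where
  "formal_normal_type G lam A D =
     gr_coset G (gluing_element G lam A D (D, mat 1) (assoc_class lam (zq_frame A D) (mat 1)))"

text \<open>The type up to changes of formal trivialization on both sides: all classes arising from
  arbitrary formal trivializations of \<open>P_+\<close> and \<open>P_-\<close> over \<open>D\<close>.\<close>

definition gauge_invariant_type ::
    "(complex^'n^'n) set \<Rightarrow> 'n::finite laurent_matrix \<Rightarrow> complex^4^4 \<Rightarrow> (complex fps^4) set \<Rightarrow>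
      (complex fls^'n^'n) set set" where
  "gauge_invariant_type G lam A D =
     {gr_coset G (gluing_element G lam A D s t) | s t.
        s \<in> fibre_plus (ward_bundle G lam A) D \<and> t \<in> fibre_minus (ward_bundle G lam A) D}"

end

theory Submission
  imports
    Defs
    "HOL-Computational_Algebra.Field_as_Ring"
    "HOL-Computational_Algebra.Polynomial_Factorial"
    "HOL-Computational_Algebra.Fundamental_Theorem_Algebra"
begin

text \<open>
  On a transverse disc \<open>q = z w\<close> with a unit \<open>w\<close>, so the frame \<open>z q^(-1)\<close> of the line bundle exists
  and \<open>[q^(-1), 1] = [z q^(-1), \<lambda>(z^(-1))]\<close>; other trivializations multiply
  this element by points over power series on both sides.

  If \<open>z^(-\<nu>) = a z^(-\<mu>) b\<close>, the limit of \<open>\<nu>(s) g \<mu>(s)^(-1)\<close> for \<open>s\<close> tending to \<open>0\<close> exists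
  in \<open>G\<close> for a suitable \<open>g\<close> in \<open>G\<close> and conjugates \<open>\<mu>\<close> to \<open>\<nu>\<close>. Conjugate cocharacters of \<open>T\<close> are conjugate under
  the normalizer because maximal tori of the centralizer of \<open>\<nu>\<close> are conjugate. The latter holds in
  any linear algebraic group: the null space of \<open>ad X\<close> is, up to conjugation, locally constant on the
  regular elements \<open>X\<close> of the Lie algebra, whose complement in a complex line is finite; and a generic
  element of the Lie algebra of a maximal torus is regular, with the torus central in its null space.
\<close>

text \<open>The conjugation takes place in the centralizer of a cocharacter, which is available here
  just as a linear algebraic group. Root systems and the Bruhat decomposition therefore give way to
  an analysis of the Lie algebra that works for every such group. Three bridges between
  Zariski-closed sets and analysis carry it. Sums in the Lie algebra come from derivations of the
  vanishing ideal and the identity theorem. The semisimple part S of X stays in the Lie algebra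
  because a polynomial in the entries of exp(c S) exp(b (X - S)) is an exponential polynomial in (b,
  c), which vanishes identically as soon as it vanishes for b = c. The torus around a connected
  diagonalizable set is cut out by the characters trivial on that set; connectedness makes their
  lattice saturated, and this is what allows the logarithms of a point to be corrected by multiples
  of 2 pi i so that a whole one-parameter group stays inside. Regularity is defined by minimal
  dimension of the null space of \<open>ad X\<close>, a notion that is invariant under conjugation
  and generic on complex lines.\<close>

lemma matrix_mul_add_left: "(A + B) ** C = A ** C + B ** (C :: 'a::semiring_1^'p^'n)"
  by (vector matrix_matrix_mult_def sum.distrib[symmetric] field_simps)

lemma matrix_mul_add_right: "A ** (B + C) = A ** B + A ** (C :: 'a::semiring_1^'p^'n)"
  by (vector matrix_matrix_mult_def sum.distrib[symmetric] field_simps)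

lemma matrix_mul_diff_left: "(A - B) ** C = A ** C - B ** (C :: 'a::ring_1^'p^'n)"
  by (vector matrix_matrix_mult_def sum_subtractf[symmetric] field_simps)

lemma matrix_mul_diff_right: "A ** (B - C) = A ** B - A ** (C :: 'a::ring_1^'p^'n)"
  by (vector matrix_matrix_mult_def sum_subtractf[symmetric] field_simps)

lemma matrix_mul_minus_left: "(- A) ** C = - (A ** (C :: 'a::ring_1^'p^'n))"
  using matrix_mul_diff_left[of 0 A C] by simp

lemma matrix_mul_minus_right: "A ** (- C) = - (A ** (C :: 'a::ring_1^'p^'n))"
  using matrix_mul_diff_right[of A 0 C] by simp

lemma matrix_mul_sum_left: "sum f S ** C = (\<Sum>x\<in>S. f x ** (C :: 'a::ring_1^'p^'n))"
  by (induction S rule: infinite_finite_induct) (simp_all add: matrix_mul_add_left)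

lemma matrix_mul_sum_right: "C ** sum f S = (\<Sum>x\<in>S. (C :: 'a::ring_1^'p^'n) ** f x)"
  by (induction S rule: infinite_finite_induct) (simp_all add: matrix_mul_add_right)

section \<open>Complex multiples of matrices and continuity of the matrix operations\<close>

lemma scale_tensor_nth [simp]: "scale_tensor c l $ i $ j = c * l $ i $ j"
  by (simp add: scale_tensor_def)

lemma scale_tensor_mul_left:
  "scale_tensor c A ** B = scale_tensor c (A ** (B :: 'a::comm_semiring_1^'p^'n))"
  by (simp add: vec_eq_iff matrix_matrix_mult_def sum_distrib_left mult_ac)

lemma scale_tensor_mul_right:
  "A ** scale_tensor c B = scale_tensor c (A ** (B :: 'a::comm_semiring_1^'p^'n))"
  by (simp add: vec_eq_iff matrix_matrix_mult_def sum_distrib_left mult_ac)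

lemma scale_tensor_scale_tensor [simp]:
  "scale_tensor a (scale_tensor b A) = scale_tensor (a * b :: 'a::semigroup_mult) A"
  by (simp add: vec_eq_iff mult.assoc)

lemma scale_tensor_add: "scale_tensor (c :: 'a::semiring_1) (A + B) = scale_tensor c A + scale_tensor c B"
  by (simp add: vec_eq_iff distrib_left)
lemma scale_tensor_diff: "scale_tensor (c :: 'a::ring_1) (A - B) = scale_tensor c A - scale_tensor c B"
  by (simp add: vec_eq_iff right_diff_distrib)
lemma scale_tensor_0 [simp]: "scale_tensor (c :: 'a::semiring_1) 0 = 0" "scale_tensor (0::'a) A = 0"
  by (simp_all add: vec_eq_iff)
lemma scale_tensor_1 [simp]: "scale_tensor (1 :: 'a::semiring_1) A = A"
  by (simp add: vec_eq_iff)
lemma scale_tensor_sum: "scale_tensor (c :: 'a::ring_1) (sum f S) = (\<Sum>x\<in>S. scale_tensor c (f x))"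
  by (induction S rule: infinite_finite_induct) (simp_all add: scale_tensor_add)
lemma scale_tensor_add_left: "scale_tensor (c + d :: 'a::semiring_1) A = scale_tensor c A + scale_tensor d A"
  by (simp add: vec_eq_iff distrib_right)
lemma scale_tensor_diff_left: "scale_tensor (c - d :: 'a::ring_1) A = scale_tensor c A - scale_tensor d A"
  by (simp add: vec_eq_iff left_diff_distrib)
lemma scale_tensor_scaleR: "scale_tensor (c::complex) (r *\<^sub>R A) = r *\<^sub>R scale_tensor c A"
  by (simp add: vec_eq_iff)
text \<open>Subspaces and dimensions below are real; this is the bridge from them to the
  complex-linear identities.\<close>

lemma scaleR_eq_scale_tensor: "r *\<^sub>R A = scale_tensor (complex_of_real r) A"
  unfolding vec_eq_iff vector_scaleR_component scale_tensor_nth by (simp add: scaleR_conv_of_real)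

lemma matrix_mul_scaleR_left: "(r *\<^sub>R A) ** B = r *\<^sub>R (A ** (B::complex^'p^'n))"
  by (simp add: scaleR_eq_scale_tensor scale_tensor_mul_left)
lemma matrix_mul_scaleR_right: "A ** (r *\<^sub>R B) = r *\<^sub>R (A ** (B::complex^'p^'n))"
  by (simp add: scaleR_eq_scale_tensor scale_tensor_mul_right)

lemma bounded_bilinear_matrix_mul:
  "bounded_bilinear ((**) :: complex^'n^'m \<Rightarrow> complex^'p^'n \<Rightarrow> complex^'p^'m)"
  unfolding bilinear_conv_bounded_bilinear[symmetric] bilinear_def
  by (auto intro!: linearI simp: matrix_mul_add_left matrix_mul_add_right
       matrix_mul_scaleR_left matrix_mul_scaleR_right)

lemma bounded_linear_matrix_mul_left: "bounded_linear (\<lambda>X. X ** (A::complex^'p^'n) :: complex^'p^'m)"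
  by (rule bounded_bilinear.bounded_linear_left[OF bounded_bilinear_matrix_mul])

lemma bounded_linear_matrix_mul_right: "bounded_linear (\<lambda>X::complex^'p^'n. (A :: complex^'n^'m) ** X)"
  by (rule bounded_bilinear.bounded_linear_right[OF bounded_bilinear_matrix_mul])

lemma bounded_linear_scale_tensor_left: "bounded_linear (\<lambda>c::complex. scale_tensor c (A :: complex^'n^'m))"
  unfolding linear_conv_bounded_linear[symmetric]
  by (rule linearI) (simp_all add: vec_eq_iff distrib_right)

lemma bounded_linear_matrix_entry: "bounded_linear (\<lambda>X :: complex^'n^'m. X $ i $ j)"
  by (intro bounded_linear_compose[OF bounded_linear_vec_nth] bounded_linear_vec_nth)

lemmas continuous_on_matrix_mul [continuous_intros] =
  bounded_bilinear.continuous_on[OF bounded_bilinear_matrix_mul]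

lemma bounded_bilinear_matrix_vector:
  "bounded_bilinear ((*v) :: complex^'n^'m \<Rightarrow> complex^'n \<Rightarrow> complex^'m)"
  unfolding bilinear_conv_bounded_bilinear[symmetric] bilinear_def
  by (auto intro!: linearI simp: matrix_vector_mult_def vec_eq_iff ring_distribs sum.distrib scaleR_sum_right)

section \<open>The matrix exponential\<close>

text \<open>The library's exponential needs a unital Banach algebra. The operator norm provides one,
  on a copy of the matrix type since that type already carries the Euclidean norm.\<close>

typedef (overloaded) 'n cmat = "UNIV :: (complex^'n^'n::finite) set"
  morphisms of_cmat to_cmat ..

setup_lifting type_definition_cmat

instantiation cmat :: (finite) ring_1
begin
lift_definition zero_cmat :: "'a cmat" is 0 .
lift_definition one_cmat :: "'a cmat" is "mat 1" .
lift_definition plus_cmat :: "'a cmat \<Rightarrow> 'a cmat \<Rightarrow> 'a cmat" is "(+)" .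
lift_definition minus_cmat :: "'a cmat \<Rightarrow> 'a cmat \<Rightarrow> 'a cmat" is "(-)" .
lift_definition uminus_cmat :: "'a cmat \<Rightarrow> 'a cmat" is "uminus" .
lift_definition times_cmat :: "'a cmat \<Rightarrow> 'a cmat \<Rightarrow> 'a cmat" is "(**)" .
instance
proof
  fix a b c :: "'a cmat"
  show "a + b + c = a + (b + c)" "a + b = b + a" by (transfer; simp add: add_ac)+
  show "0 + a = a" "- a + a = 0" "a - b = a + - b" by (transfer; simp)+
  show "a * b * c = a * (b * c)" by transfer (simp add: matrix_mul_assoc)
  show "1 * a = a" "a * 1 = a" by (transfer; simp)+
  show "(a + b) * c = a * c + b * c" by transfer (rule matrix_mul_add_left)
  show "a * (b + c) = a * b + a * c" by transfer (rule matrix_mul_add_right)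
  show "(0 :: 'a cmat) \<noteq> 1" by transfer (simp add: vec_eq_iff mat_def)
qed
end

instantiation cmat :: (finite) real_normed_algebra_1
begin
lift_definition scaleR_cmat :: "real \<Rightarrow> 'a cmat \<Rightarrow> 'a cmat" is scaleR .
lift_definition norm_cmat :: "'a cmat \<Rightarrow> real" is "\<lambda>A. onorm ((*v) A)" .
definition dist_cmat :: "'a cmat \<Rightarrow> 'a cmat \<Rightarrow> real" where "dist_cmat A B = norm (A - B)"
definition sgn_cmat :: "'a cmat \<Rightarrow> 'a cmat" where "sgn_cmat A = inverse (norm A) *\<^sub>R A"
definition uniformity_cmat :: "('a cmat \<times> 'a cmat) filter" where
  "uniformity_cmat = (INF e\<in>{0<..}. principal {(x, y). dist x y < e})"
definition open_cmat :: "'a cmat set \<Rightarrow> bool" where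
  "open_cmat U = (\<forall>x\<in>U. eventually (\<lambda>(x', y). x' = x \<longrightarrow> y \<in> U) uniformity)"
instance
proof
  have bl: "bounded_linear ((*v) A)" for A :: "complex^'a^'a"
    by (rule bounded_bilinear.bounded_linear_right[OF bounded_bilinear_matrix_vector])
  note simps = matrix_mul_scaleR_left matrix_mul_scaleR_right
  fix a b :: real and x y :: "'a cmat"
  show "a *\<^sub>R (x + y) = a *\<^sub>R x + a *\<^sub>R y" by transfer (simp add: scaleR_right_distrib)
  show "(a + b) *\<^sub>R x = a *\<^sub>R x + b *\<^sub>R x" by transfer (simp add: scaleR_left_distrib)
  show "a *\<^sub>R b *\<^sub>R x = (a * b) *\<^sub>R x" by transfer simp
  show "1 *\<^sub>R x = x" by transfer simp
  show "a *\<^sub>R x * y = a *\<^sub>R (x * y)" "x * a *\<^sub>R y = a *\<^sub>R (x * y)" by (transfer; simp add: simps)+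
  show "dist x y = norm (x - y)" by (rule dist_cmat_def)
  show "sgn x = inverse (norm x) *\<^sub>R x" by (rule sgn_cmat_def)
  show "(uniformity :: ('a cmat \<times> 'a cmat) filter) = (INF e\<in>{0<..}. principal {(x, y). dist x y < e})"
    by (rule uniformity_cmat_def)
  show "open U = (\<forall>x\<in>U. eventually (\<lambda>(x', y). x' = x \<longrightarrow> y \<in> U) uniformity)" for U :: "'a cmat set"
    by (rule open_cmat_def)
  show "norm x = 0 \<longleftrightarrow> x = 0"
  proof (transfer, goal_cases)
    case (1 A)
    have "onorm ((*v) A) = 0 \<longleftrightarrow> (\<forall>v. A *v v = 0)" by (rule onorm_eq_0[OF bl])
    also have "\<dots> \<longleftrightarrow> A = 0" by (metis matrix_eq matrix_vector_mult_0)
    finally show ?case .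
  qed
  show "norm (x + y) \<le> norm x + norm y"
  proof (transfer, goal_cases)
    case (1 A B)
    have "((*v) (A + B)) = (\<lambda>v. A *v v + B *v v)" by (simp add: fun_eq_iff matrix_vector_mult_add_rdistrib)
    then show ?case by (simp add: onorm_triangle[OF bl bl])
  qed
  show "norm (a *\<^sub>R x) = \<bar>a\<bar> * norm x"
  proof (transfer, goal_cases)
    case (1 a A)
    have "((*v) (a *\<^sub>R A)) = (\<lambda>v. a *\<^sub>R (A *v v))"
      by (auto simp: matrix_vector_mult_def vec_eq_iff scaleR_sum_right)
    then show ?case by (simp add: onorm_scaleR[OF bl])
  qed
  show "norm (x * y) \<le> norm x * norm y"
  proof (transfer, goal_cases)
    case (1 A B)
    have "((*v) (A ** B)) = (*v) A \<circ> (*v) B" by (auto simp: matrix_vector_mul_assoc)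
    then show ?case by (simp add: onorm_compose[OF bl bl])
  qed
  show "norm (1 :: 'a cmat) = 1"
  proof (transfer)
    have "((*v) (mat 1 :: complex^'a^'a)) = (\<lambda>x. x)" by auto
    moreover have "onorm (\<lambda>x::complex^'a. x) = 1"
      using onorm_id[where 'a="complex^'a"] by (simp add: id_def)
    ultimately show "onorm ((*v) (mat 1 :: complex^'a^'a)) = 1" by simp
  qed
qed
end

text \<open>Together with the bound for \<open>to_cmat\<close> this makes the operator norm
  equivalent to the Euclidean one, so that completeness, series and derivatives pass between the two
  copies of the matrix type.\<close>

lemma of_cmat_bounded_linear: "bounded_linear (of_cmat :: 'n::finite cmat \<Rightarrow> _)"
proof (rule bounded_linear_intro)
  fix x y :: "'n cmat" and r :: real
  show "of_cmat (x + y) = of_cmat x + of_cmat y" by (rule plus_cmat.rep_eq)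
  show "of_cmat (r *\<^sub>R x) = r *\<^sub>R of_cmat x" by (rule scaleR_cmat.rep_eq)
  have bl: "bounded_linear ((*v) A)" for A :: "complex^'n^'n"
    by (rule bounded_bilinear.bounded_linear_right[OF bounded_bilinear_matrix_vector])
  let ?A = "of_cmat x"
  have e: "norm (?A $ i $ j) \<le> norm x" for i j
  proof -
    have "?A $ i $ j = (?A *v axis j 1) $ i"
      by (simp add: matrix_vector_mult_def axis_def if_distrib cong: if_cong)
    also have "norm \<dots> \<le> norm (?A *v axis j 1)" by (rule Finite_Cartesian_Product.norm_nth_le)
    also have "\<dots> \<le> onorm ((*v) ?A) * norm (axis j (1::complex))" by (rule onorm[OF bl])
    also have "\<dots> = norm x" by (simp add: norm_cmat.rep_eq norm_eq_sqrt_inner inner_axis_axis)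
    finally show ?thesis .
  qed
  have "norm ?A \<le> (\<Sum>i\<in>UNIV. norm (?A $ i))"
    by (simp add: norm_vec_def L2_set_le_sum)
  also have "\<dots> \<le> (\<Sum>i\<in>UNIV. \<Sum>j\<in>UNIV. norm (?A $ i $ j))"
    by (intro sum_mono) (simp add: norm_vec_def L2_set_le_sum)
  also have "\<dots> \<le> (\<Sum>i\<in>(UNIV::'n set). \<Sum>j\<in>(UNIV::'n set). norm x)"
    by (intro sum_mono e)
  finally show "norm ?A \<le> norm x * (real CARD('n) * real CARD('n))" by (simp add: mult_ac)
qed

lemma to_cmat_bounded_linear: "bounded_linear (to_cmat :: _ \<Rightarrow> 'n::finite cmat)"
proof -
  obtain K where K: "\<And>(A::complex^'n^'n) (v::complex^'n). norm (A *v v) \<le> norm A * norm v * K" and "K \<ge> 0"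
    using bounded_bilinear.nonneg_bounded[OF bounded_bilinear_matrix_vector] by blast
  show ?thesis
  proof (rule bounded_linear_intro)
    fix A B :: "complex^'n^'n" and r :: real
    show "to_cmat (A + B) = to_cmat A + to_cmat B"
      by (simp add: plus_cmat.abs_eq)
    show "to_cmat (r *\<^sub>R A) = r *\<^sub>R to_cmat A"
      by (simp add: scaleR_cmat.abs_eq)
    have "onorm ((*v) A) \<le> norm A * K"
      by (rule onorm_le) (use K[of A] in \<open>simp add: mult_ac\<close>)
    then show "norm (to_cmat A) \<le> norm A * K" by (simp add: norm_cmat.abs_eq)
  qed
qed

instance cmat :: (finite) banach
proof
  fix X :: "nat \<Rightarrow> 'a cmat"
  assume "Cauchy X"
  then have "Cauchy (\<lambda>n. of_cmat (X n))" by (rule bounded_linear.Cauchy[OF of_cmat_bounded_linear])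
  then obtain L where "(\<lambda>n. of_cmat (X n)) \<longlonglongrightarrow> L" using Cauchy_convergent_iff convergent_def by blast
  from bounded_linear.tendsto[OF to_cmat_bounded_linear this] have "X \<longlonglongrightarrow> to_cmat L"
    by (simp add: of_cmat_inverse)
  then show "convergent X" by (rule convergentI)
qed

definition matrix_power :: "'a::semiring_1^'n^'n \<Rightarrow> nat \<Rightarrow> 'a^'n^'n" where
  "matrix_power X k = ((**) X ^^ k) (mat 1)"

lemma matrix_power_0 [simp]: "matrix_power X 0 = mat 1"
  and matrix_power_Suc: "matrix_power X (Suc k) = X ** matrix_power X k"
  by (simp_all add: matrix_power_def)

lemma of_cmat_power: "of_cmat (x ^ k) = matrix_power (of_cmat x) k"
  by (induction k) (simp_all add: matrix_power_Suc one_cmat.rep_eq times_cmat.rep_eq)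

definition matrix_exp :: "complex^'n^'n \<Rightarrow> complex^'n^'n" where
  "matrix_exp X = of_cmat (exp (to_cmat X))"

lemma matrix_exp_sums: "(\<lambda>k. matrix_power X k /\<^sub>R fact k) sums matrix_exp X"
proof -
  have "(\<lambda>k. to_cmat X ^ k /\<^sub>R fact k) sums exp (to_cmat X)" by (rule exp_converges)
  from bounded_linear.sums[OF of_cmat_bounded_linear this] show ?thesis
    by (simp add: matrix_exp_def scaleR_cmat.rep_eq of_cmat_power to_cmat_inverse)
qed

lemma matrix_exp_0 [simp]: "matrix_exp 0 = mat 1"
  by (simp add: matrix_exp_def zero_cmat.abs_eq[symmetric] one_cmat.rep_eq)

lemma matrix_exp_add:
  assumes "X ** Y = Y ** X"
  shows "matrix_exp (X + Y) = matrix_exp X ** matrix_exp Y"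
proof -
  have "to_cmat X * to_cmat Y = to_cmat Y * to_cmat X" by (simp add: times_cmat.abs_eq assms)
  from exp_add_commuting[OF this] show ?thesis
    by (simp add: matrix_exp_def plus_cmat.abs_eq times_cmat.rep_eq)
qed

lemma matrix_exp_minus: "matrix_exp X ** matrix_exp (- X) = mat 1"
  using matrix_exp_add[of X "- X"] by (simp add: matrix_mul_minus_left matrix_mul_minus_right)

lemma matrix_exp_minus': "matrix_exp (- X) ** matrix_exp X = mat 1"
  using matrix_exp_minus[of "- X"] by simp

lemma invertible_matrix_exp: "invertible (matrix_exp X)"
  using matrix_exp_minus matrix_exp_minus' unfolding invertible_def by blast

lemma matrix_exp_conj:
  assumes "P ** Q = mat 1" "Q ** P = mat 1"
  shows "matrix_exp (P ** X ** Q) = P ** matrix_exp X ** Q"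
proof (rule sums_unique2[OF matrix_exp_sums])
  have p: "matrix_power (P ** X ** Q) k = P ** matrix_power X k ** Q" for k
  proof (induction k)
    case (Suc k)
    have "P ** X ** Q ** (P ** matrix_power X k ** Q) = P ** X ** (Q ** P) ** matrix_power X k ** Q"
      by (simp only: matrix_mul_assoc)
    then show ?case by (simp add: matrix_power_Suc Suc assms matrix_mul_assoc)
  qed (simp add: assms)
  have "bounded_linear (\<lambda>X. P ** X ** Q)"
    by (intro bounded_linear_compose[OF bounded_linear_matrix_mul_left] bounded_linear_matrix_mul_right)
  from bounded_linear.sums[OF this matrix_exp_sums[of X]]
  show "(\<lambda>k. matrix_power (P ** X ** Q) k /\<^sub>R fact k) sums (P ** matrix_exp X ** Q)"
    by (simp add: p matrix_mul_scaleR_left matrix_mul_scaleR_right)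
qed

text \<open>On a ball of radius \<open>R\<close> the series is dominated by the real exponential
  series at \<open>R\<close>, hence converges uniformly there, and the balls exhaust the
  algebra.\<close>

lemma continuous_on_exp_algebra: "continuous_on S (exp :: 'a::{real_normed_algebra_1,banach} \<Rightarrow> 'a)"
proof -
  have "continuous_on (cball 0 R) (exp :: 'a \<Rightarrow> 'a)" for R
  proof -
    have "uniform_limit (cball (0::'a) R) (\<lambda>n x. \<Sum>i<n. x ^ i /\<^sub>R fact i) (\<lambda>x. suminf (\<lambda>i. x ^ i /\<^sub>R fact i)) sequentially"
    proof (rule Weierstrass_m_test)
      show "summable (\<lambda>n. inverse (fact n) * R ^ n)" by (rule summable_exp)
      fix n :: nat and x :: 'a
      assume "x \<in> cball 0 R"
      then have "norm x \<le> R" by simp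
      have "norm (x ^ n) \<le> R ^ n"
        using norm_power_ineq[of x n] power_mono[OF \<open>norm x \<le> R\<close>, of n] by simp
      then show "norm (x ^ n /\<^sub>R fact n) \<le> inverse (fact n) * R ^ n"
        by (simp add: mult_left_mono)
    qed
    then have "uniform_limit (cball (0::'a) R) (\<lambda>n x. \<Sum>i<n. x ^ i /\<^sub>R fact i) exp sequentially"
      by (simp add: exp_def)
    then show ?thesis
      by (rule uniform_limit_theorem[rotated]) (auto intro!: always_eventually continuous_intros)
  qed
  then have "isCont exp x" for x :: 'a
    using continuous_on_interior[of "cball 0 (norm x + 1)" exp x] by (auto simp: interior_cball)
  then show ?thesis by (simp add: continuous_at_imp_continuous_on)
qed

lemma continuous_on_matrix_exp: "continuous_on S matrix_exp"
  unfolding matrix_exp_def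
  by (intro bounded_linear.continuous_on[OF of_cmat_bounded_linear]
      continuous_on_compose2[OF continuous_on_exp_algebra[of UNIV]]
      bounded_linear.continuous_on[OF to_cmat_bounded_linear] continuous_on_id) auto

text \<open>For \<open>norm x < 1\<close> the term of degree n + 2 is bounded by
  \<open>norm x ^ 2\<close> divided by \<open>fact n\<close>, so the remainder after the linear part
  is at most \<open>norm x ^ 2 * exp 1\<close>.\<close>

lemma exp_algebra_has_derivative_0:
  "(exp has_derivative (\<lambda>x. x)) (at (0 :: 'a::{real_normed_algebra_1,banach}))"
proof (rule has_derivativeI_sandwich[where e = 1 and H = "\<lambda>x. norm x * exp 1"])
  show "bounded_linear (\<lambda>x::'a. x)" by (rule bounded_linear_ident)
  show "((\<lambda>x::'a. norm x * exp 1) \<longlongrightarrow> 0) (at 0)"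
    by (rule tendsto_eq_intros | simp)+
  fix x :: 'a
  assume x: "x \<noteq> 0" "dist x 0 < 1"
  let ?s = "\<lambda>n. inverse (fact (n + 2)) *\<^sub>R x ^ (n + 2)"
  have le: "norm (?s n) \<le> norm x ^ 2 * (inverse (fact n) * 1 ^ n)" for n
  proof -
    have "norm (x ^ (n + 2)) \<le> norm x ^ (n + 2)" by (rule norm_power_ineq)
    also have "\<dots> = norm x ^ 2 * norm x ^ n" by (simp only: power_add mult.commute)
    also have "\<dots> \<le> norm x ^ 2 * 1" using x by (intro mult_left_mono power_le_one) auto
    finally have 1: "norm (x ^ (n + 2)) \<le> norm x ^ 2" by simp
    have 2: "inverse (fact (n + 2)) \<le> (inverse (fact n) :: real)"
      by (intro le_imp_inverse_le fact_mono) auto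
    have "norm (?s n) = inverse (fact (n + 2)) * norm (x ^ (n + 2))" by simp
    also have "\<dots> \<le> inverse (fact n) * norm x ^ 2" by (rule mult_mono[OF 2 1]) auto
    finally show ?thesis by simp
  qed
  have sm: "summable (\<lambda>n. norm x ^ 2 * (inverse (fact n) * (1::real) ^ n))"
    by (intro summable_mult summable_exp)
  have "norm (suminf ?s) \<le> suminf (\<lambda>n. norm x ^ 2 * (inverse (fact n) * 1 ^ n))"
    by (rule norm_suminf_le[OF le sm])
  also have "\<dots> = norm x ^ 2 * exp 1"
    by (subst suminf_mult) (use summable_exp[of "1::real"] in \<open>simp_all add: exp_def\<close>)
  finally have "norm (suminf ?s) \<le> norm x ^ 2 * exp 1" .
  then have "norm (exp x - exp 0 - (x - 0)) \<le> norm x ^ 2 * exp 1"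
    by (simp add: exp_first_two_terms[of x])
  then show "norm (exp x - exp 0 - (x - 0)) / norm (x - 0) \<le> norm x * exp 1"
    using x by (simp add: field_simps power2_eq_square)
qed auto

lemma matrix_exp_has_derivative_0: "(matrix_exp has_derivative (\<lambda>X. X)) (at (0 :: complex^'n^'n))"
proof -
  have "((\<lambda>X. of_cmat (exp (to_cmat X))) has_derivative (\<lambda>X. of_cmat (to_cmat X))) (at (0 :: complex^'n^'n))"
    by (intro bounded_linear.has_derivative[OF of_cmat_bounded_linear]
        has_derivative_compose[OF bounded_linear.has_derivative[OF to_cmat_bounded_linear has_derivative_ident]])
      (simp add: zero_cmat.abs_eq[symmetric] exp_algebra_has_derivative_0)
  then show ?thesis by (simp add: matrix_exp_def[abs_def] to_cmat_inverse)
qed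

text \<open>Since exp(h X) = exp(t X) exp((h - t) X), the derivative at \<open>t\<close> reduces to
  the one at 0. The parameter is complex, so that later the identity theorem for holomorphic
  functions applies.\<close>

lemma matrix_exp_entry_has_field_derivative:
  "((\<lambda>t. (g ** matrix_exp (scale_tensor t X)) $ i $ j) has_field_derivative
      (g ** matrix_exp (scale_tensor t X) ** X) $ i $ j) (at t)"
proof -
  have "((\<lambda>h. matrix_exp (scale_tensor (h - t) X)) has_derivative (\<lambda>h. scale_tensor (h - 0) X)) (at t)"
    using matrix_exp_has_derivative_0
    by (intro has_derivative_compose[of "\<lambda>h. scale_tensor (h - t) X" "\<lambda>h. scale_tensor (h - 0) X", where g = matrix_exp])
      (auto intro!: derivative_eq_intros bounded_linear.has_derivative[OF bounded_linear_scale_tensor_left])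
  from bounded_linear.has_derivative[OF bounded_linear_compose[OF bounded_linear_matrix_entry[of i j]
      bounded_linear_matrix_mul_right[of "g ** matrix_exp (scale_tensor t X)"]] this]
  have "((\<lambda>h. (g ** matrix_exp (scale_tensor t X) ** matrix_exp (scale_tensor (h - t) X)) $ i $ j) has_derivative
     (\<lambda>h. (g ** matrix_exp (scale_tensor t X) ** scale_tensor h X) $ i $ j)) (at t)"
    by simp
  moreover have "g ** matrix_exp (scale_tensor t X) ** matrix_exp (scale_tensor (h - t) X) = g ** matrix_exp (scale_tensor h X)" for h
  proof -
    have "matrix_exp (scale_tensor h X) = matrix_exp (scale_tensor t X + scale_tensor (h - t) X)"
      by (simp add: scale_tensor_add_left[symmetric])
    also have "\<dots> = matrix_exp (scale_tensor t X) ** matrix_exp (scale_tensor (h - t) X)"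
      by (rule matrix_exp_add) (simp add: scale_tensor_mul_left scale_tensor_mul_right mult_ac)
    finally show ?thesis by (simp add: matrix_mul_assoc)
  qed
  ultimately show ?thesis
    by (simp add: has_field_derivative_def scale_tensor_mul_right mult.commute[of _ "_ $ _ $ _"] fun_eq_iff mult_commute_abs)
qed

section \<open>Polynomials in the matrix entries\<close>

lemma of_complex_0 [simp]: "of_complex 0 = (0 :: 'r::complex_algebra)"
  using of_complex_add[of 0 0, where 'a='r] by simp

lemma of_complex_sum: "of_complex (sum f S) = (\<Sum>x\<in>S. of_complex (f x) :: 'r::complex_algebra)"
  by (induction S rule: infinite_finite_induct) (simp_all add: of_complex_add)

lemma of_complex_minus: "of_complex (- a) = - (of_complex a :: 'r::complex_algebra)"
proof -
  have "of_complex a + (of_complex (- a) :: 'r) = 0" by (simp flip: of_complex_add)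
  then show ?thesis by (simp add: eq_neg_iff_add_eq_0 add.commute)
qed

lemma of_complex_of_complex [simp]: "(of_complex :: complex \<Rightarrow> complex) = (\<lambda>x. x)"
  by (simp add: of_complex_complex_def fun_eq_iff)

text \<open>The product runs over all entries instead of the support of the exponent, so that the
  index set does not change when monomials are multiplied.\<close>

definition eval_monom :: "('n \<times> 'n \<Rightarrow>\<^sub>0 nat) \<Rightarrow> 'r::complex_algebra^'n^'n \<Rightarrow> 'r" where
  "eval_monom m g = (\<Prod>(i, j)\<in>UNIV. (g $ i $ j) ^ Poly_Mapping.lookup m (i, j))"

lemma eval_monom_keys:
  "(\<Prod>(i, j)\<in>Poly_Mapping.keys m. (g $ i $ j) ^ Poly_Mapping.lookup m (i, j)) = eval_monom m g"
  for g :: "'r::complex_algebra^'n^'n::finite"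
  unfolding eval_monom_def
  by (rule prod.mono_neutral_left) (auto simp: in_keys_iff)

lemma eval_monom_add: "eval_monom (m + m') g = eval_monom m g * eval_monom m' g"
  by (simp add: eval_monom_def lookup_add power_add prod.distrib split_def)

lemma eval_monom_0 [simp]: "eval_monom 0 g = 1"
  by (simp add: eval_monom_def)

lemma eval_monom_single: "eval_monom (Poly_Mapping.single (i, j) 1) g = g $ i $ j"
  for g :: "'r::complex_algebra^'n^'n::finite"
proof -
  have "eval_monom (Poly_Mapping.single (i, j) 1) g = (\<Prod>x\<in>UNIV. if x = (i, j) then g $ i $ j else 1)"
    unfolding eval_monom_def
    by (rule prod.cong) (auto simp: lookup_single_eq lookup_single_not_eq simp del: One_nat_def split: prod.splits)
  then show ?thesis by simp
qed

lemma eval_poly_superset: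
  fixes g :: "'r::complex_algebra^'n^'n::finite"
  assumes "finite K" "Poly_Mapping.keys p \<subseteq> K"
  shows "eval_poly p g = (\<Sum>m\<in>K. of_complex (Poly_Mapping.lookup p m) * eval_monom m g)"
  unfolding eval_poly_def eval_monom_keys
  by (rule sum.mono_neutral_left) (use assms in \<open>auto simp: in_keys_iff\<close>)

lemma eval_poly_add: "eval_poly (p + q) g = eval_poly p g + eval_poly q g"
  for g :: "'r::complex_algebra^'n^'n::finite"
proof -
  let ?K = "Poly_Mapping.keys p \<union> Poly_Mapping.keys q"
  have "Poly_Mapping.keys (p + q) \<subseteq> ?K" by (rule keys_add)
  then show ?thesis
    by (simp add: eval_poly_superset[of ?K] lookup_add of_complex_add distrib_right sum.distrib)
qed

lemma eval_poly_0 [simp]: "eval_poly 0 g = 0"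
  by (simp add: eval_poly_def)

lemma eval_poly_sum: "eval_poly (sum f S) g = (\<Sum>x\<in>S. eval_poly (f x) g)"
  for g :: "'r::complex_algebra^'n^'n::finite"
  by (induction S rule: infinite_finite_induct) (simp_all add: eval_poly_add)

lemma eval_poly_single: "eval_poly (Poly_Mapping.single m c) g = of_complex c * eval_monom m g"
  for g :: "'r::complex_algebra^'n^'n::finite"
  by (subst eval_poly_superset[of "{m}"]) (auto simp: lookup_single)

lemma eval_poly_mult: "eval_poly (p * q) g = eval_poly p g * eval_poly q g"
  for g :: "'r::complex_algebra^'n^'n::finite"
proof -
  have s: "p = (\<Sum>m\<in>Poly_Mapping.keys p. Poly_Mapping.single m (Poly_Mapping.lookup p m))" for p :: "'n matrix_poly"
    by (rule poly_mapping_eqI) (simp add: lookup_sum lookup_single when_def in_keys_iff)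
  have "p * q = (\<Sum>m\<in>Poly_Mapping.keys p. \<Sum>m'\<in>Poly_Mapping.keys q.
      Poly_Mapping.single (m + m') (Poly_Mapping.lookup p m * Poly_Mapping.lookup q m'))"
    by (subst s[of p], subst s[of q]) (simp add: sum_product mult_single)
  then have "eval_poly (p * q) g = (\<Sum>m\<in>Poly_Mapping.keys p. \<Sum>m'\<in>Poly_Mapping.keys q.
      of_complex (Poly_Mapping.lookup p m) * eval_monom m g * (of_complex (Poly_Mapping.lookup q m') * eval_monom m' g))"
    by (simp add: eval_poly_sum eval_poly_single eval_monom_add of_complex_mult mult_ac)
  also have "\<dots> = eval_poly p g * eval_poly q g"
    by (simp add: eval_poly_superset[of "Poly_Mapping.keys p" p] eval_poly_superset[of "Poly_Mapping.keys q" q] sum_product)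
  finally show ?thesis .
qed

text \<open>Pairs of a polynomial function on complex matrices and the same function on matrices over
  the test ring.\<close>

inductive poly_pair :: "(complex^'n^'n \<Rightarrow> complex) \<Rightarrow> ('r::complex_algebra^'n^'n \<Rightarrow> 'r) \<Rightarrow> bool" where
  const: "poly_pair (\<lambda>_. c) (\<lambda>_. of_complex c)"
| entry: "poly_pair (\<lambda>g. g $ i $ j) (\<lambda>g. g $ i $ j)"
| add: "poly_pair f F \<Longrightarrow> poly_pair f' F' \<Longrightarrow> poly_pair (\<lambda>g. f g + f' g) (\<lambda>g. F g + F' g)"
| mult: "poly_pair f F \<Longrightarrow> poly_pair f' F' \<Longrightarrow> poly_pair (\<lambda>g. f g * f' g) (\<lambda>g. F g * F' g)"

lemma poly_pair_eval:
  assumes "poly_pair f (F :: 'r::complex_algebra^'n^'n::finite \<Rightarrow> 'r)"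
  obtains p where "f = eval_poly p" "F = eval_poly p"
  using assms
proof (induction arbitrary: thesis)
  case (const c)
  show ?case by (rule const[of "Poly_Mapping.single 0 c"]) (simp_all add: fun_eq_iff eval_poly_single)
next
  case (entry i j)
  show ?case by (rule entry[of "Poly_Mapping.single (Poly_Mapping.single (i, j) 1) 1"])
    (simp_all add: fun_eq_iff eval_poly_single eval_monom_single of_complex_1 del: One_nat_def)
next
  case (add f F f' F')
  obtain p q where "f = eval_poly p" "F = eval_poly p" "f' = eval_poly q" "F' = eval_poly q"
    using add.IH by metis
  then show ?case by (intro add.prems[of "p + q"]) (simp_all add: fun_eq_iff eval_poly_add)
next
  case (mult f F f' F')
  obtain p q where "f = eval_poly p" "F = eval_poly p" "f' = eval_poly q" "F' = eval_poly q"
    using mult.IH by metis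
  then show ?case by (intro mult.prems[of "p * q"]) (simp_all add: fun_eq_iff eval_poly_mult)
qed

lemma poly_pair_power: "poly_pair f F \<Longrightarrow> poly_pair (\<lambda>g. f g ^ k) (\<lambda>g. F g ^ k)"
proof (induction k)
  case 0
  show ?case using poly_pair.const[of 1, where 'r='b] by (simp add: of_complex_1)
next
  case (Suc k)
  then show ?case by (auto intro: poly_pair.mult)
qed

lemma poly_pair_sum:
  assumes "\<And>x. x \<in> S \<Longrightarrow> poly_pair (f x) (F x :: 'r::complex_algebra^'n^'n \<Rightarrow> 'r)"
  shows "poly_pair (\<lambda>g. \<Sum>x\<in>S. f x g) (\<lambda>g. \<Sum>x\<in>S. F x g)"
  using assms
proof (induction S rule: infinite_finite_induct)
  case (insert x S)
  then show ?case by (auto intro: poly_pair.add)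
qed (use poly_pair.const[of 0, where 'r='r] in simp_all)

lemma poly_pair_prod:
  assumes "\<And>x. x \<in> S \<Longrightarrow> poly_pair (f x) (F x :: 'r::complex_algebra^'n^'n \<Rightarrow> 'r)"
  shows "poly_pair (\<lambda>g. \<Prod>x\<in>S. f x g) (\<lambda>g. \<Prod>x\<in>S. F x g)"
  using assms
proof (induction S rule: infinite_finite_induct)
  case (insert x S)
  then show ?case by (auto intro: poly_pair.mult)
qed (use poly_pair.const[of 1, where 'r='r] in \<open>simp_all add: of_complex_1\<close>)

lemma eval_poly_expand:
  "eval_poly p = (\<lambda>g::'r::complex_algebra^'n^'n::finite. \<Sum>m\<in>Poly_Mapping.keys p.
      of_complex (Poly_Mapping.lookup p m) * (\<Prod>x\<in>UNIV. (g $ fst x $ snd x) ^ Poly_Mapping.lookup m x))"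
  by (simp add: eval_poly_superset[of "Poly_Mapping.keys p" p] eval_monom_def split_def fun_eq_iff)

lemma poly_pair_eval_poly: "poly_pair (eval_poly p) (eval_poly p :: 'r::complex_algebra^'n^'n::finite \<Rightarrow> 'r)"
  unfolding eval_poly_expand of_complex_of_complex
  by (intro poly_pair_sum poly_pair.mult poly_pair_prod poly_pair_power poly_pair.const poly_pair.entry)

lemma poly_pair_points:
  assumes "poly_pair f (F :: 'r::complex_algebra^'n^'n::finite \<Rightarrow> 'r)"
    and "\<And>h. h \<in> G \<Longrightarrow> f h = 0" and "g \<in> points G"
  shows "F g = 0"
proof -
  obtain p where "f = eval_poly p" "F = eval_poly p" using poly_pair_eval[OF assms(1)] .
  then show ?thesis using assms(2,3) by (auto simp: points_def)
qed

lemma pointsI: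
  assumes "invertible g"
    and "\<And>f F. poly_pair f (F :: 'r::complex_algebra^'n^'n::finite \<Rightarrow> 'r) \<Longrightarrow> (\<And>h. h \<in> G \<Longrightarrow> f h = 0) \<Longrightarrow> F g = 0"
  shows "g \<in> points G"
  unfolding points_def using assms poly_pair_eval_poly by blast

section \<open>The group of points\<close>

text \<open>Matrix multiplication is dual to a comultiplication on polynomial functions, defined
  over the complex numbers. The same finite list of pairs therefore has to serve complex matrices
  and the test ring at once; this is what lets an identity on \<open>G\<close> be
  transported.\<close>

lemma poly_pair_mult_expand:
  assumes "poly_pair f (F :: 'r::complex_algebra^'n^'n::finite \<Rightarrow> 'r)"
  shows "\<exists>N r R s S. (\<forall>i<N::nat. poly_pair (r i) (R i) \<and> poly_pair (s i) (S i)) \<and>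
    (\<forall>x y. f (x ** y) = (\<Sum>i<N. r i x * s i y)) \<and> (\<forall>x y. F (x ** y) = (\<Sum>i<N. R i x * S i y))"
proof -
  define P where "P f F \<longleftrightarrow> (\<exists>(I::nat set) r R s S. finite I \<and> (\<forall>i\<in>I. poly_pair (r i) (R i) \<and> poly_pair (s i) (S i)) \<and>
    (\<forall>x y. f (x ** y) = (\<Sum>i\<in>I. r i x * s i y)) \<and> (\<forall>x y. F (x ** y) = (\<Sum>i\<in>I. R i x * S i y)))"
    for f and F :: "'r^'n^'n \<Rightarrow> 'r"
  \<comment> \<open>The induction produces index sets that are sums and products of earlier ones;
    they are renumbered by natural numbers so that one predicate \<open>P\<close> covers all
    cases.\<close>
  have PI: "P f F" if "finite (J :: 'j set)" "\<And>i. i \<in> J \<Longrightarrow> poly_pair (r i) (R i)" "\<And>i. i \<in> J \<Longrightarrow> poly_pair (s i) (S i)"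
    "\<And>x y. f (x ** y) = (\<Sum>i\<in>J. r i x * s i y)" "\<And>x y. F (x ** y) = (\<Sum>i\<in>J. R i x * S i y)"
    for J :: "'j set" and r R s S f F
  proof -
    obtain e :: "nat \<Rightarrow> 'j" where e: "bij_betw e {..<card J} J"
      using ex_bij_betw_nat_finite[OF \<open>finite J\<close>] by (auto simp: atLeast0LessThan)
    show ?thesis unfolding P_def
      by (rule exI[of _ "{..<card J}"], rule exI[of _ "r \<circ> e"], rule exI[of _ "R \<circ> e"], rule exI[of _ "s \<circ> e"], rule exI[of _ "S \<circ> e"])
        (use that bij_betwE[OF e] in \<open>simp add: sum.reindex_bij_betw[OF e, of "\<lambda>i. r i _ * s i _"] sum.reindex_bij_betw[OF e, of "\<lambda>i. R i _ * S i _"]\<close>)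
  qed
  from assms have "P f F"
  proof induction
    case (const c)
    show ?case
      by (rule PI[where J = "{()}" and r = "\<lambda>_ _. c" and R = "\<lambda>_ _. of_complex c" and s = "\<lambda>_ _. 1" and S = "\<lambda>_ _. of_complex 1"])
        (simp_all only: poly_pair.const finite.intros, simp_all add: of_complex_1)
  next
    case (entry i j)
    show ?case
      by (rule PI[where J = "UNIV :: 'n set" and r = "\<lambda>k g. g $ i $ k" and R = "\<lambda>k g. g $ i $ k" and s = "\<lambda>k g. g $ k $ j" and S = "\<lambda>k g. g $ k $ j"])
        (auto intro: poly_pair.entry simp: matrix_matrix_mult_def)
  next
    case (add f F f' F')
    from add.IH(1)[unfolded P_def] obtain I :: "nat set" and r R s S where *:
      "finite I" "\<forall>i\<in>I. poly_pair (r i) (R i) \<and> poly_pair (s i) (S i)"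
      "\<forall>x y. f (x ** y) = (\<Sum>i\<in>I. r i x * s i y)" "\<forall>x y. F (x ** y) = (\<Sum>i\<in>I. R i x * S i y)"
      by blast
    from add.IH(2)[unfolded P_def] obtain I' :: "nat set" and r' R' s' S' where **:
      "finite I'" "\<forall>i\<in>I'. poly_pair (r' i) (R' i) \<and> poly_pair (s' i) (S' i)"
      "\<forall>x y. f' (x ** y) = (\<Sum>i\<in>I'. r' i x * s' i y)" "\<forall>x y. F' (x ** y) = (\<Sum>i\<in>I'. R' i x * S' i y)"
      by blast
    show ?case
      by (rule PI[where J = "I <+> I'" and r = "case_sum r r'" and R = "case_sum R R'" and s = "case_sum s s'" and S = "case_sum S S'"])
        (use * ** in \<open>auto simp: sum.Plus\<close>)
  next
    case (mult f F f' F')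
    from mult.IH(1)[unfolded P_def] obtain I :: "nat set" and r R s S where *:
      "finite I" "\<forall>i\<in>I. poly_pair (r i) (R i) \<and> poly_pair (s i) (S i)"
      "\<forall>x y. f (x ** y) = (\<Sum>i\<in>I. r i x * s i y)" "\<forall>x y. F (x ** y) = (\<Sum>i\<in>I. R i x * S i y)"
      by blast
    from mult.IH(2)[unfolded P_def] obtain I' :: "nat set" and r' R' s' S' where **:
      "finite I'" "\<forall>i\<in>I'. poly_pair (r' i) (R' i) \<and> poly_pair (s' i) (S' i)"
      "\<forall>x y. f' (x ** y) = (\<Sum>i\<in>I'. r' i x * s' i y)" "\<forall>x y. F' (x ** y) = (\<Sum>i\<in>I'. R' i x * S' i y)"
      by blast
    show ?case
      by (rule PI[where J = "I \<times> I'" and r = "\<lambda>(i, j) g. r i g * r' j g" and R = "\<lambda>(i, j) g. R i g * R' j g"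
            and s = "\<lambda>(i, j) g. s i g * s' j g" and S = "\<lambda>(i, j) g. S i g * S' j g"])
        (use * ** in \<open>auto simp: sum_product sum.cartesian_product split_def intro: poly_pair.mult intro!: sum.cong\<close>)
  qed
  then obtain I :: "nat set" and r R s S where *:
      "finite I" "\<forall>i\<in>I. poly_pair (r i) (R i) \<and> poly_pair (s i) (S i)"
      "\<forall>x y. f (x ** y) = (\<Sum>i\<in>I. r i x * s i y)" "\<forall>x y. F (x ** y) = (\<Sum>i\<in>I. R i x * S i y)"
    unfolding P_def by blast
  obtain e :: "nat \<Rightarrow> nat" where e: "bij_betw e {..<card I} I"
    using ex_bij_betw_nat_finite[OF \<open>finite I\<close>] by (auto simp: atLeast0LessThan)
  show ?thesis
    by (rule exI[of _ "card I"], rule exI[of _ "r \<circ> e"], rule exI[of _ "R \<circ> e"], rule exI[of _ "s \<circ> e"], rule exI[of _ "S \<circ> e"])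
        (use * bij_betwE[OF e] in \<open>simp add: sum.reindex_bij_betw[OF e, of "\<lambda>i. r i _ * s i _"] sum.reindex_bij_betw[OF e, of "\<lambda>i. R i _ * S i _"]\<close>)
qed


text \<open>A coordinate-free form of the fact that the ideal of G x G is generated by the ideals of
  the two factors. If the last \<open>s\<close> vanishes on \<open>G\<close> its summand drops out.
  Otherwise a point \<open>y0\<close> where it does not vanish expresses the last \<open>r\<close>
  on \<open>G\<close>, and hence at \<open>g\<close>, as a combination of the others; substituting
  shortens the sum by one.\<close>

lemma sum_products_vanish:
  assumes "\<And>i. i < N \<Longrightarrow> poly_pair (r i) (R i)"
    and "\<And>i. i < N \<Longrightarrow> poly_pair (s i) (S i :: 'r::complex_algebra^'n^'n::finite \<Rightarrow> 'r)"
    and "\<And>x y. x \<in> G \<Longrightarrow> y \<in> G \<Longrightarrow> (\<Sum>i<N. r i x * s i y) = 0"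
    and "g \<in> points G" "h \<in> points G"
  shows "(\<Sum>i<N::nat. R i g * S i h) = 0"
  using assms
proof (induction N arbitrary: s S r R)
  case (Suc N)
  show ?case
  proof (cases "\<forall>y\<in>G. s N y = 0")
    case True
    then have "S N h = 0" by (intro poly_pair_points[OF Suc.prems(2)[of N], where G = G] Suc.prems) auto
    moreover have "(\<Sum>i<N. R i g * S i h) = 0"
      using Suc.prems True by (intro Suc.IH[of r R s S]) force+
    ultimately show ?thesis by simp
  next
    case False
    then obtain y0 where y0: "y0 \<in> G" "s N y0 \<noteq> 0" by blast
    define c where "c i = s i y0 / s N y0" for i
    have r: "r N x = (\<Sum>i<N. - c i * r i x)" if "x \<in> G" for x
    proof -
      have "(\<Sum>i<N. r i x * s i y0) + r N x * s N y0 = 0" using Suc.prems(3)[OF that y0(1)] by simp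
      then have "r N x = (\<Sum>i<N. r i x * s i y0) * (- 1 / s N y0)" using y0(2) by (simp add: field_simps add_eq_0_iff)
      then show ?thesis by (simp add: c_def sum_distrib_left sum_distrib_right mult_ac)
    qed
    have R: "R N g = (\<Sum>i<N. of_complex (- c i) * R i g)"
    proof -
      have "poly_pair (\<lambda>x. r N x + (\<Sum>i<N. c i * r i x)) (\<lambda>x. R N x + (\<Sum>i<N. of_complex (c i) * R i x))"
        by (intro poly_pair.add poly_pair_sum poly_pair.mult poly_pair.const Suc.prems) auto
      from poly_pair_points[OF this _ Suc.prems(4)] r
      have "R N g + (\<Sum>i<N. of_complex (c i) * R i g) = 0" by (simp add: sum_negf)
      then show ?thesis by (simp add: of_complex_minus sum_negf eq_neg_iff_add_eq_0)
    qed
    have "(\<Sum>i<N. R i g * (S i h + of_complex (- c i) * S N h)) = 0"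
    proof (rule Suc.IH)
      show "poly_pair (\<lambda>y. s i y + - c i * s N y) (\<lambda>y. S i y + of_complex (- c i) * S N y)" if "i < N" for i
        using that by (intro poly_pair.add poly_pair.mult poly_pair.const Suc.prems) auto
      fix x y assume "x \<in> G" "y \<in> G"
      have "(\<Sum>i<N. r i x * (s i y + - c i * s N y)) = (\<Sum>i<N. r i x * s i y) + (\<Sum>i<N. - c i * r i x) * s N y"
        by (simp add: sum_distrib_right sum_distrib_left sum_subtractf sum_negf algebra_simps)
      also have "\<dots> = 0" using Suc.prems(3)[OF \<open>x \<in> G\<close> \<open>y \<in> G\<close>] r[OF \<open>x \<in> G\<close>] by simp
      finally show "(\<Sum>i<N. r i x * (s i y + - c i * s N y)) = 0" .
    qed (use Suc.prems in auto)
    also have "(\<Sum>i<N. R i g * (S i h + of_complex (- c i) * S N h)) =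
        (\<Sum>i<N. R i g * S i h) + (\<Sum>i<N. of_complex (- c i) * R i g) * S N h"
      by (simp add: sum_distrib_right sum_distrib_left distrib_left sum.distrib mult_ac)
    also have "\<dots> = (\<Sum>i<Suc N. R i g * S i h)"
      by (simp flip: R)
    finally show ?thesis .
  qed
qed simp

lemma points_mult:
  fixes g h :: "'r::complex_algebra^'n^'n::finite"
  assumes G: "\<And>x y. x \<in> G \<Longrightarrow> y \<in> G \<Longrightarrow> x ** y \<in> G" and g: "g \<in> points G" and h: "h \<in> points G"
  shows "g ** h \<in> points G"
proof (rule pointsI)
  show "invertible (g ** h)" using g h by (simp add: points_def invertible_mult)
  fix f and F :: "'r^'n^'n \<Rightarrow> 'r"
  assume f: "poly_pair f F" and f0: "\<And>x. x \<in> G \<Longrightarrow> f x = 0"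
  from poly_pair_mult_expand[OF f] obtain N :: nat and r R s S where
    *: "\<forall>i<N. poly_pair (r i) (R i) \<and> poly_pair (s i) (S i)"
    "\<forall>x y. f (x ** y) = (\<Sum>i<N. r i x * s i y)" "\<forall>x y. F (x ** y) = (\<Sum>i<N. R i x * S i y)"
    by blast
  show "F (g ** h) = 0"
    unfolding *(3)[rule_format]
  proof (rule sum_products_vanish[OF _ _ _ g h])
    show "(\<Sum>i<N. r i x * s i y) = 0" if "x \<in> G" "y \<in> G" for x y
      using *(2)[rule_format, of x y] f0[OF G[OF that]] by simp
  qed (use *(1) in auto)
qed

section \<open>Inverses of points\<close>

lemma poly_pair_det:
  fixes F :: "'m \<Rightarrow> 'm::finite \<Rightarrow> 'r::complex_algebra^'n^'n \<Rightarrow> 'r"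
  assumes "\<And>i j. poly_pair (f i j) (F i j)"
  shows "poly_pair (\<lambda>g. det (\<chi> i j. f i j g)) (\<lambda>g. det (\<chi> i j. F i j g))"
proof -
  have "poly_pair (\<lambda>_. of_int (sign p)) (\<lambda>_::'r^'n^'n. of_int (sign p))" for p :: "'m \<Rightarrow> 'm"
    using poly_pair.const[of "of_int (sign p)", where 'r='r and 'n='n]
    by (cases p rule: sign_cases) (simp_all add: of_complex_minus of_complex_1)
  then show ?thesis
    unfolding det_def by (auto intro!: poly_pair_sum poly_pair.mult poly_pair_prod assms)
qed

text \<open>Column \<open>l\<close> of \<open>B\<close> solves a linear system with the
  \<open>l\<close>-th unit vector on the right; Cramer's rule for its \<open>k\<close>-th unknown
  puts that vector in column \<open>k\<close> of \<open>A\<close>.\<close>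

lemma det_mult_inverse_entry:
  fixes A :: "'a::field^'n^'n"
  assumes "A ** B = mat 1"
  shows "det A * B $ k $ l = det (\<chi> i j. if j = k then (if i = l then 1 else 0) else A $ i $ j)"
proof -
  have "A *v (\<chi> i. B $ i $ l) = (\<chi> i. if i = l then 1 else 0)"
    using assms by (auto simp: vec_eq_iff matrix_vector_mult_def matrix_matrix_mult_def mat_def)
  with cramer_lemma[where A = A and x = "\<chi> i. B $ i $ l" and k = k] show ?thesis
    by (simp add: mult.commute cong: if_cong)
qed

text \<open>Entries of the inverse have denominator \<open>det A\<close>, so a polynomial in them
  becomes a polynomial in \<open>A\<close> after multiplication by a power of the determinant. The
  exponent \<open>d\<close> must be the same for complex matrices and for the test ring.\<close>

lemma poly_pair_inverse:
  assumes "poly_pair f (F :: 'r::complex_field^'n^'n::finite \<Rightarrow> 'r)"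
  shows "\<exists>d f' F'. poly_pair f' F' \<and> (\<forall>A B. A ** B = mat 1 \<longrightarrow> det A ^ d * f B = f' A) \<and>
    (\<forall>A B. A ** B = mat 1 \<longrightarrow> det A ^ d * F B = F' A)"
  using assms
proof induction
  case (const c)
  show ?case by (intro exI[of _ 0] exI conjI) (rule poly_pair.const[of c], auto)
next
  case (entry i j)
  have e: "poly_pair (\<lambda>A. if j' = i then (if i' = j then 1 else 0) else A $ i' $ j')
     (\<lambda>A. if j' = i then (if i' = j then 1 else 0) else A $ i' $ j' :: 'r)" for i' j'
    using poly_pair.const[of 1, where 'r='r and 'n='n] poly_pair.const[of 0, where 'r='r and 'n='n]
    by (cases "j' = i"; cases "i' = j") (simp_all add: of_complex_1 poly_pair.entry)
  show ?case
    by (intro exI[of _ 1] exI conjI) (rule poly_pair_det, rule e, auto simp: det_mult_inverse_entry)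
next
  case (add f F f' F')
  from add.IH(1) obtain d p P where p0: "poly_pair p P"
    "\<forall>A B. A ** B = mat 1 \<longrightarrow> det A ^ d * f B = p A"
    "\<forall>A B. A ** B = mat 1 \<longrightarrow> det A ^ d * F B = P A"
    by blast
  note p = p0(1) p0(2)[rule_format, symmetric] p0(3)[rule_format, symmetric]
  from add.IH(2) obtain d' p' P' where p'0: "poly_pair p' P'"
    "\<forall>A B. A ** B = mat 1 \<longrightarrow> det A ^ d' * f' B = p' A"
    "\<forall>A B. A ** B = mat 1 \<longrightarrow> det A ^ d' * F' B = P' A"
    by blast
  note p' = p'0(1) p'0(2)[rule_format, symmetric] p'0(3)[rule_format, symmetric]
  have det: "poly_pair det (det :: 'r^'n^'n \<Rightarrow> 'r)"
    using poly_pair_det[where f = "\<lambda>i j g. g $ i $ j" and F = "\<lambda>i j g. g $ i $ j", OF poly_pair.entry] by simp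
  show ?case
  proof (intro exI conjI allI impI)
    show "poly_pair (\<lambda>A. det A ^ d' * p A + det A ^ d * p' A) (\<lambda>A. det A ^ d' * P A + det A ^ d * P' A)"
      by (rule poly_pair.add[OF poly_pair.mult[OF poly_pair_power[OF det] p(1)] poly_pair.mult[OF poly_pair_power[OF det] p'(1)]])
    show "det A ^ (d + d') * (f B + f' B) = det A ^ d' * p A + det A ^ d * p' A" if "A ** B = mat 1" for A B
      by (simp add: p(2)[OF that] p'(2)[OF that] power_add distrib_left mult_ac)
    show "det A ^ (d + d') * (F B + F' B) = det A ^ d' * P A + det A ^ d * P' A" if "A ** B = mat 1" for A B
      by (simp add: p(3)[OF that] p'(3)[OF that] power_add distrib_left mult_ac)
  qed
next
  case (mult f F f' F')
  from mult.IH(1) obtain d p P where p0: "poly_pair p P"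
    "\<forall>A B. A ** B = mat 1 \<longrightarrow> det A ^ d * f B = p A"
    "\<forall>A B. A ** B = mat 1 \<longrightarrow> det A ^ d * F B = P A"
    by blast
  note p = p0(1) p0(2)[rule_format, symmetric] p0(3)[rule_format, symmetric]
  from mult.IH(2) obtain d' p' P' where p'0: "poly_pair p' P'"
    "\<forall>A B. A ** B = mat 1 \<longrightarrow> det A ^ d' * f' B = p' A"
    "\<forall>A B. A ** B = mat 1 \<longrightarrow> det A ^ d' * F' B = P' A"
    by blast
  note p' = p'0(1) p'0(2)[rule_format, symmetric] p'0(3)[rule_format, symmetric]
  show ?case
  proof (intro exI conjI allI impI)
    show "poly_pair (\<lambda>A. p A * p' A) (\<lambda>A. P A * P' A)" by (rule poly_pair.mult[OF p(1) p'(1)])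
    show "det A ^ (d + d') * (f B * f' B) = p A * p' A" if "A ** B = mat 1" for A B
      by (simp add: p(2)[OF that] p'(2)[OF that] power_add mult_ac)
    show "det A ^ (d + d') * (F B * F' B) = P A * P' A" if "A ** B = mat 1" for A B
      by (simp add: p(3)[OF that] p'(3)[OF that] power_add mult_ac)
  qed
qed

lemma matrix_inv_mult:
  assumes "invertible (A :: 'a::semiring_1^'n^'n)"
  shows "A ** matrix_inv A = mat 1" "matrix_inv A ** A = mat 1"
  using someI_ex[OF assms[unfolded invertible_def]] by (simp_all add: matrix_inv_def)

lemma matrix_inv_unique:
  assumes "(A :: 'a::semiring_1^'n^'n) ** B = mat 1" "B ** A = mat 1"
  shows "matrix_inv A = B"
proof -
  have "invertible A" using assms invertible_def by blast
  then have "matrix_inv A = matrix_inv A ** (A ** B)" by (simp add: assms)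
  also have "\<dots> = B" by (simp only: matrix_mul_assoc matrix_inv_mult[OF \<open>invertible A\<close>] matrix_mul_lid)
  finally show ?thesis .
qed

lemma points_inverse_field:
  fixes A B :: "'r::complex_field^'n^'n::finite"
  assumes G: "\<And>g. g \<in> G \<Longrightarrow> invertible g \<and> matrix_inv g \<in> G" and A: "A \<in> points G" and AB: "A ** B = mat 1"
  shows "B \<in> points G"
proof (rule pointsI)
  show "invertible B" using AB invertible_left_inverse by blast
  fix f and F :: "'r^'n^'n \<Rightarrow> 'r"
  assume f: "poly_pair f F" and f0: "\<And>x. x \<in> G \<Longrightarrow> f x = 0"
  from poly_pair_inverse[OF f] obtain d f' F' where *: "poly_pair f' F'"
    "\<forall>A B. A ** B = mat 1 \<longrightarrow> det A ^ d * f B = f' A" "\<forall>A B. A ** B = mat 1 \<longrightarrow> det A ^ d * F B = F' A"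
    by blast
  have "f' g = 0" if "g \<in> G" for g
    using *(2)[rule_format, of g "matrix_inv g"] G[OF that] f0[of "matrix_inv g"] by (simp add: matrix_inv_mult)
  then have "F' A = 0" by (rule poly_pair_points[OF *(1) _ A])
  moreover have "det A \<noteq> 0" using A by (simp add: points_def invertible_det_nz)
  ultimately show "F B = 0" using *(3)[rule_format, OF AB] by simp
qed

section \<open>Change of the test ring\<close>

definition complex_algebra_hom :: "('r::complex_algebra \<Rightarrow> 's::complex_algebra) \<Rightarrow> bool" where
  "complex_algebra_hom \<phi> \<longleftrightarrow> (\<forall>a b. \<phi> (a + b) = \<phi> a + \<phi> b) \<and> (\<forall>a b. \<phi> (a * b) = \<phi> a * \<phi> b) \<and>
     (\<forall>c. \<phi> (of_complex c) = of_complex c)"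

lemma complex_algebra_hom_simps:
  assumes "complex_algebra_hom \<phi>"
  shows "\<phi> (a + b) = \<phi> a + \<phi> b" "\<phi> (a * b) = \<phi> a * \<phi> b" "\<phi> (of_complex c) = of_complex c"
    "\<phi> 0 = 0" "\<phi> 1 = 1" "\<phi> (a ^ n) = \<phi> a ^ n" "\<phi> (sum f S) = (\<Sum>x\<in>S. \<phi> (f x))" "\<phi> (prod f S) = (\<Prod>x\<in>S. \<phi> (f x))"
proof -
  show 1: "\<phi> (a + b) = \<phi> a + \<phi> b" "\<phi> (a * b) = \<phi> a * \<phi> b" "\<phi> (of_complex c) = of_complex c" for a b c
    using assms by (simp_all add: complex_algebra_hom_def)
  show 2: "\<phi> 0 = 0" "\<phi> 1 = 1" using 1(3)[of 0] 1(3)[of 1] by (simp_all add: of_complex_1)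
  show "\<phi> (a ^ n) = \<phi> a ^ n" by (induction n) (simp_all add: 1 2)
  show "\<phi> (sum f S) = (\<Sum>x\<in>S. \<phi> (f x))" by (induction S rule: infinite_finite_induct) (simp_all add: 1 2)
  show "\<phi> (prod f S) = (\<Prod>x\<in>S. \<phi> (f x))" by (induction S rule: infinite_finite_induct) (simp_all add: 1 2)
qed

lemma hom_eval_poly:
  fixes g :: "'r::complex_algebra^'n^'n::finite"
  assumes "complex_algebra_hom \<phi>"
  shows "eval_poly p (map_matrix \<phi> g) = \<phi> (eval_poly p g)"
  by (simp add: eval_poly_expand complex_algebra_hom_simps[OF assms])

lemma hom_matrix_mult:
  assumes "complex_algebra_hom \<phi>"
  shows "map_matrix \<phi> (A ** B) = map_matrix \<phi> A ** map_matrix \<phi> B"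
  by (simp add: vec_eq_iff matrix_matrix_mult_def complex_algebra_hom_simps[OF assms])

lemma hom_mat_1:
  assumes "complex_algebra_hom \<phi>"
  shows "map_matrix \<phi> (mat 1) = mat 1"
  by (simp add: vec_eq_iff mat_def complex_algebra_hom_simps[OF assms])

lemma hom_invertible:
  assumes "complex_algebra_hom \<phi>" "invertible A"
  shows "invertible (map_matrix \<phi> A)"
  using assms(2) unfolding invertible_def by (metis hom_matrix_mult[OF assms(1)] hom_mat_1[OF assms(1)])

lemma hom_points:
  fixes g :: "'r::complex_algebra^'n^'n::finite"
  assumes "complex_algebra_hom \<phi>" "g \<in> points G"
  shows "map_matrix \<phi> g \<in> points G"
  using assms(2) by (auto simp: points_def hom_eval_poly[OF assms(1)] hom_invertible[OF assms(1)] complex_algebra_hom_simps[OF assms(1)])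

lemma complex_algebra_hom_of_complex: "complex_algebra_hom (of_complex :: complex \<Rightarrow> 'r::complex_algebra)"
  by (simp add: complex_algebra_hom_def of_complex_add of_complex_mult)

lemma complex_algebra_hom_fps_to_fls: "complex_algebra_hom (fps_to_fls :: complex fps \<Rightarrow> complex fls)"
  by (simp add: complex_algebra_hom_def fls_times_fps_to_fls of_complex_fps_def of_complex_fls_def)

lemma complex_algebra_hom_fps_nth_0: "complex_algebra_hom (\<lambda>f :: complex fps. fps_nth f 0)"
  by (simp add: complex_algebra_hom_def of_complex_fps_def)

lemma linear_algebraic_groupD:
  assumes "linear_algebraic_group G"
  shows "mat 1 \<in> G" "\<And>g h. g \<in> G \<Longrightarrow> h \<in> G \<Longrightarrow> g ** h \<in> G" "\<And>g. g \<in> G \<Longrightarrow> matrix_inv g \<in> G" "\<And>g. g \<in> G \<Longrightarrow> invertible g"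
  using assms by (auto simp: linear_algebraic_group_def zariski_closed_GL_def)

lemma points_complex:
  assumes "linear_algebraic_group (G :: (complex^'n^'n::finite) set)"
  shows "points G = G"
proof -
  from assms obtain I where "G = {g. invertible g \<and> (\<forall>p\<in>I. eval_poly p g = 0)}"
    by (auto simp: linear_algebraic_group_def zariski_closed_GL_def)
  then show ?thesis by (auto simp: points_def)
qed

lemma const_in_points:
  fixes h :: "complex^'n^'n::finite"
  assumes "linear_algebraic_group G" "h \<in> G"
  shows "map_matrix of_complex h \<in> (points G :: ('r::complex_algebra^'n^'n) set)"
  using hom_points[OF complex_algebra_hom_of_complex, of h G] points_complex[OF assms(1)] assms(2) by blast

text \<open>Power series embed injectively into Laurent series, so polynomial equations may be
  tested there. Invertibility may not: the matrix with single entry z becomes invertible.\<close>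

lemma points_fps_iff:
  fixes g :: "complex fps^'n^'n::finite"
  shows "g \<in> points G \<longleftrightarrow> invertible g \<and> map_matrix fps_to_fls g \<in> points G"
proof
  assume g: "invertible g \<and> map_matrix fps_to_fls g \<in> points G"
  show "g \<in> points G"
    unfolding points_def
  proof (intro CollectI conjI allI impI)
    fix p assume "\<forall>h\<in>G. eval_poly p h = 0"
    then have "eval_poly p (map_matrix fps_to_fls g) = 0" using g by (auto simp: points_def)
    then show "eval_poly p g = 0" by (simp add: hom_eval_poly[OF complex_algebra_hom_fps_to_fls])
  qed (use g in blast)
qed (auto simp: hom_points[OF complex_algebra_hom_fps_to_fls], simp add: points_def)

text \<open>Clearing determinants is done over the field of Laurent series; the inverse already has
  power series entries, so the result descends.\<close>

lemma points_inverse: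
  assumes G: "linear_algebraic_group (G :: (complex^'n^'n::finite) set)"
  shows "(A :: complex fps^'n^'n) \<in> points G \<Longrightarrow> \<exists>B \<in> points G. A ** B = mat 1 \<and> B ** A = mat 1"
proof -
  assume A: "A \<in> points G"
  then obtain B where B: "A ** B = mat 1" "B ** A = mat 1" by (auto simp: points_def invertible_def)
  have "map_matrix fps_to_fls B \<in> points G"
  proof (rule points_inverse_field)
    show "map_matrix fps_to_fls A ** map_matrix fps_to_fls B = mat 1"
      by (simp add: hom_matrix_mult[OF complex_algebra_hom_fps_to_fls, symmetric] B hom_mat_1[OF complex_algebra_hom_fps_to_fls])
    show "map_matrix fps_to_fls A \<in> points G" using A by (simp add: points_fps_iff)
  qed (use linear_algebraic_groupD[OF G] in auto)
  moreover have "invertible B" using B invertible_def by blast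
  ultimately show ?thesis using B points_fps_iff by blast
qed

section \<open>Cocharacters\<close>

lemma unit_mult: "x dvd 1 \<Longrightarrow> y dvd 1 \<Longrightarrow> x * y dvd (1 :: 'a::comm_semiring_1)"
  using mult_dvd_mono[of x 1 y 1] by simp

lemma unit_inverse_unique:
  assumes "x * y = (1 :: 'r::complex_algebra)"
  shows "inverse x = y"
proof -
  have "x dvd 1" using assms by (metis dvd_triv_left)
  have "inverse x = (x * y) * inverse x" by (simp add: assms)
  also have "\<dots> = (x * inverse x) * y" by (simp add: mult_ac)
  finally show ?thesis by (simp add: unit_inverse[OF \<open>x dvd 1\<close>])
qed

lemma unit_inverse_mult:
  assumes "x dvd 1" "y dvd (1 :: 'r::complex_algebra)"
  shows "inverse (x * y) = inverse x * inverse y"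
proof (rule unit_inverse_unique)
  have "x * y * (inverse x * inverse y) = (x * inverse x) * (y * inverse y)" by (simp add: mult_ac)
  then show "x * y * (inverse x * inverse y) = 1" by (simp add: unit_inverse assms)
qed

lemma unit_inverse_dvd: "x dvd 1 \<Longrightarrow> inverse x dvd (1 :: 'r::complex_algebra)"
  by (metis dvd_triv_right unit_inverse)

lemma unit_power_int_mult:
  "x dvd 1 \<Longrightarrow> y dvd 1 \<Longrightarrow> (x * y) powi k = x powi k * y powi k" for x :: "'r::complex_algebra"
  by (simp add: power_int_def unit_inverse_mult power_mult_distrib)

lemma unit_power_int_1: "1 powi k = (1 :: 'r::complex_algebra)"
  using unit_inverse_unique[of 1 "1::'r"] by (simp add: power_int_def)

lemma unit_power_int_add_1:
  assumes "x dvd (1 :: 'r::complex_algebra)"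
  shows "x powi (k + 1) = x powi k * x"
proof (cases "k \<ge> 0")
  case True
  then show ?thesis by (simp add: power_int_def nat_add_distrib mult.commute)
next
  case False
  then have k: "k = - int (Suc (nat (- k) - 1))" by simp
  then obtain n where k: "k = - int (Suc n)" by blast
  have "inverse x ^ Suc n * x = inverse x ^ n * (x * inverse x)" by (simp add: mult_ac)
  then show ?thesis using unit_inverse[OF assms] by (cases n) (simp_all add: k power_int_def nat_add_distrib)
qed

lemma unit_power_int_add:
  assumes "x dvd (1 :: 'r::complex_algebra)"
  shows "x powi (j + k) = x powi j * x powi k"
proof (induction k rule: int_induct[where k = 0])
  case base
  show ?case by simp
next
  case (step1 k)
  then show ?case using unit_power_int_add_1[OF assms, of "j + k"] unit_power_int_add_1[OF assms, of k]
    by (simp add: add.assoc mult_ac)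
next
  case (step2 k)
  have "x powi (j + (k - 1)) * x = x powi j * x powi (k - 1) * x"
    using step2(2) unit_power_int_add_1[OF assms, of "j + (k - 1)"] unit_power_int_add_1[OF assms, of "k - 1"]
    by (simp add: add.assoc mult_ac)
  then have "x powi (j + (k - 1)) * (x * inverse x) = x powi j * x powi (k - 1) * (x * inverse x)"
    by (simp only: mult.assoc[symmetric])
  then show ?case by (simp add: unit_inverse[OF assms])
qed

text \<open>After multiplication by the power with exponent minus the least one occurring, this is a
  polynomial with infinitely many zeros.\<close>

lemma laurent_polynomial_eq_0:
  fixes a :: "int \<Rightarrow> complex"
  assumes K: "finite K" and 0: "\<And>t. t \<noteq> 0 \<Longrightarrow> (\<Sum>k\<in>K. a k * t powi k) = 0" and k: "k \<in> K"
  shows "a k = 0"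
proof -
  define m where "m = Min K"
  have m: "m \<le> j" if "j \<in> K" for j using K that by (simp add: m_def)
  define p where "p = (\<Sum>k\<in>K. monom (a k) (nat (k - m)))"
  have "poly p t = 0" if "t \<noteq> 0" for t
  proof -
    have "t ^ nat (k - m) = t powi k * t powi (- m)" if "k \<in> K" for k
      using m[OF that] power_int_add[of t k "- m"] \<open>t \<noteq> 0\<close> by (simp add: power_int_def[of t "k - m"])
    then have "poly p t = (\<Sum>k\<in>K. a k * t powi k * t powi (- m))"
      by (simp add: p_def poly_sum poly_monom mult.assoc)
    also have "\<dots> = 0" using 0[OF that] by (simp flip: sum_distrib_right)
    finally show ?thesis .
  qed
  then have "UNIV - {0} \<subseteq> {t. poly p t = 0}" by blast
  moreover have "infinite (UNIV - {0 :: complex})" by (simp add: infinite_UNIV_char_0)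
  ultimately have "p = 0" using poly_roots_finite finite_subset by blast
  have "coeff p (nat (k - m)) = (\<Sum>j\<in>K. if j = k then a j else 0)"
    unfolding p_def coeff_sum using m k by (intro sum.cong) (auto simp: eq_nat_nat_iff)
  then show ?thesis using \<open>p = 0\<close> K k by simp
qed

lemma matrix_laurent_polynomial_eq_0:
  fixes M :: "int \<Rightarrow> complex^'n^'m"
  assumes "finite K" "\<And>t. t \<noteq> 0 \<Longrightarrow> (\<Sum>k\<in>K. scale_tensor (t powi k) (M k)) = 0" "k \<in> K"
  shows "M k = 0"
proof -
  have "M k $ i $ j = 0" for i j
  proof (rule laurent_polynomial_eq_0[where a = "\<lambda>k. M k $ i $ j", OF assms(1) _ assms(3)])
    fix t :: complex assume "t \<noteq> 0"
    then have "(\<Sum>k\<in>K. scale_tensor (t powi k) (M k)) $ i $ j = 0" by (simp add: assms(2))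
    then show "(\<Sum>k\<in>K. M k $ i $ j * t powi k) = 0" by (simp add: mult.commute)
  qed
  then show ?thesis by (simp add: vec_eq_iff)
qed

lemma cochar_at_eq:
  "cochar_at lam r = (\<Sum>k\<in>Poly_Mapping.keys lam. scale_tensor (r powi k) (map_matrix of_complex (Poly_Mapping.lookup lam k)))"
  by (simp add: vec_eq_iff cochar_at_def mult.commute)

lemma map_matrix_id [simp]: "map_matrix (\<lambda>x. x) A = A"
  by (simp add: vec_eq_iff)

lemma map_matrix_of_complex_id [simp]: "map_matrix (of_complex :: complex \<Rightarrow> complex) A = A"
  by (simp add: vec_eq_iff)

lemma laurent_matrix_eq_iff:
  fixes lam mu :: "int \<Rightarrow>\<^sub>0 complex^'n^'n::finite"
  assumes "\<And>t::complex. t \<noteq> 0 \<Longrightarrow> cochar_at lam t = cochar_at mu t"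
  shows "lam = mu"
proof (rule poly_mapping_eqI)
  fix k
  let ?K = "Poly_Mapping.keys lam \<union> Poly_Mapping.keys mu"
  have s: "cochar_at lam t = (\<Sum>k\<in>?K. scale_tensor (t powi k) (Poly_Mapping.lookup lam k))"
    "cochar_at mu t = (\<Sum>k\<in>?K. scale_tensor (t powi k) (Poly_Mapping.lookup mu k))" for t :: complex
    unfolding cochar_at_eq map_matrix_of_complex_id
    by (intro sum.mono_neutral_left; auto simp: in_keys_iff)+
  show "Poly_Mapping.lookup lam k = Poly_Mapping.lookup mu k"
  proof (cases "k \<in> ?K")
    case True
    have "Poly_Mapping.lookup lam k - Poly_Mapping.lookup mu k = 0"
      by (rule matrix_laurent_polynomial_eq_0[where M = "\<lambda>k. Poly_Mapping.lookup lam k - Poly_Mapping.lookup mu k" and K = ?K])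
        (use True assms in \<open>auto simp: s scale_tensor_diff sum_subtractf\<close>)
    then show ?thesis by simp
  qed (auto simp: in_keys_iff)
qed

context
  fixes T :: "(complex^'n^'n::finite) set" and lam :: "int \<Rightarrow>\<^sub>0 complex^'n^'n"
  assumes lam: "cocharacter T lam" and T: "\<And>t. t \<in> T \<Longrightarrow> invertible t"
begin

text \<open>The coefficients of a cocharacter are the projections onto its weight spaces. Compare
  coefficients in the identity for the value at \<open>s * t\<close>, first as Laurent polynomials
  in \<open>t\<close> with \<open>s\<close> fixed, then in \<open>s\<close>.\<close>

lemma cochar_projections:
  assumes "j \<in> Poly_Mapping.keys lam" "k \<in> Poly_Mapping.keys lam"
  shows "Poly_Mapping.lookup lam j ** Poly_Mapping.lookup lam k = (if j = k then Poly_Mapping.lookup lam k else 0)"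
proof -
  let ?K = "Poly_Mapping.keys lam" and ?M = "Poly_Mapping.lookup lam"
  have 1: "(\<Sum>j\<in>?K. scale_tensor (s powi j) (?M j ** ?M k)) - scale_tensor (s powi k) (?M k) = 0" if "s \<noteq> 0" "k \<in> ?K" for k s
  proof (rule matrix_laurent_polynomial_eq_0[where M = "\<lambda>k. (\<Sum>j\<in>?K. scale_tensor (s powi j) (?M j ** ?M k)) - scale_tensor (s powi k) (?M k)", OF finite_keys[of lam] _ \<open>k \<in> ?K\<close>])
    fix t :: complex assume "t \<noteq> 0"
    with lam \<open>s \<noteq> 0\<close> have "cochar_at lam (s * t) = cochar_at lam s ** cochar_at lam t" by (auto simp: cocharacter_def)
    then have "(\<Sum>k\<in>?K. scale_tensor ((s * t) powi k) (?M k)) = (\<Sum>k\<in>?K. \<Sum>j\<in>?K. scale_tensor (t powi k * s powi j) (?M j ** ?M k))"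
      by (simp add: cochar_at_eq matrix_mul_sum_left matrix_mul_sum_right scale_tensor_mul_left scale_tensor_mul_right scale_tensor_sum mult_ac)
    then show "(\<Sum>k\<in>?K. scale_tensor (t powi k) ((\<Sum>j\<in>?K. scale_tensor (s powi j) (?M j ** ?M k)) - scale_tensor (s powi k) (?M k))) = 0"
      by (simp add: scale_tensor_diff scale_tensor_sum sum_subtractf power_int_mult_distrib mult_ac)
  qed
  have "?M j ** ?M k - (if j = k then ?M k else 0) = 0"
  proof (rule matrix_laurent_polynomial_eq_0[where M = "\<lambda>j. ?M j ** ?M k - (if j = k then ?M k else 0)", OF finite_keys[of lam] _ assms(1)])
    fix s :: complex assume "s \<noteq> 0"
    have "(\<Sum>j\<in>?K. scale_tensor (s powi j) (if j = k then ?M k else 0)) = (\<Sum>j\<in>?K. if j = k then scale_tensor (s powi j) (?M k) else 0)"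
      by (intro sum.cong) auto
    also have "\<dots> = scale_tensor (s powi k) (?M k)" using assms(2) by simp
    finally show "(\<Sum>j\<in>?K. scale_tensor (s powi j) (?M j ** ?M k - (if j = k then ?M k else 0))) = 0"
      using 1[OF \<open>s \<noteq> 0\<close> assms(2)] by (simp add: scale_tensor_diff sum_subtractf)
  qed
  then show ?thesis by simp
qed

text \<open>Multiplicativity makes the value at 1 idempotent, and an invertible idempotent is the
  identity.\<close>

lemma cochar_at_complex_1: "cochar_at lam (1::complex) = mat 1"
proof -
  let ?e = "cochar_at lam (1::complex)"
  have e: "?e = ?e ** ?e"
    using lam[unfolded cocharacter_def, THEN conjunct2, rule_format, of 1 1] by simp
  have "?e \<in> T"
    using lam[unfolded cocharacter_def, THEN conjunct1, rule_format, of 1] by simp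
  then have i: "invertible ?e" by (rule T)
  have "?e ** matrix_inv ?e = (?e ** ?e) ** matrix_inv ?e" using e by simp
  also have "\<dots> = ?e ** (?e ** matrix_inv ?e)" by (rule matrix_mul_assoc[symmetric])
  finally show ?thesis by (simp add: matrix_inv_mult[OF i])
qed

lemma cochar_projections_sum: "(\<Sum>k\<in>Poly_Mapping.keys lam. Poly_Mapping.lookup lam k) = mat 1"
  using cochar_at_complex_1 by (simp add: cochar_at_eq)

lemma cochar_at_1: "cochar_at lam (1 :: 'r::complex_algebra) = mat 1"
proof -
  have "cochar_at lam (1 :: 'r) = map_matrix of_complex (\<Sum>k\<in>Poly_Mapping.keys lam. Poly_Mapping.lookup lam k)"
    by (simp add: cochar_at_eq unit_power_int_1 vec_eq_iff of_complex_sum)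
  then show ?thesis by (simp add: cochar_projections_sum hom_mat_1[OF complex_algebra_hom_of_complex])
qed

text \<open>Multiplicativity is assumed only at complex numbers. It was turned into relations
  between the coefficients, and these survive the passage to any test ring.\<close>

lemma cochar_at_mult:
  fixes r s :: "'r::complex_algebra"
  assumes "r dvd 1" "s dvd 1"
  shows "cochar_at lam (r * s) = cochar_at lam r ** cochar_at lam s"
proof -
  let ?K = "Poly_Mapping.keys lam" and ?M = "\<lambda>k. map_matrix of_complex (Poly_Mapping.lookup lam k) :: 'r^'n^'n"
  have "?M j ** ?M k = (if j = k then ?M k else 0)" if "j \<in> ?K" "k \<in> ?K" for j k
    using cochar_projections[OF that] by (simp add: hom_matrix_mult[OF complex_algebra_hom_of_complex, symmetric] vec_eq_iff)
  then have "cochar_at lam r ** cochar_at lam s = (\<Sum>j\<in>?K. \<Sum>k\<in>?K. scale_tensor (r powi j * s powi k) (if j = k then ?M k else 0))"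
    by (subst sum.swap)
      (simp add: cochar_at_eq matrix_mul_sum_left matrix_mul_sum_right scale_tensor_mul_left scale_tensor_mul_right scale_tensor_sum mult_ac cong: sum.cong)
  also have "\<dots> = (\<Sum>j\<in>?K. \<Sum>k\<in>?K. if j = k then scale_tensor (r powi j * s powi k) (?M k) else 0)"
    by (intro sum.cong) auto
  also have "\<dots> = cochar_at lam (r * s)"
    by (simp add: cochar_at_eq unit_power_int_mult[OF assms])
  finally show ?thesis by simp
qed

lemma cochar_at_inverse:
  fixes r :: "'r::complex_algebra"
  assumes "r dvd 1"
  shows "cochar_at lam r ** cochar_at lam (inverse r) = mat 1" "cochar_at lam (inverse r) ** cochar_at lam r = mat 1"
  using cochar_at_mult[OF assms unit_inverse_dvd[OF assms]] cochar_at_mult[OF unit_inverse_dvd[OF assms] assms]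
  by (simp_all add: unit_inverse[OF assms] mult.commute[of "inverse r"] cochar_at_1)

text \<open>Restricting a polynomial function to a cocharacter gives a Laurent polynomial whose
  complex coefficients are the same for every test ring. If it vanishes at all nonzero complex
  numbers, it thus vanishes at all units.\<close>

lemma cochar_poly_laurent:
  fixes F :: "'r::complex_algebra^'n^'n \<Rightarrow> 'r"
  assumes "poly_pair f F"
  shows "\<exists>K a. finite K \<and> (\<forall>t. t \<noteq> 0 \<longrightarrow> f (cochar_at lam t) = (\<Sum>k\<in>K. a k * t powi k)) \<and>
     (\<forall>r. r dvd 1 \<longrightarrow> F (cochar_at lam r) = (\<Sum>k\<in>K. of_complex (a k) * r powi k))"
proof -
  define P where "P f F \<longleftrightarrow> (\<exists>K a. finite K \<and> (\<forall>t. t \<noteq> 0 \<longrightarrow> f (cochar_at lam t) = (\<Sum>k\<in>K. a k * t powi k)) \<and>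
     (\<forall>r. r dvd 1 \<longrightarrow> F (cochar_at lam r) = (\<Sum>k\<in>K. of_complex (a k) * r powi k)))"
    for f and F :: "'r^'n^'n \<Rightarrow> 'r"
  \<comment> \<open>Exponents may repeat in the family \<open>e\<close>; terms with equal exponents
    are collected into one coefficient.\<close>
  have PI: "P f F" if J: "finite J" and f: "\<And>t. t \<noteq> 0 \<Longrightarrow> f (cochar_at lam t) = (\<Sum>i\<in>J. a i * t powi e i)"
     and F: "\<And>r. r dvd 1 \<Longrightarrow> F (cochar_at lam r) = (\<Sum>i\<in>J. of_complex (a i) * r powi e i)"
    for J :: "'j set" and a e f and F :: "'r^'n^'n \<Rightarrow> 'r"
    unfolding P_def
  proof (rule exI[of _ "e ` J"], rule exI[of _ "\<lambda>k. \<Sum>i\<in>{i\<in>J. e i = k}. a i"], intro conjI allI impI)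
    show "finite (e ` J)" using J by simp
    show "f (cochar_at lam t) = (\<Sum>k\<in>e ` J. (\<Sum>i\<in>{i\<in>J. e i = k}. a i) * t powi k)" if "t \<noteq> 0" for t
      unfolding f[OF that] sum.image_gen[OF J, of "\<lambda>i. a i * t powi e i" e] by (simp add: sum_distrib_right)
    show "F (cochar_at lam r) = (\<Sum>k\<in>e ` J. of_complex (\<Sum>i\<in>{i\<in>J. e i = k}. a i) * r powi k)" if "r dvd 1" for r
      unfolding F[OF that] sum.image_gen[OF J, of "\<lambda>i. of_complex (a i) * r powi e i" e]
      by (simp add: sum_distrib_right of_complex_sum)
  qed
  from assms have "P f F"
  proof induction
    case (const c)
    show ?case by (rule PI[where J = "{()}" and a = "\<lambda>_. c" and e = "\<lambda>_. 0"]) auto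
  next
    case (entry i j)
    show ?case
      by (rule PI[where J = "Poly_Mapping.keys lam" and a = "\<lambda>k. Poly_Mapping.lookup lam k $ i $ j" and e = "\<lambda>k. k"])
        (auto simp: cochar_at_def)
  next
    case (add f F f' F')
    from add.IH(1)[unfolded P_def] obtain K a where *: "finite K"
      "\<forall>t. t \<noteq> 0 \<longrightarrow> f (cochar_at lam t) = (\<Sum>k\<in>K. a k * t powi k)"
      "\<forall>r. r dvd 1 \<longrightarrow> F (cochar_at lam r) = (\<Sum>k\<in>K. of_complex (a k) * r powi k)" by blast
    from add.IH(2)[unfolded P_def] obtain K' a' where **: "finite K'"
      "\<forall>t. t \<noteq> 0 \<longrightarrow> f' (cochar_at lam t) = (\<Sum>k\<in>K'. a' k * t powi k)"
      "\<forall>r. r dvd 1 \<longrightarrow> F' (cochar_at lam r) = (\<Sum>k\<in>K'. of_complex (a' k) * r powi k)" by blast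
    show ?case
      by (rule PI[where J = "K <+> K'" and a = "case_sum a a'" and e = "case_sum id id"])
        (use * ** in \<open>simp_all add: sum.Plus\<close>)
  next
    case (mult f F f' F')
    from mult.IH(1)[unfolded P_def] obtain K a where *: "finite K"
      "\<forall>t. t \<noteq> 0 \<longrightarrow> f (cochar_at lam t) = (\<Sum>k\<in>K. a k * t powi k)"
      "\<forall>r. r dvd 1 \<longrightarrow> F (cochar_at lam r) = (\<Sum>k\<in>K. of_complex (a k) * r powi k)" by blast
    from mult.IH(2)[unfolded P_def] obtain K' a' where **: "finite K'"
      "\<forall>t. t \<noteq> 0 \<longrightarrow> f' (cochar_at lam t) = (\<Sum>k\<in>K'. a' k * t powi k)"
      "\<forall>r. r dvd 1 \<longrightarrow> F' (cochar_at lam r) = (\<Sum>k\<in>K'. of_complex (a' k) * r powi k)" by blast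
    show ?case
    proof (rule PI[where J = "K \<times> K'" and a = "\<lambda>(k, l). a k * a' l" and e = "\<lambda>(k, l). k + l"])
      show "f (cochar_at lam t) * f' (cochar_at lam t) = (\<Sum>i\<in>K \<times> K'. (case i of (k, l) \<Rightarrow> a k * a' l) * t powi (case i of (k, l) \<Rightarrow> k + l))"
        if "t \<noteq> 0" for t
        unfolding *(2)[rule_format, OF that] **(2)[rule_format, OF that] sum_product sum.cartesian_product
        by (intro sum.cong) (auto simp: power_int_add that)
      show "F (cochar_at lam r) * F' (cochar_at lam r) = (\<Sum>i\<in>K \<times> K'. of_complex (case i of (k, l) \<Rightarrow> a k * a' l) * r powi (case i of (k, l) \<Rightarrow> k + l))"
        if "r dvd 1" for r
        unfolding *(3)[rule_format, OF that] **(3)[rule_format, OF that] sum_product sum.cartesian_product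
        by (intro sum.cong) (auto simp: unit_power_int_add[OF that] of_complex_mult mult_ac)
    qed (use *(1) **(1) in simp)
  qed
  then show ?thesis unfolding P_def .
qed

lemma cochar_in_points:
  fixes r :: "'r::complex_algebra"
  assumes r: "r dvd 1" and "T \<subseteq> G"
  shows "cochar_at lam r \<in> points G"
proof (rule pointsI)
  show "invertible (cochar_at lam r)" using cochar_at_inverse[OF r] invertible_def by blast
  fix f and F :: "'r^'n^'n \<Rightarrow> 'r"
  assume f: "poly_pair f F" and f0: "\<And>h. h \<in> G \<Longrightarrow> f h = 0"
  from cochar_poly_laurent[OF f] obtain K a where *: "finite K"
      "\<forall>t. t \<noteq> 0 \<longrightarrow> f (cochar_at lam t) = (\<Sum>k\<in>K. a k * t powi k)"
      "\<forall>r. r dvd 1 \<longrightarrow> F (cochar_at lam r) = (\<Sum>k\<in>K. of_complex (a k) * r powi k)" by blast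
  have "a k = 0" if "k \<in> K" for k
  proof (rule laurent_polynomial_eq_0[OF *(1) _ that])
    fix t :: complex assume t: "t \<noteq> 0"
    then have "f (cochar_at lam t) = 0" using lam \<open>T \<subseteq> G\<close> by (intro f0) (auto simp: cocharacter_def)
    then show "(\<Sum>k\<in>K. a k * t powi k) = 0" using *(2) t by simp
  qed
  then show "F (cochar_at lam r) = 0" using *(3) r by simp
qed

end

section \<open>The gluing of the Ward bundle on a formal disc\<close>

definition tensor_square :: "'r::times^'n \<Rightarrow> 'r^'n^'n" where
  "tensor_square v = (\<chi> i j. v $ i * v $ j)"

lemma tensor_square_scale: "tensor_square (u *s v) = scale_tensor (u * u) (tensor_square v)"
  for u :: "'r::comm_semiring_1"
  by (simp add: tensor_square_def vec_eq_iff mult_ac)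

lemma q_pairing_scale: "q_pairing A (scale_tensor c l) = c * q_pairing A l"
  by (simp add: q_pairing_def sum_distrib_left mult_ac)

lemma q_pairing_tensor_square: "q_pairing A (tensor_square v) = quadratic_form A v"
  by (simp add: q_pairing_def tensor_square_def quadratic_form_def mult_ac)

lemma hom_quadratic_form:
  assumes "complex_algebra_hom \<phi>"
  shows "quadratic_form A (\<chi> i. \<phi> (v $ i)) = \<phi> (quadratic_form A v)"
  by (simp add: quadratic_form_def complex_algebra_hom_simps[OF assms])

lemma hom_tensor_square:
  assumes "complex_algebra_hom \<phi>"
  shows "map_matrix \<phi> (tensor_square v) = tensor_square (\<chi> i. \<phi> (v $ i))"
  by (simp add: vec_eq_iff tensor_square_def complex_algebra_hom_simps[OF assms])

lemma hom_scale_tensor: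
  assumes "complex_algebra_hom \<phi>"
  shows "map_matrix \<phi> (scale_tensor c l) = scale_tensor (\<phi> c) (map_matrix \<phi> l)"
  by (simp add: vec_eq_iff complex_algebra_hom_simps[OF assms])

lemma hom_unit:
  assumes "complex_algebra_hom \<phi>" "c dvd 1"
  shows "\<phi> c dvd 1" "\<phi> (inverse c) = inverse (\<phi> c)"
proof -
  have "\<phi> c * \<phi> (inverse c) = 1"
    using unit_inverse[OF assms(2)] by (metis complex_algebra_hom_simps(2,5)[OF assms(1)])
  then show "\<phi> c dvd 1" "\<phi> (inverse c) = inverse (\<phi> c)"
    by (metis dvd_triv_left) (metis unit_inverse_unique \<open>\<phi> c * \<phi> (inverse c) = 1\<close>)
qed

lemma proj_class_self: "v \<in> proj_class v"
  by (auto simp: proj_class_def intro!: exI[of _ 1])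

lemma proj_class_scale:
  assumes "u dvd (1 :: 'r::complex_algebra)"
  shows "proj_class (u *s v) = proj_class v"
proof -
  have "\<exists>u'. w = u' *s (u *s v) \<and> u' dvd 1" if "w = c *s v" "c dvd 1" for w c
  proof (intro exI conjI)
    have "c * inverse u * u = c * (u * inverse u)" by (simp add: mult_ac)
    then show "w = (c * inverse u) *s (u *s v)" using that by (simp add: unit_inverse[OF assms])
    show "c * inverse u dvd 1" using that assms by (intro unit_mult unit_inverse_dvd)
  qed
  then show ?thesis unfolding proj_class_def by (auto simp: unit_mult assms)
qed

lemma proj_base_change_class:
  assumes "complex_algebra_hom \<phi>"
  shows "proj_base_change \<phi> (proj_class v) = proj_class (\<chi> i. \<phi> (v $ i))"
proof -
  have "proj_class (\<chi> i. \<phi> (w $ i)) = proj_class (\<chi> i. \<phi> (v $ i))" if "w \<in> proj_class v" for w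
  proof -
    from that obtain u where u: "w = u *s v" "u dvd 1" by (auto simp: proj_class_def)
    have "(\<chi> i. \<phi> (w $ i)) = \<phi> u *s (\<chi> i. \<phi> (v $ i))"
      by (simp add: u vec_eq_iff complex_algebra_hom_simps[OF assms])
    then show ?thesis using proj_class_scale[OF hom_unit(1)[OF assms u(2)]] by simp
  qed
  then show ?thesis unfolding proj_base_change_def using proj_class_self by blast
qed

text \<open>Another representative \<open>u *s v\<close> multiplies the tensor by the unit
  \<open>u * u\<close>, which the free factor \<open>c\<close> absorbs.\<close>

lemma LQ_units_proj_class:
  "LQ_units (proj_class v) = {scale_tensor c (tensor_square v) | c. c dvd (1 :: 'r::complex_algebra)}"
proof -
  have "\<exists>c'. scale_tensor c (tensor_square w) = scale_tensor c' (tensor_square v) \<and> c' dvd 1"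
    if "c dvd 1" "w \<in> proj_class v" for c w
  proof -
    from that obtain u where u: "w = u *s v" "u dvd 1" by (auto simp: proj_class_def)
    then show ?thesis using that
      by (intro exI[of _ "c * (u * u)"]) (simp add: tensor_square_scale unit_mult)
  qed
  note 1 = this
  show ?thesis
    unfolding LQ_units_def tensor_square_def[symmetric]
  proof (intro equalityI subsetI)
    fix l assume "l \<in> {scale_tensor c (tensor_square w) |c w. c dvd 1 \<and> w \<in> proj_class v}"
    then show "l \<in> {scale_tensor c (tensor_square v) |c. c dvd 1}" using 1 by auto
  next
    fix l assume "l \<in> {scale_tensor c (tensor_square v) |c. c dvd 1}"
    then show "l \<in> {scale_tensor c (tensor_square w) |c w. c dvd 1 \<and> w \<in> proj_class v}"
      using proj_class_self[of v] by auto
  qed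
qed

text \<open>Pairing with \<open>A\<close> sends \<open>c\<close> times the square of
  \<open>v\<close> to \<open>c\<close> times \<open>quadratic_form A v\<close>, so the normalization
  to 1 determines \<open>c\<close>; the definite description in \<open>q_inverse\<close> is
  meaningful.\<close>

lemma q_inverse_proj_class:
  assumes "quadratic_form A v dvd (1 :: 'r::complex_algebra)"
  shows "q_inverse A (proj_class v) = scale_tensor (inverse (quadratic_form A v)) (tensor_square v)"
  unfolding q_inverse_def
proof (rule the_equality)
  let ?q = "quadratic_form A v"
  have "inverse ?q * ?q = 1" using unit_inverse[OF assms] by (simp add: mult.commute)
  then show "scale_tensor (inverse ?q) (tensor_square v) \<in> LQ_units (proj_class v) \<and>
      q_pairing A (scale_tensor (inverse ?q) (tensor_square v)) = 1"
    using unit_inverse_dvd[OF assms] by (auto simp: LQ_units_proj_class q_pairing_scale q_pairing_tensor_square)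
  fix l assume l: "l \<in> LQ_units (proj_class v) \<and> q_pairing A l = 1"
  then obtain c where c: "l = scale_tensor c (tensor_square v)" by (auto simp: LQ_units_proj_class)
  then have "?q * c = 1" using l by (simp add: q_pairing_scale q_pairing_tensor_square mult.commute)
  then show "l = scale_tensor (inverse ?q) (tensor_square v)" using unit_inverse_unique[of ?q c] c by simp
qed

lemma hom_cochar_at:
  fixes lam :: "int \<Rightarrow>\<^sub>0 complex^'n^'n::finite"
  assumes "complex_algebra_hom \<phi>" "r dvd 1"
  shows "map_matrix \<phi> (cochar_at lam r) = cochar_at lam (\<phi> r)"
proof -
  have "\<phi> (r powi k) = \<phi> r powi k" for k
    by (simp add: power_int_def complex_algebra_hom_simps[OF assms(1)] hom_unit[OF assms])
  then show ?thesis by (simp add: vec_eq_iff cochar_at_def complex_algebra_hom_simps[OF assms(1)])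
qed

lemma transverse_formal_disc_form:
  assumes "transverse_formal_disc A x D"
  obtains v w where "D = proj_class v" "quadratic_form A v = fps_X * w" "w dvd (1 :: complex fps)"
proof -
  from assms obtain v where v: "D = proj_class v" by (auto simp: transverse_formal_disc_def proj_space_def)
  let ?q = "quadratic_form A v"
  have q: "fps_nth ?q 0 = 0" "fps_nth ?q 1 \<noteq> 0"
    using assms proj_class_self[of v] by (auto simp: transverse_formal_disc_def v)
  have "?q = fps_X * fps_shift 1 ?q"
    by (rule fps_ext) (simp add: q fps_X_mult_nth)
  moreover have "fps_shift 1 ?q dvd 1" using q by simp
  ultimately show ?thesis using that v by blast
qed

context
  fixes G T :: "(complex^'n^'n::finite) set" and lam :: "int \<Rightarrow>\<^sub>0 complex^'n^'n"
  assumes G: "linear_algebraic_group G" and TG: "T \<subseteq> G" and lam: "cocharacter T lam"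
begin

lemma T_invertible: "t \<in> T \<Longrightarrow> invertible t"
  using TG linear_algebraic_groupD(4)[OF G] by blast

lemmas cochar_rules = cochar_at_mult[OF lam T_invertible] cochar_at_1[OF lam T_invertible]
  cochar_at_inverse[OF lam T_invertible] cochar_in_points[OF lam T_invertible _ TG]

lemma mem_assoc_class: "(l', h) \<in> assoc_class lam l g \<longleftrightarrow> (\<exists>t. l' = scale_tensor t l \<and> t dvd 1 \<and> cochar_at lam t ** h = g)"
  by (auto simp: assoc_class_def)

lemma assoc_class_scale:
  fixes t :: "'r::complex_algebra"
  assumes t: "t dvd 1"
  shows "assoc_class lam (scale_tensor t l) g = assoc_class lam l (cochar_at lam t ** g)"
proof -
  have "(l', h) \<in> assoc_class lam (scale_tensor t l) g \<longleftrightarrow> (l', h) \<in> assoc_class lam l (cochar_at lam t ** g)" for l' h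
  proof
    assume "(l', h) \<in> assoc_class lam (scale_tensor t l) g"
    then obtain s where s: "l' = scale_tensor (t * s) l" "s dvd 1" "cochar_at lam s ** h = g"
      by (auto simp: mem_assoc_class mult.commute)
    then show "(l', h) \<in> assoc_class lam l (cochar_at lam t ** g)"
      unfolding mem_assoc_class using t
      by (intro exI[of _ "t * s"]) (auto simp: unit_mult cochar_rules matrix_mul_assoc)
  next
    assume "(l', h) \<in> assoc_class lam l (cochar_at lam t ** g)"
    then obtain s where s: "l' = scale_tensor s l" "s dvd 1" "cochar_at lam s ** h = cochar_at lam t ** g"
      by (auto simp: mem_assoc_class)
    have "s * inverse t * t = s * (t * inverse t)" by (simp add: mult_ac)
    then have 1: "s * inverse t * t = s" by (simp add: unit_inverse[OF t])
    have "cochar_at lam (inverse t * s) ** h = cochar_at lam (inverse t) ** (cochar_at lam s ** h)"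
      by (simp add: cochar_rules unit_inverse_dvd[OF t] s(2) matrix_mul_assoc)
    also have "\<dots> = g" by (simp add: s(3) cochar_rules t matrix_mul_assoc)
    finally have 2: "cochar_at lam (s * inverse t) ** h = g" by (simp add: mult.commute)
    show "(l', h) \<in> assoc_class lam (scale_tensor t l) g"
      unfolding mem_assoc_class
      by (intro exI[of _ "s * inverse t"]) (auto simp: 1 2 s(1) unit_mult[OF s(2) unit_inverse_dvd[OF t]])
  qed
  then show ?thesis by (auto simp del: split_paired_All)
qed

text \<open>Two representatives with the same tensor differ by a unit fixing that tensor. The second
  components can be compared only if scaling acts freely on it, hence the hypothesis on
  \<open>l\<close>.\<close>

lemma assoc_class_eqD:
  fixes l :: "'r::complex_algebra^4^4"
  assumes eq: "assoc_class lam l g = assoc_class lam l g'" and l: "\<And>c. scale_tensor c l = l \<Longrightarrow> c = 1"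
  shows "g = g'"
proof -
  have "(l, g) \<in> assoc_class lam l g" unfolding mem_assoc_class by (intro exI[of _ 1]) (simp add: cochar_rules)
  then obtain t where "l = scale_tensor t l" "cochar_at lam t ** g = g'" unfolding eq mem_assoc_class by blast
  then show ?thesis using l[of t] by (simp add: cochar_rules)
qed

lemma act_assoc_class:
  fixes l :: "'r::complex_algebra^4^4"
  assumes "invertible \<gamma>"
  shows "act_minus (ward_bundle G lam A) (assoc_class lam l g) \<gamma> = assoc_class lam l (g ** \<gamma>)"
proof -
  obtain \<delta> where d: "\<gamma> ** \<delta> = mat 1" "\<delta> ** \<gamma> = mat 1" using assms by (auto simp: invertible_def)
  have 1: "\<exists>h. k = h ** \<gamma> \<and> (l', h) \<in> assoc_class lam l g" if k: "(l', k) \<in> assoc_class lam l (g ** \<gamma>)" for l' k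
  proof (intro exI conjI)
    from k obtain t where t: "l' = scale_tensor t l" "t dvd 1" "cochar_at lam t ** k = g ** \<gamma>"
      unfolding mem_assoc_class by blast
    have "cochar_at lam t ** (k ** \<delta>) = g ** (\<gamma> ** \<delta>)" by (simp only: matrix_mul_assoc t)
    then show "(l', k ** \<delta>) \<in> assoc_class lam l g" unfolding mem_assoc_class using t d by auto
    show "k = k ** \<delta> ** \<gamma>" by (simp add: matrix_mul_assoc[symmetric] d)
  qed
  have 2: "(l', h ** \<gamma>) \<in> assoc_class lam l (g ** \<gamma>)" if "(l', h) \<in> assoc_class lam l g" for l' h
    using that unfolding mem_assoc_class by (auto simp: matrix_mul_assoc)
  show ?thesis using 1 2 by (auto simp: ward_bundle_def)
qed

text \<open>The union over all representatives of a class is a single class, because the units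
  relating them are mapped to units and cocharacters commute with base change.\<close>

lemma restrict_minus_assoc_class:
  "restrict_minus lam (assoc_class lam l g) = assoc_class lam (map_matrix fps_to_fls l) (map_matrix fps_to_fls g)"
proof -
  note hom = complex_algebra_hom_fps_to_fls
  have "assoc_class lam (map_matrix fps_to_fls l') (map_matrix fps_to_fls h) =
      assoc_class lam (map_matrix fps_to_fls l) (map_matrix fps_to_fls g)"
    if h: "(l', h) \<in> assoc_class lam l g" for l' h
  proof -
    from h obtain t where t: "l' = scale_tensor t l" "t dvd 1" "cochar_at lam t ** h = g"
      unfolding mem_assoc_class by blast
    have "map_matrix fps_to_fls g = cochar_at lam (fps_to_fls t) ** map_matrix fps_to_fls h"
      by (simp add: t(3)[symmetric] hom_matrix_mult[OF hom] hom_cochar_at[OF hom t(2)])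
    then show ?thesis by (simp add: t(1) hom_scale_tensor[OF hom] assoc_class_scale[OF hom_unit(1)[OF hom t(2)]])
  qed
  moreover have "(l, g) \<in> assoc_class lam l g" unfolding mem_assoc_class by (intro exI[of _ 1]) (simp add: cochar_rules)
  ultimately show ?thesis unfolding restrict_minus_def by blast
qed

section \<open>The gluing on one fixed transverse disc\<close>

context
  fixes A :: "complex^4^4" and D :: "(complex fps^4) set" and v :: "complex fps^4" and w :: "complex fps"
  assumes D: "D = proj_class v" and q: "quadratic_form A v = fps_X * w" and w: "w dvd 1"
begin

lemma fls_X_cancel: "fls_X * (inverse fls_X * y) = (y :: complex fls)" "inverse fls_X * (fls_X * y) = (y :: complex fls)"
  by (simp_all add: mult.assoc[symmetric] del: fls_X_times_conv_shift fls_inverse_X)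

abbreviation "v' \<equiv> (\<chi> i. fps_to_fls (v $ i))"

lemma q_v': "quadratic_form A v' = fls_X * fps_to_fls w"
  by (simp add: hom_quadratic_form[OF complex_algebra_hom_fps_to_fls] q fls_times_fps_to_fls del: fls_X_times_conv_shift)

lemma q_v'_nonzero: "quadratic_form A v' \<noteq> 0"
  using w by (auto simp: q_v' simp del: fls_X_times_conv_shift)

lemma q_v'_unit: "quadratic_form A v' dvd 1"
  using q_v'_nonzero by (simp add: dvd_field_iff)

lemma q_inverse_punctured:
  "q_inverse A (punctured D) = scale_tensor (inverse (quadratic_form A v')) (tensor_square v')"
  by (simp add: D proj_base_change_class[OF complex_algebra_hom_fps_to_fls] q_inverse_proj_class[OF q_v'_unit])

text \<open>The pairing with \<open>A\<close> has value 1 on this tensor and so reads off the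
  scalar.\<close>

lemma q_inverse_punctured_free:
  assumes "scale_tensor c (q_inverse A (punctured D)) = q_inverse A (punctured D)"
  shows "c = 1"
proof -
  have "q_pairing A (q_inverse A (punctured D)) = 1"
    using q_v'_nonzero by (simp add: q_inverse_punctured q_pairing_scale q_pairing_tensor_square)
  then show ?thesis using arg_cong[OF assms, of "q_pairing A"] by (simp add: q_pairing_scale)
qed

text \<open>With q = z w the factor z cancels against the pole of q^(-1), leaving the unit
  \<open>inverse w\<close>, so the frame extends over the closed point. It is unique because the
  form is nonzero on the punctured disc.\<close>

lemma zq_frame_eq: "zq_frame A D = scale_tensor (inverse w) (tensor_square v)"
  unfolding zq_frame_def
proof (rule the_equality)
  note hom = complex_algebra_hom_fps_to_fls
  have z: "scale_tensor fls_X (q_inverse A (punctured D)) = scale_tensor (fps_to_fls (inverse w)) (tensor_square v')"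
    using w by (simp add: q_inverse_punctured fls_X_cancel q_v' hom_unit[OF hom w] del: fls_X_times_conv_shift fls_inverse_X)
  then show "scale_tensor (inverse w) (tensor_square v) \<in> LQ_units D \<and>
    map_matrix fps_to_fls (scale_tensor (inverse w) (tensor_square v)) = scale_tensor fls_X (q_inverse A (punctured D))"
    using unit_inverse_dvd[OF w] by (auto simp: D LQ_units_proj_class hom_scale_tensor[OF hom] hom_tensor_square[OF hom])
  fix l assume l: "l \<in> LQ_units D \<and> map_matrix fps_to_fls l = scale_tensor fls_X (q_inverse A (punctured D))"
  then obtain c where c: "l = scale_tensor c (tensor_square v)" by (auto simp: D LQ_units_proj_class)
  have "scale_tensor (fps_to_fls c) (tensor_square v') = scale_tensor (fps_to_fls (inverse w)) (tensor_square v')"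
    using l z c by (simp add: hom_scale_tensor[OF hom] hom_tensor_square[OF hom])
  from arg_cong[OF this, of "q_pairing A"] have "c = inverse w"
    using q_v'_nonzero by (simp add: q_pairing_scale q_pairing_tensor_square)
  then show "l = scale_tensor (inverse w) (tensor_square v)" using c by simp
qed

lemma zq_frame_restrict: "map_matrix fps_to_fls (zq_frame A D) = scale_tensor fls_X (q_inverse A (punctured D))"
proof -
  note hom = complex_algebra_hom_fps_to_fls
  show ?thesis
    using w by (simp add: zq_frame_eq hom_scale_tensor[OF hom] hom_tensor_square[OF hom] q_inverse_punctured q_v' fls_X_cancel hom_unit[OF hom w] del: fls_X_times_conv_shift fls_inverse_X)
qed

lemma LQ_units_frame:
  assumes "l \<in> LQ_units D"
  obtains c where "c dvd 1" "l = scale_tensor c (zq_frame A D)"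
proof -
  from assms obtain c where c: "l = scale_tensor c (tensor_square v)" "c dvd 1" by (auto simp: D LQ_units_proj_class)
  have "c * w * inverse w = c * (w * inverse w)" by (simp add: mult_ac)
  then have "c * w * inverse w = c" by (simp add: unit_inverse[OF w])
  then have "l = scale_tensor (c * w) (zq_frame A D)" by (simp only: zq_frame_eq c scale_tensor_scale_tensor)
  moreover have "c * w dvd 1" using c w by (intro unit_mult)
  ultimately show ?thesis using that by blast
qed

text \<open>Both sides are moved to the representative with tensor q^(-1): the trivialization of the
  minus side becomes [q^(-1), \<lambda>(z) \<lambda>(c) a], that of the plus side [q^(-1), b].
  Comparing second components leaves one linear equation for the gluing element, solved by the
  inverses \<open>a'\<close> and \<open>z_minus lam\<close>.\<close>

lemma gluing_element_eq:
  assumes a: "a' \<in> points G" "a' ** (cochar_at lam c ** a) = mat 1" "(cochar_at lam c ** a) ** a' = mat 1"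
    and b: "b \<in> points G" and c: "c dvd 1"
  shows "gluing_element G lam A D (D, b) (assoc_class lam (scale_tensor c (zq_frame A D)) a) =
     map_matrix fps_to_fls a' ** z_minus lam ** map_matrix fps_to_fls b"
  unfolding gluing_element_def
proof (rule the_equality)
  note hom = complex_algebra_hom_fps_to_fls
  let ?f = "map_matrix fps_to_fls" and ?Q = "q_inverse A (punctured D)"
  let ?g = "?f a' ** z_minus lam ** ?f b"
  have X: "fls_X dvd (1 :: complex fls)" "fls_X_inv dvd (1 :: complex fls)" by (simp_all add: dvd_field_iff)
  have XX: "fls_X * fls_X_inv = (1 :: complex fls)" "fls_X_inv * fls_X = (1 :: complex fls)"
    by (simp_all add: fls_X_inv_conv_shift_1 fls_X_conv_shift_1 fls_times_both_shifted_simp)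
  have z: "cochar_at lam fls_X ** z_minus lam = mat 1" "z_minus lam ** cochar_at lam fls_X = mat 1"
    unfolding z_minus_def using cochar_rules(1)[OF _ X(1) X(2)] cochar_rules(1)[OF _ X(2) X(1)] XX
    by (simp_all add: cochar_rules)
  have glue: "glue (ward_bundle G lam A) (punctured D) (restrict_plus (D, b)) = assoc_class lam ?Q (?f b)"
    by (simp add: ward_bundle_def restrict_plus_def)
  have act: "act_minus (ward_bundle G lam A) (restrict_minus lam (assoc_class lam (scale_tensor c (zq_frame A D)) a)) \<gamma> =
      assoc_class lam ?Q (cochar_at lam fls_X ** ?f (cochar_at lam c ** a) ** \<gamma>)" if "invertible \<gamma>" for \<gamma>
  proof -
    have cX: "fps_to_fls c dvd 1" "fps_to_fls c * fls_X dvd 1" using hom_unit(1)[OF hom c] X(1) by (simp_all only: unit_mult)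
    have "restrict_minus lam (assoc_class lam (scale_tensor c (zq_frame A D)) a) =
        assoc_class lam (scale_tensor (fls_X * fps_to_fls c) ?Q) (?f a)"
      by (simp only: restrict_minus_assoc_class hom_scale_tensor[OF hom] zq_frame_restrict scale_tensor_scale_tensor mult.commute)
    also have "act_minus (ward_bundle G lam A) \<dots> \<gamma> = assoc_class lam ?Q (cochar_at lam (fls_X * fps_to_fls c) ** (?f a ** \<gamma>))"
      unfolding act_assoc_class[OF that] matrix_mul_assoc
      by (subst assoc_class_scale) (use cX in \<open>simp_all add: mult.commute matrix_mul_assoc\<close>)
    also have "cochar_at lam (fls_X * fps_to_fls c) = cochar_at lam fls_X ** cochar_at lam (fps_to_fls c)"
      by (rule cochar_rules(1)[OF _ X(1) cX(1)])
    finally show ?thesis by (simp add: hom_matrix_mult[OF hom] hom_cochar_at[OF hom c] matrix_mul_assoc)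
  qed
  have a': "?f (cochar_at lam c ** a) ** ?f a' = mat 1" "?f a' ** ?f (cochar_at lam c ** a) = mat 1"
    unfolding hom_matrix_mult[OF hom, symmetric] a hom_mat_1[OF hom] by (rule refl)+
  have "z_minus lam \<in> points G" unfolding z_minus_def by (rule cochar_rules) (use X in auto)
  then have g: "?g \<in> points G"
    using a(1) b by (intro points_mult linear_algebraic_groupD[OF G] hom_points[OF hom])
  moreover have "?f b = cochar_at lam fls_X ** ?f (cochar_at lam c ** a) ** ?g"
  proof -
    have "cochar_at lam fls_X ** ?f (cochar_at lam c ** a) ** ?g =
        cochar_at lam fls_X ** (?f (cochar_at lam c ** a) ** ?f a') ** z_minus lam ** ?f b"
      by (simp only: matrix_mul_assoc)
    then show ?thesis by (simp add: a' z)
  qed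
  ultimately show "?g \<in> points G \<and> glue (ward_bundle G lam A) (punctured D) (restrict_plus (D, b)) =
      act_minus (ward_bundle G lam A) (restrict_minus lam (assoc_class lam (scale_tensor c (zq_frame A D)) a)) ?g"
    by (simp add: glue act points_def)
  fix \<gamma> assume \<gamma>: "\<gamma> \<in> points G \<and> glue (ward_bundle G lam A) (punctured D) (restrict_plus (D, b)) =
      act_minus (ward_bundle G lam A) (restrict_minus lam (assoc_class lam (scale_tensor c (zq_frame A D)) a)) \<gamma>"
  then have "?f b = cochar_at lam fls_X ** ?f (cochar_at lam c ** a) ** \<gamma>"
    by (intro assoc_class_eqD[OF _ q_inverse_punctured_free]) (simp_all add: glue act points_def)
  then have "?g = ?f a' ** (z_minus lam ** cochar_at lam fls_X) ** ?f (cochar_at lam c ** a) ** \<gamma>"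
    by (simp only: matrix_mul_assoc)
  then show "\<gamma> = ?g" by (simp add: z a')
qed

lemma formal_normal_type_eq: "formal_normal_type G lam A D = gr_coset G (z_minus lam)"
proof -
  note hom = complex_algebra_hom_fps_to_fls
  have 1: "mat 1 \<in> (points G :: (complex fps^'n^'n) set)"
    using const_in_points[OF G linear_algebraic_groupD(1)[OF G]] by (simp add: hom_mat_1[OF complex_algebra_hom_of_complex])
  have "gluing_element G lam A D (D, mat 1) (assoc_class lam (scale_tensor 1 (zq_frame A D)) (mat 1)) =
     map_matrix fps_to_fls (mat 1) ** z_minus lam ** map_matrix fps_to_fls (mat 1)"
    by (rule gluing_element_eq) (simp_all add: 1 cochar_rules)
  then show ?thesis by (simp add: formal_normal_type_def hom_mat_1[OF hom])
qed

text \<open>Rescaling the frame by a unit \<open>c\<close> only replaces \<open>a\<close> by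
  \<open>cochar_at lam c ** a\<close>, again a point over power series. Conversely the unscaled
  frame with arbitrary \<open>a\<close> and \<open>b\<close> already produces every element of the
  double coset.\<close>

lemma gauge_invariant_type_eq: "gauge_invariant_type G lam A D = schubert_orbit G lam"
proof (intro equalityI subsetI)
  fix x assume "x \<in> gauge_invariant_type G lam A D"
  then obtain b l a where x: "x = gr_coset G (gluing_element G lam A D (D, b) (assoc_class lam l a))"
    and b: "b \<in> points G" and l: "l \<in> LQ_units D" and a: "a \<in> points G"
    by (auto simp: gauge_invariant_type_def ward_bundle_def)
  obtain c where c: "c dvd 1" "l = scale_tensor c (zq_frame A D)" using LQ_units_frame[OF l] .
  have "cochar_at lam c ** a \<in> points G"
    using a c by (intro points_mult linear_algebraic_groupD[OF G] cochar_rules)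
  then obtain a' where a': "a' \<in> points G" "a' ** (cochar_at lam c ** a) = mat 1" "(cochar_at lam c ** a) ** a' = mat 1"
    using points_inverse[OF G, of "cochar_at lam c ** a"] by auto
  show "x \<in> schubert_orbit G lam"
    unfolding schubert_orbit_def x c gluing_element_eq[OF a' b c(1)]
    by (intro CollectI exI[of _ a'] exI[of _ b] conjI refl a' b)
next
  fix x assume "x \<in> schubert_orbit G lam"
  then obtain a' b where x: "x = gr_coset G (map_matrix fps_to_fls a' ** z_minus lam ** map_matrix fps_to_fls b)"
    and a': "a' \<in> points G" and b: "b \<in> points G" by (auto simp: schubert_orbit_def)
  obtain a where a: "a \<in> points G" "a' ** a = mat 1" "a ** a' = mat 1" using points_inverse[OF G a'] by blast
  have "zq_frame A D \<in> LQ_units D"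
    unfolding zq_frame_eq unfolding D LQ_units_proj_class
    by (intro CollectI exI[of _ "inverse w"] conjI refl unit_inverse_dvd w)
  then have "assoc_class lam (scale_tensor 1 (zq_frame A D)) a \<in> fibre_minus (ward_bundle G lam A) D"
    using a by (auto simp: ward_bundle_def)
  moreover have "(D, b) \<in> fibre_plus (ward_bundle G lam A) D" using b by (simp add: ward_bundle_def)
  moreover have "gluing_element G lam A D (D, b) (assoc_class lam (scale_tensor 1 (zq_frame A D)) a) =
      map_matrix fps_to_fls a' ** z_minus lam ** map_matrix fps_to_fls b"
    by (rule gluing_element_eq) (simp_all add: a a' b cochar_rules)
  ultimately show "x \<in> gauge_invariant_type G lam A D"
    unfolding gauge_invariant_type_def x
    by (intro CollectI exI[of _ "(D, b)"] exI[of _ "assoc_class lam (scale_tensor 1 (zq_frame A D)) a"] conjI)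
      simp_all
qed

end

lemma z_minus_in_affine_grassmannian: "gr_coset G (z_minus lam) \<in> affine_grassmannian G"
  unfolding affine_grassmannian_def z_minus_def
proof (intro imageI cochar_rules)
  have "fls_X_inv \<noteq> (0 :: complex fls)" by simp
  then show "fls_X_inv dvd (1 :: complex fls)" by (simp only: dvd_field_iff) simp
qed

end

section \<open>Equal Schubert orbits come from conjugate cocharacters\<close>

lemma cochar_at_superset:
  fixes lam :: "int \<Rightarrow>\<^sub>0 complex^'n^'n::finite"
  assumes "finite K" "Poly_Mapping.keys lam \<subseteq> K"
  shows "cochar_at lam (r :: 'r::complex_algebra) = (\<Sum>k\<in>K. scale_tensor (r powi k) (map_matrix of_complex (Poly_Mapping.lookup lam k)))"
proof -
  have "map_matrix of_complex (0 :: complex^'n^'n) = (0 :: 'r^'n^'n)" by (simp add: vec_eq_iff)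
  then show ?thesis unfolding cochar_at_eq
    by (intro sum.mono_neutral_left) (use assms in \<open>auto simp: in_keys_iff\<close>)
qed

lemma lookup_conj_cochar: "Poly_Mapping.lookup (conj_cochar n lam) k = n ** Poly_Mapping.lookup lam k ** matrix_inv n"
  by (simp add: conj_cochar_def Poly_Mapping.map.rep_eq when_def)

lemma cochar_at_conj_cochar:
  fixes lam :: "int \<Rightarrow>\<^sub>0 complex^'n^'n::finite"
  shows "cochar_at (conj_cochar n lam) r = map_matrix of_complex n ** cochar_at lam r ** map_matrix of_complex (matrix_inv n)"
proof -
  have "Poly_Mapping.keys (conj_cochar n lam) \<subseteq> Poly_Mapping.keys lam"
    by (auto simp: in_keys_iff lookup_conj_cochar)
  then show ?thesis
    by (simp add: cochar_at_superset[of "Poly_Mapping.keys lam"] cochar_at_eq[of lam] lookup_conj_cochar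
        hom_matrix_mult[OF complex_algebra_hom_of_complex] matrix_mul_sum_left matrix_mul_sum_right
        scale_tensor_mul_left scale_tensor_mul_right)
qed

lemma poly_pair_continuous:
  assumes "poly_pair f (F :: 'r::complex_algebra^'n^'n::finite \<Rightarrow> 'r)"
  shows "continuous_on S f"
  using assms
proof induction
  case (entry i j)
  show ?case by (intro bounded_linear.continuous_on[OF bounded_linear_matrix_entry] continuous_on_id)
qed (auto intro!: continuous_intros)

lemma continuous_on_eval_poly: "continuous_on S (eval_poly p :: complex^'n^'n::finite \<Rightarrow> complex)"
  using poly_pair_continuous[OF poly_pair_eval_poly[where 'r = complex]] .

lemma linear_algebraic_group_iff:
  assumes "linear_algebraic_group (G :: (complex^'n^'n::finite) set)"
  shows "g \<in> G \<longleftrightarrow> invertible g \<and> (\<forall>p. (\<forall>h\<in>G. eval_poly p h = 0) \<longrightarrow> eval_poly p g = 0)"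
  using points_complex[OF assms] unfolding points_def by blast

text \<open>A common index set for both weight decompositions; a weight missing from one of them
  contributes the projection 0.\<close>

definition cochar_weights :: "(int \<Rightarrow>\<^sub>0 complex^'n^'n) \<Rightarrow> (int \<Rightarrow>\<^sub>0 complex^'n^'n) \<Rightarrow> int set" where
  "cochar_weights mu nu = Poly_Mapping.keys mu \<union> Poly_Mapping.keys nu"

context
  fixes G T :: "(complex^'n^'n::finite) set"
  assumes G: "linear_algebraic_group G" and TG: "T \<subseteq> G"
begin

text \<open>The constant matrix \<open>n\<close> and its inverse are points over power series, so
  they are absorbed into the outer factors \<open>a\<close> and \<open>b\<close>.\<close>

lemma schubert_orbit_conj_subset:
  assumes n: "n \<in> G" and nu: "nu = conj_cochar n mu"
  shows "schubert_orbit G nu \<subseteq> schubert_orbit G mu"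
proof
  note hom = complex_algebra_hom_fps_to_fls
  let ?c = "map_matrix of_complex :: complex^'n^'n \<Rightarrow> complex fps^'n^'n"
  fix x assume "x \<in> schubert_orbit G nu"
  then obtain a b where x: "x = gr_coset G (map_matrix fps_to_fls a ** z_minus nu ** map_matrix fps_to_fls b)"
    and a: "a \<in> points G" and b: "b \<in> points G" by (auto simp: schubert_orbit_def)
  have f: "map_matrix fps_to_fls (?c m) = map_matrix of_complex m" for m
    by (simp add: vec_eq_iff complex_algebra_hom_simps[OF hom])
  have eq: "map_matrix fps_to_fls a ** z_minus nu ** map_matrix fps_to_fls b =
     map_matrix fps_to_fls (a ** ?c n) ** z_minus mu ** map_matrix fps_to_fls (?c (matrix_inv n) ** b)"
    by (simp add: hom_matrix_mult[OF hom] f nu z_minus_def cochar_at_conj_cochar matrix_mul_assoc)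
  have "a ** ?c n \<in> points G"
    using a n by (intro points_mult linear_algebraic_groupD[OF G] const_in_points[OF G])
  moreover have "?c (matrix_inv n) ** b \<in> points G"
    using b n by (intro points_mult linear_algebraic_groupD[OF G] const_in_points[OF G])
  ultimately show "x \<in> schubert_orbit G mu" unfolding x eq schubert_orbit_def by blast
qed

lemma schubert_orbit_conj:
  assumes n: "n \<in> G" and nu: "nu = conj_cochar n mu"
  shows "schubert_orbit G mu = schubert_orbit G nu"
proof
  have i: "invertible n" using linear_algebraic_groupD(4)[OF G n] .
  have "matrix_inv (matrix_inv n) = n" by (rule matrix_inv_unique) (simp_all add: matrix_inv_mult[OF i])
  then have "mu = conj_cochar (matrix_inv n) nu"
    by (intro poly_mapping_eqI)
      (simp add: lookup_conj_cochar nu matrix_mul_assoc matrix_inv_mult[OF i], simp add: matrix_mul_assoc[symmetric] matrix_inv_mult[OF i])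
  then show "schubert_orbit G mu \<subseteq> schubert_orbit G nu"
    using linear_algebraic_groupD(3)[OF G n] by (intro schubert_orbit_conj_subset)
qed (rule schubert_orbit_conj_subset[OF assms])

context
  fixes mu nu :: "int \<Rightarrow>\<^sub>0 complex^'n^'n"
  assumes mu: "cocharacter T mu" and nu: "cocharacter T nu"
begin

lemma T_inv: "t \<in> T \<Longrightarrow> invertible t"
  using TG linear_algebraic_groupD(4)[OF G] by blast

abbreviation (input) "prm \<equiv> Poly_Mapping.lookup mu"
abbreviation (input) "prn \<equiv> Poly_Mapping.lookup nu"

abbreviation (input) "KK \<equiv> cochar_weights mu nu"

lemma finite_weights [simp]: "finite KK" by (simp add: cochar_weights_def)

lemma prm_mult: "prm j ** prm k = (if j = k then prm k else 0)"
  using cochar_projections[OF mu T_inv, of j k]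
  by (cases "j \<in> Poly_Mapping.keys mu"; cases "k \<in> Poly_Mapping.keys mu") (auto simp: in_keys_iff)

lemma prn_mult: "prn j ** prn k = (if j = k then prn k else 0)"
  using cochar_projections[OF nu T_inv, of j k]
  by (cases "j \<in> Poly_Mapping.keys nu"; cases "k \<in> Poly_Mapping.keys nu") (auto simp: in_keys_iff)

lemma cochar_at_weights:
  "cochar_at mu (r :: 'r::complex_algebra) = (\<Sum>k\<in>KK. scale_tensor (r powi k) (map_matrix of_complex (prm k)))"
  "cochar_at nu (r :: 'r::complex_algebra) = (\<Sum>k\<in>KK. scale_tensor (r powi k) (map_matrix of_complex (prn k)))"
  by (rule cochar_at_superset; simp add: cochar_weights_def)+

lemma prn_cochar:
  assumes "j \<in> KK"
  shows "map_matrix of_complex (prn j) ** cochar_at nu (r :: 'r::complex_algebra) = scale_tensor (r powi j) (map_matrix of_complex (prn j))"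
proof -
  have "map_matrix of_complex (prn j) ** map_matrix of_complex (prn k) = (if k = j then map_matrix of_complex (prn j) else (0 :: 'r^'n^'n))" for k
    using prn_mult[of j k] by (simp add: hom_matrix_mult[OF complex_algebra_hom_of_complex, symmetric] vec_eq_iff)
  then have "map_matrix of_complex (prn j) ** cochar_at nu r = (\<Sum>k\<in>KK. if k = j then scale_tensor (r powi j) (map_matrix of_complex (prn j)) else 0)"
    unfolding cochar_at_weights matrix_mul_sum_right by (intro sum.cong) (auto simp: scale_tensor_mul_right)
  then show ?thesis using assms by simp
qed

lemma cochar_prm:
  assumes "j \<in> KK"
  shows "cochar_at mu (r :: 'r::complex_algebra) ** map_matrix of_complex (prm j) = scale_tensor (r powi j) (map_matrix of_complex (prm j))"
proof -
  have "map_matrix of_complex (prm k) ** map_matrix of_complex (prm j) = (if k = j then map_matrix of_complex (prm j) else (0 :: 'r^'n^'n))" for k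
    using prm_mult[of k j] by (simp add: hom_matrix_mult[OF complex_algebra_hom_of_complex, symmetric] vec_eq_iff)
  then have "cochar_at mu r ** map_matrix of_complex (prm j) = (\<Sum>k\<in>KK. if k = j then scale_tensor (r powi j) (map_matrix of_complex (prm j)) else 0)"
    unfolding cochar_at_weights matrix_mul_sum_left by (intro sum.cong) (auto simp: scale_tensor_mul_left)
  then show ?thesis using assms by simp
qed

text \<open>Comparing entries of \<open>z^(-j) \<nu>_j b^(-1) \<mu>_k = z^(-k) \<nu>_j a \<mu>_k\<close>: for \<open>j < k\<close> the power series
  \<open>\<nu>_j a \<mu>_k\<close> is divisible by \<open>z\<close>.\<close>

lemma leading_term_filtered:
  assumes eq: "z_minus nu = map_matrix fps_to_fls a ** z_minus mu ** map_matrix fps_to_fls b"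
    and b: "invertible b" and jk: "j \<in> KK" "k \<in> KK" "j < k"
  shows "prn j ** map_matrix (\<lambda>f. fps_nth f 0) a ** prm k = 0"
proof -
  note hom = complex_algebra_hom_fps_to_fls and oc = complex_algebra_hom_of_complex and ev = complex_algebra_hom_fps_nth_0
  let ?f = "map_matrix fps_to_fls :: complex fps^'n^'n \<Rightarrow> complex fls^'n^'n"
  let ?c = "map_matrix of_complex :: complex^'n^'n \<Rightarrow> complex fps^'n^'n"
  obtain b' where b': "b ** b' = mat 1" using b by (auto simp: invertible_def)
  have fc: "map_matrix of_complex m = ?f (?c m)" for m
    by (simp add: vec_eq_iff complex_algebra_hom_simps[OF hom])
  have "z_minus nu ** ?f b' = ?f a ** z_minus mu ** ?f (b ** b')"
    by (simp add: eq hom_matrix_mult[OF hom] matrix_mul_assoc)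
  then have "z_minus nu ** ?f b' = ?f a ** z_minus mu" by (simp add: b' hom_mat_1[OF hom])
  then have "map_matrix of_complex (prn j) ** z_minus nu ** ?f b' ** map_matrix of_complex (prm k) =
      map_matrix of_complex (prn j) ** ?f a ** (z_minus mu ** map_matrix of_complex (prm k))"
    by (metis matrix_mul_assoc)
  then have s: "scale_tensor (fls_X_inv powi j) (?f (?c (prn j) ** b' ** ?c (prm k))) =
      scale_tensor (fls_X_inv powi k) (?f (?c (prn j) ** a ** ?c (prm k)))"
    unfolding z_minus_def prn_cochar[OF jk(1)] cochar_prm[OF jk(2)] scale_tensor_mul_left scale_tensor_mul_right
    unfolding fc hom_matrix_mult[OF hom] .
  have "fps_nth ((?c (prn j) ** a ** ?c (prm k)) $ p $ q) 0 = 0" for p q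
  proof -
    let ?g = "(?c (prn j) ** b' ** ?c (prm k)) $ p $ q" and ?h = "(?c (prn j) ** a ** ?c (prm k)) $ p $ q"
    define m where "m = nat (k - j)"
    have k: "k = j + int m" "m > 0" using jk by (simp_all add: m_def)
    have X0: "fls_X_inv \<noteq> (0 :: complex fls)" by simp
    have X: "fls_X_inv * fls_X = (1 :: complex fls)"
      by (simp add: fls_X_inv_conv_shift_1 fls_X_conv_shift_1 fls_times_both_shifted_simp)
    have "fls_X_inv powi j * fps_to_fls ?g = fls_X_inv powi k * fps_to_fls ?h"
      using arg_cong[OF s, of "\<lambda>M. M $ p $ q"] by simp
    then have "fps_to_fls ?g = fls_X_inv ^ m * fps_to_fls ?h"
      using X0 by (simp add: k power_int_add mult.assoc)
    then have "fls_X ^ m * fps_to_fls ?g = (fls_X_inv * fls_X) ^ m * fps_to_fls ?h"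
      by (simp only: power_mult_distrib mult_ac)
    then have "fps_to_fls (fps_X ^ m * ?g) = fps_to_fls ?h"
      by (simp only: X fls_times_fps_to_fls fps_to_fls_power fps_X_to_fls power_one mult_1)
    then have "?h = fps_X ^ m * ?g" by (simp only: fps_to_fls_eq_iff)
    then show ?thesis using k(2) by (simp add: fps_X_power_mult_nth)
  qed
  then have "map_matrix (\<lambda>f. fps_nth f 0) (?c (prn j) ** a ** ?c (prm k)) = 0" by (simp add: vec_eq_iff)
  moreover have "map_matrix (\<lambda>f. fps_nth f 0) (?c m) = m" for m
    by (simp add: vec_eq_iff complex_algebra_hom_simps[OF ev])
  ultimately show ?thesis by (simp add: hom_matrix_mult[OF ev])
qed

text \<open>In \<nu>(s) g \<mu>(s)^(-1) the block from weight k to weight j carries the factor s^(j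
  - k). The first vanishing condition removes all negative powers, so the expression extends to s =
  0. The condition on the inverse \<open>g'\<close> does the same for the inverse expression, which
  is what keeps the limit invertible.\<close>

lemma conjugation_limit:
  assumes g: "g \<in> G" and g': "g' \<in> G" "g ** g' = mat 1" "g' ** g = mat 1"
    and 1: "\<And>j k. j \<in> KK \<Longrightarrow> k \<in> KK \<Longrightarrow> j < k \<Longrightarrow> prn j ** g ** prm k = 0"
    and 2: "\<And>j k. j \<in> KK \<Longrightarrow> k \<in> KK \<Longrightarrow> j < k \<Longrightarrow> prm j ** g' ** prn k = 0"
  obtains u where "u \<in> G" "\<And>t::complex. t \<noteq> 0 \<Longrightarrow> u ** cochar_at mu t = cochar_at nu t ** u"
proof -
  have lim: "(\<Sum>j\<in>KK. \<Sum>k\<in>KK. scale_tensor (if k \<le> j then s ^ nat (j - k) else 0) (p' j ** h ** p k)) =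
      cochar_at y s ** h ** cochar_at x (inverse s)"
    if "s \<noteq> 0" "\<And>r::complex. cochar_at y r = (\<Sum>j\<in>KK. scale_tensor (r powi j) (p' j))"
      "\<And>r::complex. cochar_at x r = (\<Sum>j\<in>KK. scale_tensor (r powi j) (p j))"
      "\<And>j k. j \<in> KK \<Longrightarrow> k \<in> KK \<Longrightarrow> j < k \<Longrightarrow> p' j ** h ** p k = 0"
    for s :: complex and p' p :: "int \<Rightarrow> complex^'n^'n" and h and x y :: "int \<Rightarrow>\<^sub>0 complex^'n^'n"
  proof -
    have "cochar_at y s ** h ** cochar_at x (inverse s) =
        (\<Sum>j\<in>KK. \<Sum>k\<in>KK. scale_tensor (s powi j * inverse s powi k) (p' j ** h ** p k))"
      by (subst sum.swap) (simp add: that(2,3) matrix_mul_sum_left matrix_mul_sum_right scale_tensor_mul_left scale_tensor_mul_right scale_tensor_sum mult_ac)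
    also have "\<dots> = (\<Sum>j\<in>KK. \<Sum>k\<in>KK. scale_tensor (if k \<le> j then s ^ nat (j - k) else 0) (p' j ** h ** p k))"
    proof (intro sum.cong refl)
      fix j k assume jk: "j \<in> KK" "k \<in> KK"
      have "s powi j * inverse s powi k = s powi (j - k)" using \<open>s \<noteq> 0\<close>
        by (simp add: power_int_diff power_int_inverse divide_inverse)
      moreover have "s powi (j - k) = s ^ nat (j - k)" if "k \<le> j" using that by (simp add: power_int_def)
      ultimately show "scale_tensor (s powi j * inverse s powi k) (p' j ** h ** p k) =
        scale_tensor (if k \<le> j then s ^ nat (j - k) else 0) (p' j ** h ** p k)"
        using that(4)[OF jk] by (cases "k \<le> j") auto
    qed
    finally show ?thesis by simp
  qed
  \<comment> \<open>The coefficient 0 for j < k is a filler: the corresponding block is zero by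
    assumption.\<close>
  define U where "U s = (\<Sum>j\<in>KK. \<Sum>k\<in>KK. scale_tensor (if k \<le> j then s ^ nat (j - k) else 0) (prn j ** g ** prm k))" for s
  define V where "V s = (\<Sum>j\<in>KK. \<Sum>k\<in>KK. scale_tensor (if k \<le> j then s ^ nat (j - k) else 0) (prm j ** g' ** prn k))" for s
  have U: "U s = cochar_at nu s ** g ** cochar_at mu (inverse s)" if "s \<noteq> 0" for s
    unfolding U_def by (rule lim[OF that]) (use 1 in \<open>simp_all add: cochar_at_weights\<close>)
  have V: "V s = cochar_at mu s ** g' ** cochar_at nu (inverse s)" if "s \<noteq> 0" for s
    unfolding V_def by (rule lim[OF that]) (use 2 in \<open>simp_all add: cochar_at_weights\<close>)
  have cont: "continuous_on UNIV (\<lambda>s. \<Sum>j\<in>KK. \<Sum>k\<in>KK. scale_tensor (if k \<le> j then s ^ nat (j - k) else 0) (h j k))"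
    for h :: "int \<Rightarrow> int \<Rightarrow> complex^'n^'n"
  proof (intro continuous_on_sum)
    fix j k
    show "continuous_on UNIV (\<lambda>s. scale_tensor (if k \<le> j then s ^ nat (j - k) else 0) (h j k))"
      by (cases "k \<le> j") (auto intro!: bounded_linear.continuous_on[OF bounded_linear_scale_tensor_left] continuous_intros)
  qed
  have limit: "\<phi> 0 = c" if "continuous_on UNIV \<phi>" "\<And>s. s \<noteq> 0 \<Longrightarrow> \<phi> s = c" for \<phi> :: "complex \<Rightarrow> 'z::t2_space" and c
  proof -
    have "(\<phi> \<longlongrightarrow> \<phi> 0) (at 0)" using that(1) by (simp add: continuous_on_def)
    moreover have "(\<phi> \<longlongrightarrow> c) (at 0)"
      by (rule tendsto_eventually) (use that(2) in \<open>auto simp: eventually_at_filter\<close>)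
    ultimately show ?thesis using tendsto_unique[of "at (0::complex)"] by auto
  qed
  have cU: "continuous_on UNIV U" and cV: "continuous_on UNIV V"
    unfolding U_def V_def by (rule cont)+
  \<comment> \<open>For nonzero \<open>s\<close> the two families are inverse to each other, and
    this persists at 0 by continuity.\<close>
  have "V 0 ** U 0 = mat 1"
  proof (rule limit)
    show "continuous_on UNIV (\<lambda>s. V s ** U s)" by (intro continuous_on_matrix_mul cU cV)
    fix s :: complex assume s: "s \<noteq> 0"
    note c = cochar_at_inverse[OF mu T_inv, of s] cochar_at_inverse[OF nu T_inv, of s]
    have sd: "s dvd 1" using s by (simp add: dvd_field_iff)
    have "V s ** U s = cochar_at mu s ** g' ** (cochar_at nu (inverse s) ** cochar_at nu s) ** g ** cochar_at mu (inverse s)"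
      by (simp only: U[OF s] V[OF s] matrix_mul_assoc)
    also have "\<dots> = cochar_at mu s ** (g' ** g) ** cochar_at mu (inverse s)"
      by (simp add: c(4)[OF _ sd] matrix_mul_assoc)
    also have "\<dots> = mat 1" by (simp add: g' c(1)[OF _ sd])
    finally show "V s ** U s = mat 1" .
  qed
  then have inv: "invertible (U 0)" using invertible_left_inverse by blast
  have UG: "U s \<in> G" if "s \<noteq> 0" for s
    unfolding U[OF that] using mu nu that TG g
    by (intro linear_algebraic_groupD(2)[OF G]) (auto simp: cocharacter_def)
  \<comment> \<open>Polynomials vanishing on \<open>G\<close> vanish along the path for nonzero
    \<open>s\<close>, hence at its limit; invertibility of the limit is the only other
    requirement.\<close>
  have "U 0 \<in> G"
    unfolding linear_algebraic_group_iff[OF G]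
  proof (intro conjI allI impI inv)
    fix p assume p: "\<forall>h\<in>G. eval_poly p h = 0"
    show "eval_poly p (U 0) = 0"
      by (rule limit[of "\<lambda>s. eval_poly p (U s)"])
        (use p UG in \<open>auto intro!: continuous_on_compose2[OF continuous_on_eval_poly[of UNIV] cU]\<close>)
  qed
  moreover have "U 0 ** cochar_at mu t = cochar_at nu t ** U 0" if "t \<noteq> 0" for t
  proof -
    \<comment> \<open>Only blocks with equal weights survive at 0, so the limit takes each weight
      space of \<open>mu\<close> into the one of \<open>nu\<close> with the same weight and thus
      intertwines the two cocharacters.\<close>
    have U0: "U 0 = (\<Sum>k\<in>KK. prn k ** g ** prm k)"
    proof -
      have "U 0 = (\<Sum>j\<in>KK. \<Sum>k\<in>KK. if k = j then prn j ** g ** prm j else 0)"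
        unfolding U_def by (intro sum.cong refl) (auto simp: power_0_left)
      then show ?thesis by simp
    qed
    have "U 0 ** cochar_at mu t = (\<Sum>k\<in>KK. scale_tensor (t powi k) (prn k ** g ** prm k))"
    proof -
      have "prn k ** g ** prm k ** cochar_at mu t = scale_tensor (t powi k) (prn k ** g ** prm k)" if "k \<in> KK" for k
      proof -
        have "prm k ** cochar_at mu t = (\<Sum>j\<in>KK. if j = k then scale_tensor (t powi k) (prm k) else 0)"
          unfolding cochar_at_weights matrix_mul_sum_right map_matrix_of_complex_id
          by (intro sum.cong) (auto simp: scale_tensor_mul_right prm_mult)
        then have "prm k ** cochar_at mu t = scale_tensor (t powi k) (prm k)" using that by simp
        then show ?thesis by (simp only: matrix_mul_assoc[symmetric] scale_tensor_mul_right)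
      qed
      then show ?thesis unfolding U0 matrix_mul_sum_left by (intro sum.cong) auto
    qed
    also have "\<dots> = cochar_at nu t ** U 0"
    proof -
      have "cochar_at nu t ** (prn k ** g ** prm k) = scale_tensor (t powi k) (prn k ** g ** prm k)" if "k \<in> KK" for k
      proof -
        have "cochar_at nu t ** prn k = (\<Sum>j\<in>KK. if j = k then scale_tensor (t powi k) (prn k) else 0)"
          unfolding cochar_at_weights matrix_mul_sum_left map_matrix_of_complex_id
          by (intro sum.cong) (auto simp: scale_tensor_mul_left prn_mult)
        then have "cochar_at nu t ** prn k = scale_tensor (t powi k) (prn k)" using that by simp
        then show ?thesis by (simp only: matrix_mul_assoc scale_tensor_mul_left)
      qed
      then show ?thesis unfolding U0 matrix_mul_sum_right by (intro sum.cong) auto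
    qed
    finally show ?thesis .
  qed
  ultimately show thesis by (rule that)
qed

end

end

text \<open>The element of \<open>G\<close> whose limit is taken is the value of \<open>a\<close> at
  z = 0. Solving the relation for \<open>z_minus mu\<close> exchanges the two cocharacters and
  replaces \<open>a\<close> by its inverse, which supplies the second vanishing condition of
  \<open>conjugation_limit\<close>.\<close>

lemma schubert_orbit_eqD:
  fixes G T :: "(complex^'n^'n::finite) set"
  assumes G: "linear_algebraic_group G" and TG: "T \<subseteq> G" and mu: "cocharacter T mu" and nu: "cocharacter T nu"
    and eq: "schubert_orbit G mu = schubert_orbit G nu"
  obtains u where "u \<in> G" "\<And>t::complex. t \<noteq> 0 \<Longrightarrow> u ** cochar_at mu t = cochar_at nu t ** u"
proof -
  note hom = complex_algebra_hom_fps_to_fls and ev = complex_algebra_hom_fps_nth_0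
  let ?f = "map_matrix fps_to_fls :: complex fps^'n^'n \<Rightarrow> complex fls^'n^'n"
  let ?e = "map_matrix (\<lambda>f. fps_nth f 0) :: complex fps^'n^'n \<Rightarrow> complex^'n^'n"
  have 1: "mat 1 \<in> (points G :: (complex fps^'n^'n) set)"
    using const_in_points[OF G linear_algebraic_groupD(1)[OF G]] by (simp add: hom_mat_1[OF complex_algebra_hom_of_complex])
  have mem: "\<gamma> \<in> gr_coset G \<gamma>" for \<gamma>
    unfolding gr_coset_def by (rule CollectI, rule exI[of _ "mat 1"]) (simp add: 1 hom_mat_1[OF hom])
  have "gr_coset G (?f (mat 1) ** z_minus nu ** ?f (mat 1)) \<in> schubert_orbit G nu"
    unfolding schubert_orbit_def using 1 by blast
  then have "gr_coset G (z_minus nu) \<in> schubert_orbit G mu" by (simp add: eq hom_mat_1[OF hom])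
  then obtain a b where ab: "gr_coset G (z_minus nu) = gr_coset G (?f a ** z_minus mu ** ?f b)"
    and a: "a \<in> points G" and b: "b \<in> points G" unfolding schubert_orbit_def by blast
  then obtain c where c: "z_minus nu = ?f a ** z_minus mu ** ?f b ** ?f c" "c \<in> points G"
    using mem[of "z_minus nu"] unfolding ab by (auto simp: gr_coset_def)
  define d where "d = b ** c"
  have d: "d \<in> points G" unfolding d_def using b c by (intro points_mult linear_algebraic_groupD[OF G])
  have eq1: "z_minus nu = ?f a ** z_minus mu ** ?f d" by (simp add: c(1) d_def hom_matrix_mult[OF hom] matrix_mul_assoc)
  obtain a' where a': "a' \<in> points G" "a ** a' = mat 1" "a' ** a = mat 1" using points_inverse[OF G a] by blast
  obtain d' where d': "d' \<in> points G" "d ** d' = mat 1" "d' ** d = mat 1" using points_inverse[OF G d] by blast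
  have "?f a' ** z_minus nu ** ?f d' = ?f (a' ** a) ** z_minus mu ** ?f (d ** d')"
    by (simp only: eq1 hom_matrix_mult[OF hom] matrix_mul_assoc)
  then have eq2: "z_minus mu = ?f a' ** z_minus nu ** ?f d'" by (simp add: a' d' hom_mat_1[OF hom])
  have gG: "?e a \<in> G" "?e a' \<in> G"
    using hom_points[OF ev a] hom_points[OF ev a'(1)] by (simp_all add: points_complex[OF G])
  have gg: "?e a ** ?e a' = mat 1" "?e a' ** ?e a = mat 1"
    by (simp_all add: hom_matrix_mult[OF ev, symmetric] a' hom_mat_1[OF ev])
  have inv: "invertible d" "invertible d'" using d d' by (simp_all add: points_def)
  have KK: "cochar_weights nu mu = cochar_weights mu nu" by (auto simp: cochar_weights_def)
  show thesis
    by (rule conjugation_limit[OF G TG mu nu gG gg])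
      (use leading_term_filtered[OF G TG mu nu eq1 inv(1)] leading_term_filtered[OF G TG nu mu eq2 inv(2)] that in \<open>auto simp: KK\<close>)
qed

section \<open>The Lie algebra of a linear algebraic group\<close>

text \<open>Over the complex numbers both members of a pair coincide, so the closure properties of
  \<open>poly_pair\<close> are inherited.\<close>

definition poly_fun :: "(complex^'n^'n \<Rightarrow> complex) \<Rightarrow> bool" where
  "poly_fun f \<longleftrightarrow> poly_pair f f"

lemma poly_fun_const [simp]: "poly_fun (\<lambda>_. c)"
  using poly_pair.const[of c, where 'r = complex] by (simp add: poly_fun_def)

lemma poly_fun_entry [simp]: "poly_fun (\<lambda>g. g $ i $ j)"
  unfolding poly_fun_def by (rule poly_pair.entry)

lemma poly_fun_add: "poly_fun f \<Longrightarrow> poly_fun g \<Longrightarrow> poly_fun (\<lambda>x. f x + g x)"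
  unfolding poly_fun_def by (rule poly_pair.add)

lemma poly_fun_mult: "poly_fun f \<Longrightarrow> poly_fun g \<Longrightarrow> poly_fun (\<lambda>x. f x * g x)"
  unfolding poly_fun_def by (rule poly_pair.mult)

lemma poly_fun_power: "poly_fun f \<Longrightarrow> poly_fun (\<lambda>x. f x ^ k)"
  unfolding poly_fun_def by (rule poly_pair_power)

lemma poly_fun_sum: "(\<And>x. x \<in> S \<Longrightarrow> poly_fun (f x)) \<Longrightarrow> poly_fun (\<lambda>g. \<Sum>x\<in>S. f x g)"
  unfolding poly_fun_def by (rule poly_pair_sum)

lemma poly_fun_prod: "(\<And>x. x \<in> S \<Longrightarrow> poly_fun (f x)) \<Longrightarrow> poly_fun (\<lambda>g. \<Prod>x\<in>S. f x g)"
  unfolding poly_fun_def by (rule poly_pair_prod)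

lemma poly_fun_diff: "poly_fun f \<Longrightarrow> poly_fun g \<Longrightarrow> poly_fun (\<lambda>x. f x - g x)"
  using poly_fun_add[of f "\<lambda>x. (-1) * g x"] poly_fun_mult[of "\<lambda>_. -1" g] by simp

lemma poly_fun_matrix_mul: "poly_fun (\<lambda>g :: complex^'n^'n::finite. (A ** g ** B) $ i $ j)"
  unfolding matrix_matrix_mult_def by (auto intro!: poly_fun_sum poly_fun_mult)

lemma poly_fun_eval_poly: "poly_fun (eval_poly p :: complex^'n^'n::finite \<Rightarrow> complex)"
  using poly_pair_eval_poly[where 'r = complex] by (simp add: poly_fun_def)

lemma poly_fun_induct [consumes 1, case_names const entry add mult]:
  assumes "poly_fun f"
    and "\<And>c. P (\<lambda>_. c)" and "\<And>i j. P (\<lambda>g. g $ i $ j)"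
    and "\<And>f g. poly_fun f \<Longrightarrow> P f \<Longrightarrow> poly_fun g \<Longrightarrow> P g \<Longrightarrow> P (\<lambda>x. f x + g x)"
    and "\<And>f g. poly_fun f \<Longrightarrow> P f \<Longrightarrow> poly_fun g \<Longrightarrow> P g \<Longrightarrow> P (\<lambda>x. f x * g x)"
  shows "P f"
proof -
  have "poly_fun f \<and> P f" if "poly_pair f (F :: complex^'a^'a \<Rightarrow> complex)" for f F
    using that
  proof induction
  qed (auto intro: assms(2-) poly_fun_add poly_fun_mult)
  then show ?thesis using assms(1) unfolding poly_fun_def by blast
qed

lemma poly_fun_continuous: "poly_fun f \<Longrightarrow> continuous_on S (f :: complex^'n^'n::finite \<Rightarrow> complex)"
  unfolding poly_fun_def by (rule poly_pair_continuous)

lemma mem_linear_algebraic_groupI: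
  assumes "linear_algebraic_group (G :: (complex^'n^'n::finite) set)" and "invertible g"
    and "\<And>f. poly_fun f \<Longrightarrow> (\<And>h. h \<in> G \<Longrightarrow> f h = 0) \<Longrightarrow> f g = 0"
  shows "g \<in> G"
  using assms(2,3) poly_fun_eval_poly unfolding linear_algebraic_group_iff[OF assms(1)] by blast

text \<open>The derivative along the left-invariant vector field of \<open>X\<close> is linear in \<open>X\<close>.\<close>

lemma poly_fun_derivative:
  assumes "poly_fun (f :: complex^'n^'n::finite \<Rightarrow> complex)"
  shows "\<exists>f'. (\<forall>X. poly_fun (f' X)) \<and> (\<forall>X Y g. f' (X + Y) g = f' X g + f' Y g) \<and>
    (\<forall>g X t. ((\<lambda>t. f (g ** matrix_exp (scale_tensor t X))) has_field_derivative f' X (g ** matrix_exp (scale_tensor t X))) (at t))"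
  using assms
proof (induction rule: poly_fun_induct)
  case (const c)
  show ?case by (rule exI[of _ "\<lambda>_ _. 0"]) simp
next
  case (entry i j)
  show ?case
    by (rule exI[of _ "\<lambda>X g. (g ** X) $ i $ j"])
      (use poly_fun_matrix_mul[of "mat 1 :: complex^'n^'n"] in \<open>auto simp: matrix_mul_add_right matrix_exp_entry_has_field_derivative\<close>)
next
  case (add f h)
  from add.IH(1) obtain f' where f': "\<forall>X. poly_fun (f' X)" "\<forall>X Y g. f' (X + Y) g = f' X g + f' Y g"
    "\<forall>g X t. ((\<lambda>t. f (g ** matrix_exp (scale_tensor t X))) has_field_derivative f' X (g ** matrix_exp (scale_tensor t X))) (at t)"
    by blast
  from add.IH(2) obtain h' where h': "\<forall>X. poly_fun (h' X)" "\<forall>X Y g. h' (X + Y) g = h' X g + h' Y g"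
    "\<forall>g X t. ((\<lambda>t. h (g ** matrix_exp (scale_tensor t X))) has_field_derivative h' X (g ** matrix_exp (scale_tensor t X))) (at t)"
    by blast
  show ?case
    by (rule exI[of _ "\<lambda>X g. f' X g + h' X g"])
      (use f' h' in \<open>auto intro!: poly_fun_add derivative_eq_intros simp: algebra_simps\<close>)
next
  case (mult f h)
  from mult.IH(1) obtain f' where f': "\<forall>X. poly_fun (f' X)" "\<forall>X Y g. f' (X + Y) g = f' X g + f' Y g"
    "\<forall>g X t. ((\<lambda>t. f (g ** matrix_exp (scale_tensor t X))) has_field_derivative f' X (g ** matrix_exp (scale_tensor t X))) (at t)"
    by blast
  from mult.IH(2) obtain h' where h': "\<forall>X. poly_fun (h' X)" "\<forall>X Y g. h' (X + Y) g = h' X g + h' Y g"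
    "\<forall>g X t. ((\<lambda>t. h (g ** matrix_exp (scale_tensor t X))) has_field_derivative h' X (g ** matrix_exp (scale_tensor t X))) (at t)"
    by blast
  show ?case
  proof (rule exI[of _ "\<lambda>X g. f' X g * h g + f g * h' X g"], intro conjI allI)
    show "poly_fun (\<lambda>g. f' X g * h g + f g * h' X g)" for X
      using f'(1) h'(1) mult.hyps by (intro poly_fun_add poly_fun_mult) auto
    show "f' (X + Y) g * h g + f g * h' (X + Y) g = f' X g * h g + f g * h' X g + (f' Y g * h g + f g * h' Y g)" for X Y g
      using f'(2) h'(2) by (simp add: algebra_simps)
    show "((\<lambda>t. f (g ** matrix_exp (scale_tensor t X)) * h (g ** matrix_exp (scale_tensor t X))) has_field_derivative
      f' X (g ** matrix_exp (scale_tensor t X)) * h (g ** matrix_exp (scale_tensor t X)) +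
      f (g ** matrix_exp (scale_tensor t X)) * h' X (g ** matrix_exp (scale_tensor t X))) (at t)" for g X t
      by (rule derivative_eq_intros f'(3)[rule_format] h'(3)[rule_format])+ (simp add: mult.commute)
  qed
qed

text \<open>With a complex parameter, closure under complex scaling is immediate; closure under
  addition is the part that needs an argument.\<close>

definition lie_algebra :: "(complex^'n^'n) set \<Rightarrow> (complex^'n^'n) set" where
  "lie_algebra G = {X. \<forall>c. matrix_exp (scale_tensor c X) \<in> G}"

definition ad :: "complex^'n^'n \<Rightarrow> complex^'n^'n \<Rightarrow> complex^'n^'n" where
  "ad X Y = X ** Y - Y ** X"

context
  fixes G :: "(complex^'n^'n::finite) set"
  assumes G: "linear_algebraic_group G"
begin

lemma lie_algebra_scale: "X \<in> lie_algebra G \<Longrightarrow> scale_tensor c X \<in> lie_algebra G"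
  by (simp add: lie_algebra_def)

lemma lie_algebra_0: "0 \<in> lie_algebra G"
  using linear_algebraic_groupD(1)[OF G] by (simp add: lie_algebra_def)

lemma lie_algebra_exp: "X \<in> lie_algebra G \<Longrightarrow> matrix_exp X \<in> G"
  unfolding lie_algebra_def by (metis (mono_tags, lifting) mem_Collect_eq scale_tensor_1)

lemma lie_algebra_conj:
  assumes "g \<in> G" "X \<in> lie_algebra G"
  shows "g ** X ** matrix_inv g \<in> lie_algebra G"
proof -
  have i: "invertible g" using linear_algebraic_groupD(4)[OF G assms(1)] .
  have "matrix_exp (scale_tensor c (g ** X ** matrix_inv g)) = g ** matrix_exp (scale_tensor c X) ** matrix_inv g" for c
    using matrix_exp_conj[OF matrix_inv_mult[OF i], of "scale_tensor c X"]
    by (simp add: scale_tensor_mul_left scale_tensor_mul_right)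
  then show ?thesis using assms unfolding lie_algebra_def
    by (auto intro!: linear_algebraic_groupD[OF G])
qed

text \<open>The set of \<open>X\<close> whose derivation preserves the ideal of \<open>G\<close> is closed under addition, and for
  such \<open>X\<close> all derivatives of \<open>f (exp (t X))\<close> vanish at \<open>0\<close> when \<open>f\<close> is in the ideal.\<close>

lemma lie_algebra_add:
  assumes "X \<in> lie_algebra G" "Y \<in> lie_algebra G"
  shows "X + Y \<in> lie_algebra G"
proof -
  define P where "P f \<longleftrightarrow> poly_fun f \<and> (\<forall>g\<in>G. f g = 0)" for f :: "complex^'n^'n \<Rightarrow> complex"
  define E where "E t = matrix_exp (scale_tensor t (X + Y))" for t
  have "\<exists>f1. P f1 \<and> (\<forall>t. ((\<lambda>t. f (E t)) has_field_derivative f1 (E t)) (at t))" if "P f" for f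
  proof -
    from poly_fun_derivative[of f] that obtain f' where f': "\<forall>X. poly_fun (f' X)" "\<forall>X Y g. f' (X + Y) g = f' X g + f' Y g"
      "\<forall>g X t. ((\<lambda>t. f (g ** matrix_exp (scale_tensor t X))) has_field_derivative f' X (g ** matrix_exp (scale_tensor t X))) (at t)"
      unfolding P_def by blast
    have 0: "f' Z g = 0" if "Z \<in> lie_algebra G" "g \<in> G" for Z g
    proof -
      have "(\<lambda>t. f (g ** matrix_exp (scale_tensor t Z))) = (\<lambda>_. 0)"
        using that \<open>P f\<close> linear_algebraic_groupD(2)[OF G] by (auto simp: P_def lie_algebra_def)
      then have "((\<lambda>_. 0) has_field_derivative f' Z (g ** matrix_exp (scale_tensor 0 Z))) (at 0)"
        using f'(3)[rule_format, of g Z 0] by simp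
      then show ?thesis using DERIV_unique[OF _ DERIV_const[of 0]] by fastforce
    qed
    show ?thesis
    proof (intro exI[of _ "f' (X + Y)"] conjI allI)
      show "P (f' (X + Y))" using f'(1,2) 0 assms by (simp add: P_def)
      show "((\<lambda>t. f (E t)) has_field_derivative f' (X + Y) (E t)) (at t)" for t
        using f'(3)[rule_format, of "mat 1" "X + Y" t] by (simp add: E_def)
    qed
  qed
  \<comment> \<open>\<open>D\<close> is an operator on the ideal, chosen once and for all, so that
    it can be iterated to give all higher derivatives along the curve.\<close>
  then obtain D where D: "\<And>f. P f \<Longrightarrow> P (D f)"
    "\<And>f t. P f \<Longrightarrow> ((\<lambda>t. f (E t)) has_field_derivative D f (E t)) (at t)" by metis
  have "f (E t) = 0" if "P f" for f t
  proof (rule holomorphic_fun_eq_0_on_connected[where f = "\<lambda>t. f (E t)" and S = UNIV and z = 0])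
    have PD: "P ((D ^^ n) f)" for n by (induction n) (auto intro: D that)
    have dd: "(deriv ^^ n) (\<lambda>t. f (E t)) = (\<lambda>t. (D ^^ n) f (E t))" for n
    proof (induction n)
      case (Suc n)
      show ?case by (simp add: Suc) (rule ext, rule DERIV_imp_deriv, rule D(2)[OF PD])
    qed simp
    show "(deriv ^^ n) (\<lambda>t. f (E t)) 0 = 0" for n
      unfolding dd using PD[of n] linear_algebraic_groupD(1)[OF G] by (simp add: P_def E_def)
    show "(\<lambda>t. f (E t)) holomorphic_on UNIV"
      using D(2)[OF that] by (auto simp: holomorphic_on_open)
  qed auto
  then show ?thesis
    unfolding lie_algebra_def
    by (auto intro!: mem_linear_algebraic_groupI[OF G invertible_matrix_exp] simp: P_def E_def)
qed

lemma subspace_lie_algebra: "subspace (lie_algebra G)"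
  by (auto intro!: subspaceI lie_algebra_0 lie_algebra_add lie_algebra_scale simp: scaleR_eq_scale_tensor)

lemma lie_algebra_diff: "X \<in> lie_algebra G \<Longrightarrow> Y \<in> lie_algebra G \<Longrightarrow> X - Y \<in> lie_algebra G"
  using subspace_diff[OF subspace_lie_algebra] .

text \<open>The conjugates of \<open>Y\<close> by exp(t X) form a curve inside a linear subspace,
  and its derivative at 0 is \<open>ad X Y\<close>. Pairing with vectors orthogonal to the subspace
  shows that the derivative stays inside.\<close>

lemma lie_algebra_ad:
  assumes X: "X \<in> lie_algebra G" and Y: "Y \<in> lie_algebra G"
  shows "ad X Y \<in> lie_algebra G"
proof -
  define c where "c t = matrix_exp (t *\<^sub>R X) ** Y ** matrix_exp (- (t *\<^sub>R X))" for t :: real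
  have "c t \<in> lie_algebra G" for t
  proof -
    have "matrix_inv (matrix_exp (t *\<^sub>R X)) = matrix_exp (- (t *\<^sub>R X))"
      by (rule matrix_inv_unique) (simp_all add: matrix_exp_minus matrix_exp_minus')
    moreover have "matrix_exp (t *\<^sub>R X) \<in> G" using X by (simp add: scaleR_eq_scale_tensor lie_algebra_def)
    ultimately show ?thesis unfolding c_def using lie_algebra_conj[OF _ Y] by metis
  qed
  have e: "((\<lambda>t. matrix_exp (t *\<^sub>R Z)) has_derivative (\<lambda>t. t *\<^sub>R Z)) (at 0)" for Z :: "complex^'n^'n"
    by (rule has_derivative_compose[of "\<lambda>t. t *\<^sub>R Z" "\<lambda>t. t *\<^sub>R Z" 0 UNIV matrix_exp "\<lambda>X. X"])
      (auto intro!: derivative_eq_intros matrix_exp_has_derivative_0)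
  have d: "(c has_derivative (\<lambda>t. matrix_exp (0 *\<^sub>R X) ** Y ** (t *\<^sub>R (- X)) + t *\<^sub>R X ** Y ** matrix_exp (0 *\<^sub>R (- X)))) (at 0)"
    unfolding c_def scaleR_minus_right[symmetric]
    by (rule bounded_bilinear.FDERIV[OF bounded_bilinear_matrix_mul
          bounded_linear.has_derivative[OF bounded_linear_matrix_mul_left e] e])
  then have d: "(c has_derivative (\<lambda>t. t *\<^sub>R ad X Y)) (at 0)"
    by (simp add: ad_def matrix_mul_scaleR_left matrix_mul_scaleR_right matrix_mul_minus_right scaleR_diff_right)
  have "ad X Y \<bullet> z = 0" if z: "\<forall>W\<in>lie_algebra G. W \<bullet> z = 0" for z
  proof -
    have "((\<lambda>t. c t \<bullet> z) has_derivative (\<lambda>t. t *\<^sub>R ad X Y \<bullet> z)) (at 0)"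
      by (intro has_derivative_inner_left d)
    then have "((\<lambda>t. 0) has_derivative (\<lambda>t. t *\<^sub>R ad X Y \<bullet> z)) (at (0::real))"
      using z \<open>\<And>t. c t \<in> lie_algebra G\<close> by simp
    from has_derivative_unique[OF this has_derivative_const] have "1 *\<^sub>R ad X Y \<bullet> z = 0" by metis
    then show ?thesis by simp
  qed
  then have "ad X Y \<in> orthogonal_comp (orthogonal_comp (lie_algebra G))"
    by (auto simp: orthogonal_comp_def orthogonal_def inner_commute)
  then show ?thesis by (simp add: orthogonal_comp_self[OF subspace_lie_algebra])
qed

end

section \<open>Spectral projections\<close>

text \<open>Horner's scheme with the matrix product in place of a ring multiplication.\<close>

definition matrix_poly_eval :: "complex poly \<Rightarrow> complex^'n^'n \<Rightarrow> complex^'n^'n" where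
  "matrix_poly_eval p X = fold_coeffs (\<lambda>a M. scale_tensor a (mat 1) + X ** M) p 0"

lemma matrix_poly_eval_0 [simp]: "matrix_poly_eval 0 X = 0"
  by (simp add: matrix_poly_eval_def)

lemma matrix_poly_eval_pCons [simp]:
  "matrix_poly_eval (pCons a p) X = scale_tensor a (mat 1) + X ** matrix_poly_eval p X"
  by (cases "p = 0 \<and> a = 0") (auto simp: matrix_poly_eval_def)

lemma matrix_poly_eval_add: "matrix_poly_eval (p + q) X = matrix_poly_eval p X + matrix_poly_eval q X"
  by (induction p q rule: poly_induct2) (simp_all add: scale_tensor_add_left matrix_mul_add_right)

lemma matrix_poly_eval_smult: "matrix_poly_eval (smult c p) X = scale_tensor c (matrix_poly_eval p X)"
  by (induction p) (simp_all add: scale_tensor_add scale_tensor_mul_right)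

lemma matrix_poly_eval_mult: "matrix_poly_eval (p * q) X = matrix_poly_eval p X ** matrix_poly_eval q X"
  by (induction p)
    (simp_all add: matrix_poly_eval_add matrix_poly_eval_smult matrix_mul_add_left scale_tensor_mul_left matrix_mul_assoc)

lemma matrix_poly_eval_1 [simp]: "matrix_poly_eval 1 X = mat 1"
  by (simp add: one_pCons)

lemma matrix_poly_eval_sum: "matrix_poly_eval (sum f S) X = (\<Sum>x\<in>S. matrix_poly_eval (f x) X)"
  by (induction S rule: infinite_finite_induct) (simp_all add: matrix_poly_eval_add)

lemma matrix_poly_eval_power: "matrix_poly_eval (p ^ k) X = matrix_power (matrix_poly_eval p X) k"
  by (induction k) (simp_all add: matrix_poly_eval_mult matrix_power_Suc)

lemma matrix_poly_eval_monom: "matrix_poly_eval (monom a k) X = scale_tensor a (matrix_power X k)"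
  by (induction k) (simp_all add: monom_0 monom_Suc matrix_power_Suc scale_tensor_mul_right)

lemma matrix_poly_eval_commute:
  assumes "Z ** X = X ** Z"
  shows "Z ** matrix_poly_eval p X = matrix_poly_eval p X ** Z"
proof (induction p)
  case (pCons a p)
  have "Z ** (X ** matrix_poly_eval p X) = X ** matrix_poly_eval p X ** Z"
    using assms pCons.IH by (metis matrix_mul_assoc)
  then show ?case
    by (simp add: matrix_mul_add_left matrix_mul_add_right scale_tensor_mul_left scale_tensor_mul_right)
qed simp

text \<open>More powers than the dimension are linearly dependent. The case distinction is due to
  dependence being a property of sets: if two powers coincide, their difference is itself the
  relation.\<close>

lemma annihilating_poly:
  fixes X :: "complex^'n^'n::finite"
  obtains p where "p \<noteq> 0" "matrix_poly_eval p X = 0"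
proof (cases "inj (matrix_power X)")
  case False
  then obtain j k where "j \<noteq> k" "matrix_power X j = matrix_power X k" by (auto simp: inj_def)
  then have "matrix_poly_eval (monom 1 j + monom (-1) k) X = 0"
    by (simp add: matrix_poly_eval_add matrix_poly_eval_monom) (simp add: vec_eq_iff)
  moreover have "coeff (monom 1 j + monom (-1) k) j = (1 :: complex)" using \<open>j \<noteq> k\<close> by simp
  then have "monom 1 j + monom (-1) k \<noteq> (0 :: complex poly)" by force
  ultimately show ?thesis using that by blast
next
  case True
  let ?n = "DIM(complex^'n^'n)"
  let ?S = "matrix_power X ` {..?n}"
  have inj: "inj_on (matrix_power X) {..?n}" using True inj_on_subset by blast
  have "dependent ?S" by (rule dependent_biggerset) (simp only: card_image[OF inj] card_atMost lessI)
  then obtain u v where u: "v \<in> ?S" "u v \<noteq> 0" "(\<Sum>v\<in>?S. u v *\<^sub>R v) = 0"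
    by (auto simp: dependent_finite)
  then obtain k where k: "k \<le> ?n" "v = matrix_power X k" by auto
  define p where "p = (\<Sum>i\<le>?n. monom (complex_of_real (u (matrix_power X i))) i)"
  have "matrix_poly_eval p X = (\<Sum>i\<le>?n. u (matrix_power X i) *\<^sub>R matrix_power X i)"
    by (simp add: p_def matrix_poly_eval_sum matrix_poly_eval_monom scaleR_eq_scale_tensor)
  also have "\<dots> = 0" using u(3) unfolding sum.reindex[OF inj] o_def .
  finally have "matrix_poly_eval p X = 0" .
  moreover have "coeff p k = complex_of_real (u v)"
    unfolding p_def coeff_sum using k by (simp add: coeff_monom sum.delta)
  then have "p \<noteq> 0" using u(2) by auto
  ultimately show ?thesis using that by blast
qed

lemma coprime_linear_powers:
  assumes "a \<noteq> (b :: complex)"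
  shows "coprime ([:- a, 1:] ^ m) ([:- b, 1:] ^ k)"
proof -
  have "coprime [:- a, 1:] [:- b, 1:]"
  proof (rule coprimeI)
    fix c assume "c dvd [:- a, 1:]" "c dvd [:- b, 1:]"
    then have "c dvd [:- a, 1:] - [:- b, 1:]" by (rule dvd_diff)
    then have "c dvd [:b - a:]" by simp
    moreover have "is_unit [:b - a:]" using assms by (simp add: is_unit_pCons_iff)
    ultimately show "is_unit c" by (rule dvd_unit_imp_unit)
  qed
  then show ?thesis by (simp add: coprime_power_left_iff coprime_power_right_iff)
qed

text \<open>The identity behind partial fractions; evaluated at a matrix, its summands become
  spectral projections. A new factor is coprime to the product of the old ones, and in the resulting
  Bezout identity \<open>a * (\<Prod>j\<in>J. f j) + b * f x = 1\<close> the second term is expanded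
  by the identity for \<open>J\<close>.\<close>

lemma partial_fractions_bezout:
  fixes f :: "'i \<Rightarrow> complex poly"
  assumes "finite J" "J \<noteq> {}" "\<And>i j. i \<in> J \<Longrightarrow> j \<in> J \<Longrightarrow> i \<noteq> j \<Longrightarrow> coprime (f i) (f j)"
  shows "\<exists>u. (\<Sum>i\<in>J. u i * (\<Prod>j\<in>J - {i}. f j)) = 1"
  using assms
proof (induction J rule: finite_ne_induct)
  case (singleton x)
  show ?case by (rule exI[of _ "\<lambda>_. 1"]) simp
next
  case (insert x J)
  then obtain u where u: "(\<Sum>i\<in>J. u i * (\<Prod>j\<in>J - {i}. f j)) = 1" by auto
  have "coprime (\<Prod>j\<in>J. f j) (f x)"
    using insert.prems insert.hyps by (intro prod_coprime_left) auto
  then obtain a b where ab: "a * (\<Prod>j\<in>J. f j) + b * f x = 1"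
    by (metis bezout_coefficients_fst_snd coprime_imp_gcd_eq_1)
  let ?u = "\<lambda>i. if i = x then a else b * u i"
  have "(\<Sum>i\<in>insert x J. ?u i * (\<Prod>j\<in>insert x J - {i}. f j)) =
      a * (\<Prod>j\<in>J. f j) + (\<Sum>i\<in>J. b * u i * (\<Prod>j\<in>insert x J - {i}. f j))"
  proof -
    have "(\<Sum>i\<in>J. ?u i * (\<Prod>j\<in>insert x J - {i}. f j)) = (\<Sum>i\<in>J. b * u i * (\<Prod>j\<in>insert x J - {i}. f j))"
      using insert.hyps by (intro sum.cong) auto
    moreover have "insert x J - {x} = J" using insert.hyps by auto
    ultimately show ?thesis using insert.hyps by simp
  qed
  also have "(\<Sum>i\<in>J. b * u i * (\<Prod>j\<in>insert x J - {i}. f j)) = (\<Sum>i\<in>J. b * f x * (u i * (\<Prod>j\<in>J - {i}. f j)))"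
  proof (intro sum.cong refl)
    fix i assume "i \<in> J"
    then have "insert x J - {i} = insert x (J - {i})" using insert.hyps by auto
    then show "b * u i * (\<Prod>j\<in>insert x J - {i}. f j) = b * f x * (u i * (\<Prod>j\<in>J - {i}. f j))"
      using insert.hyps by simp
  qed
  also have "\<dots> = b * f x" by (simp only: sum_distrib_left[symmetric] u mult_1_right)
  finally show ?case using ab by auto
qed

text \<open>Members may be zero, so that products of two systems can be indexed by all
  pairs.\<close>

definition idempotent_system :: "'k set \<Rightarrow> ('k \<Rightarrow> complex^'n^'n) \<Rightarrow> bool" where
  "idempotent_system K \<epsilon> \<longleftrightarrow> finite K \<and> (\<forall>j\<in>K. \<forall>k\<in>K. \<epsilon> j ** \<epsilon> k = (if j = k then \<epsilon> k else 0)) \<and> (\<Sum>k\<in>K. \<epsilon> k) = mat 1"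

text \<open>An annihilating polynomial is factored into coprime powers of linear factors. The
  projections onto the generalized eigenspaces are polynomials in \<open>X\<close>, which is why
  they commute with everything that commutes with \<open>X\<close>. Orthogonality and nilpotency
  hold because the polynomials involved are divisible by all the factors at once.\<close>

lemma spectral_projections:
  fixes X :: "complex^'n^'n::finite"
  obtains J :: "complex set" and \<pi> N where "idempotent_system J \<pi>"
    "\<And>Z d. Z ** X = X ** Z \<Longrightarrow> d \<in> J \<Longrightarrow> Z ** \<pi> d = \<pi> d ** Z"
    "\<And>d. d \<in> J \<Longrightarrow> matrix_power (X - scale_tensor d (mat 1)) N ** \<pi> d = 0"
proof -
  obtain p where p: "p \<noteq> 0" "matrix_poly_eval p X = 0" by (rule annihilating_poly)
  define J where "J = {z. poly p z = 0}"
  define f where "f z = [:- z, 1:] ^ order z p" for z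
  have fin: "finite J" unfolding J_def using p(1) by (rule poly_roots_finite)
  have pf: "p = smult (lead_coeff p) (\<Prod>z\<in>J. f z)"
    using complex_poly_decompose[of p] by (simp add: J_def f_def)
  have 0: "matrix_poly_eval q X = 0" if "(\<Prod>z\<in>J. f z) dvd q" for q
  proof -
    from that have "p dvd q" using p(1) by (subst pf) (simp add: smult_dvd_iff)
    then obtain r where "q = p * r" by (elim dvdE)
    then show ?thesis by (simp add: matrix_poly_eval_mult p(2))
  qed
  \<comment> \<open>Without roots the constant 1 would annihilate \<open>X\<close>, making the
    identity matrix zero.\<close>
  have "J \<noteq> {}"
  proof
    assume "J = {}"
    then have "matrix_poly_eval 1 X = 0" by (intro 0) simp
    moreover have "mat 1 $ undefined $ undefined = (1 :: complex)" for a :: "complex^'n^'n" by (simp add: mat_def)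
    ultimately show False by (simp add: vec_eq_iff mat_def split: if_splits)
  qed
  then obtain u where u: "(\<Sum>i\<in>J. u i * (\<Prod>j\<in>J - {i}. f j)) = 1"
    using partial_fractions_bezout[OF fin, of f]
    by (auto simp: f_def coprime_linear_powers simp del: coprime_power_left_iff coprime_power_right_iff)
  define h where "h i = u i * (\<Prod>j\<in>J - {i}. f j)" for i
  define \<pi> where "\<pi> i = matrix_poly_eval (h i) X" for i
  have sum: "(\<Sum>i\<in>J. \<pi> i) = mat 1"
    unfolding \<pi>_def matrix_poly_eval_sum[symmetric] h_def u by simp
  have orth: "\<pi> i ** \<pi> j = 0" if ij: "i \<in> J" "j \<in> J" "i \<noteq> j" for i j
    unfolding \<pi>_def matrix_poly_eval_mult[symmetric]
  proof (rule 0)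
    have "(\<Prod>z\<in>J. f z) = f i * (\<Prod>z\<in>J - {i}. f z)" using fin ij by (simp add: prod.remove)
    moreover have "f i dvd h j" unfolding h_def using ij fin by (intro dvd_mult dvd_prodI) auto
    moreover have "(\<Prod>z\<in>J - {i}. f z) dvd h i" unfolding h_def by simp
    ultimately show "(\<Prod>z\<in>J. f z) dvd h i * h j" by (metis mult.commute mult_dvd_mono)
  qed
  have idem: "\<pi> i ** \<pi> i = \<pi> i" if i: "i \<in> J" for i
  proof -
    have "\<pi> i = \<pi> i ** (\<Sum>j\<in>J. \<pi> j)" by (simp add: sum)
    also have "\<dots> = (\<Sum>j\<in>J. if j = i then \<pi> i ** \<pi> i else 0)"
      unfolding matrix_mul_sum_right using orth i by (intro sum.cong) auto
    finally show ?thesis using i fin by simp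
  qed
  \<comment> \<open>The degree bounds the order of every root, so a single exponent serves all
    eigenvalues.\<close>
  show thesis
  proof (rule that[of J \<pi> "degree p"])
    show "idempotent_system J \<pi>" using fin orth idem sum by (auto simp: idempotent_system_def)
    show "Z ** \<pi> d = \<pi> d ** Z" if "Z ** X = X ** Z" for Z d
      unfolding \<pi>_def by (rule matrix_poly_eval_commute[OF that])
    fix d assume d: "d \<in> J"
    have "matrix_poly_eval ([:- d, 1:] ^ degree p * h d) X = 0"
    proof (rule 0)
      have "(\<Prod>z\<in>J. f z) = f d * (\<Prod>z\<in>J - {d}. f z)" using fin d by (simp add: prod.remove)
      moreover have "f d dvd [:- d, 1:] ^ degree p"
        unfolding f_def by (intro le_imp_power_dvd order_degree p)
      moreover have "(\<Prod>z\<in>J - {d}. f z) dvd h d" unfolding h_def by simp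
      ultimately show "(\<Prod>z\<in>J. f z) dvd [:- d, 1:] ^ degree p * h d" by (metis mult_dvd_mono)
    qed
    moreover have "matrix_poly_eval [:- d, 1:] X = X - scale_tensor d (mat 1)"
      by (simp add: vec_eq_iff)
    ultimately show "matrix_power (X - scale_tensor d (mat 1)) (degree p) ** \<pi> d = 0"
      by (simp add: matrix_poly_eval_mult matrix_poly_eval_power \<pi>_def)
  qed
qed


section \<open>Linear combinations of a system of idempotents, and exponentials of diagonalizable
  and nilpotent matrices\<close>

definition diag_comb :: "'k set \<Rightarrow> ('k \<Rightarrow> complex^'n^'n) \<Rightarrow> ('k \<Rightarrow> complex) \<Rightarrow> complex^'n^'n" where
  "diag_comb K \<epsilon> x = (\<Sum>k\<in>K. scale_tensor (x k) (\<epsilon> k))"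

lemma diag_comb_mult:
  assumes "idempotent_system K \<epsilon>"
  shows "diag_comb K \<epsilon> x ** diag_comb K \<epsilon> y = diag_comb K \<epsilon> (\<lambda>k. x k * y k)"
proof -
  have "diag_comb K \<epsilon> x ** diag_comb K \<epsilon> y = (\<Sum>j\<in>K. \<Sum>k\<in>K. scale_tensor (x j * y k) (\<epsilon> j ** \<epsilon> k))"
    unfolding diag_comb_def matrix_mul_sum_left matrix_mul_sum_right
    by (subst sum.swap) (simp add: scale_tensor_mul_left scale_tensor_mul_right scale_tensor_sum mult.commute)
  also have "\<dots> = (\<Sum>j\<in>K. \<Sum>k\<in>K. if j = k then scale_tensor (x j * y j) (\<epsilon> j) else 0)"
    using assms by (intro sum.cong) (auto simp: idempotent_system_def)
  also have "\<dots> = diag_comb K \<epsilon> (\<lambda>k. x k * y k)"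
    using assms by (simp add: diag_comb_def idempotent_system_def)
  finally show ?thesis .
qed

lemma diag_comb_1: "idempotent_system K \<epsilon> \<Longrightarrow> diag_comb K \<epsilon> (\<lambda>_. 1) = mat 1"
  by (simp add: diag_comb_def idempotent_system_def)

lemma scale_diag_comb: "scale_tensor c (diag_comb K \<epsilon> x) = diag_comb K \<epsilon> (\<lambda>k. c * x k)"
  by (simp add: diag_comb_def scale_tensor_sum)

lemma diag_comb_idempotent:
  assumes "idempotent_system K \<epsilon>" "k \<in> K"
  shows "diag_comb K \<epsilon> x ** \<epsilon> k = scale_tensor (x k) (\<epsilon> k)" "\<epsilon> k ** diag_comb K \<epsilon> x = scale_tensor (x k) (\<epsilon> k)"
proof -
  have e: "\<epsilon> k = diag_comb K \<epsilon> (\<lambda>j. if j = k then 1 else 0)"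
  proof -
    have "diag_comb K \<epsilon> (\<lambda>j. if j = k then 1 else 0) = (\<Sum>j\<in>K. if j = k then \<epsilon> k else 0)"
      unfolding diag_comb_def by (intro sum.cong) auto
    then show ?thesis using assms by (simp add: idempotent_system_def)
  qed
  have "diag_comb K \<epsilon> (\<lambda>j. x j * (if j = k then 1 else 0)) = scale_tensor (x k) (\<epsilon> k)"
    by (subst e, subst scale_diag_comb) (auto simp: diag_comb_def intro!: sum.cong)
  then show "diag_comb K \<epsilon> x ** \<epsilon> k = scale_tensor (x k) (\<epsilon> k)" "\<epsilon> k ** diag_comb K \<epsilon> x = scale_tensor (x k) (\<epsilon> k)"
    using diag_comb_mult[OF assms(1), of x "\<lambda>j. if j = k then 1 else 0"] diag_comb_mult[OF assms(1), of "\<lambda>j. if j = k then 1 else 0" x]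
    by (simp_all add: e[symmetric] mult.commute)
qed

lemma matrix_exp_diag_comb:
  fixes \<epsilon> :: "'k \<Rightarrow> complex^'n^'n::finite"
  assumes "idempotent_system K \<epsilon>"
  shows "matrix_exp (diag_comb K \<epsilon> x) = diag_comb K \<epsilon> (\<lambda>k. exp (x k))"
proof (rule sums_unique2[OF matrix_exp_sums])
  have p: "matrix_power (diag_comb K \<epsilon> x) m = diag_comb K \<epsilon> (\<lambda>k. x k ^ m)" for m
    by (induction m) (simp_all add: diag_comb_1[OF assms] matrix_power_Suc diag_comb_mult[OF assms])
  have "(\<lambda>m. \<Sum>k\<in>K. scale_tensor (x k ^ m /\<^sub>R fact m) (\<epsilon> k)) sums (\<Sum>k\<in>K. scale_tensor (exp (x k)) (\<epsilon> k))"
    by (intro sums_sum bounded_linear.sums[OF bounded_linear_scale_tensor_left] exp_converges)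
  moreover have "scale_tensor (x k ^ m /\<^sub>R fact m) (\<epsilon> k) = scale_tensor (x k ^ m) (\<epsilon> k) /\<^sub>R fact m" for k m
    by (simp add: vec_eq_iff)
  ultimately show "(\<lambda>m. matrix_power (diag_comb K \<epsilon> x) m /\<^sub>R fact m) sums diag_comb K \<epsilon> (\<lambda>k. exp (x k))"
    unfolding p by (simp add: diag_comb_def scaleR_sum_right)
qed

lemma matrix_power_scale: "matrix_power (scale_tensor c X) m = scale_tensor (c ^ m) (matrix_power X m)"
  for X :: "complex^'n^'n::finite"
  by (induction m) (simp_all add: matrix_power_Suc scale_tensor_mul_left scale_tensor_mul_right mult.commute)

lemma matrix_power_add: "matrix_power X (j + k) = matrix_power X j ** matrix_power X k"
  by (induction j) (simp_all add: matrix_power_Suc matrix_mul_assoc)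

lemma matrix_exp_nilpotent:
  fixes X :: "complex^'n^'n::finite"
  assumes "matrix_power X N = 0"
  shows "matrix_exp (scale_tensor c X) = (\<Sum>m<N. scale_tensor (c ^ m) (matrix_power X m /\<^sub>R fact m))"
proof (rule sums_unique2[OF matrix_exp_sums])
  have "matrix_power X m = 0" if "m \<notin> {..<N}" for m
    using that matrix_power_add[of X N "m - N"] assms by simp
  then have "(\<lambda>m. scale_tensor (c ^ m) (matrix_power X m /\<^sub>R fact m)) sums (\<Sum>m<N. scale_tensor (c ^ m) (matrix_power X m /\<^sub>R fact m))"
    by (intro sums_finite) simp_all
  then show "(\<lambda>m. matrix_power (scale_tensor c X) m /\<^sub>R fact m) sums (\<Sum>m<N. scale_tensor (c ^ m) (matrix_power X m /\<^sub>R fact m))"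
    by (simp add: matrix_power_scale scale_tensor_scaleR)
qed

section \<open>Linear independence of exponential polynomials\<close>

text \<open>Dividing by \<open>exp (\<delta>0 * c)\<close> and differentiating lowers the degree of
  the coefficient at \<open>\<delta>0\<close>, while every other coefficient only has its leading
  coefficient multiplied by a nonzero difference. Repeating this removes the exponent
  \<open>\<delta>0\<close> and leaves a shorter relation.\<close>

lemma exp_poly_independent:
  fixes p :: "complex \<Rightarrow> complex poly"
  assumes "finite \<Delta>" "\<And>c. (\<Sum>\<delta>\<in>\<Delta>. poly (p \<delta>) c * exp (\<delta> * c)) = 0" "\<delta> \<in> \<Delta>"
  shows "p \<delta> = 0"
  using assms
proof (induction \<Delta> arbitrary: p \<delta> rule: finite_induct)
  case (insert \<delta>0 \<Delta>)
  \<comment> \<open>The inner induction bounds the degree at \<open>\<delta>0\<close> strictly by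
    \<open>n\<close>; the zero polynomial is listed separately because its degree is 0 by
    convention.\<close>
  have main: "\<forall>\<delta>\<in>insert \<delta>0 \<Delta>. p \<delta> = 0"
    if "\<And>c. (\<Sum>\<delta>\<in>insert \<delta>0 \<Delta>. poly (p \<delta>) c * exp (\<delta> * c)) = 0" "p \<delta>0 = 0 \<or> degree (p \<delta>0) < n" for p n
    using that
  proof (induction n arbitrary: p)
    case (Suc n)
    let ?T = "\<lambda>\<delta>. pderiv (p \<delta>) + smult (\<delta> - \<delta>0) (p \<delta>)"
    show ?case
    proof (cases "p \<delta>0 = 0")
      case True
      then have "(\<Sum>\<delta>\<in>\<Delta>. poly (p \<delta>) c * exp (\<delta> * c)) = 0" for c using Suc.prems(1)[of c] insert.hyps by simp
      then show ?thesis using insert.IH[of p] True by auto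
    next
      case False
      have "(\<Sum>\<delta>\<in>insert \<delta>0 \<Delta>. poly (?T \<delta>) c * exp (\<delta> * c)) = 0" for c
      proof -
        have "((\<lambda>c. \<Sum>\<delta>\<in>insert \<delta>0 \<Delta>. poly (p \<delta>) c * exp ((\<delta> - \<delta>0) * c)) has_field_derivative
            (\<Sum>\<delta>\<in>insert \<delta>0 \<Delta>. poly (?T \<delta>) c * exp ((\<delta> - \<delta>0) * c))) (at c)"
          by (auto intro!: DERIV_sum derivative_eq_intros poly_DERIV simp: algebra_simps)
        moreover have "(\<Sum>\<delta>\<in>insert \<delta>0 \<Delta>. poly (p \<delta>) c * exp ((\<delta> - \<delta>0) * c)) = 0" for c
        proof -
          have "(\<Sum>\<delta>\<in>insert \<delta>0 \<Delta>. poly (p \<delta>) c * exp ((\<delta> - \<delta>0) * c)) =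
             (\<Sum>\<delta>\<in>insert \<delta>0 \<Delta>. poly (p \<delta>) c * exp (\<delta> * c)) * exp (- \<delta>0 * c)"
            unfolding sum_distrib_right by (intro sum.cong) (auto simp: mult_exp_exp algebra_simps)
          then show ?thesis using Suc.prems(1)[of c] by simp
        qed
        ultimately have "(\<Sum>\<delta>\<in>insert \<delta>0 \<Delta>. poly (?T \<delta>) c * exp ((\<delta> - \<delta>0) * c)) = 0"
          using DERIV_unique[OF _ DERIV_const[of 0]] by fastforce
        then have "(\<Sum>\<delta>\<in>insert \<delta>0 \<Delta>. poly (?T \<delta>) c * exp ((\<delta> - \<delta>0) * c)) * exp (\<delta>0 * c) = 0" by simp
        moreover have "exp ((\<delta> - \<delta>0) * c) * exp (\<delta>0 * c) = exp (\<delta> * c)" for \<delta>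
          by (simp add: mult_exp_exp algebra_simps)
        ultimately show ?thesis by (simp only: sum_distrib_right mult.assoc)
      qed
      moreover have "?T \<delta>0 = 0 \<or> degree (?T \<delta>0) < n"
        using Suc.prems(2) False by (auto simp: degree_pderiv pderiv_eq_0_iff)
      ultimately have T: "\<forall>\<delta>\<in>insert \<delta>0 \<Delta>. ?T \<delta> = 0" by (rule Suc.IH)
      have "p \<delta> = 0" if "\<delta> \<in> \<Delta>" for \<delta>
      proof (rule ccontr)
        assume "p \<delta> \<noteq> 0"
        have "\<delta> - \<delta>0 \<noteq> 0" using that insert.hyps by auto
        \<comment> \<open>The derivative has no term in the top degree, so vanishing of the operator
          on \<open>p \<delta>\<close> would kill its leading coefficient.\<close>
        have "coeff (?T \<delta>) (degree (p \<delta>)) = (\<delta> - \<delta>0) * lead_coeff (p \<delta>)"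
          by (simp add: coeff_pderiv coeff_eq_0)
        then show False using T that \<open>p \<delta> \<noteq> 0\<close> \<open>\<delta> - \<delta>0 \<noteq> 0\<close> by auto
      qed
      moreover from this have "poly (p \<delta>0) c * exp (\<delta>0 * c) = 0" for c
        using Suc.prems(1)[of c] insert.hyps by simp
      then have "p \<delta>0 = 0" by (simp add: poly_all_0_iff_0[symmetric])
      ultimately show ?thesis by blast
    qed
  next
    case 0
    then have "(\<Sum>\<delta>\<in>\<Delta>. poly (p \<delta>) c * exp (\<delta> * c)) = 0" for c using 0(1)[of c] insert.hyps by simp
    then show ?case using insert.IH[of p] 0 by auto
  qed
  show ?case using main[of p "Suc (degree (p \<delta>0))"] insert.prems by blast
qed simp

text \<open>The complex linear span of \<open>B\<close>. In the applications \<open>B\<close> is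
  closed under products and contains 1, so the span is an algebra.\<close>

inductive monoid_span :: "('z \<Rightarrow> complex) set \<Rightarrow> ('z \<Rightarrow> complex) \<Rightarrow> bool" for B where
  zero: "monoid_span B (\<lambda>_. 0)"
| step: "b \<in> B \<Longrightarrow> monoid_span B F \<Longrightarrow> monoid_span B (\<lambda>z. a * b z + F z)"

lemma monoid_span_base: "b \<in> B \<Longrightarrow> monoid_span B (\<lambda>z. a * b z)"
  using monoid_span.step[OF _ monoid_span.zero, of b B a] by simp

lemma monoid_span_add:
  assumes "monoid_span B F" "monoid_span B F'"
  shows "monoid_span B (\<lambda>z. F z + F' z)"
  using assms(1)
proof induction
  case (step b F a)
  then have "monoid_span B (\<lambda>z. a * b z + (F z + F' z))" by (intro monoid_span.step)
  then show ?case by (simp add: add.assoc)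
qed (simp add: assms(2))

lemma monoid_span_sum: "(\<And>i. i \<in> I \<Longrightarrow> monoid_span B (F i)) \<Longrightarrow> monoid_span B (\<lambda>z. \<Sum>i\<in>I. F i z)"
  by (induction I rule: infinite_finite_induct) (auto intro: monoid_span_add monoid_span.zero)

lemma monoid_span_mult:
  assumes B: "\<And>b b'. b \<in> B \<Longrightarrow> b' \<in> B \<Longrightarrow> (\<lambda>z. b z * b' z) \<in> B" and F: "monoid_span B F" and F': "monoid_span B F'"
  shows "monoid_span B (\<lambda>z. F z * F' z)"
proof -
  have 1: "monoid_span B (\<lambda>z. a * b z * F' z)" if b: "b \<in> B" for a b
    using F'
  proof induction
    case (step b' F' a')
    have "monoid_span B (\<lambda>z. (a * a') * (b z * b' z) + a * b z * F' z)"
      by (rule monoid_span.step[OF B[OF b step.hyps(1)] step.IH])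
    then show ?case by (simp add: algebra_simps)
  qed (simp add: monoid_span.zero)
  show ?thesis using F
  proof induction
    case (step b F a)
    from monoid_span_add[OF 1[OF step.hyps(1), of a] step.IH] show ?case by (simp add: distrib_right)
  qed (simp add: monoid_span.zero)
qed

lemma monoid_span_explicit:
  assumes "monoid_span B F"
  shows "\<exists>(n::nat) a b. (\<forall>i<n. b i \<in> B) \<and> F = (\<lambda>z. \<Sum>i<n. a i * b i z)"
  using assms
proof induction
  case zero
  show ?case by (rule exI[of _ 0]) simp
next
  case (step b0 F a0)
  then obtain n a b where *: "\<forall>i<n::nat. b i \<in> B" "F = (\<lambda>z. \<Sum>i<n. a i * b i z)" by blast
  show ?case
    by (rule exI[of _ "Suc n"], rule exI[of _ "a(n := a0)"], rule exI[of _ "b(n := b0)"])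
      (use * step.hyps in \<open>auto simp: less_Suc_eq\<close>)
qed

text \<open>An exponential polynomial vanishes identically only if all its coefficients do, so the
  polynomial and the exponential argument may be varied independently.\<close>

lemma exp_poly_separate:
  fixes F :: "complex \<times> complex \<Rightarrow> complex"
  assumes "monoid_span {\<lambda>(b, c). b ^ m * exp (\<delta> * c) | m \<delta>. True} F" and 0: "\<And>c. F (c, c) = 0"
  shows "F (b, c) = 0"
proof -
  from monoid_span_explicit[OF assms(1)] obtain n :: nat and a g where
    g: "\<forall>i<n. g i \<in> {\<lambda>(b, c). b ^ m * exp (\<delta> * c) | m \<delta>. True}" and F: "F = (\<lambda>z. \<Sum>i<n. a i * g i z)" by blast
  then have "\<forall>i<n. \<exists>m \<delta>. g i = (\<lambda>(b, c). b ^ m * exp (\<delta> * c))" by blast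
  then obtain m \<delta> where m\<delta>: "\<forall>i<n. g i = (\<lambda>(b, c). b ^ m i * exp (\<delta> i * c))" by metis
  define p where "p d = (\<Sum>i\<in>{i\<in>{..<n}. \<delta> i = d}. monom (a i) (m i))" for d
  have Fp: "F (b, c) = (\<Sum>d\<in>\<delta> ` {..<n}. poly (p d) b * exp (d * c))" for b c
  proof -
    have "F (b, c) = (\<Sum>i<n. a i * (b ^ m i * exp (\<delta> i * c)))" using m\<delta> by (simp add: F)
    also have "\<dots> = (\<Sum>d\<in>\<delta> ` {..<n}. \<Sum>i\<in>{i\<in>{..<n}. \<delta> i = d}. a i * (b ^ m i * exp (\<delta> i * c)))"
      by (rule sum.image_gen) simp
    also have "\<dots> = (\<Sum>d\<in>\<delta> ` {..<n}. poly (p d) b * exp (d * c))"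
      by (intro sum.cong refl) (simp add: p_def poly_sum poly_monom sum_distrib_right mult.assoc)
    finally show ?thesis .
  qed
  have "p d = 0" if "d \<in> \<delta> ` {..<n}" for d
    by (rule exp_poly_independent[OF _ _ that]) (use 0 Fp in auto)
  then show ?thesis by (simp add: Fp)
qed

section \<open>The semisimple part of an element of the Lie algebra\<close>

text \<open>If all entries of a parametrized matrix lie in an algebra of functions, so does every
  polynomial in them. Used for exponential polynomials and again for monomials in diagonal
  coordinates.\<close>

lemma poly_fun_monoid_span:
  assumes "poly_fun (f :: complex^'n^'n::finite \<Rightarrow> complex)"
    and B: "\<And>b b'. b \<in> B \<Longrightarrow> b' \<in> B \<Longrightarrow> (\<lambda>z. b z * b' z) \<in> B" "(\<lambda>_. 1) \<in> B"
    and E: "\<And>i j. monoid_span B (\<lambda>z. E z $ i $ j)"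
  shows "monoid_span B (\<lambda>z. f (E z))"
  using assms(1)
proof (induction rule: poly_fun_induct)
  case (const c)
  show ?case using monoid_span_base[OF B(2), of c] by simp
qed (auto intro: E monoid_span_add monoid_span_mult[OF B(1)])

text \<open>The semisimple part contributes only exponentials and the nilpotent part only powers of
  its parameter. A polynomial vanishing on \<open>G\<close> thus gives an exponential polynomial in
  two independent parameters that vanishes when they agree, hence everywhere; putting the nilpotent
  parameter to 0 leaves the one-parameter group of the semisimple part.\<close>

lemma lie_algebra_semisimple_part:
  fixes X :: "complex^'n^'n::finite"
  assumes G: "linear_algebraic_group G" and X: "X \<in> lie_algebra G"
  obtains J :: "complex set" and \<pi> N where "idempotent_system J \<pi>"
    "\<And>Z d. Z ** X = X ** Z \<Longrightarrow> d \<in> J \<Longrightarrow> Z ** \<pi> d = \<pi> d ** Z"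
    "matrix_power (X - diag_comb J \<pi> id) N = 0"
    "diag_comb J \<pi> id \<in> lie_algebra G"
proof -
  obtain J :: "complex set" and \<pi> N where \<pi>: "idempotent_system J \<pi>"
    and comm: "\<And>Z d. Z ** X = X ** Z \<Longrightarrow> d \<in> J \<Longrightarrow> Z ** \<pi> d = \<pi> d ** Z"
    and nil: "\<And>d. d \<in> J \<Longrightarrow> matrix_power (X - scale_tensor d (mat 1)) N ** \<pi> d = 0"
    by (rule spectral_projections[of X]) (rule that)
  define S where "S = diag_comb J \<pi> id"
  have XS: "X ** S = S ** X"
    using comm[OF refl] by (simp add: S_def diag_comb_def matrix_mul_sum_left matrix_mul_sum_right scale_tensor_mul_left scale_tensor_mul_right)
  \<comment> \<open>On the range of \<open>\<pi> d\<close> the matrix \<open>S\<close> acts as the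
    scalar \<open>d\<close>, so nilpotency can be read off from the projections and then summed over
    \<open>J\<close>.\<close>
  have "matrix_power (X - S) m ** \<pi> d = matrix_power (X - scale_tensor d (mat 1)) m ** \<pi> d" if d: "d \<in> J" for m d
  proof (induction m)
    case (Suc m)
    let ?Y = "X - scale_tensor d (mat 1)"
    have Y: "matrix_power ?Y m ** \<pi> d = \<pi> d ** matrix_power ?Y m" for m
    proof (induction m)
      case (Suc m)
      have "\<pi> d ** ?Y = ?Y ** \<pi> d"
        using comm[OF refl d] by (simp add: matrix_mul_diff_left matrix_mul_diff_right scale_tensor_mul_left scale_tensor_mul_right)
      then have "\<pi> d ** (?Y ** matrix_power ?Y m) = ?Y ** (\<pi> d ** matrix_power ?Y m)" by (simp only: matrix_mul_assoc)
      then show ?case by (simp only: matrix_power_Suc Suc[symmetric] matrix_mul_assoc)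
    qed simp
    have "matrix_power (X - S) (Suc m) ** \<pi> d = (X - S) ** (matrix_power ?Y m ** \<pi> d)"
      by (simp only: matrix_power_Suc matrix_mul_assoc[symmetric] Suc)
    also have "\<dots> = ((X - S) ** \<pi> d) ** matrix_power ?Y m" by (simp only: Y matrix_mul_assoc)
    also have "(X - S) ** \<pi> d = ?Y ** \<pi> d"
      by (simp add: S_def matrix_mul_diff_left diag_comb_idempotent[OF \<pi> d] scale_tensor_mul_left)
    also have "?Y ** \<pi> d ** matrix_power ?Y m = ?Y ** matrix_power ?Y m ** \<pi> d"
      by (simp only: matrix_mul_assoc[symmetric] Y)
    finally show ?case by (simp only: matrix_power_Suc)
  qed simp
  then have "matrix_power (X - S) N ** (\<Sum>d\<in>J. \<pi> d) = 0" using nil by (simp add: matrix_mul_sum_right)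
  then have nilp: "matrix_power (X - S) N = 0" using \<pi> by (simp add: idempotent_system_def)
  \<comment> \<open>The second coordinate drives the semisimple part, the first one the nilpotent
    part; on the diagonal this is the exponential of a multiple of \<open>X\<close>.\<close>
  define E where "E = (\<lambda>(b, c). diag_comb J \<pi> (\<lambda>d. exp (d * c)) ** (\<Sum>m<N. scale_tensor (b ^ m) (matrix_power (X - S) m /\<^sub>R fact m)))"
  have sS: "scale_tensor c S = diag_comb J \<pi> (\<lambda>d. d * c)" for c
    by (simp add: S_def scale_diag_comb mult.commute)
  have E: "E (b, c) = matrix_exp (scale_tensor c S) ** matrix_exp (scale_tensor b (X - S))" for b c
    unfolding E_def sS matrix_exp_diag_comb[OF \<pi>] matrix_exp_nilpotent[OF nilp] by simp
  have EX: "E (c, c) = matrix_exp (scale_tensor c X)" for c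
  proof -
    have "scale_tensor c S ** scale_tensor c (X - S) = scale_tensor c (X - S) ** scale_tensor c S"
      by (simp add: scale_tensor_mul_left scale_tensor_mul_right scale_tensor_diff matrix_mul_diff_left matrix_mul_diff_right XS)
    from matrix_exp_add[OF this] show ?thesis by (simp add: E scale_tensor_add[symmetric])
  qed
  let ?B = "{\<lambda>(b, c). b ^ m * exp (\<delta> * c) | m \<delta>. True} :: (complex \<times> complex \<Rightarrow> complex) set"
  have B1: "(\<lambda>z. b z * b' z) \<in> ?B" if bb': "b \<in> ?B" "b' \<in> ?B" for b b'
  proof -
    from bb' obtain m \<delta> m' \<delta>' where b: "b = (\<lambda>(b, c). b ^ m * exp (\<delta> * c))" "b' = (\<lambda>(b, c). b ^ m' * exp (\<delta>' * c))" by blast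
    have "(\<lambda>z. b z * b' z) = (\<lambda>(b, c). b ^ (m + m') * exp ((\<delta> + \<delta>') * c))"
      by (auto simp: b power_add distrib_right exp_add)
    then show ?thesis by blast
  qed
  have B2: "(\<lambda>_. 1) \<in> ?B" by (rule CollectI, rule exI[of _ 0], rule exI[of _ 0]) auto
  have EB: "monoid_span ?B (\<lambda>z. E z $ i $ j)" for i j
  proof -
    have e: "E z $ i $ j = (\<Sum>k\<in>UNIV. (\<Sum>d\<in>J. \<pi> d $ i $ k * (case z of (b, c) \<Rightarrow> b ^ 0 * exp (d * c))) *
        (\<Sum>m<N. (matrix_power (X - S) m $ k $ j /\<^sub>R fact m) * (case z of (b, c) \<Rightarrow> b ^ m * exp (0 * c))))" for z
      by (cases z) (simp add: E_def matrix_matrix_mult_def diag_comb_def mult.commute)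
    show ?thesis unfolding e
      by (intro monoid_span_sum monoid_span_mult[OF B1] monoid_span_base) blast+
  qed
  have "S \<in> lie_algebra G"
    unfolding lie_algebra_def
  proof (intro CollectI allI mem_linear_algebraic_groupI[OF G invertible_matrix_exp])
    fix c f assume f: "poly_fun f" and f0: "\<And>h. h \<in> G \<Longrightarrow> f h = 0"
    have "f (E (0, c)) = 0"
      by (rule exp_poly_separate[OF poly_fun_monoid_span[OF f B1 B2 EB]])
        (use f0 X EX in \<open>auto simp: lie_algebra_def\<close>)
    then show "f (matrix_exp (scale_tensor c S)) = 0" by (simp add: E)
  qed
  then show thesis using that \<pi> comm nilp by (simp add: S_def)
qed

section \<open>Saturated lattices\<close>

definition int_ip :: "int^'n \<Rightarrow> int^'n \<Rightarrow> int" where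
  "int_ip m r = (\<Sum>i\<in>UNIV. m $ i * r $ i)"

lemma int_ip_add_left: "int_ip (m + m') r = int_ip m r + int_ip m' r"
  by (simp add: int_ip_def distrib_right sum.distrib)
lemma int_ip_add_right: "int_ip m (r + r') = int_ip m r + int_ip m r'"
  by (simp add: int_ip_def distrib_left sum.distrib)
lemma int_ip_diff_right: "int_ip m (r - r') = int_ip m r - int_ip m r'"
  by (simp add: int_ip_def right_diff_distrib sum_subtractf)
lemma int_ip_scale_left: "int_ip (c *s m) r = c * int_ip m r"
  by (simp add: int_ip_def sum_distrib_left mult.assoc)
lemma int_ip_scale_right: "int_ip m (c *s r) = c * int_ip m r"
  by (simp add: int_ip_def sum_distrib_left mult.left_commute)
lemma int_ip_axis: "int_ip m (axis i 1) = m $ i"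
  by (simp add: int_ip_def axis_def if_distrib cong: if_cong)

text \<open>The least positive value \<open>c\<close> of the pairing with \<open>m\<close> is the
  greatest common divisor of its entries. Dividing \<open>m\<close> by it stays in the saturated
  lattice and makes the value 1 attained.\<close>

lemma primitive_pairing:
  fixes M :: "(int^'n::finite) set"
  assumes sat: "\<And>c m. c \<noteq> 0 \<Longrightarrow> c *s m \<in> M \<Longrightarrow> m \<in> M" and m: "m \<in> M" "m \<noteq> 0"
  obtains m1 k where "m1 \<in> M" "int_ip m1 k = 1"
proof -
  define P where "P c \<longleftrightarrow> c > 0 \<and> (\<exists>k. int_ip m k = int c)" for c :: nat
  obtain i where i: "m $ i \<noteq> 0" using m(2) by (auto simp: vec_eq_iff)
  have "P (nat \<bar>m $ i\<bar>)"
    using i int_ip_axis[of m i] int_ip_scale_right[of m "-1" "axis i 1"]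
    by (cases "m $ i > 0") (auto simp: P_def intro: exI[of _ "axis i 1"] exI[of _ "(-1) *s axis i 1"])
  then have "P (LEAST c. P c)" by (rule LeastI)
  define c where "c = (LEAST c. P c)"
  have least: "c \<le> c'" if "P c'" for c' unfolding c_def using that by (rule Least_le)
  from \<open>P (LEAST c. P c)\<close> obtain k where c: "c > 0" and k: "int_ip m k = int c"
    by (auto simp: P_def c_def)
  have dvd: "int c dvd m $ j" for j
  proof (rule ccontr)
    assume "\<not> int c dvd m $ j"
    then have r: "m $ j mod int c > 0" "m $ j mod int c < int c"
      using c by (auto simp: dvd_eq_mod_eq_0 pos_mod_bound) (metis pos_mod_sign less_le of_nat_0_less_iff)
    \<comment> \<open>A nonzero remainder of an entry modulo \<open>c\<close> would be a smaller
      positive value of the pairing.\<close>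
    have "int_ip m (axis j 1 - (m $ j div int c) *s k) = m $ j mod int c"
      by (simp add: int_ip_diff_right int_ip_scale_right int_ip_axis k minus_div_mult_eq_mod)
    then have "P (nat (m $ j mod int c))" using r unfolding P_def by auto
    from least[OF this] r show False by linarith
  qed
  define m1 where "m1 = (\<chi> j. m $ j div int c)"
  have m1: "int c *s m1 = m" using dvd by (simp add: m1_def vec_eq_iff)
  have "m1 \<in> M" using sat[of "int c" m1] c m1 m(1) by simp
  moreover have "int c * int_ip m1 k = int c" using k by (simp flip: m1 add: int_ip_scale_left)
  then have "int_ip m1 k = 1" using c by simp
  ultimately show thesis by (rule that)
qed

text \<open>A saturated sublattice is a direct summand.\<close>

lemma saturated_functional_extends:
  fixes M :: "(int^'n::finite) set" and f :: "int^'n \<Rightarrow> int"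
  assumes "0 \<in> M" "\<And>m m'. m \<in> M \<Longrightarrow> m' \<in> M \<Longrightarrow> m + m' \<in> M" "\<And>c m. m \<in> M \<Longrightarrow> c *s m \<in> M"
    and "\<And>c m. c \<noteq> 0 \<Longrightarrow> c *s m \<in> M \<Longrightarrow> m \<in> M"
    and "\<And>m m'. m \<in> M \<Longrightarrow> m' \<in> M \<Longrightarrow> f (m + m') = f m + f m'" "\<And>c m. m \<in> M \<Longrightarrow> f (c *s m) = c * f m"
  obtains r where "\<And>m. m \<in> M \<Longrightarrow> f m = int_ip m r"
  using assms
proof (induction "dim ((\<lambda>m. \<chi> i. real_of_int (m $ i)) ` M)" arbitrary: M thesis rule: less_induct)
  case less
  let ?R = "\<lambda>m :: int^'n. \<chi> i. real_of_int (m $ i)"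
  show ?case
  proof (cases "M \<subseteq> {0}")
    case True
    have "f 0 = 0" using less.prems(7)[of 0 0] less.prems(2) by simp
    then show ?thesis using True by (intro less.prems(1)[of 0]) (auto simp: int_ip_def)
  next
    case False
    then obtain m where "m \<in> M" "m \<noteq> 0" by blast
    with primitive_pairing[of M m] less.prems(5) obtain m1 k where m1: "m1 \<in> M" "int_ip m1 k = 1" by metis
    \<comment> \<open>The lattice is the direct sum of the multiples of \<open>m1\<close> and this
      kernel. It is again saturated, and its real span misses \<open>m1\<close>, so the dimension
      drops.\<close>
    define M' where "M' = {m \<in> M. int_ip m k = 0}"
    have "dim (?R ` M') < dim (?R ` M)"
    proof -
      have sub: "?R ` M' \<subseteq> {v. v \<bullet> ?R k = 0}"
        by (auto simp: M'_def int_ip_def inner_vec_def simp flip: of_int_mult of_int_sum)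
      have "?R m1 \<bullet> ?R k = 1"
        using m1(2) by (simp add: int_ip_def inner_vec_def flip: of_int_mult of_int_sum)
      then have "?R m1 \<notin> span (?R ` M')"
        using span_minimal[OF sub subspace_hyperplane2] by auto
      then have "dim (insert (?R m1) (?R ` M')) = dim (?R ` M') + 1" by (simp add: dim_insert)
      moreover have "insert (?R m1) (?R ` M') \<subseteq> ?R ` M" using m1 by (auto simp: M'_def)
      ultimately show ?thesis using dim_subset by (metis Suc_eq_plus1 Suc_le_lessD)
    qed
    then obtain r' where r': "\<And>m. m \<in> M' \<Longrightarrow> f m = int_ip m r'"
    proof (rule less.hyps[of M'])
      show "m \<in> M'" if "c \<noteq> 0" "c *s m \<in> M'" for c m
        using that less.prems(5)[of c m] by (auto simp: M'_def int_ip_scale_left)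
    qed (use less.prems in \<open>auto simp: M'_def int_ip_add_left int_ip_scale_left int_ip_def[of 0]\<close>)
    \<comment> \<open>Adding a multiple of \<open>k\<close> leaves the values on \<open>M'\<close>
      unchanged; the factor is chosen to correct the value at \<open>m1\<close>, whose pairing with
      \<open>k\<close> is 1.\<close>
    show ?thesis
    proof (rule less.prems(1)[of "r' + (f m1 - int_ip m1 r') *s k"])
      fix m assume m: "m \<in> M"
      have 1: "m + (- int_ip m k) *s m1 \<in> M'"
        using m m1 less.prems(3,4) by (auto simp: M'_def int_ip_add_left int_ip_scale_left)
      have "f (m + (- int_ip m k) *s m1) = f m - int_ip m k * f m1"
        using m m1 less.prems(4,6,7) by simp
      moreover have "f (m + (- int_ip m k) *s m1) = int_ip m r' - int_ip m k * int_ip m1 r'"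
        using r'[OF 1] by (simp add: int_ip_add_left int_ip_scale_left)
      moreover have "int_ip m (r' + (f m1 - int_ip m1 r') *s k) = int_ip m r' + (f m1 - int_ip m1 r') * int_ip m k"
        by (simp only: int_ip_add_right int_ip_scale_right)
      ultimately show "f m = int_ip m (r' + (f m1 - int_ip m1 r') *s k)"
        by (simp add: algebra_simps)
    qed
  qed
qed

section \<open>Simultaneous diagonalization\<close>

text \<open>The ranges of the idempotents span the whole space, so a basis can be chosen among their
  vectors. Each basis vector lies in one range and is an eigenvector of every combination.\<close>

lemma idempotent_system_diagonalizable:
  fixes \<epsilon> :: "'k \<Rightarrow> complex^'n^'n::finite"
  assumes \<epsilon>: "idempotent_system K \<epsilon>"
  obtains P :: "complex^'n^'n" where "invertible P" "\<And>x i j. i \<noteq> j \<Longrightarrow> (P ** diag_comb K \<epsilon> x ** matrix_inv P) $ i $ j = 0"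
proof -
  define E where "E = (\<Union>k\<in>K. range ((*v) (\<epsilon> k)))"
  obtain B where B: "B \<subseteq> E" "vec.independent B" "E \<subseteq> vec.span B"
    using vec.maximal_independent_subset[of E] by blast
  have "v \<in> vec.span B" for v
  proof -
    have "v = (\<Sum>k\<in>K. \<epsilon> k) *v v" using \<epsilon> by (simp add: idempotent_system_def)
    also have "\<dots> = (\<Sum>k\<in>K. \<epsilon> k *v v)"
      by (induction K rule: infinite_finite_induct) (simp_all add: matrix_vector_mult_add_rdistrib)
    also have "\<dots> \<in> vec.span B" using B(3) by (intro vec.span_sum) (auto simp: E_def)
    finally show ?thesis .
  qed
  then have span: "vec.span B = UNIV" by blast
  then have "card B = CARD('n)" using vec.basis_card_eq_dim[of B UNIV] B(2) by (simp add: vec.dim_UNIV card_cart_basis)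
  moreover have "finite B" using B(2) by (rule vec.finiteI_independent)
  ultimately obtain e :: "'n \<Rightarrow> complex^'n" where e: "bij_betw e UNIV B"
    using finite_same_card_bij[of "UNIV :: 'n set" B] by auto
  define Q where "Q = (\<chi> i j. e j $ i)"
  have col: "column j Q = e j" for j by (simp add: column_def Q_def vec_eq_iff)
  have "columns Q = B" using e by (auto simp: columns_def col bij_betw_def)
  then have Q: "invertible Q" using matrix_right_invertible_span_columns[of Q] span invertible_right_inverse by blast
  define P where "P = matrix_inv Q"
  have PQ: "P ** Q = mat 1" "Q ** P = mat 1" by (simp_all add: P_def matrix_inv_mult[OF Q])
  have Pinv: "matrix_inv P = Q" "invertible P" using matrix_inv_unique[OF PQ] PQ invertible_def by blast+
  show thesis
  proof (rule that[of P])
    show "invertible P" by (rule Pinv(2))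
    fix x and i j :: 'n assume "i \<noteq> j"
    have "e j \<in> E" using e B(1) by (auto simp: bij_betw_def)
    then obtain k v where k: "k \<in> K" "e j = \<epsilon> k *v v" by (auto simp: E_def)
    have "diag_comb K \<epsilon> x *v e j = x k *s e j"
    proof -
      have "diag_comb K \<epsilon> x *v e j = (diag_comb K \<epsilon> x ** \<epsilon> k) *v v" by (simp add: k matrix_vector_mul_assoc)
      also have "\<dots> = x k *s (\<epsilon> k *v v)"
        by (simp add: diag_comb_idempotent[OF \<epsilon> k(1)]) (simp add: vec_eq_iff matrix_vector_mult_def sum_distrib_left mult.assoc)
      finally show ?thesis by (simp add: k)
    qed
    then have "(diag_comb K \<epsilon> x ** Q) $ r $ j = x k * Q $ r $ j" for r
      by (simp add: vec_eq_iff matrix_vector_mult_def matrix_matrix_mult_def Q_def)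
    then have "(P ** (diag_comb K \<epsilon> x ** Q)) $ i $ j = x k * (P ** Q) $ i $ j"
      by (simp add: matrix_matrix_mult_def[of P] sum_distrib_left mult.left_commute)
    also have "\<dots> = 0" using \<open>i \<noteq> j\<close> by (simp add: PQ mat_def)
    finally show "(P ** diag_comb K \<epsilon> x ** matrix_inv P) $ i $ j = 0" by (simp add: Pinv matrix_mul_assoc)
  qed
qed


section \<open>The torus generated by a connected group of diagonal matrices\<close>

text \<open>A form of Dedekind's independence of characters.\<close>

lemma characters_relation:
  fixes ch :: "'i \<Rightarrow> 'z \<Rightarrow> complex"
  assumes "finite I" and mult: "\<And>x y. x \<in> X \<Longrightarrow> y \<in> X \<Longrightarrow> \<exists>z\<in>X. \<forall>i. ch i z = ch i x * ch i y"
    and one: "e \<in> X" "\<And>i. ch i e = 1"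
    and "\<And>x. x \<in> X \<Longrightarrow> (\<Sum>i\<in>I. a i * ch i x) = 0"
    and v: "\<And>i j. (\<And>x. x \<in> X \<Longrightarrow> ch i x = ch j x) \<Longrightarrow> v i = v j"
  shows "(\<Sum>i\<in>I. a i * v i) = 0"
  using assms(1,5)
proof (induction "card I" arbitrary: I a rule: less_induct)
  case less
  show ?case
  proof (cases "\<forall>i\<in>I. \<forall>j\<in>I. \<forall>x\<in>X. ch i x = ch j x")
    case True
    show ?thesis
    proof (cases "I = {}")
      case False
      then obtain k where k: "k \<in> I" by blast
      \<comment> \<open>All characters agree on \<open>X\<close>, so \<open>v\<close> is constant on
        \<open>I\<close>, and the relation at the unit says that the coefficients sum to 0.\<close>
      have "v i = v k" if "i \<in> I" for i using True that k by (intro v) blast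
      then have "(\<Sum>i\<in>I. a i * v i) = (\<Sum>i\<in>I. a i * ch i e) * v k"
        unfolding one sum_distrib_right by (intro sum.cong) auto
      then show ?thesis using less.prems(2)[OF one(1)] by simp
    qed simp
  next
    case False
    then obtain k l y where kl: "k \<in> I" "l \<in> I" "y \<in> X" "ch k y \<noteq> ch l y" by blast
    \<comment> \<open>Translating the relation by \<open>y\<close> and subtracting
      \<open>ch m y\<close> times the original one removes the index \<open>m\<close>, so the
      induction hypothesis applies.\<close>
    have 1: "(\<Sum>i\<in>I. a i * (ch i y - ch m y) * v i) = 0" if m: "m \<in> I" for m
    proof -
      have "(\<Sum>i\<in>I - {m}. a i * (ch i y - ch m y) * v i) = 0"
      proof (rule less.hyps)
        show "card (I - {m}) < card I" using m less.prems(1) by (meson card_Diff1_less)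
        fix x assume x: "x \<in> X"
        obtain z where z: "z \<in> X" "\<And>i. ch i z = ch i x * ch i y" using mult[OF x kl(3)] by blast
        have "(\<Sum>i\<in>I. a i * (ch i y - ch m y) * ch i x) = (\<Sum>i\<in>I. a i * ch i z) - ch m y * (\<Sum>i\<in>I. a i * ch i x)"
          by (simp add: z(2) sum_distrib_left sum_subtractf[symmetric] algebra_simps)
        also have "\<dots> = 0" using less.prems(2) x z(1) by simp
        finally show "(\<Sum>i\<in>I - {m}. a i * (ch i y - ch m y) * ch i x) = 0"
          using m less.prems(1) by (simp add: sum.remove[of I m])
      qed (use less.prems in simp)
      then show ?thesis using m less.prems(1) by (simp add: sum.remove[of I m])
    qed
    \<comment> \<open>Eliminating \<open>k\<close> and eliminating \<open>l\<close> give two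
      relations whose difference is a nonzero multiple of the wanted one.\<close>
    have "(ch l y - ch k y) * (\<Sum>i\<in>I. a i * v i) =
        (\<Sum>i\<in>I. a i * (ch i y - ch k y) * v i) - (\<Sum>i\<in>I. a i * (ch i y - ch l y) * v i)"
      by (simp add: sum_distrib_left sum_subtractf[symmetric] algebra_simps)
    then show ?thesis using 1[OF kl(1)] 1[OF kl(2)] kl(4) by simp
  qed
qed

section \<open>Diagonal matrices and their characters\<close>

definition diag_matrix :: "'a::zero^'n \<Rightarrow> 'a^'n^'n" where
  "diag_matrix x = (\<chi> i j. if i = j then x $ i else 0)"

lemma diag_matrix_mult_left: "(diag_matrix x ** B) $ i $ j = x $ i * B $ i $ j"
  for x :: "'a::semiring_1^'n"
proof -
  have "(\<Sum>k\<in>UNIV. (if i = k then x $ i else 0) * B $ k $ j) = (\<Sum>k\<in>UNIV. if i = k then x $ i * B $ i $ j else 0)"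
    by (intro sum.cong) auto
  then show ?thesis by (simp add: diag_matrix_def matrix_matrix_mult_def)
qed

lemma diag_matrix_mult_right: "(B ** diag_matrix x) $ i $ j = B $ i $ j * x $ j"
  for x :: "'a::semiring_1^'n"
proof -
  have "(\<Sum>k\<in>UNIV. B $ i $ k * (if k = j then x $ k else 0)) = (\<Sum>k\<in>UNIV. if k = j then B $ i $ j * x $ j else 0)"
    by (intro sum.cong) auto
  then show ?thesis by (simp add: diag_matrix_def matrix_matrix_mult_def)
qed

lemma diag_matrix_mult: "diag_matrix x ** diag_matrix y = diag_matrix (\<chi> i. x $ i * y $ i)"
  for x y :: "'a::semiring_1^'n"
  by (simp add: vec_eq_iff diag_matrix_mult_left) (simp add: diag_matrix_def)

lemma diag_matrix_1: "diag_matrix (\<chi> i. 1) = mat 1"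
  by (simp add: vec_eq_iff diag_matrix_def mat_def)

lemma idempotent_system_unit_matrices: "idempotent_system UNIV (\<lambda>k. diag_matrix (axis k 1) :: complex^'n^'n::finite)"
  unfolding idempotent_system_def
proof (intro conjI ballI)
  show "diag_matrix (axis j 1) ** diag_matrix (axis k 1) = (if j = k then diag_matrix (axis k 1) else (0 :: complex^'n^'n))" for j k
    by (simp add: diag_matrix_mult) (simp add: vec_eq_iff diag_matrix_def axis_def)
  show "(\<Sum>k\<in>UNIV. diag_matrix (axis k 1)) = (mat 1 :: complex^'n^'n)"
    by (simp add: vec_eq_iff diag_matrix_def axis_def mat_def)
qed simp

lemma diag_matrix_eq_diag_comb: "diag_matrix x = diag_comb UNIV (\<lambda>k. diag_matrix (axis k 1)) (\<lambda>i. x $ i)"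
  for x :: "complex^'n::finite"
proof -
  have "(\<Sum>k\<in>UNIV. x $ k * (if i = k then 1 else 0)) = x $ i" for i
  proof -
    have "(\<Sum>k\<in>UNIV. x $ k * (if i = k then 1 else 0)) = (\<Sum>k\<in>UNIV. if k = i then x $ i else 0)"
      by (intro sum.cong) auto
    then show ?thesis by simp
  qed
  then show ?thesis by (simp add: vec_eq_iff diag_comb_def diag_matrix_def axis_def)
qed

lemma matrix_exp_diag_matrix: "matrix_exp (diag_matrix x) = diag_matrix (\<chi> i. exp (x $ i))"
  for x :: "complex^'n::finite"
  using matrix_exp_diag_comb[OF idempotent_system_unit_matrices, of "\<lambda>i. x $ i"]
    diag_matrix_eq_diag_comb[of x] diag_matrix_eq_diag_comb[of "\<chi> i. exp (x $ i)"]
  by simp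

definition monomial_char :: "int^'n \<Rightarrow> complex^'n \<Rightarrow> complex" where
  "monomial_char m x = (\<Prod>i\<in>UNIV. x $ i powi m $ i)"

lemma monomial_char_add: "(\<And>i. x $ i \<noteq> 0) \<Longrightarrow> monomial_char (m + m') x = monomial_char m x * monomial_char m' x"
  by (simp add: monomial_char_def power_int_add prod.distrib)

lemma monomial_char_mult: "monomial_char m (\<chi> i. x $ i * y $ i) = monomial_char m x * monomial_char m y"
  by (simp add: monomial_char_def power_int_mult_distrib prod.distrib)

lemma monomial_char_scale: "monomial_char (c *s m) x = monomial_char m x powi c"
proof -
  have "(\<Prod>i\<in>I. (x $ i powi m $ i) powi c) = (\<Prod>i\<in>I. x $ i powi m $ i) powi c" for I
    by (induction I rule: infinite_finite_induct) (simp_all add: power_int_mult_distrib)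
  then show ?thesis by (simp add: monomial_char_def mult.commute[of c] power_int_mult)
qed

lemma monomial_char_exp: "monomial_char m (\<chi> i. exp (y $ i)) = exp (\<Sum>i\<in>UNIV. of_int (m $ i) * y $ i)"
  by (simp add: monomial_char_def exp_sum exp_power_int)


text \<open>In coordinates diagonalizing \<open>A\<close>, the group \<open>R\<close> is the common
  kernel of all characters trivial on \<open>A\<close>. It lies in \<open>H\<close> since a relation
  between monomials valid on \<open>A\<close> persists wherever these characters are trivial. It is
  connected, and each of its elements is an exponential, because connectedness of \<open>A\<close>
  makes the lattice of characters saturated.\<close>

lemma torus_hull:
  fixes H A :: "(complex^'n^'n::finite) set" and P :: "complex^'n^'n"
  assumes H: "linear_algebraic_group H" and P: "invertible P" and AH: "A \<subseteq> H" and conn: "connected A"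
    and A1: "mat 1 \<in> A" and Am: "\<And>a b. a \<in> A \<Longrightarrow> b \<in> A \<Longrightarrow> a ** b \<in> A"
    and diag: "\<And>a i j. a \<in> A \<Longrightarrow> i \<noteq> j \<Longrightarrow> (P ** a ** matrix_inv P) $ i $ j = 0"
  obtains R where "torus R" "A \<subseteq> R" "R \<subseteq> H"
    "\<And>g. g \<in> R \<Longrightarrow> \<exists>Y\<in>lie_algebra R. g = matrix_exp Y \<and> (\<forall>i j. i \<noteq> j \<longrightarrow> (P ** Y ** matrix_inv P) $ i $ j = 0)"
proof -
  define Q where "Q = matrix_inv P"
  have PQ: "P ** Q = mat 1" "Q ** P = mat 1" by (simp_all add: Q_def matrix_inv_mult[OF P])
  define co where "co g = (\<chi> i. (P ** g ** Q) $ i $ i)" for g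
  define D where "D x = Q ** diag_matrix x ** P" for x
  have PDQ: "P ** D x ** Q = diag_matrix x" for x
  proof -
    have "P ** D x ** Q = (P ** Q) ** diag_matrix x ** (P ** Q)" by (simp only: D_def matrix_mul_assoc)
    then show ?thesis by (simp add: PQ)
  qed
  have coD: "co (D x) = x" for x by (simp add: co_def PDQ) (simp add: diag_matrix_def vec_eq_iff)
  have Dco: "g = D (co g)" if "\<And>i j. i \<noteq> j \<Longrightarrow> (P ** g ** Q) $ i $ j = 0" for g
  proof -
    have "diag_matrix (co g) = P ** g ** Q" using that by (auto simp: vec_eq_iff diag_matrix_def co_def)
    then have "D (co g) = (Q ** P) ** g ** (Q ** P)" by (simp add: D_def matrix_mul_assoc)
    then show ?thesis by (simp add: PQ)
  qed
  have Dmult: "D x ** D y = D (\<chi> i. x $ i * y $ i)" for x y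
  proof -
    have "D x ** D y = Q ** diag_matrix x ** (P ** Q) ** diag_matrix y ** P" by (simp only: D_def matrix_mul_assoc)
    also have "\<dots> = Q ** (diag_matrix x ** diag_matrix y) ** P" by (simp add: PQ matrix_mul_assoc)
    finally show ?thesis by (simp add: diag_matrix_mult D_def)
  qed
  have D1: "D (\<chi> i. 1) = mat 1" by (simp add: D_def diag_matrix_1 PQ)
  have co_nz: "co g $ i \<noteq> 0" if "invertible g" "\<And>i j. i \<noteq> j \<Longrightarrow> (P ** g ** Q) $ i $ j = 0" for g i
  proof -
    obtain g' where g': "g ** g' = mat 1" using \<open>invertible g\<close> by (auto simp: invertible_def)
    have "diag_matrix (co g) = P ** g ** Q" using that(2) by (auto simp: vec_eq_iff diag_matrix_def co_def)
    then have "diag_matrix (co g) ** (P ** g' ** Q) = P ** g ** (Q ** P) ** g' ** Q" by (simp add: matrix_mul_assoc)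
    also have "\<dots> = P ** (g ** g') ** Q" by (simp add: PQ matrix_mul_assoc)
    finally have e: "diag_matrix (co g) ** (P ** g' ** Q) = mat 1" by (simp add: g' PQ)
    from diag_matrix_mult_left[of "co g" "P ** g' ** Q" i i]
    have "co g $ i * (P ** g' ** Q) $ i $ i = 1" by (simp add: e) (simp add: mat_def)
    then show ?thesis by auto
  qed
  \<comment> \<open>\<open>X\<close> holds the diagonal coordinates of the elements of
    \<open>A\<close>, \<open>M\<close> the characters trivial on them, and \<open>RX\<close> the
    coordinates of the hull.\<close>
  define X where "X = {x. (\<forall>i. x $ i \<noteq> 0) \<and> D x \<in> A}"
  define M where "M = {m. \<forall>x\<in>X. monomial_char m x = 1}"
  define RX where "RX = {x. (\<forall>i. x $ i \<noteq> 0) \<and> (\<forall>m\<in>M. monomial_char m x = 1)}"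
  define R where "R = D ` RX"
  have coA: "co a \<in> X" "a = D (co a)" if "a \<in> A" for a
  proof -
    have d: "(P ** a ** Q) $ i $ j = 0" if "i \<noteq> j" for i j using diag[OF \<open>a \<in> A\<close> that] by (simp add: Q_def)
    show "a = D (co a)" by (rule Dco[OF d])
    have "invertible a" using that AH linear_algebraic_groupD(4)[OF H] by blast
    then show "co a \<in> X" using co_nz[of a] d \<open>a = D (co a)\<close> that by (simp add: X_def)
  qed
  have X1: "(\<chi> i. 1) \<in> X" using A1 by (simp add: X_def D1)
  have Xm: "(\<chi> i. x $ i * y $ i) \<in> X" if "x \<in> X" "y \<in> X" for x y
    using that Am[of "D x" "D y"] by (simp add: X_def Dmult)
  have AR: "A \<subseteq> R" using coA by (force simp: R_def RX_def M_def X_def)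
  have M0: "0 \<in> M" by (simp add: M_def monomial_char_def)
  have Madd: "m + m' \<in> M" if "m \<in> M" "m' \<in> M" for m m' using that by (simp add: M_def X_def monomial_char_add)
  have Mscale: "c *s m \<in> M" if "m \<in> M" for m c using that by (simp add: M_def monomial_char_scale)
  \<comment> \<open>If a nonzero multiple of a character is trivial on \<open>A\<close>, its values
    there are roots of unity of a fixed order. A continuous function with finitely many values on a
    connected set is constant, and its value at the identity is 1.\<close>
  have Msat: "m \<in> M" if c: "c \<noteq> 0" "c *s m \<in> M" for c m
  proof -
    let ?h = "\<lambda>g. monomial_char m (co g)"
    have "?h constant_on A"
    proof (rule continuous_finite_range_constant[OF conn])
      show "continuous_on A ?h"
      proof -
        have "continuous_on A (\<lambda>g. co g $ i)" for i
          unfolding co_def by simp (intro poly_fun_continuous poly_fun_matrix_mul)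
        moreover have "co g $ i \<noteq> 0" if "g \<in> A" for g i using coA(1)[OF that] by (simp add: X_def)
        ultimately show ?thesis unfolding monomial_char_def by (intro continuous_on_prod continuous_on_power_int) auto
      qed
      have "?h a ^ nat \<bar>c\<bar> = 1" if "a \<in> A" for a
      proof -
        have 1: "?h a powi c = 1" using coA(1)[OF that] c(2) by (simp add: M_def monomial_char_scale)
        then show ?thesis by (cases "c \<ge> 0") (auto simp: power_int_def power_inverse)
      qed
      then have "?h ` A \<subseteq> {z. z ^ nat \<bar>c\<bar> = 1}" by blast
      moreover have "finite {z :: complex. z ^ nat \<bar>c\<bar> = 1}" using c(1) by (intro finite_nth_roots) simp
      ultimately show "finite (?h ` A)" by (rule finite_subset)
    qed
    moreover have "?h (mat 1) = 1"
      using coD[of "\<chi> i. 1"] by (simp add: D1 monomial_char_def)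
    ultimately have h: "?h a = 1" if "a \<in> A" for a
      using A1 that unfolding constant_on_def by metis
    show ?thesis unfolding M_def
    proof (intro CollectI ballI)
      fix x assume "x \<in> X"
      then show "monomial_char m x = 1" using h[of "D x"] by (simp add: X_def coD)
    qed
  qed
  have RX1: "(\<chi> i. 1) \<in> RX" by (simp add: RX_def monomial_char_def)
  have R1: "mat 1 \<in> R" unfolding R_def using RX1 D1 by force
  have Rm: "g ** h \<in> R" if gh: "g \<in> R" "h \<in> R" for g h
  proof -
    obtain x y where "x \<in> RX" "y \<in> RX" "g = D x" "h = D y" using gh by (auto simp: R_def)
    then show ?thesis by (auto simp: R_def RX_def Dmult monomial_char_mult intro!: imageI)
  qed
  have Rinv: "invertible g \<and> matrix_inv g \<in> R" if g: "g \<in> R" for g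
  proof -
    obtain x where x: "x \<in> RX" "g = D x" using g by (auto simp: R_def)
    let ?y = "\<chi> i. inverse (x $ i)"
    have xn: "x $ i \<noteq> 0" for i using x by (simp add: RX_def)
    have "monomial_char m ?y = 1" if "m \<in> M" for m
    proof -
      have "monomial_char m x * monomial_char m ?y = monomial_char m (\<chi> i. x $ i * ?y $ i)"
        by (rule monomial_char_mult[symmetric])
      also have "\<dots> = 1" using xn by (simp add: monomial_char_def)
      finally show ?thesis using x(1) that by (simp add: RX_def)
    qed
    then have y: "?y \<in> RX" using xn by (simp add: RX_def)
    have "D x ** D ?y = mat 1" "D ?y ** D x = mat 1" using xn by (simp_all add: Dmult D1)
    then have "matrix_inv g = D ?y" "invertible g" unfolding x(2)
      using matrix_inv_unique invertible_def by blast+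
    then show ?thesis using y by (simp add: R_def)
  qed
  have "R \<subseteq> H"
  proof
    fix g assume g: "g \<in> R"
    then obtain x where x: "x \<in> RX" "g = D x" by (auto simp: R_def)
    show "g \<in> H"
    proof (rule mem_linear_algebraic_groupI[OF H])
      fix f assume f: "poly_fun f" and f0: "\<And>h. h \<in> H \<Longrightarrow> f h = 0"
      \<comment> \<open>A polynomial in the matrix entries becomes a combination of monomials in the
        diagonal coordinates; these are the characters fed into
        \<open>characters_relation\<close>.\<close>
      define B where "B = {\<lambda>y :: complex^'n. \<Prod>k\<in>UNIV. y $ k ^ \<kappa> k | \<kappa>. True}"
      have B1: "(\<lambda>z. b z * b' z) \<in> B" if bb': "b \<in> B" "b' \<in> B" for b b'
      proof -
        from bb' obtain \<kappa> \<kappa>' where b: "b = (\<lambda>y. \<Prod>k\<in>UNIV. y $ k ^ \<kappa> k)" "b' = (\<lambda>y. \<Prod>k\<in>UNIV. y $ k ^ \<kappa>' k)"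
          unfolding B_def by blast
        have "(\<lambda>z. b z * b' z) = (\<lambda>y. \<Prod>k\<in>UNIV. y $ k ^ (\<kappa> k + \<kappa>' k))"
          by (simp add: b power_add prod.distrib)
        then show ?thesis unfolding B_def by (intro CollectI exI[of _ "\<lambda>k. \<kappa> k + \<kappa>' k"] conjI TrueI)
      qed
      have B2: "(\<lambda>_. 1) \<in> B" unfolding B_def by (rule CollectI, rule exI[of _ "\<lambda>_. 0"]) simp
      have coord: "(\<lambda>y. y $ k) \<in> B" for k
      proof -
        have "(\<Prod>j\<in>UNIV. y $ j ^ (if j = k then 1 else 0)) = y $ k" for y :: "complex^'n"
        proof -
          have "(\<Prod>j\<in>UNIV. y $ j ^ (if j = k then 1 else 0)) = (\<Prod>j\<in>UNIV. if j = k then y $ k else 1)"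
            by (intro prod.cong) auto
          then show ?thesis by simp
        qed
        then show ?thesis unfolding B_def by (intro CollectI exI[of _ "\<lambda>j. if j = k then 1 else 0"]) simp
      qed
      have E: "monoid_span B (\<lambda>y. D y $ i $ j)" for i j
      proof -
        have "D y $ i $ j = (\<Sum>k\<in>UNIV. (Q $ i $ k * P $ k $ j) * y $ k)" for y
        proof -
          show ?thesis unfolding D_def matrix_matrix_mult_def[of "Q ** diag_matrix y"] by (simp add: diag_matrix_mult_right mult_ac)
        qed
        then show ?thesis by (simp only:) (intro monoid_span_sum monoid_span_base coord)
      qed
      from monoid_span_explicit[OF poly_fun_monoid_span[OF f B1 B2 E]] obtain n :: nat and a b where
        b: "\<forall>i<n. b i \<in> B" and fb: "(\<lambda>y. f (D y)) = (\<lambda>y. \<Sum>i<n. a i * b i y)" by blast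
      then have "\<forall>i. \<exists>\<kappa>. i < n \<longrightarrow> b i = (\<lambda>y. \<Prod>k\<in>UNIV. y $ k ^ \<kappa> k)" unfolding B_def by blast
      then obtain \<kappa> where \<kappa>: "\<And>i. i < n \<Longrightarrow> b i = (\<lambda>y. \<Prod>k\<in>UNIV. y $ k ^ \<kappa> i k)" by metis
      define ch where "ch i y = (\<Prod>k\<in>UNIV. y $ k ^ \<kappa> i k)" for i and y :: "complex^'n"
      have fD: "f (D y) = (\<Sum>i<n. a i * ch i y)" for y
        using fun_cong[OF fb, of y] \<kappa> by (simp add: ch_def)
      have "(\<Sum>i<n. a i * ch i x) = 0"
      proof (rule characters_relation[where ch = ch and X = X and e = "\<chi> i. 1"])
        show "\<exists>z\<in>X. \<forall>i. ch i z = ch i x * ch i y" if "x \<in> X" "y \<in> X" for x y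
          by (rule bexI[OF _ Xm[OF that]]) (simp add: ch_def power_mult_distrib prod.distrib)
        show "(\<Sum>i<n. a i * ch i y) = 0" if "y \<in> X" for y
          using that AH f0 by (auto simp: fD[symmetric] X_def)
        fix i j assume eq: "\<And>y. y \<in> X \<Longrightarrow> ch i y = ch j y"
        \<comment> \<open>Two monomials that agree on \<open>X\<close> differ by a character in
          \<open>M\<close>, so they also agree at every point of \<open>RX\<close>.\<close>
        define m where "m = (\<chi> k. int (\<kappa> i k) - int (\<kappa> j k))"
        have m: "monomial_char m y * ch j y = ch i y" if "\<And>k. y $ k \<noteq> 0" for y
          using that by (simp add: monomial_char_def ch_def m_def prod.distrib[symmetric] power_int_diff)
        have nz: "ch j y \<noteq> 0" if "\<And>k. y $ k \<noteq> 0" for y using that by (simp add: ch_def)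
        have "m \<in> M" unfolding M_def
        proof (intro CollectI ballI)
          fix y assume y: "y \<in> X"
          then have "monomial_char m y * ch j y = 1 * ch j y" using m[of y] eq[OF y] by (simp add: X_def)
          then show "monomial_char m y = 1" using nz[of y] y by (simp add: X_def)
        qed
        then show "ch i x = ch j x" using m[of x] x(1) by (simp add: RX_def)
      qed (use X1 in \<open>simp_all add: ch_def\<close>)
      then show "f g = 0" by (simp add: x(2) fD)
    qed (use Rinv[OF g] in simp)
  qed
  have "zariski_closed_GL R"
    unfolding zariski_closed_GL_def
  proof (intro exI[of _ "{p. \<forall>r\<in>R. eval_poly p r = 0}"] equalityI subsetI)
    fix g :: "complex^'n^'n" assume "g \<in> {g. invertible g \<and> (\<forall>p\<in>{p. \<forall>r\<in>R. eval_poly p r = 0}. eval_poly p g = 0)}"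
    then have ig: "invertible g" and g: "\<And>p. (\<forall>r\<in>R. eval_poly p r = 0) \<Longrightarrow> eval_poly p g = 0" by auto
    have gf: "f g = 0" if pf: "poly_fun f" "\<And>r. r \<in> R \<Longrightarrow> f r = 0" for f
    proof -
      obtain p where "f = eval_poly p" using pf(1) by (auto simp: poly_fun_def elim: poly_pair_eval)
      then show ?thesis using g pf(2) by blast
    qed
    have d: "(P ** g ** Q) $ i $ j = 0" if "i \<noteq> j" for i j
      by (rule gf[OF poly_fun_matrix_mul]) (use that in \<open>auto simp: R_def PDQ diag_matrix_def\<close>)
    have nz: "co g $ i \<noteq> 0" for i using co_nz[OF ig d] by blast
    \<comment> \<open>Negative exponents are moved to the other side, turning the equation of a
      character into a polynomial one.\<close>
    have split: "monomial_char m x * (\<Prod>i\<in>UNIV. x $ i ^ nat (- m $ i)) = (\<Prod>i\<in>UNIV. x $ i ^ nat (m $ i))"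
      if "\<And>i. x $ i \<noteq> 0" for m x
      unfolding monomial_char_def prod.distrib[symmetric]
      by (intro prod.cong) (use that in \<open>auto simp: power_int_def power_mult_distrib[symmetric]\<close>)
    have "monomial_char m (co g) = 1" if m: "m \<in> M" for m
    proof -
      let ?f = "\<lambda>g. (\<Prod>i\<in>UNIV. co g $ i ^ nat (m $ i)) - (\<Prod>i\<in>UNIV. co g $ i ^ nat (- m $ i))"
      have "?f g = 0"
      proof (rule gf)
        show "poly_fun ?f" unfolding co_def
          by simp (intro poly_fun_diff poly_fun_prod poly_fun_power poly_fun_matrix_mul)
        fix r assume "r \<in> R"
        then obtain x where x: "x \<in> RX" "r = D x" by (auto simp: R_def)
        show "?f r = 0" using split[of x m] x(1) m by (simp add: x(2) coD RX_def)
      qed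
      then have "monomial_char m (co g) * (\<Prod>i\<in>UNIV. co g $ i ^ nat (- m $ i)) = 1 * (\<Prod>i\<in>UNIV. co g $ i ^ nat (- m $ i))"
        using split[of "co g" m] nz by simp
      moreover have "(\<Prod>i\<in>UNIV. co g $ i ^ nat (- m $ i)) \<noteq> 0" using nz by simp
      ultimately show ?thesis by (metis mult_right_cancel)
    qed
    then show "g \<in> R" using Dco[OF d] nz by (auto simp: R_def RX_def)
  qed (use Rinv in auto)
  then have lag: "linear_algebraic_group R"
    unfolding linear_algebraic_group_def using R1 Rm Rinv by blast
  have one_param: "\<exists>y. g = D (\<chi> i. exp (y i)) \<and> (\<forall>c. D (\<chi> i. exp (c * y i)) \<in> R)" if g: "g \<in> R" for g
  proof -
    obtain x where x: "x \<in> RX" "g = D x" using g by (auto simp: R_def)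
    \<comment> \<open>On logarithms a character in \<open>M\<close> takes values in 2 pi i times the
      integers, not necessarily 0, so the line through \<open>y\<close> may leave the group. The
      integer \<open>k m\<close> measures this defect and depends additively on
      \<open>m\<close>.\<close>
    define y where "y i = Ln (x $ i)" for i
    have ey: "exp (y i) = x $ i" for i using x(1) by (simp add: y_def RX_def)
    define s where "s m = (\<Sum>i\<in>UNIV. of_int (m $ i) * y i)" for m :: "int^'n"
    have "\<exists>k::int. s m = 2 * of_int k * of_real pi * \<i>" if "m \<in> M" for m
    proof -
      have "exp (s m) = monomial_char m (\<chi> i. exp (y i))" using monomial_char_exp[of m "\<chi> i. y i"] by (simp add: s_def)
      also have "\<dots> = 1" using x(1) that by (simp add: ey RX_def)
      finally obtain k :: int where "Re (s m) = 0" "Im (s m) = of_int (2 * k) * pi" by (auto simp: exp_eq_1)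
      then show ?thesis by (intro exI[of _ k]) (simp add: complex_eq_iff)
    qed
    then obtain k :: "int^'n \<Rightarrow> int" where k: "\<And>m. m \<in> M \<Longrightarrow> s m = 2 * of_int (k m) * of_real pi * \<i>" by metis
    have kinj: "a = b" if "2 * of_int a * of_real pi * \<i> = 2 * of_int b * of_real pi * \<i>" for a b :: int
      using that by simp
    have kadd: "k (m + m') = k m + k m'" if "m \<in> M" "m' \<in> M" for m m'
      by (rule kinj) (use k[OF that(1)] k[OF that(2)] k[OF Madd[OF that]] in \<open>simp add: s_def distrib_right sum.distrib algebra_simps\<close>)
    have kscale: "k (c *s m) = c * k m" if "m \<in> M" for c m
      by (rule kinj) (use k[OF that] k[OF Mscale[OF that, of c]] in \<open>simp add: s_def sum_distrib_left[symmetric] mult.assoc\<close>)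
    \<comment> \<open>Saturation lets the defect extend to an integral functional on the full
      lattice; subtracting 2 pi i times its vector changes the logarithms but not their exponentials
      and makes every defect 0.\<close>
    obtain r where r: "\<And>m. m \<in> M \<Longrightarrow> k m = int_ip m r"
    proof (rule saturated_functional_extends[of M k])
      show "m \<in> M" if "c \<noteq> 0" "c *s m \<in> M" for c m by (rule Msat[OF that])
    qed (use M0 Madd Mscale kadd kscale that in auto)
    define y' where "y' i = y i - 2 * of_int (r $ i) * of_real pi * \<i>" for i
    have ey': "exp (y' i) = x $ i" for i
    proof -
      have "exp (2 * of_int (r $ i) * of_real pi * \<i>) = 1" by (simp add: exp_eq_1)
      then show ?thesis by (simp add: y'_def exp_diff ey)
    qed
    have y'0: "(\<Sum>i\<in>UNIV. of_int (m $ i) * y' i) = 0" if "m \<in> M" for m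
    proof -
      have "(\<Sum>i\<in>UNIV. of_int (m $ i) * y' i) = s m - 2 * of_int (int_ip m r) * of_real pi * \<i>"
        by (simp add: y'_def s_def int_ip_def right_diff_distrib sum_subtractf sum_distrib_left sum_distrib_right mult_ac)
      then show ?thesis using k[OF that] r[OF that] by simp
    qed
    have "D (\<chi> i. exp (c * y' i)) \<in> R" for c
    proof -
      have "monomial_char m (\<chi> i. exp (c * y' i)) = 1" if "m \<in> M" for m
      proof -
        have "monomial_char m (\<chi> i. exp (c * y' i)) = exp (c * (\<Sum>i\<in>UNIV. of_int (m $ i) * y' i))"
          using monomial_char_exp[of m "\<chi> i. c * y' i"] by (simp add: sum_distrib_left mult_ac)
        then show ?thesis by (simp add: y'0[OF that])
      qed
      then show ?thesis by (auto simp: R_def RX_def)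
    qed
    then show ?thesis by (intro exI[of _ y']) (simp add: ey' x(2))
  qed
  have "connected R"
    unfolding connected_iff_connected_component
  proof -
    have "connected_component R (mat 1) g" if g: "g \<in> R" for g
    proof -
      obtain y where y: "g = D (\<chi> i. exp (y i))" "\<And>c. D (\<chi> i. exp (c * y i)) \<in> R" using one_param[OF g] by blast
      define \<gamma> where "\<gamma> t = D (\<chi> i. exp (complex_of_real t * y i))" for t
      have "continuous_on UNIV \<gamma>"
      proof -
        have "continuous_on UNIV (\<lambda>t. diag_matrix (\<chi> i. exp (complex_of_real t * y i)))"
          unfolding diag_matrix_def continuous_on_vec_lambda
        proof (intro continuous_on_vec_lambda)
          fix i j
          show "continuous_on UNIV (\<lambda>t. if i = j then (\<chi> i. exp (complex_of_real t * y i)) $ i else 0)"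
            by (cases "i = j") (auto intro!: continuous_intros)
        qed
        then show ?thesis unfolding \<gamma>_def D_def by (intro continuous_on_matrix_mul continuous_on_const)
      qed
      then have "connected (range \<gamma>)" by (rule connected_continuous_image) simp
      moreover have "\<gamma> 0 = mat 1" "\<gamma> 1 = g" by (simp_all add: \<gamma>_def D1 y(1))
      then have "mat 1 \<in> range \<gamma>" "g \<in> range \<gamma>" by (metis rangeI)+
      ultimately have "connected (range \<gamma>) \<and> range \<gamma> \<subseteq> R \<and> mat 1 \<in> range \<gamma> \<and> g \<in> range \<gamma>"
        using y(2) by (simp add: \<gamma>_def image_subset_iff)
      then show ?thesis unfolding connected_component_def by (rule exI)
    qed
    then show "\<forall>x\<in>R. \<forall>y\<in>R. connected_component R x y"
      using connected_component_sym connected_component_trans by metis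
  qed
  then have tor: "torus R"
    unfolding torus_def diagonalizable_group_def using lag P
    by (auto intro!: exI[of _ P] simp: R_def PDQ[unfolded Q_def] diag_matrix_def)
  have ex: "\<exists>Y\<in>lie_algebra R. g = matrix_exp Y \<and> (\<forall>i j. i \<noteq> j \<longrightarrow> (P ** Y ** matrix_inv P) $ i $ j = 0)"
    if g: "g \<in> R" for g
  proof -
    obtain y where y: "g = D (\<chi> i. exp (y i))" "\<And>c. D (\<chi> i. exp (c * y i)) \<in> R" using one_param[OF g] by blast
    have e: "matrix_exp (scale_tensor c (D (\<chi> i. y i))) = D (\<chi> i. exp (c * y i))" for c
    proof -
      have "scale_tensor c (D (\<chi> i. y i)) = Q ** diag_matrix (\<chi> i. c * y i) ** P"
      proof -
        have "diag_matrix (\<chi> i. c * y i) = scale_tensor c (diag_matrix (\<chi> i. y i))"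
          by (simp add: vec_eq_iff diag_matrix_def)
        then show ?thesis by (simp add: D_def scale_tensor_mul_left scale_tensor_mul_right)
      qed
      then show ?thesis using matrix_exp_conj[OF PQ(2,1), of "diag_matrix (\<chi> i. c * y i)"]
        by (simp add: D_def matrix_exp_diag_matrix)
    qed
    show ?thesis
    proof (intro bexI conjI allI impI)
      show "g = matrix_exp (D (\<chi> i. y i))" using e[of 1] y(1) by simp
      show "(P ** D (\<chi> i. y i) ** matrix_inv P) $ i $ j = 0" if "i \<noteq> j" for i j
        using that by (simp add: PDQ[unfolded Q_def]) (simp add: diag_matrix_def)
      show "D (\<chi> i. y i) \<in> lie_algebra R" using y(2) by (simp add: lie_algebra_def e)
    qed
  qed
  show thesis by (rule that[OF tor AR \<open>R \<subseteq> H\<close>]) (rule ex)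
qed

section \<open>Maximal tori\<close>

text \<open>Compare the derivatives of both sides at c = 0.\<close>

lemma commute_from_exp:
  fixes X Z :: "complex^'n^'n::finite"
  assumes "\<And>c. Z ** matrix_exp (scale_tensor c X) = matrix_exp (scale_tensor c X) ** Z"
  shows "Z ** X = X ** Z"
proof -
  have "(Z ** X) $ i $ j = (X ** Z) $ i $ j" for i j
  proof -
    have 1: "((\<lambda>t. (Z ** matrix_exp (scale_tensor t X)) $ i $ j) has_field_derivative (Z ** X) $ i $ j) (at 0)"
      using matrix_exp_entry_has_field_derivative[where g = Z and t = 0 and X = X and i = i and j = j] by simp
    have "((\<lambda>t. \<Sum>k\<in>UNIV. (matrix_exp (scale_tensor t X)) $ i $ k * Z $ k $ j) has_field_derivative (\<Sum>k\<in>UNIV. X $ i $ k * Z $ k $ j)) (at 0)"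
    proof (intro DERIV_sum)
      fix k
      show "((\<lambda>t. (matrix_exp (scale_tensor t X)) $ i $ k * Z $ k $ j) has_field_derivative X $ i $ k * Z $ k $ j) (at 0)"
        using matrix_exp_entry_has_field_derivative[where g = "mat 1" and t = 0 and X = X and i = i and j = k]
        by (intro DERIV_cmult_right) simp
    qed
    then have "((\<lambda>t. (matrix_exp (scale_tensor t X) ** Z) $ i $ j) has_field_derivative (X ** Z) $ i $ j) (at 0)"
      by (simp add: matrix_matrix_mult_def)
    then show ?thesis using DERIV_unique[OF 1] by (simp add: assms)
  qed
  then show ?thesis by (simp add: vec_eq_iff)
qed

text \<open>Two commuting systems have a common refinement, in which the combinations of either one
  can be rewritten. This simultaneously diagonalizes two commuting tori.\<close>

lemma idempotent_system_product:
  fixes \<epsilon> :: "'k \<Rightarrow> complex^'n^'n::finite"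
  assumes \<epsilon>: "idempotent_system K \<epsilon>" and \<tau>: "idempotent_system L \<tau>"
    and comm: "\<And>k l. k \<in> K \<Longrightarrow> l \<in> L \<Longrightarrow> \<epsilon> k ** \<tau> l = \<tau> l ** \<epsilon> k"
  shows "idempotent_system (K \<times> L) (\<lambda>(k, l). \<epsilon> k ** \<tau> l)"
    "diag_comb K \<epsilon> x = diag_comb (K \<times> L) (\<lambda>(k, l). \<epsilon> k ** \<tau> l) (\<lambda>(k, l). x k)"
    "diag_comb L \<tau> y = diag_comb (K \<times> L) (\<lambda>(k, l). \<epsilon> k ** \<tau> l) (\<lambda>(k, l). y l)"
proof -
  have \<epsilon>1: "(\<Sum>k\<in>K. \<epsilon> k) = mat 1" and \<tau>1: "(\<Sum>l\<in>L. \<tau> l) = mat 1" and fin: "finite K" "finite L"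
    using \<epsilon> \<tau> by (auto simp: idempotent_system_def)
  have s1: "(\<Sum>l\<in>L. \<epsilon> k ** \<tau> l) = \<epsilon> k" for k by (simp add: matrix_mul_sum_right[symmetric] \<tau>1)
  have s2: "(\<Sum>k\<in>K. \<epsilon> k ** \<tau> l) = \<tau> l" for l by (simp add: matrix_mul_sum_left[symmetric] \<epsilon>1)
  show "idempotent_system (K \<times> L) (\<lambda>(k, l). \<epsilon> k ** \<tau> l)"
    unfolding idempotent_system_def
  proof (intro conjI ballI)
    fix p q assume pq: "p \<in> K \<times> L" "q \<in> K \<times> L"
    obtain k l k' l' where p: "p = (k, l)" "q = (k', l')" by (cases p, cases q) auto
    have kl: "k \<in> K" "l \<in> L" "k' \<in> K" "l' \<in> L" using pq p by auto
    have "\<epsilon> k ** \<tau> l ** (\<epsilon> k' ** \<tau> l') = \<epsilon> k ** (\<tau> l ** \<epsilon> k') ** \<tau> l'" by (simp only: matrix_mul_assoc)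
    also have "\<dots> = (\<epsilon> k ** \<epsilon> k') ** (\<tau> l ** \<tau> l')" by (simp only: comm[OF kl(3,2), symmetric] matrix_mul_assoc)
    also have "\<dots> = (if p = q then \<epsilon> k' ** \<tau> l' else 0)"
      using kl \<epsilon> \<tau> by (auto simp: p idempotent_system_def)
    finally show "(case p of (k, l) \<Rightarrow> \<epsilon> k ** \<tau> l) ** (case q of (k, l) \<Rightarrow> \<epsilon> k ** \<tau> l) = (if p = q then case q of (k, l) \<Rightarrow> \<epsilon> k ** \<tau> l else 0)"
      by (simp add: p)
  qed (use fin in \<open>simp_all add: sum.cartesian_product[symmetric] s1 \<epsilon>1\<close>)
  show "diag_comb K \<epsilon> x = diag_comb (K \<times> L) (\<lambda>(k, l). \<epsilon> k ** \<tau> l) (\<lambda>(k, l). x k)"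
    by (simp add: diag_comb_def split_def sum.cartesian_product' scale_tensor_sum[symmetric] s1)
  show "diag_comb L \<tau> y = diag_comb (K \<times> L) (\<lambda>(k, l). \<epsilon> k ** \<tau> l) (\<lambda>(k, l). y l)"
    unfolding diag_comb_def split_def sum.cartesian_product'
    by (subst sum.swap) (simp add: scale_tensor_sum[symmetric] s2)
qed

lemma torus_linear_algebraic_group: "torus S \<Longrightarrow> linear_algebraic_group S"
  by (simp add: torus_def diagonalizable_group_def)

text \<open>Any element of the Lie algebra of the torus outside finitely many hyperplanes can serve as \<open>\<sigma>\<close>.\<close>

lemma torus_generator:
  fixes S :: "(complex^'n^'n::finite) set"
  assumes S: "torus S"
  obtains \<sigma> and J :: "complex set" and \<tau> where "\<sigma> \<in> lie_algebra S" "idempotent_system J \<tau>" "\<sigma> = diag_comb J \<tau> id"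
    "\<And>s. s \<in> S \<Longrightarrow> \<exists>x. s = diag_comb J \<tau> x"
    "\<And>Z d. Z ** \<sigma> = \<sigma> ** Z \<Longrightarrow> d \<in> J \<Longrightarrow> Z ** \<tau> d = \<tau> d ** Z"
proof -
  from S obtain P :: "complex^'n^'n" where P: "invertible P" and
    diag: "\<And>s i j. s \<in> S \<Longrightarrow> i \<noteq> j \<Longrightarrow> (P ** s ** matrix_inv P) $ i $ j = 0"
    by (auto simp: torus_def diagonalizable_group_def)
  have lag: "linear_algebraic_group S" and conn: "connected S" using S by (auto simp: torus_def diagonalizable_group_def)
  define Q where "Q = matrix_inv P"
  have PQ: "P ** Q = mat 1" "Q ** P = mat 1" by (simp_all add: Q_def matrix_inv_mult[OF P])
  \<comment> \<open>The hull of the torus inside itself is the torus; it is formed in order to write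
    every element as an exponential from the Lie algebra, diagonal in the same basis.\<close>
  obtain R where R: "S \<subseteq> R" "R \<subseteq> S"
    "\<And>g. g \<in> R \<Longrightarrow> \<exists>Y\<in>lie_algebra R. g = matrix_exp Y \<and> (\<forall>i j. i \<noteq> j \<longrightarrow> (P ** Y ** matrix_inv P) $ i $ j = 0)"
  proof (rule torus_hull[OF lag P subset_refl conn linear_algebraic_groupD(1)[OF lag]])
    show "a ** b \<in> S" if "a \<in> S" "b \<in> S" for a b by (rule linear_algebraic_groupD(2)[OF lag that])
    show "(P ** a ** matrix_inv P) $ i $ j = 0" if "a \<in> S" "i \<noteq> j" for a i j by (rule diag[OF that])
  qed (rule that)
  have RS: "R = S" using R by blast
  define L where "L = {Y \<in> lie_algebra S. \<forall>i j. i \<noteq> j \<longrightarrow> (P ** Y ** Q) $ i $ j = 0}"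
  define co where "co Y i = (P ** Y ** Q) $ i $ i" for Y i
  have co_lin: "co (Y + scale_tensor c Z) i = co Y i + c * co Z i" for Y Z c i
    by (simp add: co_def matrix_mul_add_left matrix_mul_add_right scale_tensor_mul_left scale_tensor_mul_right)
  have L_lin: "Y + scale_tensor c Z \<in> L" if "Y \<in> L" "Z \<in> L" for Y Z c
    using that lie_algebra_add[OF lag] lie_algebra_scale[OF lag]
    by (simp add: L_def matrix_mul_add_left matrix_mul_add_right scale_tensor_mul_left scale_tensor_mul_right)
  have exL: "\<exists>Y\<in>L. s = matrix_exp Y" if "s \<in> S" for s
    using R(3)[of s] that unfolding RS L_def Q_def by blast
  \<comment> \<open>Pairs of coordinates are separated one at a time by moving along a line inside
    \<open>L\<close>, which only finitely many parameters can spoil.\<close>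
  have "\<exists>\<sigma>\<in>L. \<forall>(i, j)\<in>F. (\<exists>Y\<in>L. co Y i \<noteq> co Y j) \<longrightarrow> co \<sigma> i \<noteq> co \<sigma> j" if "finite F" for F
    using that
  proof (induction F)
    case empty
    have "0 \<in> L" using lie_algebra_0[OF lag] by (simp add: L_def)
    then show ?case by auto
  next
    case (insert p F)
    obtain i j where p: "p = (i, j)" by (cases p)
    from insert.IH obtain \<sigma> where \<sigma>: "\<sigma> \<in> L" "\<And>k l. (k, l) \<in> F \<Longrightarrow> (\<exists>Y\<in>L. co Y k \<noteq> co Y l) \<Longrightarrow> co \<sigma> k \<noteq> co \<sigma> l" by blast
    show ?case
    proof (cases "(\<exists>Y\<in>L. co Y i \<noteq> co Y j) \<and> co \<sigma> i = co \<sigma> j")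
      case False
      then show ?thesis using \<sigma> p by auto
    next
      case True
      then obtain Y where Y: "Y \<in> L" "co Y i \<noteq> co Y j" by blast
      \<comment> \<open>The value 0 fails to separate the new pair; the quotients are the parameters
        that merge an old one. Where the denominator vanishes, the quotient is 0 by convention and
        already excluded.\<close>
      define bad where "bad = insert 0 ((\<lambda>(k, l). - (co \<sigma> k - co \<sigma> l) / (co Y k - co Y l)) ` F)"
      have "finite bad" using insert.hyps by (simp add: bad_def)
      then obtain e where e: "e \<notin> bad" using infinite_UNIV_char_0[where 'a=complex] ex_new_if_finite by blast
      let ?\<sigma> = "\<sigma> + scale_tensor e Y"
      have "co ?\<sigma> k \<noteq> co ?\<sigma> l" if "(k, l) \<in> F" "\<exists>Y\<in>L. co Y k \<noteq> co Y l" for k l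
      proof
        assume "co ?\<sigma> k = co ?\<sigma> l"
        then have eq: "co \<sigma> k - co \<sigma> l + e * (co Y k - co Y l) = 0" by (simp add: co_lin algebra_simps)
        show False
        proof (cases "co Y k = co Y l")
          case True
          then show False using eq \<sigma>(2)[OF that] by simp
        next
          case False
          then have "e = - (co \<sigma> k - co \<sigma> l) / (co Y k - co Y l)" using eq by (simp add: field_simps add_eq_0_iff)
          then show False using e that(1) unfolding bad_def by force
        qed
      qed
      moreover have "co ?\<sigma> i \<noteq> co ?\<sigma> j" using True Y e by (auto simp: co_lin bad_def)
      ultimately show ?thesis using L_lin[OF \<sigma>(1) Y(1)] p by (intro bexI[of _ ?\<sigma>]) auto
    qed
  qed
  from this[of UNIV] obtain \<sigma> where \<sigma>: "\<sigma> \<in> L" "\<And>i j Y. Y \<in> L \<Longrightarrow> co Y i \<noteq> co Y j \<Longrightarrow> co \<sigma> i \<noteq> co \<sigma> j" by auto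
  have D: "Y = Q ** diag_matrix (\<chi> i. co Y i) ** P" if "\<And>i j. i \<noteq> j \<Longrightarrow> (P ** Y ** Q) $ i $ j = 0" for Y
  proof -
    have "diag_matrix (\<chi> i. co Y i) = P ** Y ** Q" using that by (auto simp: vec_eq_iff diag_matrix_def co_def)
    then have "Q ** diag_matrix (\<chi> i. co Y i) ** P = (Q ** P) ** Y ** (Q ** P)" by (simp add: matrix_mul_assoc)
    then show ?thesis by (simp add: PQ)
  qed
  define J where "J = range (co \<sigma>)"
  define \<tau> where "\<tau> d = Q ** diag_matrix (\<chi> i. if co \<sigma> i = d then 1 else 0) ** P" for d
  have fin: "finite J" by (simp add: J_def)
  have comb: "diag_comb J \<tau> x = Q ** diag_matrix (\<chi> i. x (co \<sigma> i)) ** P" for x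
  proof -
    have "(\<Sum>d\<in>J. scale_tensor (x d) (diag_matrix (\<chi> i. if co \<sigma> i = d then 1 else 0))) = diag_matrix (\<chi> i. x (co \<sigma> i))"
    proof -
      have "(\<Sum>d\<in>J. x d * (if co \<sigma> i = d then 1 else 0)) = x (co \<sigma> i)" for i
      proof -
        have "(\<Sum>d\<in>J. x d * (if co \<sigma> i = d then 1 else 0)) = (\<Sum>d\<in>J. if d = co \<sigma> i then x (co \<sigma> i) else 0)"
          by (intro sum.cong) auto
        then show ?thesis using fin by (simp add: J_def)
      qed
      then show ?thesis by (simp add: vec_eq_iff diag_matrix_def)
    qed
    moreover have "diag_comb J \<tau> x = Q ** (\<Sum>d\<in>J. scale_tensor (x d) (diag_matrix (\<chi> i. if co \<sigma> i = d then 1 else 0))) ** P"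
      by (simp add: diag_comb_def \<tau>_def matrix_mul_sum_left matrix_mul_sum_right scale_tensor_mul_left scale_tensor_mul_right)
    ultimately show ?thesis by simp
  qed
  show thesis
  proof (rule that[of \<sigma> J \<tau>])
    show "\<sigma> \<in> lie_algebra S" using \<sigma>(1) by (simp add: L_def)
    show "idempotent_system J \<tau>"
      unfolding idempotent_system_def
    proof (intro conjI ballI fin)
      fix d e
      have "\<tau> d ** \<tau> e = Q ** diag_matrix (\<chi> i. if co \<sigma> i = d then 1 else 0) ** (P ** Q) ** diag_matrix (\<chi> i. if co \<sigma> i = e then 1 else 0) ** P"
        by (simp only: \<tau>_def matrix_mul_assoc)
      also have "\<dots> = Q ** (diag_matrix (\<chi> i. if co \<sigma> i = d then 1 else 0) ** diag_matrix (\<chi> i. if co \<sigma> i = e then 1 else 0)) ** P"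
        by (simp add: PQ matrix_mul_assoc)
      also have "diag_matrix (\<chi> i. if co \<sigma> i = d then 1 else 0) ** diag_matrix (\<chi> i. if co \<sigma> i = e then 1 else 0) =
          (if d = e then diag_matrix (\<chi> i. if co \<sigma> i = e then 1 else 0) else (0 :: complex^'n^'n))"
        by (simp add: diag_matrix_mult) (auto simp: vec_eq_iff diag_matrix_def)
      finally show "\<tau> d ** \<tau> e = (if d = e then \<tau> e else 0)" by (simp add: \<tau>_def)
    next
      have "(\<Sum>d\<in>J. \<tau> d) = diag_comb J \<tau> (\<lambda>_. 1)" by (simp add: diag_comb_def)
      then show "(\<Sum>d\<in>J. \<tau> d) = mat 1" by (simp add: comb diag_matrix_1 PQ)
    qed
    show "\<sigma> = diag_comb J \<tau> id" unfolding comb id_apply by (rule D) (use \<sigma>(1) in \<open>simp add: L_def\<close>)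
    show "\<exists>x. s = diag_comb J \<tau> x" if s: "s \<in> S" for s
    proof -
      obtain Y where Y: "Y \<in> L" "s = matrix_exp Y" using exL[OF s] by blast
      \<comment> \<open>The choice of an index is harmless: coordinates on which
        \<open>\<sigma>\<close> agrees are not separated by any element of \<open>L\<close>.\<close>
      define x where "x d = exp (co Y (SOME i. co \<sigma> i = d))" for d
      have "x (co \<sigma> i) = exp (co Y i)" for i
      proof -
        have "co \<sigma> (SOME j. co \<sigma> j = co \<sigma> i) = co \<sigma> i" by (rule someI_ex) auto
        then have "co Y (SOME j. co \<sigma> j = co \<sigma> i) = co Y i" using \<sigma>(2)[OF Y(1)] by blast
        then show ?thesis by (simp add: x_def)
      qed
      moreover have "s = Q ** diag_matrix (\<chi> i. exp (co Y i)) ** P"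
      proof -
        have "Y = Q ** diag_matrix (\<chi> i. co Y i) ** P" by (rule D) (use Y(1) in \<open>simp add: L_def\<close>)
        then have "s = matrix_exp (Q ** diag_matrix (\<chi> i. co Y i) ** P)" using Y(2) by simp
        then show ?thesis using matrix_exp_conj[OF PQ(2,1)] by (simp add: matrix_exp_diag_matrix)
      qed
      ultimately show ?thesis by (intro exI[of _ x]) (simp add: comb)
    qed
    fix Z d assume Z: "Z ** \<sigma> = \<sigma> ** Z"
    define Z' where "Z' = P ** Z ** Q"
    have ZZ': "Z = Q ** Z' ** P"
    proof -
      have "Q ** Z' ** P = (Q ** P) ** Z ** (Q ** P)" by (simp only: Z'_def matrix_mul_assoc)
      then show ?thesis by (simp add: PQ)
    qed
    have \<sigma>D: "\<sigma> = Q ** diag_matrix (\<chi> i. co \<sigma> i) ** P" by (rule D) (use \<sigma>(1) in \<open>simp add: L_def\<close>)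
    have comm_iff: "Z ** (Q ** diag_matrix x ** P) = (Q ** diag_matrix x ** P) ** Z \<longleftrightarrow> Z' ** diag_matrix x = diag_matrix x ** Z'" for x
    proof
      assume a: "Z ** (Q ** diag_matrix x ** P) = (Q ** diag_matrix x ** P) ** Z"
      have "P ** (Z ** (Q ** diag_matrix x ** P)) ** Q = Z' ** diag_matrix x ** (P ** Q)" by (simp only: Z'_def matrix_mul_assoc)
      moreover have "P ** ((Q ** diag_matrix x ** P) ** Z) ** Q = (P ** Q) ** diag_matrix x ** Z'" by (simp only: Z'_def matrix_mul_assoc)
      ultimately show "Z' ** diag_matrix x = diag_matrix x ** Z'" using a by (simp add: PQ)
    next
      assume a: "Z' ** diag_matrix x = diag_matrix x ** Z'"
      have "Z ** (Q ** diag_matrix x ** P) = Q ** Z' ** (P ** Q) ** diag_matrix x ** P" by (subst ZZ') (simp only: matrix_mul_assoc)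
      also have "\<dots> = Q ** (Z' ** diag_matrix x) ** P" by (simp add: PQ matrix_mul_assoc)
      also have "\<dots> = Q ** diag_matrix x ** (P ** Q) ** Z' ** P" by (simp add: a PQ matrix_mul_assoc)
      also have "\<dots> = (Q ** diag_matrix x ** P) ** Z" by (subst ZZ') (simp only: matrix_mul_assoc)
      finally show "Z ** (Q ** diag_matrix x ** P) = (Q ** diag_matrix x ** P) ** Z" .
    qed
    have "Z' ** diag_matrix (\<chi> i. co \<sigma> i) = diag_matrix (\<chi> i. co \<sigma> i) ** Z'"
      using Z comm_iff[of "\<chi> i. co \<sigma> i"] by (simp flip: \<sigma>D)
    \<comment> \<open>In the diagonal basis, a matrix commuting with \<open>\<sigma>\<close> has no
      entries between distinct eigenvalues, so it commutes with each spectral projection.\<close>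
    then have "Z' $ i $ j = 0 \<or> co \<sigma> i = co \<sigma> j" for i j
      using diag_matrix_mult_right[of Z' "\<chi> i. co \<sigma> i" i j] diag_matrix_mult_left[of "\<chi> i. co \<sigma> i" Z' i j] by auto
    then have "Z' $ i $ j * (if co \<sigma> j = d then 1 else 0) = (if co \<sigma> i = d then 1 else 0) * Z' $ i $ j" for i j
      by (metis mult.commute mult_zero_left)
    then have "Z' ** diag_matrix (\<chi> i. if co \<sigma> i = d then 1 else 0) = diag_matrix (\<chi> i. if co \<sigma> i = d then 1 else 0) ** Z'"
      by (simp add: vec_eq_iff diag_matrix_mult_left diag_matrix_mult_right)
    then show "Z ** \<tau> d = \<tau> d ** Z" unfolding \<tau>_def comm_iff .
  qed
qed

text \<open>All elements of \<open>S\<close> and \<open>C\<close> are combinations of one system of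
  idempotents. Their products therefore form a connected, simultaneously diagonalizable set closed
  under multiplication, and its torus hull contains \<open>S\<close>, hence equals it by
  maximality.\<close>

lemma maximal_torus_absorbs:
  fixes S H C :: "(complex^'n^'n::finite) set" and \<epsilon> :: "'k \<Rightarrow> complex^'n^'n"
  assumes H: "linear_algebraic_group H" and S: "maximal_torus S H" and C: "C \<subseteq> H" "connected C" "mat 1 \<in> C"
    "\<And>a b. a \<in> C \<Longrightarrow> b \<in> C \<Longrightarrow> a ** b \<in> C" and \<epsilon>: "idempotent_system K \<epsilon>"
    and SC: "\<And>g. g \<in> S \<union> C \<Longrightarrow> \<exists>x. g = diag_comb K \<epsilon> x"
  shows "C \<subseteq> S"
proof -
  have Sl: "linear_algebraic_group S" and SH: "S \<subseteq> H" and conn: "connected S"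
    using S torus_linear_algebraic_group by (auto simp: maximal_torus_def torus_def)
  have comm: "g ** h = h ** g" if gh: "g \<in> S \<union> C" "h \<in> S \<union> C" for g h
  proof -
    obtain x where "g = diag_comb K \<epsilon> x" using SC[OF gh(1)] by blast
    moreover obtain y where "h = diag_comb K \<epsilon> y" using SC[OF gh(2)] by blast
    ultimately show ?thesis by (simp add: diag_comb_mult[OF \<epsilon>] mult.commute)
  qed
  obtain P :: "complex^'n^'n" where P: "invertible P" "\<And>x i j. i \<noteq> j \<Longrightarrow> (P ** diag_comb K \<epsilon> x ** matrix_inv P) $ i $ j = 0"
    using idempotent_system_diagonalizable[OF \<epsilon>] by blast
  define A where "A = (\<lambda>(s, c). s ** c) ` (S \<times> C)"
  have "connected A"
    unfolding A_def split_def
    by (intro connected_continuous_image connected_Times conn C(2) continuous_on_matrix_mul continuous_on_fst continuous_on_snd continuous_on_id)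
  have SA: "S \<subseteq> A" unfolding A_def using C(3) by force
  have CA: "C \<subseteq> A" unfolding A_def using linear_algebraic_groupD(1)[OF Sl] by force
  obtain R where R: "torus R" "A \<subseteq> R" "R \<subseteq> H"
  proof (rule torus_hull[OF H P(1) _ \<open>connected A\<close>])
    show "A \<subseteq> H" using SH C(1) linear_algebraic_groupD(2)[OF H] by (auto simp: A_def)
    show "mat 1 \<in> A" using SA linear_algebraic_groupD(1)[OF Sl] by blast
    show "a ** b \<in> A" if ab: "a \<in> A" "b \<in> A" for a b
    proof -
      obtain s c s' c' where sc: "s \<in> S" "c \<in> C" "s' \<in> S" "c' \<in> C" "a = s ** c" "b = s' ** c'" using ab by (auto simp: A_def)
      have "a ** b = s ** (c ** s') ** c'" by (simp only: sc matrix_mul_assoc)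
      also have "\<dots> = (s ** s') ** (c ** c')" using comm[of c s'] sc by (simp add: matrix_mul_assoc)
      finally show ?thesis using sc C(4) linear_algebraic_groupD(2)[OF Sl] unfolding A_def by force
    qed
    show "(P ** a ** matrix_inv P) $ i $ j = 0" if a: "a \<in> A" and ij: "i \<noteq> j" for a i j
    proof -
      obtain s c where sc: "s \<in> S" "c \<in> C" "a = s ** c" using a by (auto simp: A_def)
      obtain x where "s = diag_comb K \<epsilon> x" using SC[of s] sc by blast
      moreover obtain y where "c = diag_comb K \<epsilon> y" using SC[of c] sc by blast
      ultimately show ?thesis using P(2)[OF ij] by (simp add: sc diag_comb_mult[OF \<epsilon>])
    qed
  qed (rule that)
  then have "R = S" using S SA by (auto simp: maximal_torus_def)
  then show ?thesis using CA R by blast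
qed

text \<open>The semisimple part of \<open>Y\<close> is built from polynomials in \<open>Y\<close>
  and so commutes with \<open>S\<close>. Its one-parameter group is absorbed by \<open>S\<close>;
  whatever commutes with \<open>S\<close> then commutes with the semisimple part.\<close>

lemma maximal_torus_semisimple_part:
  fixes S H :: "(complex^'n^'n::finite) set"
  assumes H: "linear_algebraic_group H" and S: "maximal_torus S H"
    and Y: "Y \<in> lie_algebra H" and comm: "\<And>s. s \<in> S \<Longrightarrow> Y ** s = s ** Y"
  obtains Ys N where "matrix_power (Y - Ys) N = 0" "\<And>W. (\<And>s. s \<in> S \<Longrightarrow> W ** s = s ** W) \<Longrightarrow> W ** Ys = Ys ** W"
proof -
  have tS: "torus S" using S by (simp add: maximal_torus_def)
  obtain \<sigma> and J :: "complex set" and \<tau> where \<sigma>: "\<sigma> \<in> lie_algebra S" "idempotent_system J \<tau>" "\<sigma> = diag_comb J \<tau> id"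
    "\<And>s. s \<in> S \<Longrightarrow> \<exists>x. s = diag_comb J \<tau> x"
    "\<And>Z d. Z ** \<sigma> = \<sigma> ** Z \<Longrightarrow> d \<in> J \<Longrightarrow> Z ** \<tau> d = \<tau> d ** Z"
    by (rule torus_generator[OF tS]) (rule that)
  obtain K :: "complex set" and \<pi> N where \<pi>: "idempotent_system K \<pi>"
    "\<And>Z d. Z ** Y = Y ** Z \<Longrightarrow> d \<in> K \<Longrightarrow> Z ** \<pi> d = \<pi> d ** Z"
    "matrix_power (Y - diag_comb K \<pi> id) N = 0" "diag_comb K \<pi> id \<in> lie_algebra H"
    by (rule lie_algebra_semisimple_part[OF H Y]) (rule that)
  have "Y ** \<sigma> = \<sigma> ** Y"
    by (rule commute_from_exp) (use \<sigma>(1) comm in \<open>auto simp: lie_algebra_def\<close>)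
  then have "\<sigma> ** \<pi> e = \<pi> e ** \<sigma>" if "e \<in> K" for e using \<pi>(2)[of \<sigma> e] that by simp
  then have \<pi>\<tau>: "\<pi> e ** \<tau> d = \<tau> d ** \<pi> e" if "e \<in> K" "d \<in> J" for e d using \<sigma>(5)[of "\<pi> e" d] that by simp
  note prod = idempotent_system_product[OF \<pi>(1) \<sigma>(2) \<pi>\<tau>]
  let ?Ys = "diag_comb K \<pi> id"
  define C where "C = range (\<lambda>c. matrix_exp (scale_tensor c ?Ys))"
  have exp: "matrix_exp (scale_tensor c ?Ys) = diag_comb K \<pi> (\<lambda>d. exp (c * d))" for c
    by (simp add: scale_diag_comb matrix_exp_diag_comb[OF \<pi>(1)])
  have "C \<subseteq> S"
  proof (rule maximal_torus_absorbs[OF H S])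
    show "C \<subseteq> H" using \<pi>(4) by (auto simp: C_def lie_algebra_def)
    show "connected C" unfolding C_def
      by (intro connected_continuous_image continuous_on_compose2[OF continuous_on_matrix_exp[of UNIV]]
          bounded_linear.continuous_on[OF bounded_linear_scale_tensor_left] continuous_on_id) auto
    show "mat 1 \<in> C" unfolding C_def by (rule image_eqI[of _ _ 0]) auto
    show "a ** b \<in> C" if ab: "a \<in> C" "b \<in> C" for a b
    proof -
      obtain c c' where "a = matrix_exp (scale_tensor c ?Ys)" "b = matrix_exp (scale_tensor c' ?Ys)" using ab by (auto simp: C_def)
      then have "a ** b = matrix_exp (scale_tensor (c + c') ?Ys)"
        unfolding exp by (simp add: diag_comb_mult[OF \<pi>(1)] exp_add[symmetric] distrib_right)
      then show ?thesis by (simp add: C_def)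
    qed
    show "idempotent_system (K \<times> J) (\<lambda>(k, l). \<pi> k ** \<tau> l)" by (rule prod(1))
    show "\<exists>x. g = diag_comb (K \<times> J) (\<lambda>(k, l). \<pi> k ** \<tau> l) x" if "g \<in> S \<union> C" for g
      using that
    proof
      assume "g \<in> S"
      then obtain x where "g = diag_comb J \<tau> x" using \<sigma>(4) by blast
      then show ?thesis using prod(3) by blast
    next
      assume "g \<in> C"
      then obtain c where "g = diag_comb K \<pi> (\<lambda>d. exp (c * d))" by (auto simp: C_def exp)
      then show ?thesis using prod(2) by blast
    qed
  qed
  show thesis
  proof (rule that[OF \<pi>(3)])
    fix W assume W: "\<And>s. s \<in> S \<Longrightarrow> W ** s = s ** W"
    show "W ** ?Ys = ?Ys ** W"
      by (rule commute_from_exp) (use W \<open>C \<subseteq> S\<close> in \<open>auto simp: C_def\<close>)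
  qed
qed

text \<open>Since the tori commute, so do the spectral projections of their generators. The common
  refinement contains both tori, so one absorbs the other.\<close>

lemma commuting_maximal_tori_eq:
  fixes S S' H :: "(complex^'n^'n::finite) set"
  assumes H: "linear_algebraic_group H" and S: "maximal_torus S H" and S': "maximal_torus S' H"
    and comm: "\<And>s s'. s \<in> S \<Longrightarrow> s' \<in> S' \<Longrightarrow> s ** s' = s' ** s"
  shows "S = S'"
proof -
  have t: "torus S" "torus S'" using S S' by (auto simp: maximal_torus_def)
  obtain \<sigma> and J :: "complex set" and \<tau> where \<sigma>: "\<sigma> \<in> lie_algebra S" "idempotent_system J \<tau>" "\<sigma> = diag_comb J \<tau> id"
    "\<And>s. s \<in> S \<Longrightarrow> \<exists>x. s = diag_comb J \<tau> x"
    "\<And>Z d. Z ** \<sigma> = \<sigma> ** Z \<Longrightarrow> d \<in> J \<Longrightarrow> Z ** \<tau> d = \<tau> d ** Z"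
    by (rule torus_generator[OF t(1)]) (rule that)
  obtain \<sigma>' and J' :: "complex set" and \<tau>' where \<sigma>': "\<sigma>' \<in> lie_algebra S'" "idempotent_system J' \<tau>'" "\<sigma>' = diag_comb J' \<tau>' id"
    "\<And>s. s \<in> S' \<Longrightarrow> \<exists>x. s = diag_comb J' \<tau>' x"
    "\<And>Z d. Z ** \<sigma>' = \<sigma>' ** Z \<Longrightarrow> d \<in> J' \<Longrightarrow> Z ** \<tau>' d = \<tau>' d ** Z"
    by (rule torus_generator[OF t(2)]) (rule that)
  have 1: "s' ** \<sigma> = \<sigma> ** s'" if "s' \<in> S'" for s'
  proof (rule commute_from_exp)
    fix c
    have "matrix_exp (scale_tensor c \<sigma>) \<in> S" using \<sigma>(1) by (simp add: lie_algebra_def)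
    from comm[OF this that] show "s' ** matrix_exp (scale_tensor c \<sigma>) = matrix_exp (scale_tensor c \<sigma>) ** s'" by simp
  qed
  have 2: "\<sigma> ** \<sigma>' = \<sigma>' ** \<sigma>"
  proof (rule commute_from_exp)
    fix c
    have "matrix_exp (scale_tensor c \<sigma>') \<in> S'" using \<sigma>'(1) by (simp add: lie_algebra_def)
    from 1[OF this] show "\<sigma> ** matrix_exp (scale_tensor c \<sigma>') = matrix_exp (scale_tensor c \<sigma>') ** \<sigma>" by simp
  qed
  have "\<tau>' e ** \<tau> d = \<tau> d ** \<tau>' e" if "e \<in> J'" "d \<in> J" for e d
    by (rule \<sigma>(5)[OF \<sigma>'(5)[OF 2 that(1), symmetric] that(2)])
  note prod = idempotent_system_product[OF \<sigma>'(2) \<sigma>(2) this]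
  have "S' \<subseteq> S"
  proof (rule maximal_torus_absorbs[OF H S _ _ _ _ prod(1)])
    show "\<exists>x. g = diag_comb (J' \<times> J) (\<lambda>(k, l). \<tau>' k ** \<tau> l) x" if "g \<in> S \<union> S'" for g
      using that
    proof
      assume "g \<in> S"
      then obtain x where "g = diag_comb J \<tau> x" using \<sigma>(4) by blast
      then show ?thesis using prod(3) by blast
    next
      assume "g \<in> S'"
      then obtain x where "g = diag_comb J' \<tau>' x" using \<sigma>'(4) by blast
      then show ?thesis using prod(2) by blast
    qed
    show "S' \<subseteq> H" using S' by (simp add: maximal_torus_def)
    show "connected S'" using t(2) by (simp add: torus_def)
    show "mat 1 \<in> S'" by (rule linear_algebraic_groupD(1)[OF torus_linear_algebraic_group[OF t(2)]])
    show "a ** b \<in> S'" if "a \<in> S'" "b \<in> S'" for a b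
      by (rule linear_algebraic_groupD(2)[OF torus_linear_algebraic_group[OF t(2)] that])
  qed
  then show ?thesis using S S' by (auto simp: maximal_torus_def)
qed

section \<open>Fitting decomposition\<close>

lemma linear_funpow: "linear f \<Longrightarrow> linear (f ^^ k)" for f :: "'a::real_vector \<Rightarrow> 'a"
  by (induction k) (auto intro: linear_compose simp: id_def[symmetric] linear_id)

text \<open>The kernels of the powers increase, and once two consecutive ones agree the chain is
  constant. The dimension bounds the number of strict steps.\<close>

lemma kernel_stabilizes:
  fixes f :: "'a::euclidean_space \<Rightarrow> 'a"
  assumes f: "linear f" and z: "(f ^^ k) z = 0"
  shows "(f ^^ DIM('a)) z = 0"
proof -
  define K where "K j = {z. (f ^^ j) z = 0}" for j
  have sub: "subspace (K j)" for j unfolding K_def by (rule linear_subspace_kernel[OF linear_funpow[OF f]])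
  have mono: "K j \<subseteq> K (Suc j)" for j using linear_0[OF f] by (auto simp: K_def)
  have "\<exists>j\<le>DIM('a). K j = K (Suc j)"
  proof (rule ccontr)
    assume "\<not> ?thesis"
    then have ne: "K j \<noteq> K (Suc j)" if "j \<le> DIM('a)" for j using that by blast
    \<comment> \<open>One step beyond the dimension is needed: strictness at every index up to
      \<open>DIM('a)\<close> would give a kernel of dimension \<open>DIM('a) + 1\<close>.\<close>
    have "j \<le> dim (K j)" if "j \<le> Suc (DIM('a))" for j
      using that
    proof (induction j)
      case (Suc j)
      have "dim (K j) \<noteq> dim (K (Suc j))"
        using subspace_dim_equal[OF sub sub mono, of j] ne[of j] Suc.prems by auto
      then show ?case using Suc dim_subset[OF mono, of j] by simp
    qed simp
    from this[of "Suc (DIM('a))"] dim_subset_UNIV[of "K (Suc (DIM('a)))"] show False by simp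
  qed
  then obtain j where j: "j \<le> DIM('a)" "K j = K (Suc j)" by blast
  have stab: "K (j + i) = K j" for i
  proof (induction i)
    case (Suc i)
    have "z \<in> K (j + i)" if "z \<in> K (j + Suc i)" for z
    proof -
      have "(f ^^ i) z \<in> K (Suc j)" using that by (simp add: K_def funpow_add[symmetric, THEN fun_cong, unfolded o_def] add.commute)
      then have "(f ^^ i) z \<in> K j" using j by simp
      then show ?thesis by (simp add: K_def funpow_add[symmetric, THEN fun_cong, unfolded o_def])
    qed
    moreover have "K (j + i) \<subseteq> K (j + Suc i)" using mono by simp
    ultimately show ?case using Suc by blast
  qed simp
  have "z \<in> K (j + k)" using z linear_0[OF linear_funpow[OF f]] by (simp add: K_def funpow_add)
  then have "z \<in> K (j + (DIM('a) - j))" unfolding stab .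
  then show ?thesis using j(1) by (simp add: K_def)
qed

text \<open>By stabilization \<open>F\<close> and its square have the same kernel, so
  \<open>F\<close> is injective on its image and, for dimension reasons, maps that image onto
  itself. Thus \<open>F v\<close> equals some \<open>F (F w)\<close>, and \<open>v\<close> splits
  into a null vector and an element of the image.\<close>

lemma fitting_decomposition:
  fixes f :: "'a::euclidean_space \<Rightarrow> 'a"
  assumes f: "linear f" and V: "subspace V" and fV: "\<And>v. v \<in> V \<Longrightarrow> f v \<in> V"
  defines "F \<equiv> f ^^ DIM('a)"
  shows "\<And>v. v \<in> V \<Longrightarrow> \<exists>w\<in>V. F (v - F w) = 0" "inj_on F (F ` V)" "subspace (F ` V)" "F ` V \<subseteq> V"
proof -
  have lF: "linear F" unfolding F_def by (rule linear_funpow[OF f])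
  have "(f ^^ k) v \<in> V" if "v \<in> V" for k v using that by (induction k) (auto intro: fV)
  then show FV: "F ` V \<subseteq> V" by (auto simp: F_def)
  show sub: "subspace (F ` V)" by (rule linear_subspace_image[OF lF V])
  show inj: "inj_on F (F ` V)"
    unfolding linear_injective_on_subspace_0[OF lF sub]
  proof (intro ballI impI)
    fix x assume "x \<in> F ` V" "F x = 0"
    then obtain v where v: "x = F v" "F (F v) = 0" by blast
    then have "(f ^^ (DIM('a) + DIM('a))) v = 0" by (simp add: F_def funpow_add)
    then show "x = 0" using kernel_stabilizes[OF f] v by (simp add: F_def)
  qed
  fix v assume v: "v \<in> V"
  have "dim (F ` F ` V) = dim (F ` V)"
    by (rule dim_image_eq[OF lF]) (simp add: span_eq_iff[THEN iffD2, OF sub] inj)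
  moreover have "F ` F ` V \<subseteq> F ` V" using FV by blast
  ultimately have "F ` F ` V = F ` V"
    using subspace_dim_equal[OF linear_subspace_image[OF lF sub] sub] by simp
  then obtain w where "w \<in> V" "F v = F (F w)" using v by blast
  then show "\<exists>w\<in>V. F (v - F w) = 0" using linear_diff[OF lF] by auto
qed

section \<open>Local structure at an element of the Lie algebra\<close>

lemma ad_add_left: "ad (X + Y) Z = ad X Z + ad Y Z"
  by (simp add: ad_def matrix_mul_add_left matrix_mul_add_right)
lemma ad_add_right: "ad X (Y + Z) = ad X Y + ad X Z"
  by (simp add: ad_def matrix_mul_add_left matrix_mul_add_right)
lemma ad_diff_left: "ad (X - Y) Z = ad X Z - ad Y Z"
  by (simp add: ad_def matrix_mul_diff_left matrix_mul_diff_right)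
lemma ad_diff_right: "ad X (Y - Z) = ad X Y - ad X Z"
  by (simp add: ad_def matrix_mul_diff_left matrix_mul_diff_right)
lemma ad_scale_left: "ad (scale_tensor c X) Z = scale_tensor c (ad X Z)"
  by (simp add: ad_def scale_tensor_mul_left scale_tensor_mul_right scale_tensor_diff)
lemma ad_scale_right: "ad X (scale_tensor c Z) = scale_tensor c (ad X Z)"
  by (simp add: ad_def scale_tensor_mul_left scale_tensor_mul_right scale_tensor_diff)
lemma ad_self [simp]: "ad X X = 0" by (simp add: ad_def)
lemma ad_0_right [simp]: "ad X 0 = 0" by (simp add: ad_def)
lemma ad_0_left [simp]: "ad 0 X = 0" by (simp add: ad_def)
lemma ad_eq_0_iff: "ad X Y = 0 \<longleftrightarrow> X ** Y = Y ** X" by (simp add: ad_def)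
lemma linear_ad: "linear (ad X)"
  by (rule linearI) (simp_all add: ad_add_right ad_scale_right scaleR_eq_scale_tensor)

lemma ad_leibniz: "ad X (ad Y Z) = ad (ad X Y) Z + ad Y (ad X Z)"
  by (simp add: ad_def matrix_mul_diff_left matrix_mul_diff_right matrix_mul_assoc)

lemma ad_conj:
  assumes "Q ** P = mat 1"
  shows "ad (P ** X ** Q) (P ** Z ** Q) = P ** ad X Z ** Q"
proof -
  have "P ** X ** Q ** (P ** Z ** Q) = P ** X ** (Q ** P) ** Z ** Q" for X Z by (simp only: matrix_mul_assoc)
  then have "P ** X ** Q ** (P ** Z ** Q) = P ** (X ** Z) ** Q" for X Z by (simp add: assms matrix_mul_assoc)
  then show ?thesis by (simp add: ad_def matrix_mul_diff_left matrix_mul_diff_right)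
qed

text \<open>The generalized kernel of \<open>ad X\<close> on the Lie algebra. For an
  \<open>X\<close> with nilpotent part it replaces the centralizer, which may be smaller.\<close>

definition fitting_null :: "(complex^'n^'n) set \<Rightarrow> complex^'n^'n \<Rightarrow> (complex^'n^'n) set" where
  "fitting_null H X = {Z \<in> lie_algebra H. \<exists>k. (ad X ^^ k) Z = 0}"

lemma fitting_null_eq:
  "fitting_null H X = {Z \<in> lie_algebra H. (ad X ^^ DIM(complex^'n^'n)) Z = 0}" for X :: "complex^'n^'n::finite"
  unfolding fitting_null_def using kernel_stabilizes[OF linear_ad, of _ X] by blast

context
  fixes H :: "(complex^'n^'n::finite) set"
  assumes H: "linear_algebraic_group H"
begin

lemma subspace_fitting_null: "subspace (fitting_null H X)"
proof -
  have "fitting_null H X = lie_algebra H \<inter> {Z. (ad X ^^ DIM(complex^'n^'n)) Z = 0}" by (auto simp: fitting_null_eq)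
  then show ?thesis
    using subspace_inter[OF subspace_lie_algebra[OF H] linear_subspace_kernel[OF linear_funpow[OF linear_ad]]] by simp
qed

lemma fitting_null_self: "X \<in> lie_algebra H \<Longrightarrow> X \<in> fitting_null H X"
  unfolding fitting_null_def by (intro CollectI conjI exI[of _ 1]) auto

text \<open>By the Leibniz rule, k + l applications of \<open>ad X\<close> to a bracket put at least
  \<open>k\<close> on the first factor or at least \<open>l\<close> on the second, and either kills
  the term.\<close>

lemma fitting_null_ad:
  assumes "A \<in> fitting_null H X" "B \<in> fitting_null H X"
  shows "ad A B \<in> fitting_null H X"
proof -
  have key: "(ad X ^^ n) (ad A B) = 0" if "(ad X ^^ k) A = 0" "(ad X ^^ l) B = 0" "k + l = n" for n k l and A B :: "complex^'n^'n"
    using that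
  proof (induction n arbitrary: k l A B)
    case (Suc n)
    have S: "(ad X ^^ Suc m) U = (ad X ^^ m) (ad X U)" for m U by (simp only: funpow_Suc_right o_apply)
    note z = linear_0[OF linear_funpow[OF linear_ad]]
    have 1: "(ad X ^^ n) (ad (ad X A) B) = 0"
    proof (cases k)
      case 0
      then have "A = 0" using Suc.prems(1) by simp
      then show ?thesis by (simp add: z)
    next
      fix k' assume k': "k = Suc k'"
      show ?thesis by (rule Suc.IH[of k' "ad X A" l B]) (use Suc.prems k' in \<open>auto simp: S simp del: funpow.simps\<close>)
    qed
    have 2: "(ad X ^^ n) (ad A (ad X B)) = 0"
    proof (cases l)
      case 0
      then have "B = 0" using Suc.prems(2) by simp
      then show ?thesis by (simp add: z)
    next
      fix l' assume l': "l = Suc l'"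
      show ?thesis by (rule Suc.IH[of k A l' "ad X B"]) (use Suc.prems l' in \<open>auto simp: S simp del: funpow.simps\<close>)
    qed
    have "(ad X ^^ Suc n) (ad A B) = (ad X ^^ n) (ad (ad X A) B + ad A (ad X B))"
      unfolding S ad_leibniz[of X A B] ..
    then show ?case by (simp only: 1 2 linear_add[OF linear_funpow[OF linear_ad]] add_0)
  qed simp
  obtain k l where kl: "(ad X ^^ k) A = 0" "(ad X ^^ l) B = 0" using assms by (auto simp: fitting_null_def)
  have "ad A B \<in> lie_algebra H" using assms by (auto simp: fitting_null_def intro: lie_algebra_ad[OF H])
  then show ?thesis unfolding fitting_null_def
    by (intro CollectI conjI exI[of _ "k + l"] key[OF kl refl])
qed

text \<open>Modulo its null space, \<open>ad X\<close> is injective on a complement and hence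
  bounded below there, which is stable under small perturbations. For \<open>Y\<close> inside the
  null space, \<open>ad Y\<close> preserves that space, so a vector killed by a power of
  \<open>ad Y\<close> cannot have a component outside. The radius \<open>e / B\<close> compares the
  lower bound with the size of the bilinear map.\<close>

lemma fitting_null_near:
  assumes X: "X \<in> lie_algebra H"
  obtains \<delta> where "\<delta> > 0" "\<And>Y. Y \<in> fitting_null H X \<Longrightarrow> norm (Y - X) < \<delta> \<Longrightarrow> fitting_null H Y \<subseteq> fitting_null H X"
proof -
  let ?N = "fitting_null H X"
  have inj: "inj_on id ?N" by simp
  obtain p where p: "range p \<subseteq> ?N" "linear p" "\<And>v. v \<in> ?N \<Longrightarrow> p v = v"
    using linear_exists_left_inverse_on[OF linear_id subspace_fitting_null inj] by auto
  define C where "C = {Z \<in> lie_algebra H. p Z = 0}"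
  have "subspace C"
  proof -
    have "C = lie_algebra H \<inter> {Z. p Z = 0}" by (auto simp: C_def)
    then show ?thesis using subspace_inter[OF subspace_lie_algebra[OF H] linear_subspace_kernel[OF p(2)]] by simp
  qed
  have CN: "Z = 0" if "Z \<in> C" "Z \<in> ?N" for Z using that p(3) by (auto simp: C_def)
  define g where "g U Z = ad U Z - p (ad U Z)" for U Z
  have g0: "g U Z = 0 \<longleftrightarrow> ad U Z \<in> ?N" for U Z using p(1,3) by (auto simp: g_def)
  have blg: "bounded_bilinear g"
  proof -
    show ?thesis
      unfolding g_def[abs_def] bilinear_conv_bounded_bilinear[symmetric] bilinear_def
      by (auto intro!: linearI simp: ad_add_left ad_add_right linear_add[OF p(2)])
        (simp_all add: scaleR_eq_scale_tensor ad_scale_left ad_scale_right scale_tensor_diff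
          linear_scale[OF p(2), unfolded scaleR_eq_scale_tensor])
  qed
  have "\<exists>e>0. \<forall>Z\<in>C. norm (g X Z) \<ge> e * norm Z"
  proof (rule injective_imp_isometric)
    show "closed C" by (rule closed_subspace[OF \<open>subspace C\<close>])
    show "bounded_linear (g X)" by (rule bounded_bilinear.bounded_linear_right[OF blg])
    show "\<forall>Z\<in>C. g X Z = 0 \<longrightarrow> Z = 0"
    proof (intro ballI impI)
      fix Z assume Z: "Z \<in> C" "g X Z = 0"
      then obtain k where "(ad X ^^ k) (ad X Z) = 0" by (auto simp: g0 fitting_null_def)
      then have "(ad X ^^ Suc k) Z = 0" by (simp add: funpow_Suc_right del: funpow.simps)
      then have "Z \<in> ?N" using Z(1) unfolding fitting_null_def C_def by blast
      then show "Z = 0" by (rule CN[OF Z(1)])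
    qed
  qed (rule \<open>subspace C\<close>)
  then obtain e where e: "e > 0" "\<And>Z. Z \<in> C \<Longrightarrow> norm (g X Z) \<ge> e * norm Z" by blast
  obtain B where B: "B > 0" "\<And>U Z. norm (g U Z) \<le> norm U * norm Z * B"
    using bounded_bilinear.pos_bounded[OF blg] by blast
  show thesis
  proof (rule that[of "e / B"])
    show "e / B > 0" using e B by simp
    fix Y assume Y: "Y \<in> ?N" "norm (Y - X) < e / B"
    have inj: "Z = 0" if Z: "Z \<in> C" "g Y Z = 0" for Z
    proof (rule ccontr)
      assume "Z \<noteq> 0"
      have "g Y Z = g X Z + g (Y - X) Z"
        using bounded_bilinear.add_left[OF blg, of X "Y - X" Z] by simp
      then have "norm (g X Z) = norm (g (Y - X) Z)" using Z(2) by (simp add: add_eq_0_iff)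
      then have "e * norm Z \<le> norm (Y - X) * norm Z * B" using e(2)[OF Z(1)] B(2)[of "Y - X" Z] by linarith
      moreover have "norm (Y - X) * B < e" using Y(2) B(1) by (simp add: field_simps)
      then have "norm (Y - X) * B * norm Z < e * norm Z" using \<open>Z \<noteq> 0\<close> by simp
      ultimately show False by (simp add: mult_ac)
    qed
    \<comment> \<open>Subtracting the projection \<open>p Z\<close> moves the question into the
      complement without changing it, since \<open>ad Y\<close> maps the null space to
      itself.\<close>
    have step: "Z \<in> ?N" if Z: "Z \<in> lie_algebra H" "ad Y Z \<in> ?N" for Z
    proof -
      have pZ: "p Z \<in> ?N" using p(1) by blast
      then have "p Z \<in> lie_algebra H" by (simp add: fitting_null_def)
      then have C: "Z - p Z \<in> C" using Z(1) lie_algebra_diff[OF H] linear_diff[OF p(2)] p(3)[OF pZ] by (simp add: C_def)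
      have "ad Y (Z - p Z) \<in> ?N"
        unfolding ad_diff_right by (intro subspace_diff subspace_fitting_null Z fitting_null_ad Y pZ)
      then have "Z - p Z = 0" using inj[OF C] by (simp add: g0)
      then show ?thesis using pZ by simp
    qed
    have YH: "Y \<in> lie_algebra H" using Y by (simp add: fitting_null_def)
    have "Z \<in> ?N" if "Z \<in> lie_algebra H" "(ad Y ^^ k) Z = 0" for k Z
      using that
    proof (induction k arbitrary: Z)
      case 0
      then show ?case using subspace_0[OF subspace_fitting_null] by simp
    next
      case (Suc k)
      then have "ad Y Z \<in> ?N" using lie_algebra_ad[OF H YH] by (simp add: funpow_Suc_right del: funpow.simps)
      then show ?case using step Suc.prems by blast
    qed
    then show "fitting_null H Y \<subseteq> ?N" by (auto simp: fitting_null_def)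
  qed
qed

text \<open>The map \<open>(Z, Y) \<mapsto> exp Z (X + Y) exp (- Z)\<close> has derivative \<open>Y - ad X Z\<close> at \<open>0\<close>, which by the
  Fitting decomposition maps onto the Lie algebra.\<close>

lemma conjugates_near:
  assumes X: "X \<in> lie_algebra H" and "\<delta> > 0"
  obtains \<eta> where "\<eta> > 0" "\<And>V. V \<in> lie_algebra H \<Longrightarrow> norm (V - X) < \<eta> \<Longrightarrow>
    \<exists>h\<in>H. \<exists>Y\<in>fitting_null H X. norm (Y - X) < \<delta> \<and> V = h ** Y ** matrix_inv h"
proof -
  let ?h = "lie_algebra H" and ?N = "fitting_null H X"
  note sh = subspace_lie_algebra[OF H]
  obtain p where p: "range p \<subseteq> ?h" "linear p" "\<And>v. v \<in> ?h \<Longrightarrow> p v = v"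
    using linear_exists_left_inverse_on[OF linear_id sh inj_on_id] by auto
  define L where "L = (\<lambda>(Z, Y). Y - ad X Z)"
  have L: "linear L" unfolding L_def
    by (rule linearI) (auto simp: ad_add_right ad_scale_right scaleR_eq_scale_tensor scale_tensor_diff)
  have sV: "subspace (?h \<times> ?N)" by (intro subspace_Times sh subspace_fitting_null)
  obtain g where g: "range g \<subseteq> ?h \<times> ?N" "linear g" "\<And>W. W \<in> L ` (?h \<times> ?N) \<Longrightarrow> L (g W) = W"
    using linear_exists_right_inverse_on[OF L sV] by auto
  have surj: "W \<in> L ` (?h \<times> ?N)" if W: "W \<in> ?h" for W
  proof -
    obtain w where w: "w \<in> ?h" "(ad X ^^ DIM(complex^'n^'n)) (W - (ad X ^^ DIM(complex^'n^'n)) w) = 0"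
      using fitting_decomposition(1)[OF linear_ad sh lie_algebra_ad[OF H X] W] by blast
    \<comment> \<open>One factor is split off so that (ad X)^(d + 1) w is displayed as a value of
      \<open>ad X\<close>; \<open>W\<close> is then a null vector plus such a value.\<close>
    define d where "d = DIM(complex^'n^'n) - 1"
    have d: "DIM(complex^'n^'n) = Suc d" using DIM_positive[where 'a="complex^'n^'n"] unfolding d_def by linarith
    have fh: "(ad X ^^ k) w \<in> ?h" for k using w(1) by (induction k) (auto intro: lie_algebra_ad[OF H X])
    have "W - (ad X ^^ Suc d) w \<in> ?N"
      unfolding fitting_null_eq by (intro CollectI conjI lie_algebra_diff[OF H W fh])
        (use w(2) in \<open>simp only: d\<close>)
    moreover have "- (ad X ^^ d) w \<in> ?h" by (intro subspace_neg sh fh)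
    moreover have "L (- (ad X ^^ d) w, W - (ad X ^^ Suc d) w) = W"
      using ad_diff_right[of X 0 "(ad X ^^ d) w"] by (simp add: L_def)
    ultimately show ?thesis by (intro image_eqI[of _ _ "(- (ad X ^^ d) w, W - (ad X ^^ Suc d) w)"]) simp_all
  qed
  define Zf where "Zf W = fst (g (p W))" for W
  define Yf where "Yf W = snd (g (p W))" for W
  have ZY: "Zf W \<in> ?h" "Yf W \<in> ?N" "Yf W - ad X (Zf W) = p W" for W
  proof -
    have "g (p W) \<in> ?h \<times> ?N" using g(1) by blast
    then show "Zf W \<in> ?h" "Yf W \<in> ?N" by (auto simp: Zf_def Yf_def mem_Times_iff)
    have "L (g (p W)) = p W" using p(1) by (intro g(3) surj) blast
    then show "Yf W - ad X (Zf W) = p W" by (simp add: L_def Zf_def Yf_def split_def)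
  qed
  have lin: "bounded_linear Zf" "bounded_linear Yf" "bounded_linear p"
  proof -
    have "linear (\<lambda>W. g (p W))" using linear_compose[OF p(2) g(2)] by (simp add: o_def)
    then have bl: "bounded_linear (\<lambda>W. g (p W))" by (simp add: linear_conv_bounded_linear)
    show "bounded_linear Zf" unfolding Zf_def[abs_def] by (rule bounded_linear_compose[OF bounded_linear_fst bl])
    show "bounded_linear Yf" unfolding Yf_def[abs_def] by (rule bounded_linear_compose[OF bounded_linear_snd bl])
    show "bounded_linear p" using p(2) by (simp add: linear_conv_bounded_linear)
  qed
  \<comment> \<open>The term \<open>W - p W\<close> extends the conjugation map from the Lie algebra
    to all matrices. With it the derivative at 0 is the identity, so the open mapping argument works
    on the full space.\<close>
  define F where "F W = matrix_exp (Zf W) ** (X + Yf W) ** matrix_exp (- Zf W) + (W - p W)" for W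
  have F0: "F 0 = X" using linear_0[OF lin(1)[THEN bounded_linear.linear]] linear_0[OF lin(2)[THEN bounded_linear.linear]] linear_0[OF p(2)]
    by (simp add: F_def)
  have dZ: "((\<lambda>W. matrix_exp (Zf W)) has_derivative (\<lambda>W. Zf W)) (at 0)"
  proof (rule has_derivative_compose[OF bounded_linear_imp_has_derivative[OF lin(1)]])
    show "(matrix_exp has_derivative (\<lambda>X. X)) (at (Zf 0))"
      using matrix_exp_has_derivative_0 linear_0[OF lin(1)[THEN bounded_linear.linear]] by simp
  qed
  have dZ': "((\<lambda>W. matrix_exp (- Zf W)) has_derivative (\<lambda>W. - Zf W)) (at 0)"
  proof (rule has_derivative_compose[OF has_derivative_minus[OF bounded_linear_imp_has_derivative[OF lin(1)]]])
    show "(matrix_exp has_derivative (\<lambda>X. X)) (at (- Zf 0))"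
      using matrix_exp_has_derivative_0 linear_0[OF lin(1)[THEN bounded_linear.linear]] by simp
  qed
  have z0: "Zf 0 = 0" "Yf 0 = 0" using linear_0 lin(1,2) bounded_linear.linear by blast+
  have "(F has_derivative (\<lambda>W. (matrix_exp (Zf 0) ** (X + Yf 0)) ** (- Zf W) + (matrix_exp (Zf 0) ** (0 + Yf W) + Zf W ** (X + Yf 0)) ** matrix_exp (- Zf 0) + (W - p W))) (at 0)"
    unfolding F_def[abs_def]
    by (intro has_derivative_add has_derivative_diff bounded_bilinear.FDERIV[OF bounded_bilinear_matrix_mul]
        dZ dZ' has_derivative_const bounded_linear_imp_has_derivative lin has_derivative_ident)
  then have dF: "(F has_derivative (\<lambda>W. X ** (- Zf W) + (Yf W + Zf W ** X) + (W - p W))) (at 0)"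
    by (simp add: z0)
  have dW: "X ** (- Zf W) + (Yf W + Zf W ** X) + (W - p W) = W" for W
    using ZY(3)[of W] by (simp add: ad_def matrix_mul_minus_right algebra_simps)
  have dF: "(F has_derivative (\<lambda>W. W)) (at 0)" using dF unfolding dW .
  have contF: "continuous_on UNIV F"
    unfolding F_def[abs_def]
    by (intro continuous_on_add continuous_on_diff continuous_on_matrix_mul continuous_on_const continuous_on_id
        continuous_on_compose2[OF continuous_on_matrix_exp[of UNIV]] continuous_on_minus linear_continuous_on lin) auto
  obtain b where b: "b > 0" "\<And>W. norm (Yf W) \<le> norm W * b" using bounded_linear.pos_bounded[OF lin(2)] by blast
  let ?T = "ball 0 (\<delta> / b)"
  have "F 0 \<in> interior (F ` ?T)"
    by (rule sussmann_open_mapping[OF open_UNIV contF UNIV_I dF bounded_linear_ident])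
      (use \<open>\<delta> > 0\<close> b in \<open>auto simp: fun_eq_iff interior_open\<close>)
  then obtain \<eta> where \<eta>: "\<eta> > 0" "ball X \<eta> \<subseteq> F ` ?T" by (auto simp: F0 mem_interior)
  show thesis
  proof (rule that[OF \<eta>(1)])
    fix V assume V: "V \<in> ?h" "norm (V - X) < \<eta>"
    then have "V \<in> F ` ?T" using \<eta>(2) by (auto simp: dist_norm norm_minus_commute)
    then obtain W where W: "V = F W" "norm W < \<delta> / b" by (auto simp: dist_norm)
    let ?e = "matrix_exp (Zf W)"
    have e: "?e \<in> H" by (rule lie_algebra_exp[OF H ZY(1)])
    have ei: "matrix_inv ?e = matrix_exp (- Zf W)"
      by (rule matrix_inv_unique) (simp_all add: matrix_exp_minus matrix_exp_minus')
    have XN: "X + Yf W \<in> ?N" by (intro subspace_add subspace_fitting_null fitting_null_self X ZY)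
    then have "?e ** (X + Yf W) ** matrix_inv ?e \<in> ?h" using lie_algebra_conj[OF H e] by (simp add: fitting_null_def)
    then have "V - ?e ** (X + Yf W) ** matrix_inv ?e \<in> ?h" by (rule lie_algebra_diff[OF H V(1)])
    moreover have "V - ?e ** (X + Yf W) ** matrix_inv ?e = W - p W" by (simp add: W(1) F_def ei)
    ultimately have "W - p W \<in> ?h" by simp
    \<comment> \<open>When the value lies in the Lie algebra so does the added term, on which
      \<open>p\<close> is the identity; since \<open>p\<close> also kills it, the term is 0 and the
      value is a genuine conjugate.\<close>
    moreover have "p (W - p W) = 0" using p(1) p(3)[of "p W"] by (simp add: linear_diff[OF p(2)] range_subsetD)
    ultimately have "W - p W = 0" using p(3) by metis
    then have "V = ?e ** (X + Yf W) ** matrix_inv ?e" by (simp add: W(1) F_def ei)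
    moreover have "norm (X + Yf W - X) < \<delta>"
    proof -
      have "norm W * b < \<delta>" using W(2) b(1) by (simp add: field_simps)
      then show ?thesis using b(2)[of W] by simp
    qed
    ultimately show "\<exists>h\<in>H. \<exists>Y\<in>?N. norm (Y - X) < \<delta> \<and> V = h ** Y ** matrix_inv h"
      using e XN by blast
  qed
qed

end

section \<open>Regular elements\<close>

definition conj_by :: "complex^'n^'n \<Rightarrow> complex^'n^'n \<Rightarrow> complex^'n^'n" where
  "conj_by g X = g ** X ** matrix_inv g"

lemma conj_by_inverse:
  assumes "invertible g"
  shows "conj_by g (conj_by (matrix_inv g) X) = X" "conj_by (matrix_inv g) (conj_by g X) = X"
proof -
  note i = matrix_inv_mult[OF assms]
  have ii: "matrix_inv (matrix_inv g) = g" by (rule matrix_inv_unique[OF i(2,1)])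
  have "conj_by g (conj_by (matrix_inv g) X) = (g ** matrix_inv g) ** X ** (g ** matrix_inv g)"
    by (simp only: conj_by_def ii matrix_mul_assoc)
  then show "conj_by g (conj_by (matrix_inv g) X) = X" by (simp add: i)
  have "conj_by (matrix_inv g) (conj_by g X) = (matrix_inv g ** g) ** X ** (matrix_inv g ** g)"
    by (simp only: conj_by_def ii matrix_mul_assoc)
  then show "conj_by (matrix_inv g) (conj_by g X) = X" by (simp add: i)
qed

lemma matrix_inv_matrix_mult:
  assumes "invertible (g :: complex^'n^'n)" "invertible (h :: complex^'n^'n)"
  shows "matrix_inv (g ** h) = matrix_inv h ** matrix_inv g"
proof (rule matrix_inv_unique)
  note i = matrix_inv_mult[OF assms(1)] matrix_inv_mult[OF assms(2)]
  have "g ** h ** (matrix_inv h ** matrix_inv g) = g ** (h ** matrix_inv h) ** matrix_inv g" by (simp only: matrix_mul_assoc)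
  then show "g ** h ** (matrix_inv h ** matrix_inv g) = mat 1" by (simp add: i)
  have "matrix_inv h ** matrix_inv g ** (g ** h) = matrix_inv h ** (matrix_inv g ** g) ** h" by (simp only: matrix_mul_assoc)
  then show "matrix_inv h ** matrix_inv g ** (g ** h) = mat 1" by (simp add: i)
qed

lemma conj_by_mult: "invertible g \<Longrightarrow> invertible h \<Longrightarrow> conj_by (g ** h) X = conj_by g (conj_by h X)"
  by (simp only: conj_by_def matrix_inv_matrix_mult matrix_mul_assoc)

lemma linear_conj_by: "linear (conj_by g)"
  by (rule linearI) (simp_all add: conj_by_def matrix_mul_add_left matrix_mul_add_right matrix_mul_scaleR_left matrix_mul_scaleR_right)

lemma inj_conj_by: "invertible g \<Longrightarrow> inj (conj_by g)"
  by (metis conj_by_inverse(2) injI)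

definition polynomial_in :: "(complex \<Rightarrow> complex) \<Rightarrow> bool" where
  "polynomial_in h \<longleftrightarrow> (\<exists>p. \<forall>c. h c = poly p c)"

lemma polynomial_in_const [simp]: "polynomial_in (\<lambda>_. a)"
  unfolding polynomial_in_def by (rule exI[of _ "[:a:]"]) simp
lemma polynomial_in_id [simp]: "polynomial_in (\<lambda>c. c)"
  unfolding polynomial_in_def by (rule exI[of _ "[:0, 1:]"]) simp
lemma polynomial_in_add: "polynomial_in f \<Longrightarrow> polynomial_in g \<Longrightarrow> polynomial_in (\<lambda>c. f c + g c)"
  unfolding polynomial_in_def by (metis poly_add)
lemma polynomial_in_diff: "polynomial_in f \<Longrightarrow> polynomial_in g \<Longrightarrow> polynomial_in (\<lambda>c. f c - g c)"
  unfolding polynomial_in_def by (metis poly_diff)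
lemma polynomial_in_mult: "polynomial_in f \<Longrightarrow> polynomial_in g \<Longrightarrow> polynomial_in (\<lambda>c. f c * g c)"
  unfolding polynomial_in_def by (metis poly_mult)
lemma polynomial_in_sum: "(\<And>x. x \<in> S \<Longrightarrow> polynomial_in (f x)) \<Longrightarrow> polynomial_in (\<lambda>c. \<Sum>x\<in>S. f x c)"
  by (induction S rule: infinite_finite_induct) (auto intro: polynomial_in_add)
lemma polynomial_in_prod: "(\<And>x. x \<in> S \<Longrightarrow> polynomial_in (f x)) \<Longrightarrow> polynomial_in (\<lambda>c. \<Prod>x\<in>S. f x c)"
  by (induction S rule: infinite_finite_induct) (auto intro: polynomial_in_mult)

text \<open>After flattening matrices to vectors, the determinant of the family is a polynomial in
  the parameter that is nonzero at 0, so it has finitely many roots.\<close>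

lemma polynomial_family_injective:
  fixes \<Phi> :: "complex \<Rightarrow> complex^'n^'n::finite \<Rightarrow> complex^'n^'n"
  assumes add: "\<And>c Z W. \<Phi> c (Z + W) = \<Phi> c Z + \<Phi> c W" and scale: "\<And>c a Z. \<Phi> c (scale_tensor a Z) = scale_tensor a (\<Phi> c Z)"
    and poly: "\<And>Z i j. polynomial_in (\<lambda>c. \<Phi> c Z $ i $ j)" and inj: "\<And>Z. \<Phi> 0 Z = 0 \<Longrightarrow> Z = 0"
  shows "finite {c. \<exists>Z. Z \<noteq> 0 \<and> \<Phi> c Z = 0}"
proof -
  define fl where "fl Z = (\<chi> p. Z $ fst p $ snd p)" for Z :: "complex^'n^'n"
  define e :: "'n \<times> 'n \<Rightarrow> complex^'n^'n" where "e q = (\<chi> i j. if (i, j) = q then 1 else 0)" for q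
  define m where "m c = (\<chi> p q. \<Phi> c (e q) $ fst p $ snd p)" for c
  have \<Phi>sum: "\<Phi> c (\<Sum>q\<in>S. F q) = (\<Sum>q\<in>S. \<Phi> c (F q))" for c F and S :: "('n \<times> 'n) set"
  proof -
    have "\<Phi> c 0 = 0" using scale[of c 0 0] by simp
    then show ?thesis by (induction S rule: infinite_finite_induct) (simp_all add: add)
  qed
  have Ze: "Z = (\<Sum>q\<in>UNIV. scale_tensor (fl Z $ q) (e q))" for Z
  proof -
    have "(\<Sum>q\<in>UNIV. fl Z $ q * e q $ i $ j) = Z $ i $ j" for i j
    proof -
      have "(\<Sum>q\<in>UNIV. fl Z $ q * e q $ i $ j) = (\<Sum>q\<in>UNIV. if q = (i, j) then Z $ i $ j else 0)"
        by (intro sum.cong) (auto simp: fl_def e_def)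
      then show ?thesis by simp
    qed
    then show ?thesis by (simp add: vec_eq_iff)
  qed
  have mfl: "m c *v fl Z = fl (\<Phi> c Z)" for c Z
  proof -
    have "\<Phi> c Z = (\<Sum>q\<in>UNIV. scale_tensor (fl Z $ q) (\<Phi> c (e q)))"
      by (subst Ze) (simp only: \<Phi>sum scale)
    then show ?thesis by (simp add: vec_eq_iff fl_def matrix_vector_mult_def m_def mult.commute)
  qed
  have fl0: "fl Z = 0 \<longleftrightarrow> Z = 0" for Z by (auto simp: fl_def vec_eq_iff)
  have ker: "det (m c) = 0 \<longleftrightarrow> (\<exists>v. v \<noteq> 0 \<and> m c *v v = 0)" for c
    using invertible_det_nz[of "m c"] invertible_left_inverse[of "m c"] matrix_left_invertible_ker[of "m c"] by blast
  have fl_surj: "\<exists>Z. v = fl Z" for v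
    by (rule exI[of _ "\<chi> i j. v $ (i, j)"]) (simp add: fl_def vec_eq_iff)
  have "polynomial_in (\<lambda>c. det (m c))"
    unfolding det_def m_def
    by (intro polynomial_in_sum polynomial_in_mult polynomial_in_prod) (simp_all add: poly)
  then obtain p where p: "\<And>c. det (m c) = poly p c" unfolding polynomial_in_def by blast
  have "det (m 0) \<noteq> 0"
  proof
    assume "det (m 0) = 0"
    then obtain v where "v \<noteq> 0" "m 0 *v v = 0" using ker by blast
    moreover obtain Z where "v = fl Z" using fl_surj by blast
    ultimately show False using inj[of Z] by (simp add: mfl fl0)
  qed
  then have "p \<noteq> 0" using p[of 0] by auto
  moreover have "{c. \<exists>Z. Z \<noteq> 0 \<and> \<Phi> c Z = 0} \<subseteq> {c. poly p c = 0}"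
  proof
    fix c assume "c \<in> {c. \<exists>Z. Z \<noteq> 0 \<and> \<Phi> c Z = 0}"
    then obtain Z where "Z \<noteq> 0" "\<Phi> c Z = 0" by blast
    then have "fl Z \<noteq> 0 \<and> m c *v fl Z = 0" by (simp add: mfl fl0)
    then show "c \<in> {c. poly p c = 0}" using ker[of c] p[of c] by auto
  qed
  ultimately show ?thesis using poly_roots_finite finite_subset by blast
qed

text \<open>A real-linear left inverse \<open>q\<close> becomes complex-linear on passing from q(Z)
  to the mean of q(Z) and -i q(i Z); this still inverts \<open>f\<close> because \<open>f\<close> is
  complex-linear.\<close>

lemma complex_linear_left_inverse:
  fixes f :: "complex^'n^'n::finite \<Rightarrow> complex^'n^'n"
  assumes f: "linear f" "\<And>c Z. f (scale_tensor c Z) = scale_tensor c (f Z)" and V: "subspace V" "\<And>c v. v \<in> V \<Longrightarrow> scale_tensor c v \<in> V"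
    and inj: "inj_on f V"
  obtains g where "\<And>Z W. g (Z + W) = g Z + g W" "\<And>c Z. g (scale_tensor c Z) = scale_tensor c (g Z)" "\<And>Z. g Z \<in> V" "\<And>v. v \<in> V \<Longrightarrow> g (f v) = v"
proof -
  obtain q where q: "range q \<subseteq> V" "linear q" "\<And>v. v \<in> V \<Longrightarrow> q (f v) = v"
    using linear_exists_left_inverse_on[OF f(1) V(1) inj] by auto
  define g where "g Z = scale_tensor (1/2) (q Z - scale_tensor \<i> (q (scale_tensor \<i> Z)))" for Z
  have gadd: "g (Z + W) = g Z + g W" for Z W
    by (simp add: g_def linear_add[OF q(2)] scale_tensor_add scale_tensor_diff)
  have gi: "g (scale_tensor \<i> Z) = scale_tensor \<i> (g Z)" for Z
  proof -
    have "q (scale_tensor (- 1) Z) = scale_tensor (- 1) (q Z)"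
      using linear_scale[OF q(2), of "-1" Z] by (simp add: scaleR_eq_scale_tensor)
    then show ?thesis by (simp add: g_def scale_tensor_diff) (simp add: vec_eq_iff)
  qed
  have gr: "g (scale_tensor (complex_of_real r) Z) = scale_tensor (complex_of_real r) (g Z)" for r Z
  proof -
    have "q (scale_tensor (complex_of_real r) Z) = scale_tensor (complex_of_real r) (q Z)" for Z
      using linear_scale[OF q(2), of r Z] by (simp add: scaleR_eq_scale_tensor)
    from this[of Z] this[of "scale_tensor \<i> Z"] show ?thesis by (simp add: g_def scale_tensor_diff mult_ac)
  qed
  show thesis
  proof (rule that[of g])
    show "g (scale_tensor c Z) = scale_tensor c (g Z)" for c Z
    proof -
      have c: "c = complex_of_real (Re c) + \<i> * complex_of_real (Im c)" by (rule complex_eq)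
      have "scale_tensor c Z = scale_tensor (complex_of_real (Re c)) Z + scale_tensor \<i> (scale_tensor (complex_of_real (Im c)) Z)" for Z :: "complex^'n^'n"
        by (subst c) (simp only: scale_tensor_add_left scale_tensor_scale_tensor)
      then show ?thesis by (simp only: gadd gi gr)
    qed
    show "g Z \<in> V" for Z
      unfolding g_def using q(1) by (intro V subspace_diff) auto
    show "g (f v) = v" if v: "v \<in> V" for v
    proof -
      have "q (scale_tensor \<i> (f v)) = scale_tensor \<i> v" using q(3)[OF V(2)[OF v]] by (simp add: f(2))
      then show ?thesis by (simp add: g_def q(3)[OF v] scale_tensor_diff) (simp add: vec_eq_iff)
    qed
  qed (rule gadd)
qed

lemma ad_funpow_scale: "(ad X ^^ k) (scale_tensor c Z) = scale_tensor c ((ad X ^^ k) Z)"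
  by (induction k) (simp_all add: ad_scale_right)

context
  fixes H :: "(complex^'n^'n::finite) set"
  assumes H: "linear_algebraic_group H"
begin

lemma fitting_null_conj:
  assumes g: "g \<in> H"
  shows "fitting_null H (conj_by g X) = conj_by g ` fitting_null H X"
proof -
  have sup: "conj_by g Z \<in> fitting_null H (conj_by g X)" if g: "g \<in> H" and Z: "Z \<in> fitting_null H X" for g X Z
  proof -
    have i: "invertible g" using linear_algebraic_groupD(4)[OF H g] .
    obtain k where k: "Z \<in> lie_algebra H" "(ad X ^^ k) Z = 0" using Z by (auto simp: fitting_null_def)
    have "(ad (conj_by g X) ^^ k) (conj_by g Z) = conj_by g ((ad X ^^ k) Z)" for k
      by (induction k) (simp_all add: conj_by_def ad_conj[OF matrix_inv_mult(2)[OF i]])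
    then have "(ad (conj_by g X) ^^ k) (conj_by g Z) = 0" using k(2) by (simp add: conj_by_def)
    moreover have "conj_by g Z \<in> lie_algebra H" unfolding conj_by_def by (rule lie_algebra_conj[OF H g k(1)])
    ultimately show ?thesis by (auto simp: fitting_null_def)
  qed
  have i: "invertible g" using linear_algebraic_groupD(4)[OF H g] .
  show ?thesis
  proof (intro equalityI subsetI)
    fix W assume "W \<in> fitting_null H (conj_by g X)"
    from sup[OF linear_algebraic_groupD(3)[OF H g] this] have "conj_by (matrix_inv g) W \<in> fitting_null H X"
      by (simp add: conj_by_inverse[OF i])
    then show "W \<in> conj_by g ` fitting_null H X"
      by (intro image_eqI[of _ _ "conj_by (matrix_inv g) W"]) (simp_all add: conj_by_inverse[OF i])
  next
    fix W assume "W \<in> conj_by g ` fitting_null H X"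
    then show "W \<in> fitting_null H (conj_by g X)" using sup[OF g] by blast
  qed
qed

lemma dim_fitting_null_conj:
  assumes g: "g \<in> H"
  shows "dim (fitting_null H (conj_by g X)) = dim (fitting_null H X)"
proof -
  have "inj (conj_by g)" using inj_conj_by linear_algebraic_groupD(4)[OF H g] by blast
  then show ?thesis unfolding fitting_null_conj[OF g]
    by (intro dim_image_eq linear_conj_by) (rule inj_on_subset, auto)
qed

text \<open>The radius for containment of null spaces is fixed first; the neighbourhood of
  \<open>X\<close> is then taken so small that the representative \<open>Y\<close> of the conjugacy
  class falls within that radius.\<close>

lemma local_structure:
  assumes X: "X \<in> lie_algebra H"
  obtains \<eta> where "\<eta> > 0" "\<And>V. V \<in> lie_algebra H \<Longrightarrow> norm (V - X) < \<eta> \<Longrightarrow>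
    \<exists>h\<in>H. \<exists>Y\<in>fitting_null H X. V = conj_by h Y \<and> fitting_null H Y \<subseteq> fitting_null H X"
proof -
  obtain \<delta> where \<delta>: "\<delta> > 0" "\<And>Y. Y \<in> fitting_null H X \<Longrightarrow> norm (Y - X) < \<delta> \<Longrightarrow> fitting_null H Y \<subseteq> fitting_null H X"
    by (rule fitting_null_near[OF H X]) (rule that)
  obtain \<eta> where \<eta>: "\<eta> > 0" "\<And>V. V \<in> lie_algebra H \<Longrightarrow> norm (V - X) < \<eta> \<Longrightarrow>
    \<exists>h\<in>H. \<exists>Y\<in>fitting_null H X. norm (Y - X) < \<delta> \<and> V = h ** Y ** matrix_inv h"
    by (rule conjugates_near[OF H X \<delta>(1)]) (rule that)
  show thesis
  proof (rule that[OF \<eta>(1)])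
    fix V assume "V \<in> lie_algebra H" "norm (V - X) < \<eta>"
    from \<eta>(2)[OF this] obtain h Y where "h \<in> H" "Y \<in> fitting_null H X" "norm (Y - X) < \<delta>" "V = h ** Y ** matrix_inv h" by blast
    then show "\<exists>h\<in>H. \<exists>Y\<in>fitting_null H X. V = conj_by h Y \<and> fitting_null H Y \<subseteq> fitting_null H X"
      using \<delta>(2)[of Y] unfolding conj_by_def by blast
  qed
qed

text \<open>For such elements the null space is what Lie theory calls a Cartan subalgebra.\<close>

definition regular :: "complex^'n^'n \<Rightarrow> bool" where
  "regular X \<longleftrightarrow> X \<in> lie_algebra H \<and> (\<forall>Y\<in>lie_algebra H. dim (fitting_null H X) \<le> dim (fitting_null H Y))"

lemma regular_exists: "\<exists>X. regular X"
  using ex_has_least_nat[of "\<lambda>X. X \<in> lie_algebra H" 0 "\<lambda>X. dim (fitting_null H X)"] lie_algebra_0[OF H]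
  unfolding regular_def by blast

lemma regular_conj:
  assumes "g \<in> H" "X \<in> lie_algebra H" "regular (conj_by g X)"
  shows "regular X"
  using assms(2,3) by (simp add: regular_def dim_fitting_null_conj[OF assms(1)])

text \<open>Regularity at \<open>c\<close> follows once the null space at \<open>c\<close> embeds
  linearly into the one of \<open>X0\<close>. The embedding is the Fitting projection of
  \<open>X0\<close>; its injectivity is deduced from that of a family of complex-linear maps
  depending polynomially on \<open>c\<close> and invertible at 0.\<close>

lemma regular_on_line:
  assumes X0: "regular X0" and U: "U \<in> lie_algebra H"
  shows "finite {c. \<not> regular (X0 + scale_tensor c U)}"
proof -
  let ?h = "lie_algebra H" and ?D = "DIM(complex^'n^'n)"
  have X: "X0 \<in> ?h" using X0 by (simp add: regular_def)
  note sh = subspace_lie_algebra[OF H]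
  define F where "F = ad X0 ^^ ?D"
  have lF: "linear F" unfolding F_def by (rule linear_funpow[OF linear_ad])
  have Fs: "F (scale_tensor c Z) = scale_tensor c (F Z)" for c Z unfolding F_def by (rule ad_funpow_scale)
  have fit1: "\<exists>w\<in>?h. F (v - F w) = 0" if "v \<in> ?h" for v
    unfolding F_def by (rule fitting_decomposition(1)[OF linear_ad sh]) (use that lie_algebra_ad[OF H X] in auto)
  have fit2: "inj_on F (F ` ?h)" and fit3: "subspace (F ` ?h)" and fit4: "F ` ?h \<subseteq> ?h"
    unfolding F_def by (rule fitting_decomposition[OF linear_ad sh] lie_algebra_ad[OF H X] | assumption)+
  obtain p where p: "\<And>Z W. p (Z + W) = p Z + p W" "\<And>c Z. p (scale_tensor c Z) = scale_tensor c (p Z)" "\<And>Z. p Z \<in> ?h" "\<And>v. v \<in> ?h \<Longrightarrow> p (id v) = v"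
  proof (rule complex_linear_left_inverse[OF linear_id _ sh _ inj_on_id])
    show "scale_tensor c v \<in> ?h" if "v \<in> ?h" for c v by (rule lie_algebra_scale[OF H that])
  qed (simp, rule that)
  have CV: "scale_tensor c v \<in> F ` ?h" if v: "v \<in> F ` ?h" for c v
  proof -
    obtain w where "w \<in> ?h" "v = F w" using v by blast
    then show ?thesis by (intro image_eqI[of _ _ "scale_tensor c w"]) (simp_all add: Fs lie_algebra_scale[OF H])
  qed
  obtain g where g: "\<And>Z W. g (Z + W) = g Z + g W" "\<And>c Z. g (scale_tensor c Z) = scale_tensor c (g Z)" "\<And>Z. g Z \<in> F ` ?h" "\<And>v. v \<in> F ` ?h \<Longrightarrow> g (F v) = v"
  proof (rule complex_linear_left_inverse[OF lF Fs fit3 _ fit2])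
    show "scale_tensor c v \<in> F ` ?h" if "v \<in> F ` ?h" for c v by (rule CV[OF that])
  qed (rule that)
  have g0: "g 0 = 0" "p 0 = 0" using g(2)[of 0 0] p(2)[of 0 0] by simp_all
  define L where "L c = X0 + scale_tensor c U" for c
  \<comment> \<open>The first term vanishes on the null space at \<open>c\<close>, where only the
    Fitting projection Z - g (F Z) of \<open>X0\<close> remains. At c = 0 it supplies injectivity on
    the image of \<open>F\<close>, and \<open>p\<close> extends everything to all matrices, so that
    a determinant is available.\<close>
  define \<Phi> where "\<Phi> c Z = (ad (L c) ^^ ?D) (p Z) + Z - g (F (p Z))" for c Z
  have lad: "(ad V ^^ k) (Z + W) = (ad V ^^ k) Z + (ad V ^^ k) W" for V Z W :: "complex^'n^'n" and k
    by (rule linear_add[OF linear_funpow[OF linear_ad]])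
  have "finite {c. \<exists>Z. Z \<noteq> 0 \<and> \<Phi> c Z = 0}"
  proof (rule polynomial_family_injective)
    show "\<Phi> c (Z + W) = \<Phi> c Z + \<Phi> c W" for c Z W
      by (simp add: \<Phi>_def p(1) lad linear_add[OF lF] g(1) algebra_simps)
    show "\<Phi> c (scale_tensor a Z) = scale_tensor a (\<Phi> c Z)" for c a Z
      by (simp add: \<Phi>_def p(2) ad_funpow_scale Fs g(2) scale_tensor_add scale_tensor_diff)
    have pl: "polynomial_in (\<lambda>c. (ad (L c) ^^ k) W $ i $ j)" for k W i j
    proof (induction k arbitrary: i j)
      case (Suc k)
      have Lp: "polynomial_in (\<lambda>c. L c $ i $ j)" for i j
        unfolding L_def by (simp add: polynomial_in_add polynomial_in_mult)
      have "polynomial_in (\<lambda>c. \<Sum>l\<in>UNIV. L c $ i $ l * (ad (L c) ^^ k) W $ l $ j)" "polynomial_in (\<lambda>c. \<Sum>l\<in>UNIV. (ad (L c) ^^ k) W $ i $ l * L c $ l $ j)"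
        by (intro polynomial_in_sum polynomial_in_mult Suc Lp)+
      moreover have "ad A B $ i $ j = (\<Sum>l\<in>UNIV. A $ i $ l * B $ l $ j) - (\<Sum>l\<in>UNIV. B $ i $ l * A $ l $ j)" for A B :: "complex^'n^'n"
        by (simp add: ad_def matrix_matrix_mult_def)
      ultimately show ?case by (simp only: funpow.simps o_apply polynomial_in_diff)
    qed simp
    show "polynomial_in (\<lambda>c. \<Phi> c Z $ i $ j)" for Z i j
      unfolding \<Phi>_def by (simp add: polynomial_in_add polynomial_in_diff pl)
    fix Z assume "\<Phi> 0 Z = 0"
    then have eq: "F (p Z) + Z = g (F (p Z))" by (simp add: \<Phi>_def L_def F_def)
    have "F (p Z) \<in> F ` ?h" using p(3) by blast
    from subspace_diff[OF fit3 g(3)[of "F (p Z)"] this] have "Z \<in> F ` ?h" by (simp only: eq[symmetric] add_diff_cancel_left')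
    then have Zh: "Z \<in> ?h" using fit4 by blast
    then have "p Z = Z" using p(4) by simp
    then have "F Z = 0" using eq g(4)[OF \<open>Z \<in> F ` ?h\<close>] by simp
    then have "F Z = F 0" by (simp add: linear_0[OF lF])
    moreover have "0 \<in> F ` ?h" by (rule subspace_0[OF fit3])
    ultimately show "Z = 0" using inj_onD[OF fit2] \<open>Z \<in> F ` ?h\<close> by blast
  qed
  moreover have "regular (L c)" if inj: "\<not> (\<exists>Z. Z \<noteq> 0 \<and> \<Phi> c Z = 0)" for c
  proof -
    have Lh: "L c \<in> ?h" unfolding L_def by (intro lie_algebra_add[OF H] X lie_algebra_scale[OF H] U)
    define E where "E Z = Z - g (F Z)" for Z
    have E: "linear E"
      by (rule linearI) (simp_all add: E_def linear_add[OF lF] g(1) g(2) scaleR_eq_scale_tensor Fs scale_tensor_diff)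
    have \<Phi>E: "\<Phi> c Z = E Z" if Z: "Z \<in> fitting_null H (L c)" for Z
    proof -
      have "Z \<in> ?h" "(ad (L c) ^^ ?D) Z = 0" using Z unfolding fitting_null_eq by blast+
      then show ?thesis using p(4)[of Z] by (simp add: \<Phi>_def E_def)
    qed
    have inj': "inj_on E (fitting_null H (L c))"
      unfolding linear_injective_on_subspace_0[OF E subspace_fitting_null[OF H]]
      using inj \<Phi>E by metis
    have "E ` fitting_null H (L c) \<subseteq> fitting_null H X0"
    proof
      fix W assume "W \<in> E ` fitting_null H (L c)"
      then obtain Z where Z: "Z \<in> ?h" "W = E Z" by (auto simp: fitting_null_def)
      obtain w where w: "w \<in> ?h" "F (Z - F w) = 0" using fit1[OF Z(1)] by blast
      have Fw: "F w \<in> ?h" using fit4 w(1) by blast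
      have "F Z = F (F w)" using w(2) by (simp add: linear_diff[OF lF])
      then have "W = Z - F w" using g(4)[of "F w"] w(1) by (simp add: Z(2) E_def)
      then show "W \<in> fitting_null H X0" unfolding fitting_null_eq
        using w(2) lie_algebra_diff[OF H Z(1) Fw] by (simp add: F_def)
    qed
    then have "dim (E ` fitting_null H (L c)) \<le> dim (fitting_null H X0)" by (rule dim_subset)
    moreover have "dim (E ` fitting_null H (L c)) = dim (fitting_null H (L c))"
      by (rule dim_image_eq[OF E]) (simp add: span_eq_iff[THEN iffD2, OF subspace_fitting_null[OF H]] inj')
    ultimately show ?thesis using X0 Lh unfolding regular_def by (metis le_trans)
  qed
  ultimately show ?thesis unfolding L_def[symmetric] by (elim finite_subset[rotated]) blast
qed

text \<open>Near a regular point every regular element is conjugate to one whose null space is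
  contained in the given one; minimality of the dimension turns containment into equality. Conjugacy
  is then an equivalence relation that is locally constant on the complex line through both elements
  with finitely many points removed, a connected set.\<close>

lemma regular_fitting_null_conjugate:
  assumes X0: "regular X0" and X1: "regular X1"
  shows "\<exists>h\<in>H. fitting_null H X1 = conj_by h ` fitting_null H X0"
proof -
  define U where "U = X1 - X0"
  define L where "L c = X0 + scale_tensor c U" for c
  have U: "U \<in> lie_algebra H" unfolding U_def using X0 X1 lie_algebra_diff[OF H] by (simp add: regular_def)
  define \<Omega> where "\<Omega> = {c. regular (L c)}"
  have "finite (- \<Omega>)"
    using regular_on_line[OF X0 U] by (simp add: \<Omega>_def L_def Collect_neg_eq[symmetric])
  then have "connected \<Omega>"
    using path_connected_complement_countable[of "- \<Omega>"] by (simp add: countable_finite path_connected_imp_connected)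
  define R where "R c c' \<longleftrightarrow> (\<exists>h\<in>H. fitting_null H (L c') = conj_by h ` fitting_null H (L c))" for c c'
  have "R 0 1"
  proof (rule connected_equivalence_relation[OF \<open>connected \<Omega>\<close>])
    show "0 \<in> \<Omega>" using X0 by (simp add: \<Omega>_def L_def)
    show "1 \<in> \<Omega>" using X1 by (simp add: \<Omega>_def L_def U_def)
    show "R y x" if xy: "R x y" for x y
    proof -
      obtain h where h: "h \<in> H" "fitting_null H (L y) = conj_by h ` fitting_null H (L x)" using xy by (auto simp: R_def)
      have "invertible h" using linear_algebraic_groupD(4)[OF H h(1)] .
      then have "conj_by (matrix_inv h) ` fitting_null H (L y) = fitting_null H (L x)"
        by (simp add: h(2) image_image conj_by_inverse)
      then show ?thesis unfolding R_def using linear_algebraic_groupD(3)[OF H h(1)] by metis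
    qed
    show "R x z" if xyz: "R x y" "R y z" for x y z
    proof -
      obtain h k where hk: "h \<in> H" "fitting_null H (L y) = conj_by h ` fitting_null H (L x)"
        "k \<in> H" "fitting_null H (L z) = conj_by k ` fitting_null H (L y)" using xyz by (auto simp: R_def)
      have "fitting_null H (L z) = conj_by (k ** h) ` fitting_null H (L x)"
        using linear_algebraic_groupD(4)[OF H] hk by (simp add: image_image conj_by_mult)
      then show ?thesis unfolding R_def using linear_algebraic_groupD(2)[OF H hk(3,1)] by metis
    qed
    fix a assume a: "a \<in> \<Omega>"
    then have La: "L a \<in> lie_algebra H" by (simp add: \<Omega>_def regular_def)
    obtain \<eta> where \<eta>: "\<eta> > 0" "\<And>V. V \<in> lie_algebra H \<Longrightarrow> norm (V - L a) < \<eta> \<Longrightarrow>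
        \<exists>h\<in>H. \<exists>Y\<in>fitting_null H (L a). V = conj_by h Y \<and> fitting_null H Y \<subseteq> fitting_null H (L a)"
      by (rule local_structure[OF La]) (rule that)
    define T where "T = \<Omega> \<inter> {c. norm (L c - L a) < \<eta>}"
    have "continuous_on UNIV (\<lambda>c. norm (L c - L a))"
      unfolding L_def by (intro continuous_intros bounded_linear.continuous_on[OF bounded_linear_scale_tensor_left])
    then have "open {c. norm (L c - L a) < \<eta>}" using open_Collect_less[of "\<lambda>c. norm (L c - L a)" "\<lambda>_. \<eta>"] by simp
    then have "openin (top_of_set \<Omega>) T" unfolding T_def by (rule openin_open_Int)
    moreover have "a \<in> T" using a \<eta>(1) by (simp add: T_def)
    moreover have "R a c" if c: "c \<in> T" for c
    proof -
      have reg: "regular (L c)" using c by (simp add: T_def \<Omega>_def)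
      then obtain h Y where hY: "h \<in> H" "Y \<in> fitting_null H (L a)" "L c = conj_by h Y" "fitting_null H Y \<subseteq> fitting_null H (L a)"
        using \<eta>(2)[of "L c"] c by (auto simp: T_def regular_def)
      have Yh: "Y \<in> lie_algebra H" using hY(2) by (simp add: fitting_null_def)
      have "regular Y" using regular_conj[OF hY(1) Yh] reg hY(3) by simp
      then have "dim (fitting_null H (L a)) \<le> dim (fitting_null H Y)" using a Yh by (simp add: \<Omega>_def regular_def)
      then have "fitting_null H Y = fitting_null H (L a)"
        by (intro subspace_dim_equal subspace_fitting_null[OF H] hY(4))
      then have "fitting_null H (L c) = conj_by h ` fitting_null H (L a)" by (simp add: hY(3) fitting_null_conj[OF hY(1)])
      then show ?thesis unfolding R_def using hY(1) by blast
    qed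
    ultimately show "\<exists>T. openin (top_of_set \<Omega>) T \<and> a \<in> T \<and> (\<forall>x\<in>T. R a x)" by blast
  qed
  then show ?thesis by (simp add: R_def L_def U_def)
qed

end

section \<open>Conjugacy of maximal tori\<close>

text \<open>The k-th iterate is a combination of products n^i W n^j with i + j = k. For k = 2 N one
  of the exponents is at least N.\<close>

lemma ad_nilpotent:
  fixes n W :: "complex^'n^'n::finite"
  assumes "matrix_power n N = 0"
  shows "(ad n ^^ (N + N)) W = 0"
proof -
  define T where "T k = span {matrix_power n i ** W ** matrix_power n j | i j. i + j = k}" for k
  have "(ad n ^^ k) W \<in> T k" for k
  proof (induction k)
    case 0
    have "W \<in> {matrix_power n i ** W ** matrix_power n j | i j. i + j = 0}" by auto
    then show ?case unfolding T_def by (auto intro: span_base)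
  next
    case (Suc k)
    have "ad n Z \<in> T (Suc k)" if "Z \<in> T k" for Z
      using that unfolding T_def
    proof (induction rule: span_induct_alt)
      case base
      show ?case by (simp add: span_zero)
    next
      case (step c x y)
      then obtain i j where x: "x = matrix_power n i ** W ** matrix_power n j" "i + j = k" by blast
      have comm: "n ** matrix_power n j = matrix_power n j ** n" for j
      proof (induction j)
        case (Suc j)
        have "n ** matrix_power n (Suc j) = n ** (matrix_power n j ** n)" by (simp only: matrix_power_Suc Suc)
        then show ?case by (simp only: matrix_power_Suc matrix_mul_assoc)
      qed simp
      have "ad n x = matrix_power n (Suc i) ** W ** matrix_power n j - matrix_power n i ** W ** matrix_power n (Suc j)"
        unfolding ad_def x matrix_power_Suc by (simp add: comm[of j] matrix_mul_assoc)
      moreover have "matrix_power n (Suc i) ** W ** matrix_power n j \<in> span {matrix_power n i ** W ** matrix_power n j | i j. i + j = Suc k}"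
        by (intro span_base CollectI exI[of _ "Suc i"] exI[of _ j] conjI refl) (simp add: x(2)[symmetric])
      moreover have "matrix_power n i ** W ** matrix_power n (Suc j) \<in> span {matrix_power n i ** W ** matrix_power n j | i j. i + j = Suc k}"
        by (intro span_base CollectI exI[of _ i] exI[of _ "Suc j"] conjI refl) (simp add: x(2)[symmetric])
      ultimately have adx: "ad n x \<in> span {matrix_power n i ** W ** matrix_power n j | i j. i + j = Suc k}"
        by (simp only: span_diff)
      have "ad n (c *\<^sub>R x + y) = c *\<^sub>R ad n x + ad n y"
        by (simp only: ad_add_right ad_scale_right scaleR_eq_scale_tensor)
      then show ?case using span_add[OF span_scale[OF adx] step(2)] by (simp only:)
    qed
    then show ?case using Suc by simp
  qed
  moreover have "T (N + N) \<subseteq> {0}"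
  proof -
    have z: "matrix_power n i = 0" if "i \<ge> N" for i
      using matrix_power_add[of n N "i - N"] that assms by simp
    have "matrix_power n i ** W ** matrix_power n j = 0" if "i + j = N + N" for i j
    proof (cases "i \<ge> N")
      case False
      then have "j \<ge> N" using that by linarith
      then show ?thesis by (simp add: z)
    qed (simp add: z)
    then have "{matrix_power n i ** W ** matrix_power n j | i j. i + j = N + N} \<subseteq> {0}" by blast
    from span_mono[OF this] show ?thesis unfolding T_def by simp
  qed
  ultimately show ?thesis by blast
qed

text \<open>On the block cut out by the eigenprojections for \<open>d\<close> and \<open>e\<close>
  the commutator acts as the scalar d - e. A power of it can vanish only if all blocks with distinct
  eigenvalues do.\<close>

lemma ad_diagonalizable_kernel:
  fixes \<tau> :: "complex \<Rightarrow> complex^'n^'n::finite"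
  assumes \<tau>: "idempotent_system J \<tau>" and Z: "(ad (diag_comb J \<tau> id) ^^ k) Z = 0"
  shows "diag_comb J \<tau> id ** Z = Z ** diag_comb J \<tau> id"
proof -
  let ?s = "diag_comb J \<tau> id"
  have k: "\<tau> d ** (ad ?s ^^ k) Z ** \<tau> e = scale_tensor ((d - e) ^ k) (\<tau> d ** Z ** \<tau> e)" if de: "d \<in> J" "e \<in> J" for d e k
  proof (induction k)
    case (Suc k)
    let ?Y = "(ad ?s ^^ k) Z"
    have "\<tau> d ** ad ?s ?Y ** \<tau> e = (\<tau> d ** ?s) ** ?Y ** \<tau> e - \<tau> d ** ?Y ** (?s ** \<tau> e)"
      by (simp add: ad_def matrix_mul_diff_left matrix_mul_diff_right matrix_mul_assoc)
    also have "\<dots> = scale_tensor (d - e) (\<tau> d ** ?Y ** \<tau> e)"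
      by (simp add: diag_comb_idempotent[OF \<tau> de(1)] diag_comb_idempotent[OF \<tau> de(2)] scale_tensor_mul_left scale_tensor_mul_right scale_tensor_diff_left)
    finally show ?case by (simp only: funpow.simps o_apply Suc scale_tensor_scale_tensor power_Suc)
  qed simp
  have 0: "\<tau> d ** Z ** \<tau> e = 0" if "d \<in> J" "e \<in> J" "d \<noteq> e" for d e
  proof -
    have "scale_tensor ((d - e) ^ k) (\<tau> d ** Z ** \<tau> e) = 0" using k[OF that(1,2), of k] Z by simp
    then have "scale_tensor (inverse ((d - e) ^ k)) (scale_tensor ((d - e) ^ k) (\<tau> d ** Z ** \<tau> e)) = 0" by simp
    then show ?thesis using that(3) by simp
  qed
  have one: "(\<Sum>d\<in>J. \<tau> d) = mat 1" using \<tau> by (simp add: idempotent_system_def)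
  have "?s ** Z = (\<Sum>e\<in>J. \<Sum>d\<in>J. scale_tensor d (\<tau> d ** Z ** \<tau> e))"
  proof -
    have "?s ** Z = ?s ** Z ** (\<Sum>e\<in>J. \<tau> e)" by (simp add: one)
    then show ?thesis by (simp add: matrix_mul_sum_right diag_comb_def matrix_mul_sum_left scale_tensor_mul_left)
  qed
  also have "\<dots> = (\<Sum>e\<in>J. \<Sum>d\<in>J. scale_tensor e (\<tau> d ** Z ** \<tau> e))"
  proof (intro sum.cong refl)
    fix d e assume "d \<in> J" "e \<in> J"
    then show "scale_tensor d (\<tau> d ** Z ** \<tau> e) = scale_tensor e (\<tau> d ** Z ** \<tau> e)"
      using 0 by (cases "d = e") simp_all
  qed
  also have "\<dots> = Z ** ?s"
  proof -
    have "Z ** ?s = (\<Sum>d\<in>J. \<tau> d) ** Z ** ?s" by (simp add: one)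
    also have "\<dots> = (\<Sum>e\<in>J. \<Sum>d\<in>J. scale_tensor e (\<tau> d ** Z ** \<tau> e))"
      by (simp only: diag_comb_def id_apply matrix_mul_sum_right scale_tensor_mul_right) (simp only: matrix_mul_sum_left scale_tensor_sum)
    finally show ?thesis by (rule sym)
  qed
  finally show ?thesis .
qed

text \<open>A regular \<open>Y\<close> in the null space of the generator \<open>\<sigma>\<close>,
  up to conjugation arbitrarily near, centralizes the torus. Its semisimple part commutes with that
  whole null space, so \<open>ad Y\<close> is nilpotent there. The two null spaces therefore
  coincide, and \<open>\<sigma>\<close> is regular as well.\<close>

lemma maximal_torus_regular_element:
  fixes S H :: "(complex^'n^'n::finite) set"
  assumes H: "linear_algebraic_group H" and S: "maximal_torus S H"
  obtains \<sigma> where "regular H \<sigma>" "\<And>Z. Z \<in> fitting_null H \<sigma> \<Longrightarrow> \<sigma> ** Z = Z ** \<sigma>"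
    "\<And>Z s. \<sigma> ** Z = Z ** \<sigma> \<Longrightarrow> s \<in> S \<Longrightarrow> Z ** s = s ** Z"
proof -
  have tS: "torus S" and SH: "S \<subseteq> H" using S by (auto simp: maximal_torus_def)
  obtain \<sigma> and J :: "complex set" and \<tau> where \<sigma>: "\<sigma> \<in> lie_algebra S" "idempotent_system J \<tau>" "\<sigma> = diag_comb J \<tau> id"
    "\<And>s. s \<in> S \<Longrightarrow> \<exists>x. s = diag_comb J \<tau> x"
    "\<And>Z d. Z ** \<sigma> = \<sigma> ** Z \<Longrightarrow> d \<in> J \<Longrightarrow> Z ** \<tau> d = \<tau> d ** Z"
    by (rule torus_generator[OF tS]) (rule that)
  have \<sigma>H: "\<sigma> \<in> lie_algebra H" using \<sigma>(1) SH by (auto simp: lie_algebra_def)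
  have c1: "\<sigma> ** Z = Z ** \<sigma>" if Z: "Z \<in> fitting_null H \<sigma>" for Z
  proof -
    obtain k where "(ad \<sigma> ^^ k) Z = 0" using Z by (auto simp: fitting_null_def)
    then show ?thesis unfolding \<sigma>(3) by (rule ad_diagonalizable_kernel[OF \<sigma>(2)])
  qed
  have c2: "Z ** s = s ** Z" if Z: "\<sigma> ** Z = Z ** \<sigma>" and s: "s \<in> S" for Z s
  proof -
    obtain x where x: "s = diag_comb J \<tau> x" using \<sigma>(4)[OF s] by blast
    have "Z ** \<tau> d = \<tau> d ** Z" if "d \<in> J" for d by (rule \<sigma>(5)[OF Z[symmetric] that])
    then show ?thesis
      by (simp add: x diag_comb_def matrix_mul_sum_left matrix_mul_sum_right scale_tensor_mul_left scale_tensor_mul_right)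
  qed
  obtain \<eta> where \<eta>: "\<eta> > 0" "\<And>V. V \<in> lie_algebra H \<Longrightarrow> norm (V - \<sigma>) < \<eta> \<Longrightarrow>
      \<exists>h\<in>H. \<exists>Y\<in>fitting_null H \<sigma>. V = conj_by h Y \<and> fitting_null H Y \<subseteq> fitting_null H \<sigma>"
    by (rule local_structure[OF H \<sigma>H]) (rule that)
  obtain X0 where X0: "regular H X0" using regular_exists[OF H] by blast
  define U where "U = \<sigma> - X0"
  have U: "U \<in> lie_algebra H" using \<sigma>H X0 lie_algebra_diff[OF H] by (simp add: U_def regular_def[OF H])
  \<comment> \<open>The generator sits at c = 1 on this line. Every neighbourhood of 1 is infinite,
    while only finitely many parameters are not regular.\<close>
  have "\<exists>c. regular H (X0 + scale_tensor c U) \<and> norm (X0 + scale_tensor c U - \<sigma>) < \<eta>"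
  proof -
    let ?W = "{c. norm (X0 + scale_tensor c U - \<sigma>) < \<eta>}"
    have "continuous_on UNIV (\<lambda>c. norm (X0 + scale_tensor c U - \<sigma>))"
      by (intro continuous_intros bounded_linear.continuous_on[OF bounded_linear_scale_tensor_left])
    then have "open ?W" using open_Collect_less[of "\<lambda>c. norm (X0 + scale_tensor c U - \<sigma>)" "\<lambda>_. \<eta>"] by simp
    moreover have "1 \<in> ?W" using \<eta>(1) by (simp add: U_def)
    ultimately have "infinite ?W" using not_open_singleton finite_imp_not_open by blast
    then have "\<not> ?W \<subseteq> {c. \<not> regular H (X0 + scale_tensor c U)}"
      using regular_on_line[OF H X0 U] finite_subset by blast
    then show ?thesis by blast
  qed
  then obtain V where V: "regular H V" "norm (V - \<sigma>) < \<eta>" by blast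
  then have Vh: "V \<in> lie_algebra H" by (simp add: regular_def[OF H])
  obtain h Y where hY: "h \<in> H" "Y \<in> fitting_null H \<sigma>" "V = conj_by h Y" "fitting_null H Y \<subseteq> fitting_null H \<sigma>"
    using \<eta>(2)[OF Vh V(2)] by blast
  have Yh: "Y \<in> lie_algebra H" using hY(2) by (simp add: fitting_null_def)
  have Yreg: "regular H Y" using regular_conj[OF H hY(1) Yh] V(1) hY(3) by simp
  have YS: "Y ** s = s ** Y" if "s \<in> S" for s by (rule c2[OF c1[OF hY(2)] that])
  obtain Ys N where Ys: "matrix_power (Y - Ys) N = 0" "\<And>W. (\<And>s. s \<in> S \<Longrightarrow> W ** s = s ** W) \<Longrightarrow> W ** Ys = Ys ** W"
  proof (rule maximal_torus_semisimple_part[OF H S Yh])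
    show "Y ** s = s ** Y" if "s \<in> S" for s by (rule YS[OF that])
  qed (rule that, assumption, blast)
  \<comment> \<open>The iterates of \<open>W\<close> must be kept inside the null space of
    \<open>\<sigma>\<close>: only there does the semisimple part \<open>Ys\<close> commute with
    them, so that \<open>ad Y\<close> may be replaced by the nilpotent
    \<open>ad (Y - Ys)\<close>.\<close>
  have "fitting_null H \<sigma> \<subseteq> fitting_null H Y"
  proof
    fix W assume W: "W \<in> fitting_null H \<sigma>"
    have eq: "(ad Y ^^ k) W = (ad (Y - Ys) ^^ k) W \<and> (ad Y ^^ k) W \<in> fitting_null H \<sigma>" for k
    proof (induction k)
      case (Suc k)
      let ?W = "(ad Y ^^ k) W"
      have "\<sigma> ** ?W = ?W ** \<sigma>" by (rule c1) (use Suc in blast)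
      then have "?W ** s = s ** ?W" if "s \<in> S" for s using that by (rule c2)
      then have "ad Ys ?W = 0" using Ys(2)[of ?W] by (simp add: ad_eq_0_iff)
      then have "ad Y ?W = ad (Y - Ys) ?W" by (simp add: ad_diff_left)
      then show ?case using conjunct1[OF Suc] fitting_null_ad[OF H hY(2) conjunct2[OF Suc]]
        by (simp only: funpow.simps o_apply)
    qed (simp add: W)
    have "(ad Y ^^ (N + N)) W = 0" using eq[of "N + N"] ad_nilpotent[OF Ys(1), of W] by simp
    moreover have "W \<in> lie_algebra H" using W by (simp add: fitting_null_def)
    ultimately show "W \<in> fitting_null H Y" unfolding fitting_null_def by blast
  qed
  then have "fitting_null H \<sigma> = fitting_null H Y" using hY(4) by blast
  then have "regular H \<sigma>" using Yreg \<sigma>H by (simp add: regular_def[OF H])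
  then show thesis using c1 c2 by (rule that)
qed

lemma poly_fun_compose_conj:
  fixes P Q :: "complex^'n^'n::finite"
  assumes "poly_fun f"
  shows "poly_fun (\<lambda>g. f (P ** g ** Q))"
  using assms
proof (induction rule: poly_fun_induct)
  case (entry i j)
  show ?case by (rule poly_fun_matrix_mul)
qed (auto intro: poly_fun_add poly_fun_mult)

text \<open>Testing against all vanishing polynomial functions, in place of some unspecified set of
  equations, behaves well under substitutions such as conjugation.\<close>

lemma zariski_closed_GL_iff:
  fixes S :: "(complex^'n^'n::finite) set"
  shows "zariski_closed_GL S \<longleftrightarrow> (\<forall>g\<in>S. invertible g) \<and>
    (\<forall>g. invertible g \<longrightarrow> (\<forall>f. poly_fun f \<longrightarrow> (\<forall>h\<in>S. f h = 0) \<longrightarrow> f g = 0) \<longrightarrow> g \<in> S)"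
proof
  assume "zariski_closed_GL S"
  then obtain I where I: "S = {g. invertible g \<and> (\<forall>p\<in>I. eval_poly p g = 0)}" by (auto simp: zariski_closed_GL_def)
  show "(\<forall>g\<in>S. invertible g) \<and> (\<forall>g. invertible g \<longrightarrow> (\<forall>f. poly_fun f \<longrightarrow> (\<forall>h\<in>S. f h = 0) \<longrightarrow> f g = 0) \<longrightarrow> g \<in> S)"
  proof (intro conjI allI impI)
    fix g assume g: "invertible g" "\<forall>f. poly_fun f \<longrightarrow> (\<forall>h\<in>S. f h = 0) \<longrightarrow> f g = 0"
    have "eval_poly p g = 0" if p: "p \<in> I" for p
    proof -
      have "\<forall>h\<in>S. eval_poly p h = 0" using p I by blast
      then show ?thesis using g(2) poly_fun_eval_poly[of p] by blast
    qed
    then show "g \<in> S" using g(1) I by blast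
  qed (use I in blast)
next
  assume r: "(\<forall>g\<in>S. invertible g) \<and> (\<forall>g. invertible g \<longrightarrow> (\<forall>f. poly_fun f \<longrightarrow> (\<forall>h\<in>S. f h = 0) \<longrightarrow> f g = 0) \<longrightarrow> g \<in> S)"
  show "zariski_closed_GL S"
    unfolding zariski_closed_GL_def
  proof (intro exI[of _ "{p. \<forall>h\<in>S. eval_poly p h = 0}"] equalityI subsetI)
    fix g assume "g \<in> S"
    then show "g \<in> {g. invertible g \<and> (\<forall>p\<in>{p. \<forall>h\<in>S. eval_poly p h = 0}. eval_poly p g = 0)}" using r by blast
  next
    fix g :: "complex^'n^'n" assume "g \<in> {g. invertible g \<and> (\<forall>p\<in>{p. \<forall>h\<in>S. eval_poly p h = 0}. eval_poly p g = 0)}"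
    then have g: "invertible g" "\<And>p. \<forall>h\<in>S. eval_poly p h = 0 \<Longrightarrow> eval_poly p g = 0" by auto
    have "f g = 0" if f: "poly_fun f" and f0: "\<forall>h\<in>S. f h = 0" for f
    proof -
      obtain p where "f = eval_poly p" using f by (auto simp: poly_fun_def elim: poly_pair_eval)
      then show ?thesis using g(2)[of p] f0 by simp
    qed
    then show "g \<in> S" using r g(1) by blast
  qed
qed

lemma invertible_matrix_inv: "invertible (g :: complex^'n^'n) \<Longrightarrow> invertible (matrix_inv g)"
  using matrix_inv_mult invertible_def by blast

lemma matrix_inv_matrix_inv: "invertible (g :: complex^'n^'n) \<Longrightarrow> matrix_inv (matrix_inv g) = g"
  by (rule matrix_inv_unique) (simp_all add: matrix_inv_mult)

lemma conj_by_mult_right: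
  assumes "invertible g"
  shows "conj_by g (X ** Y) = conj_by g X ** conj_by g Y"
proof -
  have "conj_by g X ** conj_by g Y = g ** X ** (matrix_inv g ** g) ** Y ** matrix_inv g"
    by (simp only: conj_by_def matrix_mul_assoc)
  then show ?thesis by (simp add: matrix_inv_mult[OF assms] conj_by_def matrix_mul_assoc)
qed

lemma linear_algebraic_group_conj:
  fixes S :: "(complex^'n^'n::finite) set"
  assumes S: "linear_algebraic_group S" and g: "invertible g"
  shows "linear_algebraic_group (conj_by g ` S)"
  unfolding linear_algebraic_group_def
proof (intro conjI ballI)
  note Sd = linear_algebraic_groupD[OF S]
  have inv: "invertible (conj_by g s)" if "s \<in> S" for s
    unfolding conj_by_def by (intro invertible_mult g invertible_matrix_inv Sd that)
  show "zariski_closed_GL (conj_by g ` S)"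
    unfolding zariski_closed_GL_iff
  proof (intro conjI allI impI ballI)
    fix h assume h: "invertible h" "\<forall>f. poly_fun f \<longrightarrow> (\<forall>h\<in>conj_by g ` S. f h = 0) \<longrightarrow> f h = 0"
    have "conj_by (matrix_inv g) h \<in> S"
    proof (rule mem_linear_algebraic_groupI[OF S])
      show "invertible (conj_by (matrix_inv g) h)"
        unfolding conj_by_def by (intro invertible_mult invertible_matrix_inv g h(1))
      fix f assume f: "poly_fun f" "\<And>s. s \<in> S \<Longrightarrow> f s = 0"
      have "poly_fun (\<lambda>h. f (conj_by (matrix_inv g) h))" unfolding conj_by_def by (rule poly_fun_compose_conj[OF f(1)])
      moreover have "\<forall>h\<in>conj_by g ` S. f (conj_by (matrix_inv g) h) = 0" using f(2) by (auto simp: conj_by_inverse[OF g])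
      ultimately show "f (conj_by (matrix_inv g) h) = 0" using h(2) by blast
    qed
    then show "h \<in> conj_by g ` S" by (intro image_eqI[of _ _ "conj_by (matrix_inv g) h"]) (simp_all add: conj_by_inverse[OF g])
  qed (use inv in auto)
  show "mat 1 \<in> conj_by g ` S"
    by (rule image_eqI[of _ _ "mat 1"]) (simp_all add: conj_by_def matrix_inv_mult[OF g] Sd(1))
  show "a ** b \<in> conj_by g ` S" if ab: "a \<in> conj_by g ` S" "b \<in> conj_by g ` S" for a b
  proof -
    obtain s t where "s \<in> S" "t \<in> S" "a = conj_by g s" "b = conj_by g t" using ab by blast
    then show ?thesis using Sd(2) by (simp add: conj_by_mult_right[OF g, symmetric])
  qed
  show "matrix_inv a \<in> conj_by g ` S" if a: "a \<in> conj_by g ` S" for a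
  proof -
    obtain s where s: "s \<in> S" "a = conj_by g s" using a by blast
    have one: "conj_by g (mat 1) = mat 1" by (simp add: conj_by_def matrix_inv_mult[OF g])
    have "matrix_inv a = conj_by g (matrix_inv s)"
      by (rule matrix_inv_unique) (simp_all add: s(2) conj_by_mult_right[OF g, symmetric] matrix_inv_mult[OF Sd(4)[OF s(1)]] one)
    then show ?thesis using Sd(3)[OF s(1)] by simp
  qed
qed

lemma torus_conj:
  fixes S :: "(complex^'n^'n::finite) set"
  assumes S: "torus S" and g: "invertible g"
  shows "torus (conj_by g ` S)"
proof -
  from S obtain P :: "complex^'n^'n" where P: "invertible P" "\<forall>s\<in>S. \<forall>i j. i \<noteq> j \<longrightarrow> (P ** s ** matrix_inv P) $ i $ j = 0"
    and conn: "connected S" and lag: "linear_algebraic_group S"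
    by (auto simp: torus_def diagonalizable_group_def)
  have "connected (conj_by g ` S)"
    using conn by (intro connected_continuous_image linear_continuous_on) (simp_all add: linear_conv_bounded_linear[symmetric] linear_conj_by)
  moreover have "invertible (P ** matrix_inv g)" using P(1) g by (intro invertible_mult invertible_matrix_inv)
  moreover have "(P ** matrix_inv g) ** conj_by g s ** matrix_inv (P ** matrix_inv g) = P ** s ** matrix_inv P" for s
  proof -
    have "(P ** matrix_inv g) ** conj_by g s ** matrix_inv (P ** matrix_inv g) =
        P ** (matrix_inv g ** g) ** s ** (matrix_inv g ** g) ** matrix_inv P"
      by (simp only: conj_by_def matrix_inv_matrix_mult[OF P(1) invertible_matrix_inv[OF g]] matrix_inv_matrix_inv[OF g] matrix_mul_assoc)
    then show ?thesis by (simp add: matrix_inv_mult[OF g])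
  qed
  ultimately show ?thesis
    unfolding torus_def diagonalizable_group_def using linear_algebraic_group_conj[OF lag g] P(2)
    by (intro conjI exI[of _ "P ** matrix_inv g"]) auto
qed

lemma maximal_torus_conj:
  fixes S H :: "(complex^'n^'n::finite) set"
  assumes H: "linear_algebraic_group H" and S: "maximal_torus S H" and g: "g \<in> H"
  shows "maximal_torus (conj_by g ` S) H"
  unfolding maximal_torus_def
proof (intro conjI allI impI)
  have i: "invertible g" using linear_algebraic_groupD(4)[OF H g] .
  note H' = linear_algebraic_groupD[OF H]
  have cH: "conj_by h x \<in> H" if "h \<in> H" "x \<in> H" for h x
    unfolding conj_by_def by (intro H'(2,3) that)
  show "torus (conj_by g ` S)" using torus_conj[OF _ i] S by (simp add: maximal_torus_def)
  show "conj_by g ` S \<subseteq> H" using S cH[OF g] by (auto simp: maximal_torus_def)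
  fix R assume R: "torus R \<and> R \<subseteq> H \<and> conj_by g ` S \<subseteq> R"
  have "torus (conj_by (matrix_inv g) ` R)" using R torus_conj invertible_matrix_inv[OF i] by blast
  moreover have "conj_by (matrix_inv g) ` R \<subseteq> H" using R cH[OF H'(3)[OF g]] by blast
  moreover have "S \<subseteq> conj_by (matrix_inv g) ` R"
  proof
    fix s assume "s \<in> S"
    then have "conj_by g s \<in> R" using R by blast
    then show "s \<in> conj_by (matrix_inv g) ` R" by (intro image_eqI[of _ _ "conj_by g s"]) (simp_all add: conj_by_inverse[OF i])
  qed
  ultimately have "conj_by (matrix_inv g) ` R = S" using S by (simp add: maximal_torus_def)
  then have "conj_by g ` S = conj_by g ` conj_by (matrix_inv g) ` R" by simp
  also have "\<dots> = R" by (simp add: image_image conj_by_inverse[OF i])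
  finally show "R = conj_by g ` S" by simp
qed

text \<open>Conjugating by \<open>h\<close> takes \<open>\<sigma>\<close> into the null space of
  \<open>\<sigma>'\<close>, so its image centralizes \<open>S'\<close>. Read backwards, each element
  of \<open>S'\<close> conjugated by the inverse of \<open>h\<close> commutes with
  \<open>\<sigma>\<close>, and hence with all of \<open>S\<close>. The conjugated torus and
  \<open>S'\<close> thus commute, and commuting maximal tori are equal.\<close>

theorem maximal_tori_conjugate:
  fixes S S' H :: "(complex^'n^'n::finite) set"
  assumes H: "linear_algebraic_group H" and S: "maximal_torus S H" and S': "maximal_torus S' H"
  obtains h where "h \<in> H" "S' = conj_by h ` S"
proof -
  obtain \<sigma> where \<sigma>: "regular H \<sigma>" "\<And>Z. Z \<in> fitting_null H \<sigma> \<Longrightarrow> \<sigma> ** Z = Z ** \<sigma>"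
    "\<And>Z s. \<sigma> ** Z = Z ** \<sigma> \<Longrightarrow> s \<in> S \<Longrightarrow> Z ** s = s ** Z"
    by (rule maximal_torus_regular_element[OF H S]) (rule that)
  obtain \<sigma>' where \<sigma>': "regular H \<sigma>'" "\<And>Z. Z \<in> fitting_null H \<sigma>' \<Longrightarrow> \<sigma>' ** Z = Z ** \<sigma>'"
    "\<And>Z s. \<sigma>' ** Z = Z ** \<sigma>' \<Longrightarrow> s \<in> S' \<Longrightarrow> Z ** s = s ** Z"
    by (rule maximal_torus_regular_element[OF H S']) (rule that)
  obtain h where h: "h \<in> H" "fitting_null H \<sigma>' = conj_by h ` fitting_null H \<sigma>"
    using regular_fitting_null_conjugate[OF H \<sigma>(1) \<sigma>'(1)] by blast
  have i: "invertible h" using linear_algebraic_groupD(4)[OF H h(1)] .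
  have "\<sigma> \<in> fitting_null H \<sigma>" using fitting_null_self[OF H] \<sigma>(1) by (simp add: regular_def[OF H])
  then have "conj_by h \<sigma> \<in> fitting_null H \<sigma>'" using h(2) by blast
  then have c: "conj_by h \<sigma> ** s' = s' ** conj_by h \<sigma>" if "s' \<in> S'" for s' using \<sigma>'(2,3) that by blast
  have "conj_by h ` S = S'"
  proof (rule commuting_maximal_tori_eq[OF H maximal_torus_conj[OF H S h(1)] S'])
    fix x s' assume "x \<in> conj_by h ` S" and s': "s' \<in> S'"
    then obtain s where s: "s \<in> S" "x = conj_by h s" by blast
    let ?c = "conj_by (matrix_inv h)"
    have m: "?c (A ** B) = ?c A ** ?c B" for A B by (rule conj_by_mult_right[OF invertible_matrix_inv[OF i]])
    have "?c (conj_by h \<sigma> ** s') = ?c (s' ** conj_by h \<sigma>)" using c[OF s'] by simp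
    then have "\<sigma> ** ?c s' = ?c s' ** \<sigma>" by (simp add: m conj_by_inverse[OF i])
    from \<sigma>(3)[OF this s(1)] have "conj_by h (?c s' ** s) = conj_by h (s ** ?c s')" by simp
    then show "x ** s' = s' ** x" by (simp add: conj_by_mult_right[OF i] conj_by_inverse[OF i] s(2))
  qed
  then show thesis using that h(1) by blast
qed

section \<open>The Weyl group\<close>

lemma torus_commute:
  fixes S :: "(complex^'n^'n::finite) set"
  assumes "torus S" "a \<in> S" "b \<in> S"
  shows "a ** b = b ** a"
proof -
  obtain J :: "complex set" and \<tau> :: "complex \<Rightarrow> complex^'n^'n" and x y where
    "idempotent_system J \<tau>" "a = diag_comb J \<tau> x" "b = diag_comb J \<tau> y"
  proof (rule torus_generator[OF assms(1)])
    fix \<sigma> and J :: "complex set" and \<tau> :: "complex \<Rightarrow> complex^'n^'n"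
    assume "idempotent_system J \<tau>" and *: "\<And>s. s \<in> S \<Longrightarrow> \<exists>x. s = diag_comb J \<tau> x"
    with *[OF assms(2)] *[OF assms(3)] that show thesis by blast
  qed
  then show ?thesis by (simp add: diag_comb_mult mult.commute)
qed

lemma linear_algebraic_group_centralizer:
  fixes G :: "(complex^'n^'n::finite) set"
  assumes G: "linear_algebraic_group G"
  shows "linear_algebraic_group {g \<in> G. \<forall>N\<in>\<N>. g ** N = N ** g}"
  unfolding linear_algebraic_group_def
proof (intro conjI ballI)
  let ?H = "{g \<in> G. \<forall>N\<in>\<N>. g ** N = N ** g}"
  note Gd = linear_algebraic_groupD[OF G]
  show "zariski_closed_GL ?H"
    unfolding zariski_closed_GL_iff
  proof (intro conjI allI impI ballI CollectI)
    show "invertible g" if "g \<in> ?H" for g using that Gd(4) by blast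
    fix g assume g: "invertible g" "\<forall>f. poly_fun f \<longrightarrow> (\<forall>h\<in>?H. f h = 0) \<longrightarrow> f g = 0"
    show "g \<in> G"
    proof (rule mem_linear_algebraic_groupI[OF G g(1)])
      fix f assume "poly_fun f" "\<And>h. h \<in> G \<Longrightarrow> f h = 0"
      then show "f g = 0" using g(2) by blast
    qed
    fix N assume N: "N \<in> \<N>"
    have "(g ** N) $ i $ j - (N ** g) $ i $ j = 0" for i j
    proof -
      have "poly_fun (\<lambda>g. (g ** N) $ i $ j - (N ** g) $ i $ j)"
        using poly_fun_matrix_mul[of "mat 1" N i j] poly_fun_matrix_mul[of N "mat 1" i j] by (simp add: poly_fun_diff)
      moreover have "\<forall>h\<in>?H. (h ** N) $ i $ j - (N ** h) $ i $ j = 0" using N by simp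
      ultimately show ?thesis using g(2) by blast
    qed
    then show "g ** N = N ** g" by (simp add: vec_eq_iff)
  qed
  show "mat 1 \<in> ?H" using Gd(1) by simp
  show "g ** h \<in> ?H" if gh: "g \<in> ?H" "h \<in> ?H" for g h
  proof -
    have "g ** h ** N = N ** (g ** h)" if "N \<in> \<N>" for N
    proof -
      have "g ** h ** N = g ** (h ** N)" by (rule matrix_mul_assoc[symmetric])
      also have "\<dots> = (g ** N) ** h" using gh(2) that by (simp add: matrix_mul_assoc)
      also have "\<dots> = N ** (g ** h)" using gh(1) that by (simp add: matrix_mul_assoc)
      finally show ?thesis .
    qed
    then show ?thesis using gh Gd(2) by blast
  qed
  show "matrix_inv g \<in> ?H" if g: "g \<in> ?H" for g
  proof -
    have i: "invertible g" using g Gd(4) by blast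
    have "matrix_inv g ** N = N ** matrix_inv g" if "N \<in> \<N>" for N
    proof -
      have "matrix_inv g ** N = matrix_inv g ** (N ** g) ** matrix_inv g"
        by (simp only: matrix_mul_assoc[symmetric] matrix_inv_mult[OF i] matrix_mul_rid)
      also have "N ** g = g ** N" using g that by simp
      also have "matrix_inv g ** (g ** N) ** matrix_inv g = N ** matrix_inv g"
        by (simp only: matrix_mul_assoc matrix_inv_mult[OF i] matrix_mul_lid)
      finally show ?thesis .
    qed
    then show ?thesis using g Gd(3) by blast
  qed
qed

lemma maximal_torus_subgroup: "maximal_torus S G \<Longrightarrow> S \<subseteq> H \<Longrightarrow> H \<subseteq> G \<Longrightarrow> maximal_torus S H"
  using order_trans[of _ H G] by (simp add: maximal_torus_def)

text \<open>Every representative \<open>n ** t\<close> of a class again normalizes the torus, since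
  \<open>t\<close> acts trivially on it by conjugation; the orbit may thus be taken under the
  normalizer.\<close>

lemma weyl_orbit_eq:
  assumes T: "torus T" and TG: "T \<subseteq> G" and G: "linear_algebraic_group (G :: (complex^'n^'n::finite) set)"
  shows "weyl_orbit G T mu = {conj_cochar n mu | n. n \<in> normalizer G T}"
proof -
  note Gd = linear_algebraic_groupD[OF G] and Td = linear_algebraic_groupD[OF torus_linear_algebraic_group[OF T]]
  have "n ** t \<in> normalizer G T" if n: "n \<in> normalizer G T" and t: "t \<in> T" for n t
  proof -
    have i: "invertible n" "invertible t" using n t Gd(4) TG by (auto simp: normalizer_def)
    have "(n ** t) ** s ** matrix_inv (n ** t) = n ** s ** matrix_inv n" if s: "s \<in> T" for s
    proof -
      have "(n ** t) ** s ** matrix_inv (n ** t) = n ** (t ** s) ** matrix_inv t ** matrix_inv n"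
        by (simp only: matrix_inv_matrix_mult[OF i] matrix_mul_assoc)
      also have "t ** s = s ** t" by (rule torus_commute[OF T t s])
      also have "n ** (s ** t) ** matrix_inv t = n ** s"
        by (simp only: matrix_mul_assoc[symmetric] matrix_inv_mult[OF i(2)] matrix_mul_rid)
      finally show ?thesis .
    qed
    then have "(\<lambda>s. (n ** t) ** s ** matrix_inv (n ** t)) ` T = (\<lambda>s. n ** s ** matrix_inv n) ` T" by simp
    then show ?thesis using n t TG Gd(2) by (auto simp: normalizer_def)
  qed
  then have le: "n \<in> normalizer G T" if "w \<in> weyl_group G T" "n \<in> w" for n w
    using that by (auto simp: weyl_group_def)
  have ge: "\<exists>w. w \<in> weyl_group G T \<and> n \<in> w" if "n \<in> normalizer G T" for n
  proof (intro exI conjI)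
    show "(\<lambda>t. n ** t) ` T \<in> weyl_group G T" unfolding weyl_group_def using that by (rule imageI)
    show "n \<in> (\<lambda>t. n ** t) ` T" by (rule image_eqI[OF _ Td(1)]) simp
  qed
  show ?thesis
  proof (intro equalityI subsetI)
    fix x assume "x \<in> weyl_orbit G T mu"
    then show "x \<in> {conj_cochar n mu | n. n \<in> normalizer G T}" unfolding weyl_orbit_def by (auto dest: le)
  next
    fix x assume "x \<in> {conj_cochar n mu | n. n \<in> normalizer G T}"
    then show "x \<in> weyl_orbit G T mu" unfolding weyl_orbit_def by (auto dest: ge)
  qed
qed

text \<open>If \<open>u\<close> carries \<open>mu\<close> to \<open>nu\<close>, then \<open>T\<close> and its conjugate by \<open>u\<close> are maximal tori of the
  centralizer of \<open>nu\<close>; an element of that centralizer conjugating one to the other corrects \<open>u\<close>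
  to an element normalizing \<open>T\<close>.\<close>

lemma conjugate_cocharacters_weyl_orbit:
  fixes G T :: "(complex^'n^'n::finite) set"
  assumes G: "linear_algebraic_group G" and T: "maximal_torus T G" and mu: "cocharacter T mu" and nu: "cocharacter T nu"
    and u: "u \<in> G" "\<And>t::complex. t \<noteq> 0 \<Longrightarrow> u ** cochar_at mu t = cochar_at nu t ** u"
  shows "nu \<in> weyl_orbit G T mu"
proof -
  note Gd = linear_algebraic_groupD[OF G]
  have tT: "torus T" and TG: "T \<subseteq> G" using T by (auto simp: maximal_torus_def)
  have iu: "invertible u" by (rule Gd(4)[OF u(1)])
  define \<N> where "\<N> = {cochar_at nu t | t::complex. t \<noteq> 0}"
  define H where "H = {g \<in> G. \<forall>N\<in>\<N>. g ** N = N ** g}"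
  have H: "linear_algebraic_group H" unfolding H_def by (rule linear_algebraic_group_centralizer[OF G])
  have HG: "H \<subseteq> G" by (auto simp: H_def)
  have nuT: "cochar_at nu t \<in> T" if "t \<noteq> 0" for t :: complex using nu that by (simp add: cocharacter_def)
  have muT: "cochar_at mu t \<in> T" if "t \<noteq> 0" for t :: complex using mu that by (simp add: cocharacter_def)
  have conj_mu: "conj_by u (cochar_at mu t) = cochar_at nu t" if "t \<noteq> 0" for t :: complex
    unfolding conj_by_def u(2)[OF that]
    by (simp only: matrix_mul_assoc[symmetric] matrix_inv_mult[OF iu] matrix_mul_rid)
  have HI: "g \<in> H" if "g \<in> G" "\<And>t::complex. t \<noteq> 0 \<Longrightarrow> g ** cochar_at nu t = cochar_at nu t ** g" for g
    unfolding H_def \<N>_def using that by blast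
  have "T \<subseteq> H"
  proof
    fix s assume s: "s \<in> T"
    show "s \<in> H"
    proof (rule HI)
      show "s ** cochar_at nu t = cochar_at nu t ** s" if "t \<noteq> 0" for t :: complex
        by (rule torus_commute[OF tT s nuT[OF that]])
    qed (use s TG in blast)
  qed
  then have 1: "maximal_torus T H" using HG by (rule maximal_torus_subgroup[OF T])
  have Tu: "maximal_torus (conj_by u ` T) G" by (rule maximal_torus_conj[OF G T u(1)])
  have "conj_by u ` T \<subseteq> H"
  proof
    fix x assume "x \<in> conj_by u ` T"
    then obtain s where s: "s \<in> T" "x = conj_by u s" by blast
    have "x ** cochar_at nu t = cochar_at nu t ** x" if t: "t \<noteq> 0" for t :: complex
      unfolding s(2) conj_mu[OF t, symmetric] conj_by_mult_right[OF iu, symmetric] torus_commute[OF tT s(1) muT[OF t]] ..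
    moreover have "x \<in> G" using Tu \<open>x \<in> conj_by u ` T\<close> unfolding maximal_torus_def by (elim conjE subsetD)
    ultimately show "x \<in> H" by (intro HI)
  qed
  then have 2: "maximal_torus (conj_by u ` T) H" using HG by (rule maximal_torus_subgroup[OF Tu])
  obtain k where k: "k \<in> H" "T = conj_by k ` conj_by u ` T"
    by (rule maximal_tori_conjugate[OF H 2 1]) (rule that)
  have ik: "invertible k" using k(1) HG Gd(4) by blast
  have "conj_by (k ** u) ` T = conj_by k ` conj_by u ` T" by (simp add: image_image conj_by_mult[OF ik iu])
  then have "conj_by (k ** u) ` T = T" by (simp only: k(2)[symmetric])
  then have norm: "k ** u \<in> normalizer G T" using Gd(2)[OF subsetD[OF HG k(1)] u(1)]
    unfolding normalizer_def conj_by_def by simp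
  \<comment> \<open>Laurent matrices are determined by their values at nonzero complex numbers, and
    there \<open>k\<close> commutes with the values of \<open>nu\<close>.\<close>
  have "nu = conj_cochar (k ** u) mu"
  proof (rule laurent_matrix_eq_iff)
    fix t :: complex assume t: "t \<noteq> 0"
    have N: "cochar_at nu t \<in> \<N>" unfolding \<N>_def using t by blast
    have "cochar_at (conj_cochar (k ** u) mu) t = conj_by (k ** u) (cochar_at mu t)"
      by (simp add: cochar_at_conj_cochar conj_by_def)
    also have "\<dots> = k ** cochar_at nu t ** matrix_inv k"
      by (simp add: conj_by_mult[OF ik iu] conj_mu[OF t]) (simp add: conj_by_def)
    also have "k ** cochar_at nu t = cochar_at nu t ** k"
      using k(1) N unfolding H_def by blast
    also have "\<dots> ** matrix_inv k = cochar_at nu t" by (simp only: matrix_mul_assoc[symmetric] matrix_inv_mult[OF ik] matrix_mul_rid)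
    finally show "cochar_at nu t = cochar_at (conj_cochar (k ** u) mu) t" by simp
  qed
  then show ?thesis unfolding weyl_orbit_eq[OF tT TG G] using norm by blast
qed

theorem proposition9p2:
  fixes G T :: "(complex^'n^'n) set"
    and lam :: "int \<Rightarrow>\<^sub>0 complex^'n^'n"
    and A :: "complex^4^4"
    and x :: "(complex^4) set"
    and D :: "(complex fps^4) set"
  assumes "connected_reductive_group G"
    and "maximal_torus T G"
    and "cocharacter T lam"
    and "smooth_quadric A"
    and "x \<in> quadric_points A"
    and "transverse_formal_disc A x D"
  shows "gr_coset G (z_minus lam) \<in> affine_grassmannian G
    \<and> formal_normal_type G lam A D = gr_coset G (z_minus lam)
    \<and> gauge_invariant_type G lam A D = schubert_orbit G lam
    \<and> (\<forall>mu nu. cocharacter T mu \<and> cocharacter T nu \<longrightarrow>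
         (schubert_orbit G mu = schubert_orbit G nu \<longleftrightarrow> nu \<in> weyl_orbit G T mu))"
proof (intro conjI allI impI)
  have G: "linear_algebraic_group G" using assms(1) by (simp add: connected_reductive_group_def)
  have tT: "torus T" and TG: "T \<subseteq> G" using assms(2) by (auto simp: maximal_torus_def)
  obtain v w where D: "D = proj_class v" "quadratic_form A v = fps_X * w" "w dvd 1"
    by (rule transverse_formal_disc_form[OF assms(6)])
  show "gr_coset G (z_minus lam) \<in> affine_grassmannian G"
    by (rule z_minus_in_affine_grassmannian[OF G TG assms(3)])
  show "formal_normal_type G lam A D = gr_coset G (z_minus lam)"
    by (rule formal_normal_type_eq[OF G TG assms(3) D])
  show "gauge_invariant_type G lam A D = schubert_orbit G lam"
    by (rule gauge_invariant_type_eq[OF G TG assms(3) D])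
  fix mu nu assume "cocharacter T mu \<and> cocharacter T nu"
  then have mu: "cocharacter T mu" and nu: "cocharacter T nu" by auto
  show "schubert_orbit G mu = schubert_orbit G nu \<longleftrightarrow> nu \<in> weyl_orbit G T mu"
  proof
    assume "schubert_orbit G mu = schubert_orbit G nu"
    then obtain u where "u \<in> G" "\<And>t::complex. t \<noteq> 0 \<Longrightarrow> u ** cochar_at mu t = cochar_at nu t ** u"
      by (rule schubert_orbit_eqD[OF G TG mu nu]) (rule that)
    then show "nu \<in> weyl_orbit G T mu" by (rule conjugate_cocharacters_weyl_orbit[OF G assms(2) mu nu])
  next
    assume "nu \<in> weyl_orbit G T mu"
    then obtain n where "n \<in> normalizer G T" "nu = conj_cochar n mu" unfolding weyl_orbit_eq[OF tT TG G] by blast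
    then show "schubert_orbit G mu = schubert_orbit G nu"
      by (intro schubert_orbit_conj[OF G TG]) (simp_all add: normalizer_def)
  qed
qed

end
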